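(* Let $G$ be the Kleinian $4$-group, $R=\mathbb{Z}_2G$, and let $T_k^f$ (for $f\in\mathbb{F}_2[x]$ an irreducible unital polynomial, $f\notin\{x,x-1\}$) and $T_k^{ji}$ (for $j\in\{2,3,4\}$, $i\in\{1,2\}$), $k\ge1$, be the indecomposable $R$-lattices lying in the homogeneous and special tubes, respectively, of the Auslander–Reiten quiver of $A$-lattices, where $A$ is the minimal overring of $R$. Then for all integers $n$ and all $k\ge1$: \[ \hat H^n(G,T_k^f)\simeq kd\,\mathbb{F}_2,\quad\text{where } d=\deg f, \] and for every $j\in\{2,3,4\}$ \[ \hat H^n(G,T^{ji}_{2k})\simeq k\,\mathbb{F}_2\quad\text{for both } i=1,2, \] \[ \hat H^n(G,T^{j1}_{2k-1})\simeq\begin{cases}k\,\mathbb{F}_2&\text{if } |n| \text{ is even},\\ (k-1)\,\mathbb{F}_2&\text{if } |n|\text{ is odd},\end{cases} \] \[ \hat H^n(G,T^{j2}_{2k-1})\simeq\begin{cases}k\,\mathbb{F}_2&\text{if } |n| \text{ is odd},\\ (k-1)\,\mathbb{F}_2&\text{if } |n|\text{ is even}.\end{cases} \]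
   Context: $\mathbb{Z}_2$ is the ring of $2$-adic integers, $G=\langle a,b\mid a^2=b^2=1,\ ab=ba\rangle$, $\hat H^n$ ($n\in\mathbb{Z}$) denotes Tate cohomology, and $m\mathbb{F}_2$ denotes the direct sum of $m$ copies of $\mathbb{F}_2$. Isomorphisms are of abelian groups. An $R$-lattice is a finitely generated $R$-module that is torsion free (over $\mathbb{Z}_2$). For $u,v\in\{+,-\}$, $L_{uv}$ is the lattice equal to $\mathbb{Z}_2$ as a $\mathbb{Z}_2$-module, on which $a$ acts as $u1$ and $b$ as $v1$. The ring $R$ is local, Gorenstein and non-regular. Its minimal overring is the unique ring $A\supset R$ (inside $R\otimes_{\mathbb{Z}_2}\mathbb{Q}_2$) such that $A/R\simeq R/\operatorname{rad}R$ and $A$ is an $R$-lattice; every indecomposable $R$-lattice not isomorphic to $R$ is an $A$-lattice. Let $\tilde A$ be the integral closure of $A$ in $A\otimes_{\mathbb{Z}_2}\mathbb{Q}_2$. For an $A$-lattice $M$ (viewed inside $M\otimes_{\mathbb{Z}_2}\mathbb{Q}_2$) put $\tilde M=\tilde AM$; then $\tilde M=\bigoplus_{u,v\in\{+,-\}}M_{uv}$ with $M_{uv}\simeq L_{uv}^{\oplus r_{uv}M}$ for some integers $r_{uv}M\ge0$. An Auslander–Reiten sequence in the category of $R$-lattices is a non-split exact sequence $0\to M'\xrightarrow{\beta}N\xrightarrow{\alpha}M\to0$ with $M,M'$ indecomposable such that every non-isomorphism $L\to M$ with $L$ an indecomposable $R$-lattice factors through $\alpha$ and every non-isomorphism $M'\to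 L$ with $L$ an indecomposable $R$-lattice factors through $\beta$; one writes $M'=\tau_RM$, $M=\tau_R^{-1}M'$. The translate $\tau_R$ is a bijection on the isomorphism classes of indecomposable $R$-lattices other than $R$. The Auslander–Reiten quiver has the isomorphism classes of indecomposable lattices as vertices, and its arrows are the components $N_i\to M$ and $M'\to N_i$ of the maps $\alpha,\beta$ of the Auslander–Reiten sequences, where $N=\bigoplus_iN_i$ with $N_i$ indecomposable (together with the components of the inclusion of the radical into the ring, and their duals). The Auslander–Reiten quiver of the category of $A$-lattices is known to consist of one preprojective-preinjective component, whose vertices are the lattices $\tau_R^kA$ and $\tau_R^kL_{uv}$ ($k\in\mathbb{Z}$, $u,v\in\{+,-\}$), and of the following tubes (the numbering of lattices in the tubes being fixed by the data listed). (i) Homogeneous tubes $\mathcal{T}^f$, parametrized by irreducible unital (monic) polynomials $f\in\mathbb{F}_2[x]$, $f\notin\{x,x-1\}$. The vertices of $\mathcal{T}^f$ are $T_k^f$, $k\ge1$, with arrows $T^f_k\to T^f_{k+1}$ and $T^f_{k+1}\to T^f_k$ for all $k\ge1$. Here $r_{++}(T_k^f)=kd$ with $d=\deg f$, and $\tau_RT_k^f=T_k^f$. (ii) Three special tubes $\mathcal{T}^j$, $j\in\{2,3,4\}$. The vertices of $\mathcal{T}^j$ are $T^{j1}_k,T^{j2}_k$, $k\ge1$, with arrows $T^{ji}_k\to T^{ji}_{k+1}$ ($i=1,2$), $T^{j1}_{k+1}\to T^{j2}_k$ and $T^{j2}_{k+1}\to T^{j1}_k$ for all $k\ge1$. Here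 $r_{++}T^{j1}_{2k}=r_{++}T^{j2}_{2k}=k$, $r_{++}T^{j1}_{2k-1}=k$, $r_{++}T^{j2}_{2k-1}=k-1$, and $\tau_RT^{j1}_k=T^{j2}_k$, $\tau_RT^{j2}_k=T^{j1}_k$. *)

theory Defs
  imports
    "HOL-Library.Poly_Mapping"
    "HOL-Library.Product_Plus"
    "HOL-Library.Z2"
    "HOL-Computational_Algebra.Polynomial_Factorial"
    "HOL-Algebra.Module"
    "HOL-Algebra.Subrings"
    "HOL-Algebra.Product_Groups"
begin

section \<open>The 2-adic integers and the 2-adic numbers\<close>

text \<open>The inverse limit of the rings of integers modulo \<open>2 ^ n\<close>, each residue class being
  represented by its least nonnegative element.\<close>

typedef z2adic = "{x :: nat \<Rightarrow> int. \<forall>n. x n = x (Suc n) mod 2 ^ n}"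
  morphisms residue Abs_z2adic
  by (rule exI[of _ "\<lambda>_. 0"]) simp

setup_lifting type_definition_z2adic

lemma mod_power_Suc_mod: "(a mod 2 ^ Suc n) mod 2 ^ n = (a :: int) mod 2 ^ n"
  by (rule mod_mod_cancel) (simp add: le_imp_power_dvd)

lemma residue_Suc_mod: "residue x (Suc n) mod 2 ^ n = residue x n"
proof -
  have "residue x \<in> {x. \<forall>n. x n = x (Suc n) mod 2 ^ n}" by (rule residue)
  then have "\<forall>n. residue x n = residue x (Suc n) mod 2 ^ n" by (rule CollectD)
  then show ?thesis by (metis (no_types))
qed

lemma residue_mod: "residue x n mod 2 ^ n = residue x n"
  using mod_mod_trivial[of "residue x (Suc n)" "2 ^ n"] by (simp only: residue_Suc_mod)

lemma residue_zero: "residue x 0 = 0"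
proof -
  have "residue x 0 mod 2 ^ 0 = 0" by simp
  then show ?thesis by (simp only: residue_mod)
qed

lemma residue_mod_le: "m \<le> n \<Longrightarrow> residue x n mod 2 ^ m = residue x m"
proof (induction n rule: dec_induct)
  case base
  show ?case by (rule residue_mod)
next
  case (step n)
  have "residue x (Suc n) mod 2 ^ m = (residue x (Suc n) mod 2 ^ n) mod 2 ^ m"
    using step.hyps by (intro mod_mod_cancel[symmetric] le_imp_power_dvd)
  then show ?case by (simp only: residue_Suc_mod step.IH)
qed

instantiation z2adic :: comm_ring_1
begin

lift_definition zero_z2adic :: z2adic is "\<lambda>_. 0" by simp
lift_definition one_z2adic :: z2adic is "\<lambda>n. 1 mod 2 ^ n"
  by (simp only: mod_power_Suc_mod)
lift_definition plus_z2adic :: "z2adic \<Rightarrow> z2adic \<Rightarrow> z2adic" is "\<lambda>x y n. (x n + y n) mod 2 ^ n"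
  by (metis mod_power_Suc_mod mod_add_eq)
lift_definition minus_z2adic :: "z2adic \<Rightarrow> z2adic \<Rightarrow> z2adic" is "\<lambda>x y n. (x n - y n) mod 2 ^ n"
  by (metis mod_power_Suc_mod mod_diff_eq)
lift_definition uminus_z2adic :: "z2adic \<Rightarrow> z2adic" is "\<lambda>x n. (- x n) mod 2 ^ n"
  by (metis mod_power_Suc_mod mod_minus_eq)
lift_definition times_z2adic :: "z2adic \<Rightarrow> z2adic \<Rightarrow> z2adic" is "\<lambda>x y n. (x n * y n) mod 2 ^ n"
  by (metis mod_power_Suc_mod mod_mult_eq)

instance
proof
  fix a b c :: z2adic
  note s = residue_inject[symmetric] plus_z2adic.rep_eq minus_z2adic.rep_eq uminus_z2adic.rep_eq
    times_z2adic.rep_eq zero_z2adic.rep_eq one_z2adic.rep_eq fun_eq_iff mod_simps residue_mod residue_zero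
  show "a + b + c = a + (b + c)" "a + b = b + a" "0 + a = a" "- a + a = 0" "a - b = a + - b"
    by (simp_all add: s algebra_simps)
  show "a * b * c = a * (b * c)" "a * b = b * a" "1 * a = a" "(a + b) * c = a * c + b * c"
    by (simp_all add: s algebra_simps)
  have "residue 0 1 \<noteq> residue 1 1" by (simp add: s)
  then show "(0 :: z2adic) \<noteq> 1" by metis
qed

end

lemma z2adic_valuation:
  fixes x :: z2adic
  assumes "x \<noteq> 0"
  shows "\<exists>v. \<forall>n>v. \<exists>a. residue x n = 2 ^ v * a \<and> odd a"
proof -
  obtain m where m: "residue x m \<noteq> 0"
    using assms by (auto simp: residue_inject[symmetric] zero_z2adic.rep_eq)
  define k where "k = (LEAST m. residue x m \<noteq> 0)"
  have k: "residue x k \<noteq> 0" unfolding k_def using m by (rule LeastI)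
  then obtain v where v: "k = Suc v" using residue_zero not0_implies_Suc by metis
  have v0: "residue x v = 0" using not_less_Least[of v "\<lambda>m. residue x m \<noteq> 0"] v k_def by auto
  have "\<exists>a. residue x n = 2 ^ v * a \<and> odd a" if "n > v" for n
  proof -
    have "residue x n mod 2 ^ v = 0" using residue_mod_le[of v n x] v0 that by simp
    then obtain a where a: "residue x n = 2 ^ v * a" by auto
    have "residue x n mod 2 ^ Suc v \<noteq> 0" using residue_mod_le[of "Suc v" n x] k v that by simp
    then have "odd a" using a by (auto simp: ac_simps elim!: evenE)
    with a show ?thesis by blast
  qed
  then show ?thesis by blast
qed

instance z2adic :: idom
proof
  fix x y :: z2adic
  assume "x \<noteq> 0" "y \<noteq> 0"
  then obtain v w where v: "\<forall>n>v. \<exists>a. residue x n = 2 ^ v * a \<and> odd a"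
    and w: "\<forall>n>w. \<exists>a. residue y n = 2 ^ w * a \<and> odd a"
    using z2adic_valuation by metis
  obtain a b where "residue x (Suc (v + w)) = 2 ^ v * a" "odd a"
    and "residue y (Suc (v + w)) = 2 ^ w * b" "odd b"
    using v w by (meson le_add1 le_add2 le_imp_less_Suc)
  then have m: "residue (x * y) (Suc (v + w)) = (2 ^ v * a * (2 ^ w * b)) mod 2 ^ Suc (v + w)"
    and o: "odd (a * b)"
    by (simp_all add: times_z2adic.rep_eq)
  have "2 ^ v * a * (2 ^ w * b) = 2 ^ (v + w) * (a * b)" by (simp add: power_add)
  moreover have "2 ^ Suc (v + w) = 2 ^ (v + w) * (2 :: int)" by simp
  ultimately have "residue (x * y) (Suc (v + w)) = 2 ^ (v + w) * (a * b mod 2)"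
    using m mult_mod_right[of "2 ^ (v + w)" "a * b" 2] by argo
  moreover have "a * b mod 2 = 1" using o by (simp only: odd_iff_mod_2_eq_one)
  ultimately have "residue (x * y) (Suc (v + w)) \<noteq> 0" by simp
  then show "x * y \<noteq> 0" by (auto simp: zero_z2adic.rep_eq)
qed

type_synonym q2adic = "z2adic fract"

section \<open>The group, its group rings and their modules\<close>

text \<open>Klein's four-group, written additively, with \<open>a = (1, 0)\<close> and \<open>b = (0, 1)\<close>. The product
  of finitely supported functions is convolution, so that \<open>q2G\<close> is the group algebra over the
  2-adic numbers.\<close>

type_synonym klein = "bit \<times> bit"
type_synonym q2G = "klein \<Rightarrow>\<^sub>0 q2adic"

definition Z2 :: "q2adic set" where
  "Z2 = range to_fract"

definition Z2G :: "q2G set" where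
  "Z2G = {x. \<forall>g. Poly_Mapping.lookup x g \<in> Z2}"

definition scalar :: "z2adic \<Rightarrow> q2G" where
  "scalar c = Poly_Mapping.single 0 (to_fract c)"

text \<open>All rings occurring below are subrings of the group algebra \<open>q2G\<close> and are given by their
  carriers. Enlarging or shrinking such a ring does not change the record of a module over it, so a
  lattice over an overring of \<open>Z2G\<close> is literally also a lattice over \<open>Z2G\<close>.\<close>

definition ring_on :: "'a::comm_ring_1 set \<Rightarrow> 'a ring" where
  "ring_on S = \<lparr>carrier = S, mult = (*), one = 1, zero = 0, add = (+)\<rparr>"

definition as_module :: "'a::comm_ring_1 set \<Rightarrow> ('a, 'a) module" where
  "as_module S = \<lparr>carrier = S, mult = (*), one = 1, zero = 0, add = (+), smult = (*)\<rparr>"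

definition mod_hom :: "'r::comm_ring_1 set \<Rightarrow> ('r, 'a) module \<Rightarrow> ('r, 'b) module \<Rightarrow> ('a \<Rightarrow> 'b) set" where
  "mod_hom \<Lambda> M N = {f \<in> carrier M \<rightarrow> carrier N.
     (\<forall>x\<in>carrier M. \<forall>y\<in>carrier M. f (x \<oplus>\<^bsub>M\<^esub> y) = f x \<oplus>\<^bsub>N\<^esub> f y) \<and>
     (\<forall>r\<in>\<Lambda>. \<forall>x\<in>carrier M. f (r \<odot>\<^bsub>M\<^esub> x) = r \<odot>\<^bsub>N\<^esub> f x)}"

definition mod_iso :: "'r::comm_ring_1 set \<Rightarrow> ('r, 'a) module \<Rightarrow> ('r, 'b) module \<Rightarrow> bool" where
  "mod_iso \<Lambda> M N \<longleftrightarrow> (\<exists>f\<in>mod_hom \<Lambda> M N. bij_betw f (carrier M) (carrier N))"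

definition quot_module :: "('r, 'a) module \<Rightarrow> 'a set \<Rightarrow> ('r, 'a set) module" where
  "quot_module M H = \<lparr>carrier = a_rcosets\<^bsub>M\<^esub> H, mult = undefined, one = undefined, zero = H,
     add = set_add M, smult = (\<lambda>r X. \<Union>x\<in>X. H +>\<^bsub>M\<^esub> (r \<odot>\<^bsub>M\<^esub> x))\<rparr>"

definition power_module :: "nat \<Rightarrow> ('r, 'a) module \<Rightarrow> ('r, nat \<Rightarrow> 'a) module" where
  "power_module m L = \<lparr>carrier = {..<m} \<rightarrow>\<^sub>E carrier L, mult = undefined, one = undefined,
     zero = (\<lambda>i\<in>{..<m}. \<zero>\<^bsub>L\<^esub>), add = (\<lambda>x y. \<lambda>i\<in>{..<m}. x i \<oplus>\<^bsub>L\<^esub> y i),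
     smult = (\<lambda>r x. \<lambda>i\<in>{..<m}. r \<odot>\<^bsub>L\<^esub> x i)\<rparr>"

definition generated_submodule :: "'r::comm_ring_1 set \<Rightarrow> ('r, 'a) module \<Rightarrow> 'a set \<Rightarrow> 'a set" where
  "generated_submodule \<Lambda> M S = \<Inter>{H. submodule H (ring_on \<Lambda>) M \<and> S \<subseteq> H}"

definition direct_decomp ::
    "'r::comm_ring_1 set \<Rightarrow> ('r, 'a) module \<Rightarrow> 'i set \<Rightarrow> ('i \<Rightarrow> 'a set) \<Rightarrow> bool" where
  "direct_decomp \<Lambda> M I H \<longleftrightarrow> finite I \<and> (\<forall>i\<in>I. submodule (H i) (ring_on \<Lambda>) M) \<and>
     bij_betw (\<lambda>x. \<Oplus>\<^bsub>M\<^esub>i\<in>I. x i) (Pi\<^sub>E I H) (carrier M)"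

definition is_lattice :: "q2G set \<Rightarrow> (q2G, 'a) module \<Rightarrow> bool" where
  "is_lattice \<Lambda> M \<longleftrightarrow> module (ring_on \<Lambda>) M \<and>
     (\<exists>S. finite S \<and> S \<subseteq> carrier M \<and> generated_submodule \<Lambda> M S = carrier M) \<and>
     (\<forall>c. \<forall>x\<in>carrier M. scalar c \<odot>\<^bsub>M\<^esub> x = \<zero>\<^bsub>M\<^esub> \<longrightarrow> c = 0 \<or> x = \<zero>\<^bsub>M\<^esub>)"

definition indec_lattice :: "q2G set \<Rightarrow> (q2G, 'a) module \<Rightarrow> bool" where
  "indec_lattice \<Lambda> M \<longleftrightarrow> is_lattice \<Lambda> M \<and> carrier M \<noteq> {\<zero>\<^bsub>M\<^esub>} \<and>
     (\<forall>H K. submodule H (ring_on \<Lambda>) M \<and> submodule K (ring_on \<Lambda>) M \<and>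
        H \<inter> K = {\<zero>\<^bsub>M\<^esub>} \<and> H <+>\<^bsub>M\<^esub> K = carrier M \<longrightarrow> H = {\<zero>\<^bsub>M\<^esub>} \<or> K = {\<zero>\<^bsub>M\<^esub>})"

definition radical :: "q2G set \<Rightarrow> q2G set" where
  "radical \<Lambda> = \<Inter>{I. maximalideal I (ring_on \<Lambda>)}"

definition minimal_overring :: "q2G set \<Rightarrow> bool" where
  "minimal_overring A \<longleftrightarrow> subring A (ring_on UNIV) \<and> Z2G \<subset> A \<and> is_lattice Z2G (as_module A) \<and>
     mod_iso Z2G (quot_module (as_module A) Z2G) (quot_module (as_module Z2G) (radical Z2G))"

section \<open>The lattices of rank one and the multiplicities of a lattice\<close>

datatype sign = Plus | Minus

fun sign_pow :: "sign \<Rightarrow> bit \<Rightarrow> 'a::comm_ring_1" where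
  "sign_pow Plus i = 1"
| "sign_pow Minus i = (if i = 0 then 1 else - 1)"

definition L :: "sign \<times> sign \<Rightarrow> (q2G, q2adic) module" where
  "L uv = \<lparr>carrier = Z2, mult = (*), one = 1, zero = 0, add = (+),
     smult = (\<lambda>x z. (\<Sum>g\<in>UNIV. Poly_Mapping.lookup x g * (sign_pow (fst uv) (fst g) * sign_pow (snd uv) (snd g))) * z)\<rparr>"

definition integral_closure :: "'a::comm_ring_1 set \<Rightarrow> 'a set" where
  "integral_closure A = {x. \<exists>p. lead_coeff p = 1 \<and> (\<forall>i. Polynomial.coeff p i \<in> A) \<and> poly p x = 0}"

text \<open>The universe over which lattices and rational modules range below. As lattices are free of
  finite rank over the 2-adic integers, every lattice, and every finite-dimensional module over the
  group algebra \<open>q2G\<close>, is isomorphic to one whose carrier lies in \<open>nat \<Rightarrow> q2adic\<close>. Hence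
  quantifying over this type amounts to quantifying over all of them.\<close>

type_synonym lat = "(q2G, nat \<Rightarrow> q2adic) module"

text \<open>\<open>V\<close>, with \<open>j : M \<rightarrow> V\<close>, is the extension of scalars of \<open>M\<close> to the 2-adic numbers, that
  is, the localization of the torsion free module \<open>M\<close> at the nonzero 2-adic integers.\<close>

definition rational_hull :: "q2G set \<Rightarrow> (q2G, 'a) module \<Rightarrow> (q2G, 'b) module \<Rightarrow> ('a \<Rightarrow> 'b) \<Rightarrow> bool" where
  "rational_hull \<Lambda> M V j \<longleftrightarrow> module (ring_on UNIV) V \<and> j \<in> mod_hom \<Lambda> M V \<and> inj_on j (carrier M) \<and>
     (\<forall>v\<in>carrier V. \<exists>c. c \<noteq> 0 \<and> scalar c \<odot>\<^bsub>V\<^esub> v \<in> j ` carrier M)"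

text \<open>\<open>r uv\<close> is the number of copies of \<open>L uv\<close> in the span of \<open>M\<close>, inside its rational hull, over
  the integral closure of \<open>A\<close>.\<close>

definition multiplicities :: "q2G set \<Rightarrow> lat \<Rightarrow> (sign \<times> sign \<Rightarrow> nat) \<Rightarrow> bool" where
  "multiplicities A M r \<longleftrightarrow> (\<exists>(V :: lat) j H.
     rational_hull A M V j \<and>
     direct_decomp (integral_closure A)
       (V\<lparr>carrier := generated_submodule (integral_closure A) V (j ` carrier M)\<rparr>) UNIV H \<and>
     (\<forall>uv. mod_iso (integral_closure A) (V\<lparr>carrier := H uv\<rparr>) (power_module (r uv) (L uv))))"

section \<open>Auslander-Reiten sequences and the Auslander-Reiten quiver\<close>

definition short_exact :: "'r::comm_ring_1 set \<Rightarrow>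
    ('r, 'a) module \<Rightarrow> ('a \<Rightarrow> 'b) \<Rightarrow> ('r, 'b) module \<Rightarrow> ('b \<Rightarrow> 'c) \<Rightarrow> ('r, 'c) module \<Rightarrow> bool" where
  "short_exact \<Lambda> M' \<beta> N \<alpha> M \<longleftrightarrow> \<beta> \<in> mod_hom \<Lambda> M' N \<and> \<alpha> \<in> mod_hom \<Lambda> N M \<and>
     inj_on \<beta> (carrier M') \<and> \<alpha> ` carrier N = carrier M \<and>
     \<beta> ` carrier M' = {x \<in> carrier N. \<alpha> x = \<zero>\<^bsub>M\<^esub>}"

definition ar_sequence ::
    "q2G set \<Rightarrow> lat \<Rightarrow> _ \<Rightarrow> lat \<Rightarrow> _ \<Rightarrow> lat \<Rightarrow> bool" where
  "ar_sequence \<Lambda> M' \<beta> N \<alpha> M \<longleftrightarrow>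
     indec_lattice \<Lambda> M' \<and> is_lattice \<Lambda> N \<and> indec_lattice \<Lambda> M \<and> short_exact \<Lambda> M' \<beta> N \<alpha> M \<and>
     \<not> (\<exists>\<sigma>\<in>mod_hom \<Lambda> M N. \<forall>x\<in>carrier M. \<alpha> (\<sigma> x) = x) \<and>
     (\<forall>(X :: lat) f. indec_lattice \<Lambda> X \<and> f \<in> mod_hom \<Lambda> X M \<and> \<not> bij_betw f (carrier X) (carrier M) \<longrightarrow>
        (\<exists>h\<in>mod_hom \<Lambda> X N. \<forall>x\<in>carrier X. \<alpha> (h x) = f x)) \<and>
     (\<forall>(X :: lat) f. indec_lattice \<Lambda> X \<and> f \<in> mod_hom \<Lambda> M' X \<and> \<not> bij_betw f (carrier M') (carrier X) \<longrightarrow>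
        (\<exists>h\<in>mod_hom \<Lambda> N X. \<forall>x\<in>carrier M'. h (\<beta> x) = f x))"

text \<open>\<open>is_tau M' M\<close> means that \<open>M'\<close> is isomorphic to the translate of \<open>M\<close> in the category of
  \<open>Z2G\<close>-lattices.\<close>

definition is_tau :: "lat \<Rightarrow> lat \<Rightarrow> bool" where
  "is_tau M' M \<longleftrightarrow> (\<exists>\<beta> N \<alpha>. ar_sequence Z2G M' \<beta> N \<alpha> M)"

text \<open>The lattices isomorphic to the images of \<open>X\<close> under the powers, with exponents in the
  integers, of the translation.\<close>

inductive_set tau_orbit :: "(q2G, 'a) module \<Rightarrow> lat set" for X :: "(q2G, 'a) module" where
  base: "is_lattice Z2G M \<Longrightarrow> mod_iso Z2G M X \<Longrightarrow> M \<in> tau_orbit X"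
| tau: "M \<in> tau_orbit X \<Longrightarrow> is_tau M' M \<Longrightarrow> M' \<in> tau_orbit X"
| tau_inv: "M' \<in> tau_orbit X \<Longrightarrow> is_tau M' M \<Longrightarrow> M \<in> tau_orbit X"

definition is_component :: "q2G set \<Rightarrow> (q2G, 'a) module \<Rightarrow> (q2G, 'b) module \<Rightarrow> 'b set \<Rightarrow> bool" where
  "is_component \<Lambda> X N K \<longleftrightarrow> (\<exists>(m :: nat) H. direct_decomp \<Lambda> N {..<m} H \<and>
     (\<forall>i<m. indec_lattice \<Lambda> (N\<lparr>carrier := H i\<rparr>)) \<and>
     (\<exists>i<m. H i = K) \<and> mod_iso \<Lambda> X (N\<lparr>carrier := K\<rparr>))"

definition dual :: "(q2G, 'a) module \<Rightarrow> (q2G, 'a \<Rightarrow> z2adic) module" where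
  "dual M = \<lparr>carrier = {f \<in> extensional (carrier M).
       (\<forall>x\<in>carrier M. \<forall>y\<in>carrier M. f (x \<oplus>\<^bsub>M\<^esub> y) = f x + f y) \<and>
       (\<forall>c. \<forall>x\<in>carrier M. f (scalar c \<odot>\<^bsub>M\<^esub> x) = c * f x)},
     mult = undefined, one = undefined, zero = (\<lambda>x\<in>carrier M. 0),
     add = (\<lambda>f g. \<lambda>x\<in>carrier M. f x + g x),
     smult = (\<lambda>r f. \<lambda>x\<in>carrier M. f (r \<odot>\<^bsub>M\<^esub> x))\<rparr>"

text \<open>Arrows of the Auslander-Reiten quiver of the category of \<open>\<Lambda>\<close>-lattices: the components of
  the two maps of an Auslander-Reiten sequence, those of the inclusion of the radical into the ring,
  and the duals of the latter.\<close>

definition ar_arrow :: "q2G set \<Rightarrow> lat \<Rightarrow> lat \<Rightarrow> bool" where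
  "ar_arrow \<Lambda> X Y \<longleftrightarrow> indec_lattice \<Lambda> X \<and> indec_lattice \<Lambda> Y \<and>
     ((\<exists>M' \<beta> N \<alpha> K. ar_sequence \<Lambda> M' \<beta> N \<alpha> Y \<and> is_component \<Lambda> X N K) \<or>
      (\<exists>\<beta> N \<alpha> M K. ar_sequence \<Lambda> X \<beta> N \<alpha> M \<and> is_component \<Lambda> Y N K) \<or>
      (mod_iso \<Lambda> Y (as_module \<Lambda>) \<and> (\<exists>K. is_component \<Lambda> X (as_module (radical \<Lambda>)) K)) \<or>
      (mod_iso \<Lambda> X (dual (as_module \<Lambda>)) \<and>
        (\<exists>(Z :: lat) K. is_component \<Lambda> Z (as_module (radical \<Lambda>)) K \<and> mod_iso \<Lambda> Y (dual Z))))"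

section \<open>The tubes\<close>

datatype vertex = Homog "bit poly" nat | Special nat nat nat

text \<open>\<open>Homog f k\<close> and \<open>Special j i k\<close> label the lattices \<open>T\<close> with indices \<open>f, k\<close> and \<open>j i, k\<close>.\<close>

definition homog_param :: "bit poly \<Rightarrow> bool" where
  "homog_param f \<longleftrightarrow> Factorial_Ring.irreducible f \<and> lead_coeff f = 1 \<and> f \<noteq> [:0, 1:] \<and> f \<noteq> [:-1, 1:]"

definition tube_vertices :: "vertex set" where
  "tube_vertices = {Homog f k | f k. homog_param f \<and> k \<ge> 1} \<union>
     {Special j i k | j i k. j \<in> {2, 3, 4} \<and> i \<in> {1, 2} \<and> k \<ge> 1}"

inductive tube_arrow :: "vertex \<Rightarrow> vertex \<Rightarrow> bool" where
  "tube_arrow (Homog f k) (Homog f (k + 1))"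
| "tube_arrow (Homog f (k + 1)) (Homog f k)"
| "tube_arrow (Special j i k) (Special j i (k + 1))"
| "tube_arrow (Special j 1 (k + 1)) (Special j 2 k)"
| "tube_arrow (Special j 2 (k + 1)) (Special j 1 k)"

fun tube_tau :: "vertex \<Rightarrow> vertex" where
  "tube_tau (Homog f k) = Homog f k"
| "tube_tau (Special j i k) = Special j (if i = 1 then 2 else 1) k"

fun tube_rank :: "vertex \<Rightarrow> nat" where
  "tube_rank (Homog f k) = k * Polynomial.degree f"
| "tube_rank (Special j i k) =
     (if even k then k div 2 else if i = 1 then (k + 1) div 2 else (k - 1) div 2)"

definition tau_orbits :: "q2G set \<Rightarrow> lat set" where
  "tau_orbits A = tau_orbit (as_module A) \<union> (\<Union>uv. tau_orbit (L uv))"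

text \<open>The record of a member of \<open>tau_orbits A\<close> is constrained only as a \<open>Z2G\<close>-module, so that
  the scalars in \<open>A\<close> outside \<open>Z2G\<close> may act on it in a meaningless way; hence the restriction to
  the records that are modules over \<open>A\<close>.\<close>

definition prepro_preinj :: "q2G set \<Rightarrow> lat set" where
  "prepro_preinj A = {X \<in> tau_orbits A. indec_lattice A X}"

text \<open>The Auslander-Reiten quiver of the category of \<open>A\<close>-lattices consists of the
  preprojective-preinjective component and of the tubes, with \<open>T v\<close> representing the isomorphism
  class at the vertex \<open>v\<close>.\<close>

definition ar_quiver :: "q2G set \<Rightarrow> (vertex \<Rightarrow> lat) \<Rightarrow> bool" where
  "ar_quiver A T \<longleftrightarrow>
     (\<forall>X\<in>tau_orbits A. \<exists>Y\<in>prepro_preinj A. mod_iso Z2G X Y) \<and>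
     (\<forall>X\<in>prepro_preinj A. \<forall>Y\<in>prepro_preinj A. equivclp (ar_arrow A) X Y) \<and>
     (\<forall>v\<in>tube_vertices. indec_lattice A (T v) \<and> T v \<notin> prepro_preinj A) \<and>
     (\<forall>v\<in>tube_vertices. \<forall>w\<in>tube_vertices. mod_iso A (T v) (T w) \<longrightarrow> v = w) \<and>
     (\<forall>X. indec_lattice A X \<longrightarrow> X \<in> prepro_preinj A \<or> (\<exists>v\<in>tube_vertices. mod_iso A X (T v))) \<and>
     (\<forall>v\<in>tube_vertices. \<forall>X. indec_lattice A X \<longrightarrow>
        (ar_arrow A X (T v) \<longleftrightarrow> (\<exists>w\<in>tube_vertices. tube_arrow w v \<and> mod_iso A X (T w))) \<and>
        (ar_arrow A (T v) X \<longleftrightarrow> (\<exists>w\<in>tube_vertices. tube_arrow v w \<and> mod_iso A X (T w)))) \<and>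
     (\<forall>v\<in>tube_vertices. \<exists>r. multiplicities A (T v) r \<and> r (Plus, Plus) = tube_rank v) \<and>
     (\<forall>v\<in>tube_vertices. is_tau (T (tube_tau v)) (T v))"

section \<open>Tate cohomology\<close>

text \<open>The cochain complex of homogeneous cochains for the standard complete resolution of a finite
  group, written additively. Degree \<open>n \<ge> 0\<close> consists of the equivariant functions of \<open>n + 1\<close>
  group elements; degree \<open>n < 0\<close> consists of the equivariant functions of \<open>- n\<close> group elements,
  the term of the resolution being the dual of the one in degree \<open>- n - 1\<close>. The differential in
  degree \<open>-1\<close> is the norm, and those in lower degrees are transposes of the usual ones.\<close>

definition tuples :: "int \<Rightarrow> 'g list set" where
  "tuples n = {s. int (length s) = (if n \<ge> 0 then n + 1 else - n)}"

definition tate_cochains :: "('g::group_add \<Rightarrow> 'm \<Rightarrow> 'm) \<Rightarrow> ('m, 'z) ring_scheme \<Rightarrow> int \<Rightarrow> ('g list \<Rightarrow> 'm) set" where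
  "tate_cochains act M n = {c \<in> tuples n \<rightarrow>\<^sub>E carrier M. \<forall>g. \<forall>s\<in>tuples n. c (map ((+) g) s) = act g (c s)}"

definition tate_group :: "('g::group_add \<Rightarrow> 'm \<Rightarrow> 'm) \<Rightarrow> ('m, 'z) ring_scheme \<Rightarrow> int \<Rightarrow> ('g list \<Rightarrow> 'm) monoid" where
  "tate_group act M n = \<lparr>carrier = tate_cochains act M n,
     mult = (\<lambda>c d. \<lambda>s\<in>tuples n. c s \<oplus>\<^bsub>M\<^esub> d s), one = (\<lambda>s\<in>tuples n. \<zero>\<^bsub>M\<^esub>)\<rparr>"

definition tate_diff :: "('m, 'z) ring_scheme \<Rightarrow> int \<Rightarrow> ('g list \<Rightarrow> 'm) \<Rightarrow> 'g list \<Rightarrow> 'm" where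
  "tate_diff M n c = (\<lambda>s\<in>tuples (n + 1).
     if n \<ge> 0 then \<Oplus>\<^bsub>M\<^esub>i\<in>{..<length s}. [((-1) ^ i :: int)] \<cdot>\<^bsub>M\<^esub> c (take i s @ drop (Suc i) s)
     else if n = -1 then \<Oplus>\<^bsub>M\<^esub>g\<in>UNIV. c [g]
     else \<Oplus>\<^bsub>M\<^esub>i\<in>{..length s}. [((-1) ^ i :: int)] \<cdot>\<^bsub>M\<^esub> (\<Oplus>\<^bsub>M\<^esub>g\<in>UNIV. c (take i s @ g # drop i s)))"

definition tate_cohomology :: "('g::group_add \<Rightarrow> 'm \<Rightarrow> 'm) \<Rightarrow> ('m, 'z) ring_scheme \<Rightarrow> int \<Rightarrow> ('g list \<Rightarrow> 'm) set monoid" where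
  "tate_cohomology act M n =
     (tate_group act M n)\<lparr>carrier := kernel (tate_group act M n) (tate_group act M (n + 1)) (tate_diff M n)\<rparr>
       Mod (tate_diff M (n - 1) ` tate_cochains act M (n - 1))"

definition tate :: "int \<Rightarrow> (q2G, 'a) module \<Rightarrow> (klein list \<Rightarrow> 'a) set monoid" where
  "tate n M = tate_cohomology (\<lambda>g x. Poly_Mapping.single g 1 \<odot>\<^bsub>M\<^esub> x) M n"

definition F2_sum :: "nat \<Rightarrow> (nat \<Rightarrow> bit) monoid" where
  "F2_sum m = sum_group {..<m} (\<lambda>_. \<lparr>carrier = UNIV, mult = (+), one = 0\<rparr>)"

end

theory Submission
  imports Defs "HOL-Library.Function_Algebras"
begin

text \<open>Write \<open>M'\<close> for the translate of a lattice \<open>M\<close> and let \<open>0 \<rightarrow> M' \<rightarrow> N \<rightarrow> M \<rightarrow> 0\<close> be the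
Auslander-Reiten sequence. Over the Gorenstein order \<open>Z2G\<close> the translate is a syzygy up to projective
summands, so dimension shifting relates the Tate cohomology of \<open>M'\<close> in degree \<open>n\<close> to that of \<open>M\<close> in
degree \<open>n - 1\<close>. The translation has period one or two on the tubes; therefore all groups are known as soon
as those in degree zero are.

The syzygy statement is obtained in the weak form that \<open>M'\<close> is a retract of \<open>syz M\<close> and \<open>M\<close> one of
\<open>cosyz M'\<close> (lemma \<open>ar_retracts\<close>). The class of the sequence is a homomorphism from \<open>syz M\<close> to \<open>M'\<close> that
does not factor through a projective lattice. Homomorphisms \<open>f\<close> modulo those that factor are in perfect
duality under the trace form \<open>tr (u f)\<close> modulo \<open>4\<close> (lemma \<open>stable_duality\<close>), so some \<open>u\<close> in the other
direction makes the composite stably nonzero, and it stays nonzero on an indecomposable summand of \<open>syz M\<close>.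
Since a non-isomorphism out of \<open>M'\<close> extends to \<open>N\<close> and thereby kills the class, the resulting map
from \<open>M'\<close> to the summand must be an isomorphism. The other retraction is dual.

The Tate group in degree \<open>n\<close> of \<open>syz M\<close> embeds in the one of \<open>M\<close> in degree \<open>n - 1\<close>, and similarly for
\<open>cosyz\<close> (\<open>temb_syz\<close>, \<open>temb_cosyz\<close>). Together with the retractions this gives embeddings in both
directions between the groups of \<open>M'\<close> and \<open>M\<close>; when one group is finite they are isomorphisms (\<open>tau_shift\<close>).

In degree zero the group of \<open>M\<close> is \<open>M\<^sup>G / \<Sigma>M\<close>, where \<open>\<Sigma>\<close> is the sum of the group elements. The
averaging idempotent projects \<open>M\<close> onto a lattice \<open>P\<close> of rank \<open>r\<close>, the multiplicity of the trivial lattice, and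
maps \<open>\<Sigma>M\<close> onto \<open>4P\<close>. The minimal overring contains \<open>\<Sigma> / 2\<close>, so the fixed submodule, which the projection leaves as it is, contains \<open>2P\<close>. If it were
larger, a fixed vector with an odd coordinate would split off a copy of the trivial lattice; this is
excluded in the tubes, since the trivial lattice belongs to the preprojective-preinjective component.
Hence \<open>M\<^sup>G / \<Sigma>M\<close> is \<open>2P / 4P\<close> (lemma \<open>tate_degree_zero\<close>).

Lattices are handled through representations on a type: a family of endomorphisms \<open>\<rho> g\<close> in which
\<open>\<rho> 0\<close> is only required to be a projection, the lattice being its image. Summands, syzygies and
cosyzygies then need no carrier sets. The lemmas \<open>lattice_presented\<close> and \<open>rep_lattice\<close> translate between
the two languages.\<close>

section \<open>Arithmetic of the 2-adic integers\<close>

lemma residue_bounds: "0 \<le> residue x n" "residue x n < 2 ^ n"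
  using residue_mod[of x n] by (metis pos_mod_bound pos_mod_sign zero_less_numeral zero_less_power)+

lemma residue_Abs:
  assumes "\<And>n. x n = x (Suc n) mod 2 ^ n"
  shows "residue (Abs_z2adic x) = x"
  using assms by (intro Abs_z2adic_inverse CollectI allI)

lemma residue_of_nat: "residue (of_nat k) n = int k mod 2 ^ n"
  by (induction k) (simp_all add: zero_z2adic.rep_eq one_z2adic.rep_eq plus_z2adic.rep_eq mod_simps)

instance z2adic :: ring_char_0
proof
  show "inj (of_nat :: nat \<Rightarrow> z2adic)"
  proof (rule injI)
    fix m n :: nat
    assume "(of_nat m :: z2adic) = of_nat n"
    then have "int m mod 2 ^ (m + n) = int n mod 2 ^ (m + n)"
      by (metis residue_of_nat)
    moreover have "m < 2 ^ (m + n)" "n < 2 ^ (m + n)"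
      by (metis less_exp le_add1 le_add2 order_less_le_trans power_increasing one_le_numeral)+
    then have "int m < 2 ^ (m + n)" "int n < 2 ^ (m + n)"
      by (metis of_nat_less_iff of_nat_numeral of_nat_power)+
    ultimately show "m = n" by simp
  qed
qed

lemma residue_1_cases: "residue x 1 = 0 \<or> residue x 1 = 1"
  using residue_bounds[of x 1] by auto

lemma two_dvd_iff: "2 dvd x \<longleftrightarrow> residue x 1 = 0" for x :: z2adic
proof
  assume "2 dvd x"
  then obtain y where "x = 2 * y" by auto
  then have "x = y + y" by simp
  then have "residue x 1 = (residue y 1 + residue y 1) mod 2"
    by (metis plus_z2adic.rep_eq power_one_right)
  then show "residue x 1 = 0" by presburger
next
  assume 0: "residue x 1 = 0"
  define y where "y = Abs_z2adic (\<lambda>n. residue x (Suc n) div 2)"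
  have ev: "residue x (Suc n) mod 2 = 0" for n
    using residue_mod_le[of 1 "Suc n" x] 0 by simp
  have "residue x (Suc n) div 2 = residue x (Suc (Suc n)) div 2 mod 2 ^ n" for n
  proof -
    have "residue x (Suc n) = residue x (Suc (Suc n)) mod (2 * 2 ^ n)"
      using residue_Suc_mod[of x "Suc n"] by simp
    also have "\<dots> = 2 * (residue x (Suc (Suc n)) div 2 mod 2 ^ n) + residue x (Suc (Suc n)) mod 2"
      using zmod_zmult2_eq[of "2 ^ n" "residue x (Suc (Suc n))" 2] by simp
    finally show ?thesis using ev[of "Suc n"] by simp
  qed
  then have "residue y n = residue x (Suc n) div 2" for n
    unfolding y_def by (subst residue_Abs) (assumption, rule refl)
  then have "residue y n + residue y n = residue x (Suc n)" for n
    using ev[of n] by presburger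
  then have "residue (y + y) = residue x"
    by (intro ext) (simp only: plus_z2adic.rep_eq residue_Suc_mod)
  then have "y + y = x" by (simp only: residue_inject)
  then have "x = 2 * y" by simp
  then show "2 dvd x" by simp
qed

lemma odd_z2adic_is_unit:
  fixes x :: z2adic
  assumes "\<not> 2 dvd x"
  shows "\<exists>y. x * y = 1"
proof -
  have r1: "residue x 1 = 1" using assms two_dvd_iff residue_1_cases by blast
  have "\<exists>y. 0 \<le> y \<and> y < 2 ^ n \<and> residue x n * y mod 2 ^ n = 1 mod 2 ^ n" for n
  proof -
    have "coprime (residue x n) (2 ^ n)"
    proof (cases n)
      case (Suc m)
      then have "residue x n mod 2 = 1" using residue_mod_le[of 1 n x] r1 by simp
      then have "odd (residue x n)" by presburger
      then show ?thesis by simp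
    qed simp
    moreover obtain u v where "u * residue x n + v * 2 ^ n = gcd (residue x n) (2 ^ n)"
      using bezout_int by blast
    ultimately have "residue x n * u = 1 - v * 2 ^ n" by (simp add: algebra_simps)
    then have "residue x n * (u mod 2 ^ n) mod 2 ^ n = 1 mod 2 ^ n"
      by (simp only: mod_mult_right_eq mod_eq_dvd_iff) simp
    then show ?thesis by (intro exI[of _ "u mod 2 ^ n"]) simp
  qed
  then obtain y where y: "\<And>n. 0 \<le> y n \<and> y n < 2 ^ n \<and> residue x n * y n mod 2 ^ n = 1 mod 2 ^ n"
    by metis
  have "y n = y (Suc n) mod 2 ^ n" for n
  proof -
    have "residue x (Suc n) * y (Suc n) mod 2 ^ Suc n mod 2 ^ n = 1 mod 2 ^ Suc n mod 2 ^ n"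
      using y by metis
    then have "residue x (Suc n) * y (Suc n) mod 2 ^ n = 1 mod 2 ^ n"
      by (simp only: mod_power_Suc_mod)
    then have 1: "residue x n * y (Suc n) mod 2 ^ n = 1 mod 2 ^ n"
      by (metis mod_mult_left_eq residue_Suc_mod)
    have "y n mod 2 ^ n = y n * (residue x n * y (Suc n)) mod 2 ^ n"
      using 1 by (metis mod_mult_right_eq mult.right_neutral)
    also have "\<dots> = (residue x n * y n) * y (Suc n) mod 2 ^ n" by (simp add: ac_simps)
    also have "\<dots> = y (Suc n) mod 2 ^ n"
      using y[of n] by (metis mod_mult_left_eq mult_1)
    finally show ?thesis using y[of n] by simp
  qed
  then have "residue (Abs_z2adic y) = y"
    by (rule residue_Abs)
  then have "residue (x * Abs_z2adic y) = residue 1"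
    using y by (simp add: times_z2adic.rep_eq one_z2adic.rep_eq fun_eq_iff)
  then show ?thesis by (metis residue_inject)
qed

lemma odd_plus_odd: "\<not> 2 dvd x \<Longrightarrow> \<not> 2 dvd y \<Longrightarrow> 2 dvd (x + y)" for x y :: z2adic
  using residue_1_cases[of x] residue_1_cases[of y] by (auto simp: two_dvd_iff plus_z2adic.rep_eq)

lemma prime_two: "2 dvd (x * y) \<longleftrightarrow> 2 dvd x \<or> 2 dvd y" for x y :: z2adic
  using residue_1_cases[of x] residue_1_cases[of y] by (auto simp: two_dvd_iff times_z2adic.rep_eq)

lemma not_two_dvd_one: "\<not> 2 dvd (1 :: z2adic)"
  by (simp add: two_dvd_iff one_z2adic.rep_eq)

text \<open>A nonzero family has a largest common power of 2, found by induction on a precision at which some entry does not vanish.\<close>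

lemma normalize_family:
  fixes c :: "'i \<Rightarrow> z2adic"
  assumes "\<exists>i. c i \<noteq> 0"
  shows "\<exists>k d. (\<forall>i. c i = 2 ^ k * d i) \<and> (\<exists>i. \<not> 2 dvd d i)"
proof -
  obtain i where "c i \<noteq> 0" using assms by blast
  then have "residue (c i) \<noteq> residue 0" by (simp add: residue_inject)
  then obtain v where "residue (c i) v \<noteq> 0" by (auto simp: zero_z2adic.rep_eq)
  then show ?thesis
  proof (induction v arbitrary: c)
    case 0
    then show ?case by (simp add: residue_zero)
  next
    case (Suc v)
    show ?case
    proof (cases "\<forall>j. 2 dvd c j")
      case True
      then obtain d where d: "\<And>j. c j = 2 * d j" unfolding dvd_def by metis
      have "residue (d i) v \<noteq> 0"
      proof
        assume "residue (d i) v = 0"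
        then obtain z where "residue (d i) (Suc v) = 2 ^ v * z"
          using residue_Suc_mod[of "d i" v] by auto
        moreover have "c i = d i + d i" using d by simp
        ultimately have "residue (c i) (Suc v) = (2 ^ Suc v * z) mod 2 ^ Suc v"
          by (simp only: plus_z2adic.rep_eq) simp
        then show False using Suc.prems by simp
      qed
      then obtain k e where "\<forall>j. d j = 2 ^ k * e j" "\<exists>j. \<not> 2 dvd e j" using Suc.IH by blast
      then show ?thesis by (intro exI[of _ "Suc k"] exI[of _ e]) (simp add: d mult.assoc)
    next
      case False
      then show ?thesis by (intro exI[of _ 0] exI[of _ c]) auto
    qed
  qed
qed

section \<open>Torsion-free modules over the 2-adic integers\<close>

text \<open>A type class, so that function types are again instances; finitely generated lattices occur as images of projections.\<close>

class zmod = ab_group_add +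
  fixes zscale :: "z2adic \<Rightarrow> 'a \<Rightarrow> 'a" (infixr "*z" 75)
  assumes zscale_add_right: "c *z (x + y) = c *z x + c *z y"
    and zscale_add_left: "(c + d) *z x = c *z x + d *z x"
    and zscale_zscale [simp]: "c *z (d *z x) = (c * d) *z x"
    and zscale_one [simp]: "1 *z x = x"
    and zscale_torsion_free: "c *z x = 0 \<Longrightarrow> c = 0 \<or> x = 0"
begin

lemma zscale_zero [simp]: "0 *z x = 0" "c *z 0 = 0"
  using zscale_add_left[of 0 0 x] zscale_add_right[of c 0 0] by auto

lemma zscale_minus [simp]: "(- c) *z x = - (c *z x)" "c *z (- x) = - (c *z x)"
proof -
  have "(- c) *z x + c *z x = 0" "c *z (- x) + c *z x = 0"
    by (simp_all flip: zscale_add_left zscale_add_right)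
  then show "(- c) *z x = - (c *z x)" "c *z (- x) = - (c *z x)"
    by (simp_all only: eq_neg_iff_add_eq_0)
qed

lemma zscale_diff_right: "c *z (x - y) = c *z x - c *z y"
  using zscale_add_right[of c x "- y"] by simp

lemma zscale_diff_left: "(c - d) *z x = c *z x - d *z x"
  using zscale_add_left[of c "- d" x] by simp

lemma zscale_eq_0_iff [simp]: "c *z x = 0 \<longleftrightarrow> c = 0 \<or> x = 0"
  using zscale_torsion_free by auto

lemma zscale_cancel: "c \<noteq> 0 \<Longrightarrow> c *z x = c *z y \<longleftrightarrow> x = y"
  using zscale_eq_0_iff[of c "x - y"] by (simp add: zscale_diff_right)

lemma zscale_sum_right: "c *z (\<Sum>i\<in>I. f i) = (\<Sum>i\<in>I. c *z f i)"
  by (induction I rule: infinite_finite_induct) (simp_all add: zscale_add_right)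

lemma zscale_sum_left: "(\<Sum>i\<in>I. f i) *z x = (\<Sum>i\<in>I. f i *z x)"
  by (induction I rule: infinite_finite_induct) (simp_all add: zscale_add_left)

end

instantiation z2adic :: zmod
begin
definition zscale_z2adic :: "z2adic \<Rightarrow> z2adic \<Rightarrow> z2adic" where [simp]: "zscale_z2adic c x = c * x"
instance by standard (simp_all add: algebra_simps)
end

instantiation "fun" :: (type, zmod) zmod
begin
definition zscale_fun :: "z2adic \<Rightarrow> ('a \<Rightarrow> 'b) \<Rightarrow> 'a \<Rightarrow> 'b" where "zscale_fun c f = (\<lambda>x. c *z f x)"
instance by standard (auto simp: zscale_fun_def fun_eq_iff zscale_add_right zscale_add_left)
end

lemma zscale_fun_apply [simp]: "(c *z f) x = c *z f x"
  by (simp add: zscale_fun_def)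

lemma sum_fun_apply [simp]: "(\<Sum>i\<in>I. f i) x = (\<Sum>i\<in>I. f i x)"
  for f :: "'i \<Rightarrow> 'a \<Rightarrow> 'b::comm_monoid_add"
  by (induction I rule: infinite_finite_induct) simp_all

definition zlin :: "('a::zmod \<Rightarrow> 'b::zmod) \<Rightarrow> bool" where
  "zlin f \<longleftrightarrow> (\<forall>x y. f (x + y) = f x + f y) \<and> (\<forall>c x. f (c *z x) = c *z f x)"

lemma zlinI: "(\<And>x y. f (x + y) = f x + f y) \<Longrightarrow> (\<And>c x. f (c *z x) = c *z f x) \<Longrightarrow> zlin f"
  by (simp add: zlin_def)

lemma zlin_add: "zlin f \<Longrightarrow> f (x + y) = f x + f y"
  and zlin_scale: "zlin f \<Longrightarrow> f (c *z x) = c *z f x"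
  by (simp_all add: zlin_def)

lemma zlin_zero: "zlin f \<Longrightarrow> f 0 = 0"
  using zlin_scale[of f 0 0] by simp

lemma zlin_minus: "zlin f \<Longrightarrow> f (- x) = - f x"
  using zlin_scale[of f "- 1" x] by simp

lemma zlin_diff: "zlin f \<Longrightarrow> f (x - y) = f x - f y"
  using zlin_add[of f x "- y"] by (simp add: zlin_minus)

lemma zlin_sum: "zlin f \<Longrightarrow> f (\<Sum>i\<in>I. g i) = (\<Sum>i\<in>I. f (g i))"
  by (induction I rule: infinite_finite_induct) (simp_all add: zlin_zero zlin_add)

lemma zlin_id: "zlin (\<lambda>x. x)" and zlin_0: "zlin (\<lambda>x. 0)"
  by (simp_all add: zlin_def)

lemma zlin_comp: "zlin f \<Longrightarrow> zlin g \<Longrightarrow> zlin (\<lambda>x. f (g x))"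
  by (simp add: zlin_def)

lemma zlin_plus: "zlin f \<Longrightarrow> zlin g \<Longrightarrow> zlin (\<lambda>x. f x + g x)"
  by (simp add: zlin_def zscale_add_right algebra_simps)

lemma zlin_uminus: "zlin f \<Longrightarrow> zlin (\<lambda>x. - f x)"
  by (simp add: zlin_def)

lemma zlin_minus': "zlin f \<Longrightarrow> zlin g \<Longrightarrow> zlin (\<lambda>x. f x - g x)"
  by (simp add: zlin_def zscale_diff_right algebra_simps)

lemma zlin_sum': "(\<And>i. i \<in> I \<Longrightarrow> zlin (f i)) \<Longrightarrow> zlin (\<lambda>x. \<Sum>i\<in>I. f i x)"
  by (simp add: zlin_def sum.distrib zscale_sum_right)

lemma zlin_scale': "zlin f \<Longrightarrow> zlin (\<lambda>x. c *z f x)"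
  by (simp add: zlin_def zscale_add_right mult.commute)

lemma zlin_scale_vec: "zlin f \<Longrightarrow> zlin (\<lambda>x. f x *z v)" for f :: "_ \<Rightarrow> z2adic"
  by (simp add: zlin_def zscale_add_left)

lemma zlin_eval: "zlin (\<lambda>f. f i)"
  by (simp add: zlin_def)

lemma zlin_app: "zlin f \<Longrightarrow> zlin (\<lambda>x. f x i)"
  by (simp add: zlin_def)

lemma zlin_fun: "(\<And>i. zlin (\<lambda>x. f x i)) \<Longrightarrow> zlin f"
  by (simp add: zlin_def fun_eq_iff)

lemmas zlin_intros = zlin_id zlin_0 zlin_plus zlin_uminus zlin_minus' zlin_sum' zlin_scale' zlin_scale_vec zlin_eval

subsection \<open>Pure submodules\<close>

definition pure_submodule :: "'a::zmod set \<Rightarrow> bool" where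
  "pure_submodule S \<longleftrightarrow> 0 \<in> S \<and> (\<forall>x\<in>S. \<forall>y\<in>S. x + y \<in> S) \<and> (\<forall>c. \<forall>x\<in>S. c *z x \<in> S) \<and>
     (\<forall>c x. c \<noteq> 0 \<longrightarrow> c *z x \<in> S \<longrightarrow> x \<in> S)"

text \<open>The 2-adic substitute for Gaussian elimination: a pure submodule contains a vector with an entry \<open>1\<close>, and
this pivot can be removed. The set \<open>J\<close> indexes the coordinates that remain free, and \<open>p\<close> is the projection along \<open>S\<close>
onto the functions supported there. It yields both bases of torsion-free modules and the extension of
functionals from pure submodules.\<close>

lemma pure_submodule_complement:
  fixes S :: "('i \<Rightarrow> z2adic) set"
  assumes "finite I" "pure_submodule S" "\<forall>c\<in>S. \<forall>i. i \<notin> I \<longrightarrow> c i = 0"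
  shows "\<exists>J p. J \<subseteq> I \<and> zlin p \<and> (\<forall>c. (\<forall>i. i \<notin> I \<longrightarrow> c i = 0) \<longrightarrow> c - p c \<in> S \<and> (\<forall>i. i \<notin> J \<longrightarrow> p c i = 0))
     \<and> (\<forall>c\<in>S. p c = 0) \<and> (\<forall>c. (\<forall>i. i \<notin> J \<longrightarrow> c i = 0) \<longrightarrow> p c = c)"
  using assms
proof (induction I arbitrary: S rule: finite_psubset_induct)
  case (psubset I)
  note supp = psubset.prems(2)[rule_format]
  note S = psubset.prems(1)[unfolded pure_submodule_def]
  show ?case
  proof (cases "S \<subseteq> {0}")
    case True
    then have "S = {0}" using S by auto
    then show ?thesis by (intro exI[of _ I] exI[of _ "\<lambda>c. c"]) (simp add: zlin_id zero_fun_def)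
  next
    case False
    then obtain c where c: "c \<in> S" "c \<noteq> 0" by auto
    then have "\<exists>i. c i \<noteq> 0" by (auto simp: fun_eq_iff)
    then obtain k d j where d: "\<And>i. c i = 2 ^ k * d i" and j: "\<not> 2 dvd d j"
      using normalize_family[of c] by blast
    have "c = 2 ^ k *z d" using d by (simp add: fun_eq_iff)
    moreover have "(2 :: z2adic) ^ k \<noteq> 0" by simp
    ultimately have "d \<in> S" using S c(1) by metis
    obtain u where u: "d j * u = 1" using odd_z2adic_is_unit[OF j] by blast
    \<comment> \<open>Purity removes the common power of 2, which gives a vector of \<open>S\<close> with entry \<open>1\<close> at \<open>j\<close>. Subtracting multiples of it
    reduces to the vectors that vanish at \<open>j\<close>.\<close>
    define r where "r = u *z d"
    have r: "r \<in> S" "r j = 1" using \<open>d \<in> S\<close> S u unfolding r_def by (blast, simp add: mult.commute)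
    have "j \<in> I" using supp[OF r(1)] r(2) by (metis zero_neq_one)
    define S' where "S' = {c\<in>S. c j = 0}"
    have S': "pure_submodule S'" "\<forall>c\<in>S'. \<forall>i. i \<notin> I - {j} \<longrightarrow> c i = 0"
    proof -
      have "c *z x \<in> S \<and> (c *z x) j = 0" if "x \<in> S" "x j = 0" for c x
        using S that by simp
      moreover have "x \<in> S \<and> x j = 0" if "c \<noteq> 0" "c *z x \<in> S" "(c *z x) j = 0" for c x
      proof -
        have "x \<in> S" using S that by blast
        then show ?thesis using that by simp
      qed
      moreover have "x + y \<in> S \<and> (x + y) j = 0" if "x \<in> S" "x j = 0" "y \<in> S" "y j = 0" for x y
        using S that by simp
      moreover have "0 \<in> S \<and> (0 :: 'i \<Rightarrow> z2adic) j = 0" using S by simp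
      ultimately show "pure_submodule S'" unfolding pure_submodule_def S'_def by blast
    qed (use supp in \<open>auto simp: S'_def\<close>)
    have "I - {j} \<subset> I" using \<open>j \<in> I\<close> by auto
    from psubset.IH[of "I - {j}" S', OF this S'] obtain J p where J: "J \<subseteq> I - {j}" "zlin p"
      "\<forall>c. (\<forall>i. i \<notin> I - {j} \<longrightarrow> c i = 0) \<longrightarrow> c - p c \<in> S' \<and> (\<forall>i. i \<notin> J \<longrightarrow> p c i = 0)"
      "\<forall>c\<in>S'. p c = 0" "\<forall>c. (\<forall>i. i \<notin> J \<longrightarrow> c i = 0) \<longrightarrow> p c = c"
      by blast
    note Jp = J(1,2) J(3)[THEN spec, THEN mp] J(4)[THEN bspec] J(5)[THEN spec, THEN mp]
    define q where "q c = p (c - c j *z r)" for c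
    have "zlin q" unfolding q_def by (intro zlin_comp[OF Jp(2)] zlin_intros)
    moreover have "c - q c \<in> S \<and> (\<forall>i. i \<notin> J \<longrightarrow> q c i = 0)" if "\<forall>i. i \<notin> I \<longrightarrow> c i = 0" for c
    proof -
      have "\<forall>i. i \<notin> I - {j} \<longrightarrow> (c - c j *z r) i = 0"
        using that r supp[OF r(1)] by auto
      from Jp(3)[OF this] have 1: "c - c j *z r - q c \<in> S" "\<forall>i. i \<notin> J \<longrightarrow> q c i = 0"
        unfolding q_def S'_def by blast+
      have "c j *z r \<in> S" using r S by blast
      then have "(c - c j *z r - q c) + c j *z r \<in> S" using 1 S by blast
      then show ?thesis using 1(2) by (simp add: algebra_simps)
    qed
    moreover have "q c = 0" if "c \<in> S" for c
    proof -
      have "(- c j) *z r \<in> S" using r S by blast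
      then have "c + (- c j) *z r \<in> S" using S that by blast
      then have "c - c j *z r \<in> S'" using r(2) by (simp add: S'_def)
      then show ?thesis unfolding q_def by (rule Jp(4))
    qed
    moreover have "q c = c" if "\<forall>i. i \<notin> J \<longrightarrow> c i = 0" for c
    proof -
      have "c j = 0" using that Jp(1) by auto
      then show ?thesis using Jp(5)[OF that] by (simp add: q_def)
    qed
    ultimately show ?thesis using Jp(1) by (intro exI[of _ J] exI[of _ q]) blast
  qed
qed

section \<open>Bases and traces of projections of finite rank\<close>

text \<open>\<open>F\<close> factors through a free module of finite rank. For a projection this says that its image is a lattice.\<close>

definition finrank :: "('v::zmod \<Rightarrow> 'v) \<Rightarrow> bool" where
  "finrank F \<longleftrightarrow> (\<exists>(n::nat) e d. (\<forall>i. zlin (d i)) \<and> (\<forall>x. F x = (\<Sum>i<n. d i x *z e i)))"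

text \<open>For a projection \<open>F\<close>: the \<open>e i\<close> are a basis of its image and \<open>d\<close> is the dual basis, extended by \<open>F\<close> to the whole type.\<close>

definition is_basis :: "('v::zmod \<Rightarrow> 'v) \<Rightarrow> nat \<Rightarrow> (nat \<Rightarrow> 'v) \<Rightarrow> (nat \<Rightarrow> 'v \<Rightarrow> z2adic) \<Rightarrow> bool" where
  "is_basis F n e d \<longleftrightarrow> (\<forall>i. zlin (d i)) \<and> (\<forall>x. F x = (\<Sum>i<n. d i x *z e i)) \<and>
     (\<forall>i<n. \<forall>j<n. d i (e j) = (if i = j then 1 else 0))"

lemma finrankI:
  assumes "finite I" "\<And>i. i \<in> I \<Longrightarrow> zlin (d i)" "\<And>x. F x = (\<Sum>i\<in>I. d i x *z e i)"
  shows "finrank F"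
proof -
  obtain h where h: "bij_betw h {..<card I} I"
    using assms(1) by (metis atLeast0LessThan ex_bij_betw_nat_finite)
  define d' where "d' k = (if k < card I then d (h k) else (\<lambda>x. 0))" for k
  have "zlin (d' k)" for k
    using assms(2) bij_betwE[OF h] by (auto simp: d'_def zlin_0)
  moreover have "F x = (\<Sum>k<card I. d' k x *z e (h k))" for x
    using sum.reindex_bij_betw[OF h, of "\<lambda>i. d i x *z e i"] by (simp add: assms(3) d'_def)
  ultimately show ?thesis
    unfolding finrank_def by (intro exI[of _ "card I"] exI[of _ "\<lambda>k. e (h k)"] exI[of _ d']) blast
qed

lemma finrank_sum:
  assumes "finite K" "\<And>k. k \<in> K \<Longrightarrow> finrank (F k)"
  shows "finrank (\<lambda>x. \<Sum>k\<in>K. F k x)"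
proof -
  have "\<exists>(n::nat) e d. (\<forall>i. zlin (d i)) \<and> (\<forall>x. F k x = (\<Sum>i<n. d i x *z e i))" if "k \<in> K" for k
    using assms(2)[OF that] by (simp add: finrank_def)
  then obtain n e d where d: "\<And>k i. k \<in> K \<Longrightarrow> zlin (d k i)"
    "\<And>k x. k \<in> K \<Longrightarrow> F k x = (\<Sum>i<(n k::nat). d k i x *z e k i)"
    by metis
  show ?thesis
  proof (rule finrankI[where I = "SIGMA k:K. {..<n k}" and d = "\<lambda>p. d (fst p) (snd p)" and e = "\<lambda>p. e (fst p) (snd p)"])
    show "(\<Sum>k\<in>K. F k x) = (\<Sum>p\<in>(SIGMA k:K. {..<n k}). d (fst p) (snd p) x *z e (fst p) (snd p))" for x
      using d(2) by (simp add: sum.Sigma[OF assms(1)] split_def)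
  qed (use assms d in auto)
qed

lemma finrank_comp:
  assumes "finrank F" "zlin f" "zlin g"
  shows "finrank (\<lambda>x. f (F (g x)))"
proof -
  obtain n :: nat and e d where d: "\<And>i. zlin (d i)" "\<And>x. F x = (\<Sum>i<n. d i x *z e i)"
    using assms(1) by (auto simp: finrank_def)
  have "f (F (g x)) = (\<Sum>i<n. d i (g x) *z f (e i))" for x
    using assms(2) by (simp add: d(2) zlin_sum zlin_scale)
  moreover have "zlin (\<lambda>x. d i (g x))" for i by (rule zlin_comp[OF d(1) assms(3)])
  ultimately show ?thesis
    by (intro finrankI[where I = "{..<n}" and d = "\<lambda>i x. d i (g x)" and e = "\<lambda>i. f (e i)"]) auto
qed

text \<open>The relations among the generators \<open>F (e0 i)\<close> form a pure submodule, because the type is torsion free; the free coordinates of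
a complement index a basis.\<close>

lemma basis_exists:
  assumes F: "finrank F" "zlin F" and idem: "\<And>x. F (F x) = F x"
  shows "\<exists>n e d. is_basis F n e d"
proof -
  obtain n :: nat and e0 d where d: "\<And>i. zlin (d i)" "\<And>x. F x = (\<Sum>i<n. d i x *z e0 i)"
    using F(1) by (auto simp: finrank_def)
  define e where "e i = F (e0 i)" for i
  have F_eq: "F x = (\<Sum>i<n. d i x *z e i)" for x
    using idem[of x] d(2)[of x] F(2) by (simp add: zlin_sum zlin_scale e_def)
  have Fe: "F (e i) = e i" for i by (simp add: e_def idem)
  define ev where "ev c = (\<Sum>i<n. c i *z e i)" for c :: "nat \<Rightarrow> z2adic"
  have ev: "ev (c + c') = ev c + ev c'" "ev (a *z c) = a *z ev c" "ev (c - c') = ev c - ev c'" "ev 0 = 0" for a c c'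
    by (simp_all add: ev_def zscale_add_left zscale_diff_left sum.distrib sum_subtractf zscale_sum_right)
  define S where "S = {c. (\<forall>i. i \<notin> {..<n} \<longrightarrow> c i = 0) \<and> ev c = 0}"
  have "pure_submodule S"
    unfolding pure_submodule_def S_def by (simp add: ev)
  moreover have "\<forall>c\<in>S. \<forall>i. i \<notin> {..<n} \<longrightarrow> c i = 0" by (simp add: S_def)
  ultimately obtain J p where J: "J \<subseteq> {..<n}" and p: "zlin p"
    "\<forall>c. (\<forall>i. i \<notin> {..<n} \<longrightarrow> c i = 0) \<longrightarrow> c - p c \<in> S \<and> (\<forall>i. i \<notin> J \<longrightarrow> p c i = 0)"
    "\<forall>c\<in>S. p c = 0" "\<forall>c. (\<forall>i. i \<notin> J \<longrightarrow> c i = 0) \<longrightarrow> p c = c"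
    using pure_submodule_complement[of "{..<n}" S] by auto
  define co where "co x i = (if i < n then d i x else 0)" for x i
  have co: "zlin co"
  proof (rule zlin_fun)
    show "zlin (\<lambda>x. co x i)" for i
      unfolding co_def by (cases "i < n") (simp_all add: d(1) zlin_0)
  qed
  have ev_co: "ev (co x) = F x" for x by (simp add: ev_def co_def F_eq)
  define d' where "d' j x = p (co x) j" for j x
  have d': "zlin (d' j)" for j
    unfolding d'_def by (rule zlin_app[OF zlin_comp[OF p(1) co]])
  have 1: "F x = (\<Sum>j\<in>J. d' j x *z e j)" for x
  proof -
    have "co x - p (co x) \<in> S" and z: "\<forall>i. i \<notin> J \<longrightarrow> p (co x) i = 0"
      using p(2) by (auto simp: co_def)
    then have "F x = ev (p (co x))" using ev_co[of x] ev(3)[of "co x" "p (co x)"] by (simp add: S_def)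
    also have "\<dots> = (\<Sum>j\<in>J. d' j x *z e j)"
      unfolding ev_def d'_def using J z by (intro sum.mono_neutral_right) auto
    finally show ?thesis .
  qed
  have 2: "d' j (e k) = (if j = k then 1 else 0)" if "k \<in> J" for j k
  proof -
    define u where "u i = (if i = k then 1 else 0 :: z2adic)" for i
    have "k < n" using that J by auto
    have "ev u = (\<Sum>i<n. if i = k then e k else 0)"
      unfolding ev_def u_def by (intro sum.cong) auto
    then have "ev u = e k" using \<open>k < n\<close> by simp
    then have "ev (co (e k) - u) = 0" by (simp add: ev ev_co Fe)
    then have "co (e k) - u \<in> S" using \<open>k < n\<close> by (auto simp: S_def co_def u_def)
    then have "p (co (e k)) = p u" using p(1,3) by (metis zlin_diff eq_iff_diff_eq_0)
    also have "p u = u" using p(4) that by (auto simp: u_def)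
    finally show ?thesis by (simp add: d'_def u_def)
  qed
  have "finite J" using J finite_subset by blast
  then obtain h where h: "bij_betw h {..<card J} J"
    by (metis atLeast0LessThan ex_bij_betw_nat_finite)
  have "is_basis F (card J) (\<lambda>i. e (h i)) (\<lambda>i. d' (h i))"
    unfolding is_basis_def
  proof (intro conjI allI impI)
    show "F x = (\<Sum>i<card J. d' (h i) x *z e (h i))" for x
      using sum.reindex_bij_betw[OF h, of "\<lambda>i. d' i x *z e i"] by (simp add: 1)
    show "d' (h i) (e (h j)) = (if i = j then 1 else 0)" if "i < card J" "j < card J" for i j
      using that 2[of "h j" "h i"] bij_betwE[OF h] bij_betw_imp_inj_on[OF h] by (auto simp: inj_on_eq_iff)
  qed (rule d')
  then show ?thesis by blast
qed

lemma basis_lin: "is_basis F n e d \<Longrightarrow> zlin (d i)"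
  and basis_expand: "is_basis F n e d \<Longrightarrow> F x = (\<Sum>i<n. d i x *z e i)"
  and basis_dual: "is_basis F n e d \<Longrightarrow> i < n \<Longrightarrow> j < n \<Longrightarrow> d i (e j) = (if i = j then 1 else 0)"
  by (simp_all add: is_basis_def)

lemma basis_fixed: "is_basis F n e d \<Longrightarrow> j < n \<Longrightarrow> F (e j) = e j"
proof -
  assume b: "is_basis F n e d" and j: "j < n"
  have "F (e j) = (\<Sum>i<n. if i = j then e j else 0)"
    unfolding basis_expand[OF b] using j by (intro sum.cong) (auto simp: basis_dual[OF b])
  then show ?thesis using j by simp
qed

lemma trace_comm:
  assumes b: "is_basis F n e d" and b': "is_basis F' m e' d'" and f: "zlin f" and g: "zlin g"
    and F: "\<And>x. F' (f x) = f x" "\<And>y. F (g y) = g y"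
  shows "(\<Sum>i<n. d i (g (f (e i)))) = (\<Sum>j<m. d' j (f (g (e' j))))"
proof -
  note l = basis_lin[OF b] and l' = basis_lin[OF b']
  have "d i (g (f (e i))) = (\<Sum>j<m. d' j (f (e i)) * d i (g (e' j)))" for i
  proof -
    have "f (e i) = (\<Sum>j<m. d' j (f (e i)) *z e' j)"
      using basis_expand[OF b', of "f (e i)"] F(1) by simp
    from arg_cong[OF this, of "\<lambda>x. d i (g x)"] show ?thesis
      by (simp only: zlin_sum[OF g] zlin_scale[OF g] zlin_sum[OF l] zlin_scale[OF l] zscale_z2adic_def)
  qed
  moreover have "d' j (f (g (e' j))) = (\<Sum>i<n. d i (g (e' j)) * d' j (f (e i)))" for j
  proof -
    have "g (e' j) = (\<Sum>i<n. d i (g (e' j)) *z e i)"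
      using basis_expand[OF b, of "g (e' j)"] F(2) by simp
    from arg_cong[OF this, of "\<lambda>x. d' j (f x)"] show ?thesis
      by (simp only: zlin_sum[OF f] zlin_scale[OF f] zlin_sum[OF l'] zlin_scale[OF l'] zscale_z2adic_def)
  qed
  ultimately show ?thesis by (simp only: mult.commute) (rule sum.swap)
qed

text \<open>The trace of \<open>f\<close> on the image of the projection \<open>F\<close>; by \<open>trace_eq\<close> it does not depend on the basis.\<close>

definition trace :: "('v::zmod \<Rightarrow> 'v) \<Rightarrow> ('v \<Rightarrow> 'v) \<Rightarrow> z2adic" where
  "trace F f = (SOME t. \<exists>n e d. is_basis F n e d \<and> t = (\<Sum>i<n. d i (f (e i))))"

lemma trace_eq:
  assumes b: "is_basis F n e d" and f: "zlin f" "\<And>x. F (f x) = f x" and F: "zlin F" "\<And>x. F (F x) = F x"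
  shows "trace F f = (\<Sum>i<n. d i (f (e i)))"
  unfolding trace_def
proof (rule some_equality)
  fix t assume "\<exists>n e d. is_basis F n e d \<and> t = (\<Sum>i<n. d i (f (e i)))"
  then obtain m e' d' where b': "is_basis F m e' d'" and t: "t = (\<Sum>i<m. d' i (f (e' i)))" by blast
  have "(\<Sum>i<n. d i (F (f (e i)))) = (\<Sum>j<m. d' j (f (F (e' j))))"
    by (rule trace_comm[OF b b' f(1) F(1) f(2) F(2)])
  then show "t = (\<Sum>i<n. d i (f (e i)))"
    using t by (simp add: f(2) basis_fixed[OF b'])
qed (use b in blast)

definition zproj :: "('v::zmod \<Rightarrow> 'v) \<Rightarrow> bool" where
  "zproj F \<longleftrightarrow> zlin F \<and> (\<forall>x. F (F x) = F x) \<and> finrank F"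

lemma zprojD: "zproj F \<Longrightarrow> zlin F" "zproj F \<Longrightarrow> F (F x) = F x" "zproj F \<Longrightarrow> finrank F"
  by (simp_all add: zproj_def)

lemma zproj_basis: "zproj F \<Longrightarrow> \<exists>n e d. is_basis F n e d"
  by (rule basis_exists) (simp_all add: zproj_def)

lemma trace_cyclic:
  assumes F: "zproj F" "zproj F'" and fg: "zlin f" "zlin g" "\<And>x. F' (f x) = f x" "\<And>y. F (g y) = g y"
  shows "trace F (\<lambda>x. g (f x)) = trace F' (\<lambda>y. f (g y))"
proof -
  obtain n e d m e' d' where b: "is_basis F n e d" "is_basis F' m e' d'"
    using F zproj_basis by metis
  show ?thesis
    using trace_comm[OF b fg] trace_eq[OF b(1) zlin_comp[OF fg(2,1)]] trace_eq[OF b(2) zlin_comp[OF fg(1,2)]] fg F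
    by (simp add: zprojD)
qed

lemma trace_sum:
  assumes F: "zproj F" and f: "\<And>k. k \<in> K \<Longrightarrow> zlin (f k)" "\<And>k x. k \<in> K \<Longrightarrow> F (f k x) = f k x"
  shows "trace F (\<lambda>x. \<Sum>k\<in>K. f k x) = (\<Sum>k\<in>K. trace F (f k))"
proof -
  obtain n e d where b: "is_basis F n e d" using F zproj_basis by metis
  have "trace F (\<lambda>x. \<Sum>k\<in>K. f k x) = (\<Sum>i<n. d i (\<Sum>k\<in>K. f k (e i)))"
    using f F by (intro trace_eq[OF b] zlin_intros) (auto simp: zprojD zlin_sum)
  also have "\<dots> = (\<Sum>i<n. \<Sum>k\<in>K. d i (f k (e i)))"
    by (simp add: zlin_sum[OF basis_lin[OF b]])
  also have "\<dots> = (\<Sum>k\<in>K. \<Sum>i<n. d i (f k (e i)))" by (rule sum.swap)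
  also have "\<dots> = (\<Sum>k\<in>K. trace F (f k))"
    using f F by (intro sum.cong refl trace_eq[OF b, symmetric]) (auto simp: zprojD)
  finally show ?thesis .
qed

lemma trace_add:
  assumes F: "zproj F" and f: "zlin f" "\<And>x. F (f x) = f x" and g: "zlin g" "\<And>x. F (g x) = g x"
  shows "trace F (\<lambda>x. f x + g x) = trace F f + trace F g"
proof -
  have "trace F (\<lambda>x. \<Sum>k\<in>{True, False}. (if k then f else g) x) = (\<Sum>k\<in>{True, False}. trace F (if k then f else g))"
    using f g by (intro trace_sum[OF F]) auto
  then show ?thesis by simp
qed

text \<open>The trace of an idempotent is its rank. In characteristic zero it can serve as a measure for induction.\<close>

lemma trace_proj:
  assumes F: "zproj F" and E: "zproj E" "\<And>x. F (E x) = E x"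
  shows "\<exists>n. trace F E = of_nat n \<and> (n = 0 \<longrightarrow> (\<forall>x. E x = 0))"
proof -
  obtain n e d where b: "is_basis E n e d" using E zproj_basis by metis
  have "trace F (\<lambda>x. E (E x)) = trace E (\<lambda>x. E (E x))"
    by (rule trace_cyclic[OF F E(1)]) (simp_all add: E zprojD)
  then have "trace F E = trace E E" by (simp add: zprojD(2)[OF E(1)])
  also have "\<dots> = (\<Sum>i<n. d i (E (e i)))" by (rule trace_eq[OF b]) (simp_all add: E zprojD)
  also have "\<dots> = (\<Sum>i<n. 1)" by (intro sum.cong) (auto simp: basis_fixed[OF b] basis_dual[OF b])
  finally have "trace F E = of_nat n" by simp
  moreover have "n = 0 \<longrightarrow> (\<forall>x. E x = 0)" using basis_expand[OF b] by simp
  ultimately show ?thesis by blast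
qed

section \<open>Lattices over the group ring\<close>

type_synonym 'v rep = "klein \<Rightarrow> 'v \<Rightarrow> 'v"

text \<open>The map \<open>\<rho> 0\<close> is a projection of finite rank and need not be the identity: the lattice is its image, on which
the group acts.\<close>

definition glat :: "'v::zmod rep \<Rightarrow> bool" where
  "glat \<rho> \<longleftrightarrow> (\<forall>g. zlin (\<rho> g)) \<and> (\<forall>g h x. \<rho> g (\<rho> h x) = \<rho> (g + h) x) \<and> finrank (\<rho> 0)"

text \<open>The last condition makes \<open>f\<close> take values in the lattice of \<open>\<sigma>\<close>; with equivariance it also makes
\<open>f\<close> vanish on the complement of the lattice of \<open>\<rho>\<close>, so that \<open>f\<close> is determined by its restriction.\<close>

definition ghom :: "'v::zmod rep \<Rightarrow> 'w::zmod rep \<Rightarrow> ('v \<Rightarrow> 'w) \<Rightarrow> bool" where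
  "ghom \<rho> \<sigma> f \<longleftrightarrow> zlin f \<and> (\<forall>g x. f (\<rho> g x) = \<sigma> g (f x)) \<and> (\<forall>x. \<sigma> 0 (f x) = f x)"

text \<open>The sum of the conjugates of \<open>h\<close>; the group has exponent two, so every element is its own inverse.\<close>

definition nm :: "'v::zmod rep \<Rightarrow> 'w::zmod rep \<Rightarrow> ('v \<Rightarrow> 'w) \<Rightarrow> 'v \<Rightarrow> 'w" where
  "nm \<rho> \<sigma> h x = (\<Sum>g\<in>UNIV. \<sigma> g (h (\<rho> g x)))"

text \<open>Over a group ring these are the homomorphisms that factor through a projective lattice.\<close>

definition null :: "'v::zmod rep \<Rightarrow> 'w::zmod rep \<Rightarrow> ('v \<Rightarrow> 'w) \<Rightarrow> bool" where
  "null \<rho> \<sigma> f \<longleftrightarrow> (\<exists>h. zlin h \<and> f = nm \<rho> \<sigma> h)"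

lemma bit_add_self: "(i :: bit) + i = 0"
  by (cases i) simp_all

lemma klein_add_self: "(g :: klein) + g = 0"
  by (simp add: prod_eq_iff bit_add_self)

lemma klein_add_left_cancel_self: "(g :: klein) + (g + h) = h"
  by (metis add.assoc add_0 klein_add_self)

lemma UNIV_bit: "(UNIV :: bit set) = {0, 1}"
  using bit.exhaust by auto

lemma finite_klein: "finite (UNIV :: klein set)"
  by (simp add: UNIV_bit flip: UNIV_Times_UNIV)

lemma card_klein: "card (UNIV :: klein set) = 4"
  by (simp add: UNIV_bit card_cartesian_product flip: UNIV_Times_UNIV)

lemma bij_klein_add: "bij ((+) (g :: klein))"
  by (rule o_bij[of "(+) g"]) (auto simp: fun_eq_iff klein_add_left_cancel_self)

lemma sum_klein_shift: "(\<Sum>h\<in>UNIV. f ((g :: klein) + h)) = (\<Sum>h\<in>UNIV. f h)"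
  using sum.reindex_bij_betw[OF bij_klein_add, of f g] by simp

lemma glat_lin: "glat \<rho> \<Longrightarrow> zlin (\<rho> g)"
  and glat_mult: "glat \<rho> \<Longrightarrow> \<rho> g (\<rho> h x) = \<rho> (g + h) x"
  and glat_finrank: "glat \<rho> \<Longrightarrow> finrank (\<rho> 0)"
  unfolding glat_def by blast+

lemma glat_self: "glat \<rho> \<Longrightarrow> \<rho> g (\<rho> g x) = \<rho> 0 x"
  by (simp add: glat_mult klein_add_self)

lemma glat_zproj: "glat \<rho> \<Longrightarrow> zproj (\<rho> 0)"
  by (simp add: zproj_def glat_lin glat_mult glat_finrank)

lemma ghom_lin: "ghom \<rho> \<sigma> f \<Longrightarrow> zlin f"
  and ghom_comm: "ghom \<rho> \<sigma> f \<Longrightarrow> f (\<rho> g x) = \<sigma> g (f x)"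
  and ghom_fix: "ghom \<rho> \<sigma> f \<Longrightarrow> \<sigma> 0 (f x) = f x"
  unfolding ghom_def by blast+

lemma ghom_fix': "ghom \<rho> \<sigma> f \<Longrightarrow> f (\<rho> 0 x) = f x"
  by (simp add: ghom_comm ghom_fix)

lemma ghomI: "zlin f \<Longrightarrow> (\<And>g x. f (\<rho> g x) = \<sigma> g (f x)) \<Longrightarrow> (\<And>x. \<sigma> 0 (f x) = f x) \<Longrightarrow> ghom \<rho> \<sigma> f"
  by (simp add: ghom_def)

lemma ghom_comp: "ghom \<rho> \<sigma> f \<Longrightarrow> ghom \<sigma> \<tau> g \<Longrightarrow> ghom \<rho> \<tau> (\<lambda>x. g (f x))"
  by (rule ghomI) (simp_all add: ghom_lin ghom_comm ghom_fix zlin_comp)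

lemma ghom_id: "glat \<rho> \<Longrightarrow> ghom \<rho> \<rho> (\<rho> 0)"
  by (rule ghomI) (simp_all add: glat_lin glat_mult)

lemma ghom_0: "glat \<sigma> \<Longrightarrow> ghom \<rho> \<sigma> (\<lambda>x. 0)"
  by (rule ghomI) (simp_all add: zlin_0 zlin_zero[OF glat_lin])

lemma ghom_add: "glat \<sigma> \<Longrightarrow> ghom \<rho> \<sigma> f \<Longrightarrow> ghom \<rho> \<sigma> g \<Longrightarrow> ghom \<rho> \<sigma> (\<lambda>x. f x + g x)"
  by (rule ghomI) (auto simp: ghom_lin ghom_comm ghom_fix zlin_add[OF glat_lin] intro: zlin_plus)

lemma ghom_diff: "glat \<sigma> \<Longrightarrow> ghom \<rho> \<sigma> f \<Longrightarrow> ghom \<rho> \<sigma> g \<Longrightarrow> ghom \<rho> \<sigma> (\<lambda>x. f x - g x)"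
  by (rule ghomI) (auto simp: ghom_lin ghom_comm ghom_fix zlin_diff[OF glat_lin] intro: zlin_minus')

lemma ghom_scale: "glat \<sigma> \<Longrightarrow> ghom \<rho> \<sigma> f \<Longrightarrow> ghom \<rho> \<sigma> (\<lambda>x. c *z f x)"
  by (rule ghomI) (auto simp: ghom_lin ghom_comm ghom_fix zlin_scale[OF glat_lin] intro: zlin_scale')

lemma zlin_nm:
  assumes "glat \<rho>" "glat \<sigma>" "zlin h"
  shows "zlin (nm \<rho> \<sigma> h)"
proof -
  have "zlin (\<lambda>x. \<sigma> g (h (\<rho> g x)))" for g
    by (rule zlin_comp[OF glat_lin[OF assms(2)] zlin_comp[OF assms(3) glat_lin[OF assms(1)]]])
  then have "zlin (\<lambda>x. nm \<rho> \<sigma> h x)" unfolding nm_def by (rule zlin_sum')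
  then show ?thesis by simp
qed

lemma ghom_nm:
  assumes "glat \<rho>" "glat \<sigma>" "zlin h"
  shows "ghom \<rho> \<sigma> (nm \<rho> \<sigma> h)"
proof (rule ghomI)
  show "nm \<rho> \<sigma> h (\<rho> g x) = \<sigma> g (nm \<rho> \<sigma> h x)" for g x
  proof -
    have "nm \<rho> \<sigma> h (\<rho> g x) = (\<Sum>k\<in>UNIV. \<sigma> k (h (\<rho> (k + g) x)))"
      by (simp add: nm_def glat_mult[OF assms(1)])
    also have "\<dots> = (\<Sum>k\<in>UNIV. \<sigma> (g + k) (h (\<rho> (g + k + g) x)))"
      by (rule sum_klein_shift[symmetric])
    also have "\<dots> = \<sigma> g (nm \<rho> \<sigma> h x)"
      by (simp add: nm_def zlin_sum[OF glat_lin[OF assms(2)]] glat_mult[OF assms(2)] add.commute[of _ g]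
          klein_add_left_cancel_self)
    finally show ?thesis .
  qed
  show "\<sigma> 0 (nm \<rho> \<sigma> h x) = nm \<rho> \<sigma> h x" for x
    by (simp add: nm_def zlin_sum[OF glat_lin[OF assms(2)]] glat_mult[OF assms(2)])
qed (rule zlin_nm[OF assms])

lemma null_add:
  assumes "glat \<sigma>" "null \<rho> \<sigma> f" "null \<rho> \<sigma> g"
  shows "null \<rho> \<sigma> (\<lambda>x. f x + g x)"
proof -
  obtain h k where h: "zlin h" "f = nm \<rho> \<sigma> h" and k: "zlin k" "g = nm \<rho> \<sigma> k"
    using assms by (auto simp: null_def)
  have "(\<lambda>x. f x + g x) = nm \<rho> \<sigma> (\<lambda>x. h x + k x)"
    by (simp add: h(2) k(2) nm_def fun_eq_iff zlin_add[OF glat_lin[OF assms(1)]] sum.distrib)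
  then show ?thesis using zlin_plus[OF h(1) k(1)] by (auto simp: null_def)
qed

lemma null_0: "glat \<sigma> \<Longrightarrow> null \<rho> \<sigma> (\<lambda>x. 0)"
  unfolding null_def by (rule exI[of _ "\<lambda>x. 0"]) (simp add: zlin_0 nm_def fun_eq_iff zlin_zero[OF glat_lin])

lemma null_comp_left:
  assumes "null \<rho> \<sigma> f" "ghom \<sigma> \<tau> g"
  shows "null \<rho> \<tau> (\<lambda>x. g (f x))"
proof -
  obtain h where h: "zlin h" "f = nm \<rho> \<sigma> h" using assms by (auto simp: null_def)
  have "(\<lambda>x. g (f x)) = nm \<rho> \<tau> (\<lambda>x. g (h x))"
    by (simp add: h(2) nm_def fun_eq_iff zlin_sum[OF ghom_lin[OF assms(2)]] ghom_comm[OF assms(2)])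
  then show ?thesis using zlin_comp[OF ghom_lin[OF assms(2)] h(1)] by (auto simp: null_def)
qed

lemma null_comp_right:
  assumes "null \<sigma> \<tau> g" "ghom \<rho> \<sigma> f"
  shows "null \<rho> \<tau> (\<lambda>x. g (f x))"
proof -
  obtain h where h: "zlin h" "g = nm \<sigma> \<tau> h" using assms by (auto simp: null_def)
  have "(\<lambda>x. g (f x)) = nm \<rho> \<tau> (\<lambda>x. h (f x))"
    by (simp add: h(2) nm_def fun_eq_iff ghom_comm[OF assms(2)])
  then show ?thesis using zlin_comp[OF h(1) ghom_lin[OF assms(2)]] by (auto simp: null_def)
qed

subsection \<open>The trace form on stable homomorphisms\<close>

lemma trace_conj_sum:
  assumes \<rho>: "glat \<rho>" and B: "zlin B"
  shows "trace (\<rho> 0) (\<lambda>x. \<Sum>g\<in>UNIV. \<rho> g (B (\<rho> g x))) = 4 * trace (\<rho> 0) (\<lambda>x. \<rho> 0 (B x))"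
proof -
  note l = glat_lin[OF \<rho>] and m = glat_mult[OF \<rho>] and P = glat_zproj[OF \<rho>]
  have *: "trace (\<rho> 0) (\<lambda>x. \<rho> g (B (\<rho> g x))) = trace (\<rho> 0) (\<lambda>x. \<rho> 0 (B x))" for g
  proof -
    have "trace (\<rho> 0) (\<lambda>x. \<rho> g (B (\<rho> g x))) = trace (\<rho> 0) (\<lambda>x. \<rho> g (\<rho> g (B x)))"
      by (rule trace_cyclic[OF P P, of "\<rho> g" "\<lambda>x. \<rho> g (B x)"]) (simp_all add: m l zlin_comp[OF l B])
    then show ?thesis by (simp add: glat_self[OF \<rho>])
  qed
  have "trace (\<rho> 0) (\<lambda>x. \<Sum>g\<in>UNIV. \<rho> g (B (\<rho> g x))) = (\<Sum>g\<in>UNIV. trace (\<rho> 0) (\<lambda>x. \<rho> g (B (\<rho> g x))))"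
    by (intro trace_sum[OF P] zlin_comp[OF l zlin_comp[OF B l]]) (simp add: m)
  then show ?thesis by (simp add: card_klein *)
qed

lemma trace_nm:
  assumes "glat \<rho>" "ghom \<sigma> \<rho> u" "zlin h"
  shows "trace (\<rho> 0) (\<lambda>x. u (nm \<rho> \<sigma> h x)) = 4 * trace (\<rho> 0) (\<lambda>x. u (h x))"
proof -
  have "(\<lambda>x. u (nm \<rho> \<sigma> h x)) = (\<lambda>x. \<Sum>g\<in>UNIV. \<rho> g (u (h (\<rho> g x))))"
    by (simp only: nm_def zlin_sum[OF ghom_lin[OF assms(2)]] ghom_comm[OF assms(2)])
  then show ?thesis
    using trace_conj_sum[OF assms(1) zlin_comp[OF ghom_lin[OF assms(2)] assms(3)]]
    by (simp only: ghom_fix[OF assms(2)])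
qed

lemma trace_nm':
  assumes "glat \<rho>" "ghom \<rho> \<sigma> f" "zlin u"
  shows "trace (\<rho> 0) (\<lambda>x. nm \<sigma> \<rho> u (f x)) = 4 * trace (\<rho> 0) (\<lambda>x. \<rho> 0 (u (f x)))"
proof -
  have "(\<lambda>x. nm \<sigma> \<rho> u (f x)) = (\<lambda>x. \<Sum>g\<in>UNIV. \<rho> g (u (f (\<rho> g x))))"
    by (simp only: nm_def ghom_comm[OF assms(2)])
  then show ?thesis
    using trace_conj_sum[OF assms(1) zlin_comp[OF assms(3) ghom_lin[OF assms(2)]]] by (simp only:)
qed

text \<open>Conjugation does not change a trace, and there are four conjugates.\<close>

lemma trace_null_dvd:
  assumes "glat \<rho>" "ghom \<sigma> \<rho> u" "null \<rho> \<sigma> f"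
  shows "4 dvd trace (\<rho> 0) (\<lambda>x. u (f x))"
proof -
  obtain h where h: "zlin h" "f = nm \<rho> \<sigma> h" using assms(3) by (auto simp: null_def)
  show ?thesis unfolding h(2) trace_nm[OF assms(1,2) h(1)] by (rule dvd_triv_left)
qed

text \<open>The trace form identifies the dual of the linear maps from \<open>\<sigma>\<close> to \<open>\<rho>\<close> with the linear maps in the other direction. By
assumption a quarter of the functional \<open>u \<mapsto> tr (u f)\<close> is integral on the equivariant maps. These form a
pure submodule, so the quotient extends to all linear maps and is given by some \<open>h\<close>. Then \<open>f\<close> and the norm of \<open>h\<close> pair
equally with all equivariant maps and therefore agree.\<close>

lemma stable_duality:
  assumes \<rho>: "glat \<rho>" and \<sigma>: "glat \<sigma>" and f: "ghom \<rho> \<sigma> f"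
    and dv: "\<And>u. ghom \<sigma> \<rho> u \<Longrightarrow> 4 dvd trace (\<rho> 0) (\<lambda>x. u (f x))"
  shows "null \<rho> \<sigma> f"
proof -
  note P = glat_zproj[OF \<rho>] and P' = glat_zproj[OF \<sigma>]
  obtain n e d m e' d' where b: "is_basis (\<rho> 0) n e d" and b': "is_basis (\<sigma> 0) m e' d'"
    using zproj_basis[OF P] zproj_basis[OF P'] by metis
  note l = basis_lin[OF b] and l' = basis_lin[OF b']
  define I where "I = {..<n} \<times> {..<m}"
  have finI: "finite I" by (simp add: I_def)
  define U where "U c y = (\<Sum>p\<in>I. (c p * d' (snd p) y) *z e (fst p))" for c :: "nat \<times> nat \<Rightarrow> z2adic" and y
  have U_lin: "zlin (U c)" for c
    by (rule zlinI) (simp_all add: U_def zlin_add[OF l'] zlin_scale[OF l'] distrib_left zscale_add_left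
        sum.distrib zscale_sum_right mult_ac)
  have U_add: "U (c + c') y = U c y + U c' y" and U_scale: "U (a *z c) y = a *z U c y" and U_0: "U 0 y = 0" for a c c' y
    by (simp_all add: U_def distrib_left distrib_right zscale_add_left sum.distrib zscale_sum_right mult_ac)
  have U_fix: "\<rho> 0 (U c y) = U c y" for c y
    unfolding U_def zlin_sum[OF glat_lin[OF \<rho>]] zlin_scale[OF glat_lin[OF \<rho>]]
    by (intro sum.cong) (auto simp: I_def basis_fixed[OF b])
  have U_trace: "trace (\<rho> 0) (\<lambda>x. U c (D x)) = (\<Sum>k<n. d k (U c (D (e k))))" if "zlin D" for c D
    by (rule trace_eq[OF b zlin_comp[OF U_lin that]]) (simp_all add: U_fix zprojD[OF P])
  \<comment> \<open>The matrices of the equivariant maps; these are pure because equivariance can be tested after multiplication by a nonzero scalar.\<close>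
  define S where "S = {c. (\<forall>p. p \<notin> I \<longrightarrow> c p = 0) \<and> ghom \<sigma> \<rho> (U c)}"
  have "pure_submodule S"
  proof -
    have 0: "ghom \<sigma> \<rho> (U 0)" using ghom_0[OF \<rho>, of \<sigma>] by (simp add: U_0[abs_def])
    have add: "ghom \<sigma> \<rho> (U (c + c'))" if "ghom \<sigma> \<rho> (U c)" "ghom \<sigma> \<rho> (U c')" for c c'
      using ghom_add[OF \<rho> that] by (simp add: U_add[abs_def])
    have scale: "ghom \<sigma> \<rho> (U (a *z c))" if "ghom \<sigma> \<rho> (U c)" for a c
      using ghom_scale[OF \<rho> that] by (simp add: U_scale[abs_def])
    have pure: "c \<in> S" if "a \<noteq> 0" "a *z c \<in> S" for a c
    proof -
      have 0: "(a *z c) p = 0" if "p \<notin> I" for p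
        using \<open>a *z c \<in> S\<close> that unfolding S_def by blast
      have 1: "a * c p = 0" if "p \<notin> I" for p
        using 0[OF that] by simp
      have 2: "ghom \<sigma> \<rho> (U (a *z c))"
        using that(2) unfolding S_def by blast
      have "U c (\<sigma> g y) = \<rho> g (U c y)" for g y
        using ghom_comm[OF 2, of g y] that(1)
        by (simp add: U_scale zlin_scale[OF glat_lin[OF \<rho>]] zscale_cancel)
      then have "ghom \<sigma> \<rho> (U c)" using U_lin U_fix by (intro ghomI)
      then show ?thesis using 1 that(1) by (simp add: S_def)
    qed
    show ?thesis
      unfolding pure_submodule_def
    proof (intro conjI ballI allI impI)
      show "0 \<in> S" using 0 by (simp add: S_def)
      show "x + y \<in> S" if "x \<in> S" "y \<in> S" for x y using add that by (simp add: S_def)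
      show "a *z x \<in> S" if "x \<in> S" for a x using scale that by (simp add: S_def)
    qed (rule pure)
  qed
  moreover have "\<forall>c\<in>S. \<forall>p. p \<notin> I \<longrightarrow> c p = 0" by (simp add: S_def)
  ultimately obtain J Q where Q: "zlin Q" "\<forall>c. (\<forall>p. p \<notin> I \<longrightarrow> c p = 0) \<longrightarrow> c - Q c \<in> S \<and> (\<forall>p. p \<notin> J \<longrightarrow> Q c p = 0)"
    "\<forall>c\<in>S. Q c = 0"
    using pure_submodule_complement[OF finI, of S] by blast
  define \<tau> where "\<tau> c = (\<Sum>k<n. d k (U c (f (e k))))" for c
  have \<tau>_lin: "zlin \<tau>"
    by (rule zlinI) (simp_all add: \<tau>_def U_add U_scale zlin_add[OF l] zlin_scale[OF l] sum.distrib sum_distrib_left)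
  define \<delta> where "\<delta> p q = (if q = p then 1 else 0 :: z2adic)" for p q :: "nat \<times> nat"
  have "\<exists>w. \<tau> (\<delta> p - Q (\<delta> p)) = 4 * w" if "p \<in> I" for p
  proof -
    have "\<forall>q. q \<notin> I \<longrightarrow> \<delta> p q = 0" using that by (auto simp: \<delta>_def)
    then have "\<delta> p - Q (\<delta> p) \<in> S" using Q(2) by blast
    then have "4 dvd trace (\<rho> 0) (\<lambda>x. U (\<delta> p - Q (\<delta> p)) (f x))" using dv by (simp add: S_def)
    then show ?thesis by (simp add: U_trace[OF ghom_lin[OF f]] \<tau>_def dvd_def)
  qed
  then obtain w where w: "\<And>p. p \<in> I \<Longrightarrow> \<tau> (\<delta> p - Q (\<delta> p)) = 4 * w p" by metis
  have \<tau>_S: "\<tau> c = 4 * (\<Sum>p\<in>I. c p * w p)" if "c \<in> S" for c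
  proof -
    have K: "zlin (\<lambda>c. \<tau> (c - Q c))"
      by (rule zlin_comp[OF \<tau>_lin zlin_minus'[OF zlin_id Q(1)]])
    have "c q = (\<Sum>p\<in>I. c p *z \<delta> p) q" for q
    proof -
      have "(\<Sum>p\<in>I. c p *z \<delta> p) q = (\<Sum>p\<in>I. if q = p then c p else 0)"
        unfolding sum_fun_apply by (intro sum.cong) (auto simp: \<delta>_def)
      also have "\<dots> = (if q \<in> I then c q else 0)" using finI by simp
      finally have "(\<Sum>p\<in>I. c p *z \<delta> p) q = (if q \<in> I then c q else 0)" .
      moreover have "q \<notin> I \<Longrightarrow> c q = 0" using that unfolding S_def by blast
      ultimately show ?thesis by (cases "q \<in> I") simp_all
    qed
    then have c: "c = (\<Sum>p\<in>I. c p *z \<delta> p)" by (rule ext)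
    have "\<tau> c = \<tau> (c - Q c)" using Q(3) that by simp
    also have "\<dots> = (\<Sum>p\<in>I. c p * \<tau> (\<delta> p - Q (\<delta> p)))"
      by (subst (1 2) c, subst zlin_sum[OF K], simp only: zlin_scale[OF K] zscale_z2adic_def)
    also have "\<dots> = 4 * (\<Sum>p\<in>I. c p * w p)"
      unfolding sum_distrib_left by (intro sum.cong) (simp_all add: w)
    finally show ?thesis .
  qed
  \<comment> \<open>The functional \<open>\<tau> / 4\<close> extends to all matrices with the values \<open>w\<close> on the matrix units; \<open>h\<close> is the map dual to it under the trace.\<close>
  define h where "h x = (\<Sum>p\<in>I. (w p * d (fst p) x) *z e' (snd p))" for x
  have h_lin: "zlin h"
    by (rule zlinI) (simp_all add: h_def zlin_add[OF l] zlin_scale[OF l] distrib_left zscale_add_left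
        sum.distrib zscale_sum_right mult_ac)
  have dh: "d' j (h (e k)) = w (k, j)" if "k < n" "j < m" for k j
  proof -
    have "d' j (h (e k)) = (\<Sum>p\<in>I. w p * d (fst p) (e k) * d' j (e' (snd p)))"
      by (simp add: h_def zlin_sum[OF l'] zlin_scale[OF l'])
    also have "\<dots> = (\<Sum>p\<in>I. if p = (k, j) then w p else 0)"
      using that by (intro sum.cong) (auto simp: I_def basis_dual[OF b] basis_dual[OF b'] split: if_splits)
    finally show ?thesis using that finI by (simp add: I_def)
  qed
  have Uh: "trace (\<rho> 0) (\<lambda>x. U c (h x)) = (\<Sum>p\<in>I. c p * w p)" for c
  proof -
    have "d k (U c (h (e k))) = (\<Sum>p\<in>I. if fst p = k then c p * w p else 0)" if "k < n" for k
      unfolding U_def zlin_sum[OF l] zlin_scale[OF l]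
      using that by (intro sum.cong) (auto simp: I_def basis_dual[OF b] dh)
    then have "trace (\<rho> 0) (\<lambda>x. U c (h x)) = (\<Sum>k<n. \<Sum>p\<in>I. if fst p = k then c p * w p else 0)"
      by (simp add: U_trace[OF h_lin])
    also have "\<dots> = (\<Sum>p\<in>I. \<Sum>k<n. if fst p = k then c p * w p else 0)" by (rule sum.swap)
    also have "\<dots> = (\<Sum>p\<in>I. c p * w p)" by (intro sum.cong) (auto simp: I_def)
    finally show ?thesis .
  qed
  \<comment> \<open>\<open>D\<close> is orthogonal to all equivariant maps, in particular to the norms of linear maps, hence to all linear maps.\<close>
  define D where "D x = f x - nm \<rho> \<sigma> h x" for x
  have D: "ghom \<rho> \<sigma> D" unfolding D_def by (rule ghom_diff[OF \<sigma> f ghom_nm[OF \<rho> \<sigma> h_lin]])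
  have "trace (\<rho> 0) (\<lambda>x. U c (D x)) = 0" if "c \<in> S" for c
  proof -
    have u: "ghom \<sigma> \<rho> (U c)" using that by (simp add: S_def)
    have "trace (\<rho> 0) (\<lambda>x. U c (nm \<rho> \<sigma> h x)) = 4 * (\<Sum>p\<in>I. c p * w p)"
      by (simp add: trace_nm[OF \<rho> u h_lin] Uh)
    moreover have "trace (\<rho> 0) (\<lambda>x. U c (f x)) = 4 * (\<Sum>p\<in>I. c p * w p)"
      using \<tau>_S[OF that] by (simp add: U_trace[OF ghom_lin[OF f]] \<tau>_def)
    moreover have "trace (\<rho> 0) (\<lambda>x. U c (D x)) = trace (\<rho> 0) (\<lambda>x. U c (f x)) - trace (\<rho> 0) (\<lambda>x. U c (nm \<rho> \<sigma> h x))"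
      unfolding U_trace[OF ghom_lin[OF f]] U_trace[OF ghom_lin[OF D]] U_trace[OF zlin_nm[OF \<rho> \<sigma> h_lin]]
      by (simp add: D_def zlin_diff[OF U_lin] zlin_diff[OF l] sum_subtractf)
    ultimately show ?thesis by simp
  qed
  moreover have "\<exists>c\<in>S. v = U c" if v: "ghom \<sigma> \<rho> v" for v
  proof -
    define c where "c p = (if p \<in> I then d (fst p) (v (e' (snd p))) else 0)" for p
    have "v y = U c y" for y
    proof -
      have "v y = v (\<sigma> 0 y)" by (simp add: ghom_fix'[OF v])
      also have "\<dots> = (\<Sum>j<m. d' j y *z v (e' j))"
        by (simp add: basis_expand[OF b'] zlin_sum[OF ghom_lin[OF v]] zlin_scale[OF ghom_lin[OF v]])
      also have "\<dots> = (\<Sum>j<m. d' j y *z (\<Sum>i<n. d i (v (e' j)) *z e i))"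
        by (simp only: basis_expand[OF b, symmetric] ghom_fix[OF v])
      also have "\<dots> = (\<Sum>j<m. \<Sum>i<n. (d i (v (e' j)) * d' j y) *z e i)"
        by (simp add: zscale_sum_right mult.commute)
      also have "\<dots> = (\<Sum>i<n. \<Sum>j<m. (d i (v (e' j)) * d' j y) *z e i)" by (rule sum.swap)
      also have "\<dots> = U c y"
        unfolding U_def I_def sum.cartesian_product by (intro sum.cong) (auto simp: c_def I_def)
      finally show ?thesis .
    qed
    then have "v = U c" by (rule ext)
    moreover have "c \<in> S" using v \<open>v = U c\<close> by (simp add: S_def c_def)
    ultimately show ?thesis by blast
  qed
  ultimately have orth: "trace (\<rho> 0) (\<lambda>x. v (D x)) = 0" if "ghom \<sigma> \<rho> v" for v
    using that by blast
  have "d' j (D (e i)) = 0" if "i < n" for i j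
  proof -
    define u where "u y = d' j y *z e i" for y
    have u: "zlin u" unfolding u_def by (rule zlin_scale_vec[OF l'])
    have "4 * trace (\<rho> 0) (\<lambda>x. \<rho> 0 (u (D x))) = 0"
      using trace_nm'[OF \<rho> D u] orth[OF ghom_nm[OF \<sigma> \<rho> u]] by simp
    then have "trace (\<rho> 0) (\<lambda>x. \<rho> 0 (u (D x))) = 0" by simp
    moreover have "trace (\<rho> 0) (\<lambda>x. \<rho> 0 (u (D x))) = (\<Sum>k<n. d k (\<rho> 0 (u (D (e k)))))"
      by (rule trace_eq[OF b zlin_comp[OF glat_lin[OF \<rho>] zlin_comp[OF u ghom_lin[OF D]]]]) (simp_all add: zprojD[OF P])
    moreover have "\<dots> = (\<Sum>k<n. if k = i then d' j (D (e i)) else 0)"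
      using that by (intro sum.cong) (auto simp: u_def zlin_scale[OF glat_lin[OF \<rho>]] zlin_scale[OF l] basis_fixed[OF b] basis_dual[OF b])
    ultimately show ?thesis using that by simp
  qed
  then have "\<sigma> 0 (D (e i)) = 0" if "i < n" for i
    using that by (simp add: basis_expand[OF b'])
  then have De: "D (e i) = 0" if "i < n" for i
    using that by (simp add: ghom_fix[OF D])
  have "D x = 0" for x
  proof -
    have "D x = D (\<rho> 0 x)" by (simp add: ghom_fix'[OF D])
    also have "\<dots> = (\<Sum>i<n. d i x *z D (e i))"
      by (simp add: basis_expand[OF b] zlin_sum[OF ghom_lin[OF D]] zlin_scale[OF ghom_lin[OF D]])
    finally show ?thesis by (simp add: De)
  qed
  then have "f = nm \<rho> \<sigma> h" by (simp add: D_def fun_eq_iff)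
  then show ?thesis using h_lin by (auto simp: null_def)
qed

subsection \<open>Retracts\<close>

text \<open>The summand cut out by the idempotent \<open>\<epsilon>\<close>, on the same type.\<close>

definition sub :: "'v::zmod rep \<Rightarrow> ('v \<Rightarrow> 'v) \<Rightarrow> 'v rep" where
  "sub \<rho> \<epsilon> g x = \<epsilon> (\<rho> g x)"

definition summand :: "'v::zmod rep \<Rightarrow> ('v \<Rightarrow> 'v) \<Rightarrow> bool" where
  "summand \<rho> \<epsilon> \<longleftrightarrow> ghom \<rho> \<rho> \<epsilon> \<and> (\<forall>x. \<epsilon> (\<epsilon> x) = \<epsilon> x)"

definition indec :: "'v::zmod rep \<Rightarrow> bool" where
  "indec \<rho> \<longleftrightarrow> (\<exists>x. \<rho> 0 x \<noteq> 0) \<and> (\<forall>\<epsilon>. summand \<rho> \<epsilon> \<longrightarrow> (\<forall>x. \<epsilon> x = 0) \<or> (\<forall>x. \<epsilon> x = \<rho> 0 x))"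

text \<open>The two composites are the projections onto the lattices, which play the role of the identities.\<close>

definition giso :: "'v::zmod rep \<Rightarrow> 'w::zmod rep \<Rightarrow> ('v \<Rightarrow> 'w) \<Rightarrow> bool" where
  "giso \<rho> \<sigma> f \<longleftrightarrow> ghom \<rho> \<sigma> f \<and> (\<exists>g. ghom \<sigma> \<rho> g \<and> (\<forall>x. g (f x) = \<rho> 0 x) \<and> (\<forall>y. f (g y) = \<sigma> 0 y))"

definition retract :: "'v::zmod rep \<Rightarrow> 'w::zmod rep \<Rightarrow> bool" where
  "retract \<rho> \<sigma> \<longleftrightarrow> (\<exists>i p. ghom \<rho> \<sigma> i \<and> ghom \<sigma> \<rho> p \<and> (\<forall>x. p (i x) = \<rho> 0 x))"

lemma summandD: "summand \<rho> \<epsilon> \<Longrightarrow> ghom \<rho> \<rho> \<epsilon>" "summand \<rho> \<epsilon> \<Longrightarrow> \<epsilon> (\<epsilon> x) = \<epsilon> x"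
  by (simp_all add: summand_def)

lemma summand_zproj:
  assumes "glat \<rho>" "summand \<rho> \<epsilon>"
  shows "zproj \<epsilon>"
proof -
  note h = summandD(1)[OF assms(2)]
  have "finrank (\<lambda>x. \<epsilon> (\<rho> 0 x))"
    using finrank_comp[OF glat_finrank[OF assms(1)] ghom_lin[OF h] zlin_id] .
  then show ?thesis using assms ghom_lin[OF h] by (simp add: zproj_def ghom_fix'[OF h] summandD)
qed

lemma sub_glat:
  assumes "glat \<rho>" "summand \<rho> \<epsilon>"
  shows "glat (sub \<rho> \<epsilon>)"
proof -
  note h = summandD(1)[OF assms(2)]
  have "finrank (\<lambda>x. \<epsilon> (\<rho> 0 x))"
    using finrank_comp[OF glat_finrank[OF assms(1)] ghom_lin[OF h] zlin_id] .
  note fr = this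
  have l: "zlin (sub \<rho> \<epsilon> g)" for g
    using zlin_comp[OF ghom_lin[OF h] glat_lin[OF assms(1)]] by (simp add: sub_def[abs_def])
  have "finrank (sub \<rho> \<epsilon> 0)" using fr by (simp add: sub_def[abs_def])
  moreover have "sub \<rho> \<epsilon> g (sub \<rho> \<epsilon> k x) = sub \<rho> \<epsilon> (g + k) x" for g k x
    by (simp add: sub_def ghom_comm[OF h, symmetric] glat_mult[OF assms(1)] summandD(2)[OF assms(2)])
  ultimately show ?thesis using l unfolding glat_def by blast
qed

text \<open>Among the idempotents with \<open>P\<close> one of least rank is indecomposable: if it were a sum of two, one of these would still have \<open>P\<close>.\<close>

lemma indec_summand:
  assumes \<rho>: "glat \<rho>" and P: "P (\<rho> 0)" "\<not> P (\<lambda>x. 0)"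
    and split: "\<And>\<epsilon> \<epsilon>'. P (\<lambda>x. \<epsilon> x + \<epsilon>' x) \<Longrightarrow> summand \<rho> \<epsilon> \<Longrightarrow> summand \<rho> \<epsilon>' \<Longrightarrow> P \<epsilon> \<or> P \<epsilon>'"
  shows "\<exists>\<epsilon>. summand \<rho> \<epsilon> \<and> P \<epsilon> \<and> indec (sub \<rho> \<epsilon>)"
proof -
  have tr: "\<exists>n. trace (\<rho> 0) \<epsilon> = of_nat n \<and> (n = 0 \<longrightarrow> (\<forall>x. \<epsilon> x = 0))" if "summand \<rho> \<epsilon>" for \<epsilon>
    using trace_proj[OF glat_zproj[OF \<rho>] summand_zproj[OF \<rho> that] ghom_fix[OF summandD(1)[OF that]]] .
  define R where "R n \<longleftrightarrow> (\<exists>\<epsilon>. summand \<rho> \<epsilon> \<and> P \<epsilon> \<and> trace (\<rho> 0) \<epsilon> = of_nat n)" for n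
  have "summand \<rho> (\<rho> 0)" by (simp add: summand_def ghom_id[OF \<rho>] glat_mult[OF \<rho>])
  then have "\<exists>n. R n" using tr P(1) unfolding R_def by blast
  then obtain n where n: "R n" and min: "\<And>k. k < n \<Longrightarrow> \<not> R k" by (metis exists_least_iff)
  then obtain \<epsilon> where \<epsilon>: "summand \<rho> \<epsilon>" "P \<epsilon>" "trace (\<rho> 0) \<epsilon> = of_nat n" by (auto simp: R_def)
  note h = summandD(1)[OF \<epsilon>(1)] and ii = summandD(2)[OF \<epsilon>(1)]
  have sub0: "sub \<rho> \<epsilon> 0 x = \<epsilon> x" for x by (simp add: sub_def ghom_fix'[OF h])
  have "indec (sub \<rho> \<epsilon>)"
    unfolding indec_def
  proof (intro conjI allI impI)
    have "\<epsilon> \<noteq> (\<lambda>x. 0)" using P(2) \<epsilon>(2) by metis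
    then show "\<exists>x. sub \<rho> \<epsilon> 0 x \<noteq> 0" by (auto simp: sub0)
    fix \<epsilon>' assume \<epsilon>': "summand (sub \<rho> \<epsilon>) \<epsilon>'"
    note h' = summandD(1)[OF \<epsilon>'] and ii' = summandD(2)[OF \<epsilon>']
    have 1: "\<epsilon> (\<epsilon>' x) = \<epsilon>' x" "\<epsilon>' (\<epsilon> x) = \<epsilon>' x" for x
      using ghom_fix[OF h', of x] ghom_fix'[OF h', of x] by (simp_all add: sub0)
    have 2: "\<epsilon>' (\<rho> g x) = \<rho> g (\<epsilon>' x)" for g x
    proof -
      have "\<epsilon>' (\<rho> g x) = \<epsilon>' (\<epsilon> (\<rho> g x))" by (simp add: 1)
      also have "\<dots> = \<epsilon> (\<rho> g (\<epsilon>' x))" using ghom_comm[OF h', of g x] by (simp add: sub_def)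
      finally show ?thesis by (simp add: ghom_comm[OF h] 1)
    qed
    have "\<rho> 0 (\<epsilon>' x) = \<epsilon>' x" for x using ghom_fix[OF h, of "\<epsilon>' x"] by (simp add: 1)
    then have s1: "summand \<rho> \<epsilon>'" unfolding summand_def by (auto intro!: ghomI simp: ghom_lin[OF h'] 2 ii')
    have s2: "summand \<rho> (\<lambda>x. \<epsilon> x - \<epsilon>' x)"
      unfolding summand_def using ghom_diff[OF \<rho> h summandD(1)[OF s1]]
      by (auto simp: zlin_diff[OF ghom_lin[OF h]] zlin_diff[OF ghom_lin[OF h']] ii ii' 1)
    obtain a where a: "trace (\<rho> 0) \<epsilon>' = of_nat a" "a = 0 \<longrightarrow> (\<forall>x. \<epsilon>' x = 0)" using tr[OF s1] by blast
    obtain b where b: "trace (\<rho> 0) (\<lambda>x. \<epsilon> x - \<epsilon>' x) = of_nat b" "b = 0 \<longrightarrow> (\<forall>x. \<epsilon> x - \<epsilon>' x = 0)"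
      using tr[OF s2] by blast
    have "trace (\<rho> 0) (\<lambda>x. \<epsilon>' x + (\<epsilon> x - \<epsilon>' x)) = trace (\<rho> 0) \<epsilon>' + trace (\<rho> 0) (\<lambda>x. \<epsilon> x - \<epsilon>' x)"
      by (rule trace_add[OF glat_zproj[OF \<rho>] ghom_lin[OF summandD(1)[OF s1]] ghom_fix[OF summandD(1)[OF s1]]
            ghom_lin[OF summandD(1)[OF s2]] ghom_fix[OF summandD(1)[OF s2]]])
    then have "(of_nat n :: z2adic) = of_nat (a + b)" using \<epsilon>(3) a(1) b(1) by simp
    then have nab: "n = a + b" by (simp only: of_nat_eq_iff)
    have "P \<epsilon>' \<or> P (\<lambda>x. \<epsilon> x - \<epsilon>' x)"
      using \<epsilon>(2) by (intro split[OF _ s1 s2]) simp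
    then have "R a \<or> R b" using s1 s2 a b unfolding R_def by blast
    then have "\<not> a < n \<or> \<not> b < n" using min by blast
    then have "b = 0 \<or> a = 0" using nab by auto
    then show "(\<forall>x. \<epsilon>' x = 0) \<or> (\<forall>x. \<epsilon>' x = sub \<rho> \<epsilon> 0 x)"
      using a(2) b(2) by (auto simp: sub0)
  qed
  then show ?thesis using \<epsilon> by blast
qed

lemma not_null_summand:
  assumes \<rho>: "glat \<rho>" and u: "ghom \<rho> \<rho> u" "\<not> null \<rho> \<rho> u"
  shows "\<exists>\<epsilon>. summand \<rho> \<epsilon> \<and> \<not> null \<rho> \<rho> (\<lambda>x. \<epsilon> (u x)) \<and> indec (sub \<rho> \<epsilon>)"
    "\<exists>\<epsilon>. summand \<rho> \<epsilon> \<and> \<not> null \<rho> \<rho> (\<lambda>x. u (\<epsilon> x)) \<and> indec (sub \<rho> \<epsilon>)"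
proof -
  note na = null_add[OF \<rho>, of \<rho>]
  show "\<exists>\<epsilon>. summand \<rho> \<epsilon> \<and> \<not> null \<rho> \<rho> (\<lambda>x. \<epsilon> (u x)) \<and> indec (sub \<rho> \<epsilon>)"
  proof (rule indec_summand[OF \<rho>, of "\<lambda>\<epsilon>. \<not> null \<rho> \<rho> (\<lambda>x. \<epsilon> (u x))"])
    show "\<not> null \<rho> \<rho> (\<lambda>x. \<rho> 0 (u x))" using u(2) by (simp add: ghom_fix[OF u(1)])
    show "\<not> \<not> null \<rho> \<rho> (\<lambda>x. 0)" using null_0[OF \<rho>] by simp
    show "\<not> null \<rho> \<rho> (\<lambda>x. \<epsilon> (u x)) \<or> \<not> null \<rho> \<rho> (\<lambda>x. \<epsilon>' (u x))"
      if "\<not> null \<rho> \<rho> (\<lambda>x. \<epsilon> (u x) + \<epsilon>' (u x))" for \<epsilon> \<epsilon>'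
      using na[of "\<lambda>x. \<epsilon> (u x)" "\<lambda>x. \<epsilon>' (u x)"] that by blast
  qed
  show "\<exists>\<epsilon>. summand \<rho> \<epsilon> \<and> \<not> null \<rho> \<rho> (\<lambda>x. u (\<epsilon> x)) \<and> indec (sub \<rho> \<epsilon>)"
  proof (rule indec_summand[OF \<rho>, of "\<lambda>\<epsilon>. \<not> null \<rho> \<rho> (\<lambda>x. u (\<epsilon> x))"])
    show "\<not> null \<rho> \<rho> (\<lambda>x. u (\<rho> 0 x))" using u(2) by (simp add: ghom_fix'[OF u(1)])
    show "\<not> \<not> null \<rho> \<rho> (\<lambda>x. u 0)" using null_0[OF \<rho>] by (simp add: zlin_zero[OF ghom_lin[OF u(1)]])
    show "\<not> null \<rho> \<rho> (\<lambda>x. u (\<epsilon> x)) \<or> \<not> null \<rho> \<rho> (\<lambda>x. u (\<epsilon>' x))"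
      if "\<not> null \<rho> \<rho> (\<lambda>x. u (\<epsilon> x + \<epsilon>' x))" for \<epsilon> \<epsilon>'
      using na[of "\<lambda>x. u (\<epsilon> x)" "\<lambda>x. u (\<epsilon>' x)"] that
      by (auto simp: zlin_add[OF ghom_lin[OF u(1)]])
  qed
qed

lemma sub_ghoms:
  assumes "glat \<rho>" "summand \<rho> \<epsilon>"
  shows "ghom \<rho> (sub \<rho> \<epsilon>) \<epsilon>" "ghom (sub \<rho> \<epsilon>) \<rho> \<epsilon>"
  using ghom_lin[OF summandD(1)[OF assms(2)]] ghom_comm[OF summandD(1)[OF assms(2)]]
    ghom_fix[OF summandD(1)[OF assms(2)]] summandD(2)[OF assms(2)]
  by (auto intro!: ghomI simp: sub_def)

text \<open>Duality provides \<open>\<psi>\<close> with \<open>\<psi> \<circ> \<phi>\<close> not null, and some indecomposable summand of \<open>X\<close> still detects this. By the hypothesis the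
component of \<open>\<psi>\<close> into that summand cannot be a non-isomorphism.\<close>

lemma retract_of_source:
  assumes X: "glat X" and Y: "glat Y" and \<phi>: "ghom X Y \<phi>" "\<not> null X Y \<phi>"
    and ar: "\<And>\<epsilon> f. summand X \<epsilon> \<Longrightarrow> indec (sub X \<epsilon>) \<Longrightarrow> ghom Y (sub X \<epsilon>) f \<Longrightarrow> \<not> giso Y (sub X \<epsilon>) f \<Longrightarrow>
      null X (sub X \<epsilon>) (\<lambda>x. f (\<phi> x))"
  shows "retract Y X"
proof -
  obtain \<psi> where \<psi>: "ghom Y X \<psi>" "\<not> 4 dvd trace (X 0) (\<lambda>x. \<psi> (\<phi> x))"
    using stable_duality[OF X Y \<phi>(1)] \<phi>(2) by blast
  have "\<not> null X X (\<lambda>x. \<psi> (\<phi> x))"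
  proof
    assume "null X X (\<lambda>x. \<psi> (\<phi> x))"
    from trace_null_dvd[OF X ghom_id[OF X] this] show False
      using \<psi> by (simp add: ghom_fix[OF \<psi>(1)])
  qed
  from not_null_summand(1)[OF X ghom_comp[OF \<phi>(1) \<psi>(1)] this]
  obtain \<epsilon> where \<epsilon>: "summand X \<epsilon>" "\<not> null X X (\<lambda>x. \<epsilon> (\<psi> (\<phi> x)))" "indec (sub X \<epsilon>)" by blast
  have f: "ghom Y (sub X \<epsilon>) (\<lambda>y. \<epsilon> (\<psi> y))" by (rule ghom_comp[OF \<psi>(1) sub_ghoms(1)[OF X \<epsilon>(1)]])
  have "giso Y (sub X \<epsilon>) (\<lambda>y. \<epsilon> (\<psi> y))"
  proof (rule ccontr)
    assume "\<not> giso Y (sub X \<epsilon>) (\<lambda>y. \<epsilon> (\<psi> y))"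
    from ar[OF \<epsilon>(1,3) f this] have "null X (sub X \<epsilon>) (\<lambda>x. \<epsilon> (\<psi> (\<phi> x)))" .
    from null_comp_left[OF this sub_ghoms(2)[OF X \<epsilon>(1)]] show False
      using \<epsilon>(2) by (simp add: summandD(2)[OF \<epsilon>(1)])
  qed
  then obtain g where g: "ghom (sub X \<epsilon>) Y g" "\<And>y. g (\<epsilon> (\<psi> y)) = Y 0 y" by (auto simp: giso_def)
  have "ghom X Y (\<lambda>x. g (\<epsilon> x))" by (rule ghom_comp[OF sub_ghoms(1)[OF X \<epsilon>(1)] g(1)])
  then show ?thesis using \<psi>(1) g(2) unfolding retract_def by blast
qed

text \<open>The dual argument, with an indecomposable summand of the target.\<close>

lemma retract_of_target:
  assumes X: "glat X" and Y: "glat Y" and \<chi>: "ghom X Y \<chi>" "\<not> null X Y \<chi>"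
    and ar: "\<And>\<epsilon> f. summand Y \<epsilon> \<Longrightarrow> indec (sub Y \<epsilon>) \<Longrightarrow> ghom (sub Y \<epsilon>) X f \<Longrightarrow> \<not> giso (sub Y \<epsilon>) X f \<Longrightarrow>
      null (sub Y \<epsilon>) Y (\<lambda>x. \<chi> (f x))"
  shows "retract X Y"
proof -
  obtain \<psi> where \<psi>: "ghom Y X \<psi>" "\<not> 4 dvd trace (X 0) (\<lambda>x. \<psi> (\<chi> x))"
    using stable_duality[OF X Y \<chi>(1)] \<chi>(2) by blast
  have "\<not> null Y Y (\<lambda>x. \<chi> (\<psi> x))"
  proof
    assume "null Y Y (\<lambda>x. \<chi> (\<psi> x))"
    from trace_null_dvd[OF Y ghom_id[OF Y] this] have "4 dvd trace (Y 0) (\<lambda>x. \<chi> (\<psi> x))"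
      by (simp add: ghom_fix[OF \<chi>(1)])
    moreover have "trace (X 0) (\<lambda>x. \<psi> (\<chi> x)) = trace (Y 0) (\<lambda>x. \<chi> (\<psi> x))"
      using \<psi>(1) \<chi>(1) by (intro trace_cyclic glat_zproj X Y) (auto simp: ghom_lin ghom_fix)
    ultimately show False using \<psi>(2) by simp
  qed
  from not_null_summand(2)[OF Y ghom_comp[OF \<psi>(1) \<chi>(1)] this]
  obtain \<epsilon> where \<epsilon>: "summand Y \<epsilon>" "\<not> null Y Y (\<lambda>x. \<chi> (\<psi> (\<epsilon> x)))" "indec (sub Y \<epsilon>)" by blast
  have f: "ghom (sub Y \<epsilon>) X (\<lambda>y. \<psi> (\<epsilon> y))" by (rule ghom_comp[OF sub_ghoms(2)[OF Y \<epsilon>(1)] \<psi>(1)])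
  have "giso (sub Y \<epsilon>) X (\<lambda>y. \<psi> (\<epsilon> y))"
  proof (rule ccontr)
    assume "\<not> giso (sub Y \<epsilon>) X (\<lambda>y. \<psi> (\<epsilon> y))"
    from ar[OF \<epsilon>(1,3) f this] have "null (sub Y \<epsilon>) Y (\<lambda>x. \<chi> (\<psi> (\<epsilon> x)))" .
    from null_comp_right[OF this sub_ghoms(1)[OF Y \<epsilon>(1)]] show False
      using \<epsilon>(2) by (simp add: summandD(2)[OF \<epsilon>(1)])
  qed
  then obtain g where g: "ghom X (sub Y \<epsilon>) g" "\<And>y. \<psi> (\<epsilon> (g y)) = X 0 y" by (auto simp: giso_def)
  have "ghom X Y (\<lambda>x. \<epsilon> (g x))" by (rule ghom_comp[OF g(1) sub_ghoms(2)[OF Y \<epsilon>(1)]])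
  then show ?thesis using \<psi>(1) g(2) unfolding retract_def by blast
qed

section \<open>Extensions of lattices and their syzygies\<close>

text \<open>The class of an extension of \<open>M\<close> by \<open>M'\<close>, computed from a linear section; coboundaries correspond to split extensions.\<close>

definition cocycle :: "'v::zmod rep \<Rightarrow> 'w::zmod rep \<Rightarrow> (klein \<Rightarrow> 'v \<Rightarrow> 'w) \<Rightarrow> bool" where
  "cocycle M M' c \<longleftrightarrow> (\<forall>g. zlin (c g)) \<and> (\<forall>g x. c g (M 0 x) = c g x) \<and> (\<forall>g x. M' 0 (c g x) = c g x) \<and>
     (\<forall>g h x. c (g + h) x = c g (M h x) + M' g (c h x))"

definition coboundary :: "'v::zmod rep \<Rightarrow> 'w::zmod rep \<Rightarrow> (klein \<Rightarrow> 'v \<Rightarrow> 'w) \<Rightarrow> bool" where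
  "coboundary M M' c \<longleftrightarrow> (\<exists>\<theta>. zlin \<theta> \<and> (\<forall>g x. c g x = M' g (\<theta> x) - \<theta> (M g x)))"

text \<open>A splitting map may be cut down to the lattices.\<close>

lemma coboundary_fixed:
  assumes "glat M" "glat M'" "coboundary M M' c" "\<And>g x. c g (M 0 x) = c g x" "\<And>g x. M' 0 (c g x) = c g x"
  shows "\<exists>\<theta>. zlin \<theta> \<and> (\<forall>g x. c g x = M' g (\<theta> x) - \<theta> (M g x)) \<and> (\<forall>x. \<theta> (M 0 x) = \<theta> x) \<and> (\<forall>x. M' 0 (\<theta> x) = \<theta> x)"
proof -
  note m = glat_mult[OF assms(1)] and m' = glat_mult[OF assms(2)]
  obtain \<theta> where \<theta>: "zlin \<theta>" "\<And>g x. c g x = M' g (\<theta> x) - \<theta> (M g x)"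
    using assms(3) by (auto simp: coboundary_def)
  define \<eta> where "\<eta> x = M' 0 (\<theta> (M 0 x))" for x
  have "c g x = M' g (\<eta> x) - \<eta> (M g x)" for g x
  proof -
    have "c g x = M' 0 (c g (M 0 x))" by (simp add: assms(4,5))
    also have "\<dots> = M' g (\<eta> x) - \<eta> (M g x)"
      by (simp add: \<theta>(2) zlin_diff[OF glat_lin[OF assms(2)]] m m' \<eta>_def)
    finally show ?thesis .
  qed
  moreover have "zlin \<eta>"
    unfolding \<eta>_def by (rule zlin_comp[OF glat_lin[OF assms(2)] zlin_comp[OF \<theta>(1) glat_lin[OF assms(1)]]])
  ultimately show ?thesis by (intro exI[of _ \<eta>]) (simp add: \<eta>_def m m')
qed

lemma cocycleD:
  assumes "cocycle M M' c"
  shows "zlin (c g)" "c g (M 0 x) = c g x" "M' 0 (c g x) = c g x" "c (g + h) x = c g (M h x) + M' g (c h x)"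
  using assms unfolding cocycle_def by blast+

lemma cocycle_0:
  assumes "cocycle M M' c"
  shows "c 0 x = 0"
  using cocycleD(4)[OF assms, of 0 0 x] by (simp add: cocycleD(2,3)[OF assms])

text \<open>The augmentation onto \<open>M\<close> of the module \<open>klein \<Rightarrow> M\<close> induced from the underlying abelian group of \<open>M\<close>.\<close>

definition aug :: "'v::zmod rep \<Rightarrow> (klein \<Rightarrow> 'v) \<Rightarrow> 'v" where
  "aug M f = (\<Sum>k\<in>UNIV. M k (f k))"

text \<open>The kernel of the augmentation, with the group acting by translation. The correction at \<open>h = g\<close> composes the
translation with the projection onto this kernel; it is absent on functions with augmentation zero.\<close>

definition syz :: "'v::zmod rep \<Rightarrow> (klein \<Rightarrow> 'v) rep" where
  "syz M g f = (\<lambda>h. M 0 (f (g + h)) - (if h = g then aug M f else 0))"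

text \<open>The cokernel of the embedding that sends \<open>m\<close> to the function \<open>h \<mapsto> M h m\<close>. Each class is represented by its member that vanishes
at \<open>0\<close>, which is the purpose of the second term.\<close>

definition cosyz :: "'v::zmod rep \<Rightarrow> (klein \<Rightarrow> 'v) rep" where
  "cosyz M g f = (\<lambda>h. M 0 (f (g + h)) - M h (f g))"

lemma zlin_aug: "glat M \<Longrightarrow> zlin (aug M)"
proof -
  assume M: "glat M"
  have "zlin (\<lambda>f. aug M f)" unfolding aug_def
    by (rule zlin_sum') (rule zlin_comp[OF glat_lin[OF M] zlin_eval])
  then show ?thesis by simp
qed

lemma aug_shift:
  assumes M: "glat M"
  shows "aug M (\<lambda>h. f (g + h)) = M g (aug M f)"
proof -
  have "aug M (\<lambda>h. f (g + h)) = (\<Sum>k\<in>UNIV. M (g + k) (f (g + (g + k))))"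
    unfolding aug_def by (rule sum_klein_shift[symmetric])
  then show ?thesis
    by (simp add: aug_def klein_add_left_cancel_self zlin_sum[OF glat_lin[OF M]] glat_mult[OF M])
qed

lemma aug_fix: "glat M \<Longrightarrow> M 0 (aug M f) = aug M f" "glat M \<Longrightarrow> aug M (\<lambda>h. M 0 (f h)) = aug M f"
  by (simp_all add: aug_def zlin_sum[OF glat_lin] glat_mult)

lemma klein_add_eq_iff: "(g :: klein) + h = k \<longleftrightarrow> h = g + k"
  using klein_add_left_cancel_self by metis

lemma aug_syz:
  assumes M: "glat M"
  shows "aug M (syz M g f) = 0"
proof -
  have "aug M (\<lambda>h. if h = g then aug M f else 0) = (\<Sum>k\<in>UNIV. if k = g then M g (aug M f) else 0)"
    unfolding aug_def by (intro sum.cong) (auto simp: zlin_zero[OF glat_lin[OF M]])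
  also have "\<dots> = M g (aug M f)" by (simp add: finite_klein)
  finally have 1: "aug M (\<lambda>h. if h = g then aug M f else 0) = M g (aug M f)" .
  have "syz M g f = (\<lambda>h. M 0 (f (g + h))) - (\<lambda>h. if h = g then aug M f else 0)"
    by (simp add: syz_def fun_eq_iff)
  then have "aug M (syz M g f) = aug M (\<lambda>h. M 0 (f (g + h))) - M g (aug M f)"
    by (simp add: zlin_diff[OF zlin_aug[OF M]] 1)
  then show ?thesis by (simp add: aug_fix(2)[OF M, of "\<lambda>h. f (g + h)"] aug_shift[OF M])
qed

lemma glat_syz:
  assumes M: "glat M"
  shows "glat (syz M)"
  unfolding glat_def
proof (intro conjI allI)
  note l = glat_lin[OF M]
  show "zlin (syz M g)" for g
    by (rule zlinI) (auto simp: syz_def fun_eq_iff zlin_add[OF l] zlin_scale[OF l] zlin_add[OF zlin_aug[OF M]]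
        zlin_scale[OF zlin_aug[OF M]] zscale_diff_right)
  show "syz M g (syz M k f) = syz M (g + k) f" for g k f
  proof
    fix h
    have "syz M g (syz M k f) h = M 0 (syz M k f (g + h))"
      using aug_syz[OF M, of k f] by (simp add: syz_def[of M g])
    also have "\<dots> = syz M (g + k) f h"
      by (simp add: syz_def zlin_diff[OF l] glat_mult[OF M] aug_fix(1)[OF M] zlin_zero[OF l] klein_add_eq_iff add_ac)
    finally show "syz M g (syz M k f) h = syz M (g + k) f h" .
  qed
  define \<delta> where "\<delta> k m = (\<lambda>h. (if h = k then m else 0) - (if h = 0 then M k m else 0))" for k m
  have \<delta>: "zlin (\<delta> k)" for k
    by (rule zlinI) (auto simp: \<delta>_def fun_eq_iff zlin_add[OF l] zlin_scale[OF l] zscale_diff_right)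
  have "syz M 0 f h = (\<Sum>k\<in>UNIV. \<delta> k (M 0 (f k))) h" for f h
  proof -
    have "(\<Sum>k\<in>UNIV. \<delta> k (M 0 (f k))) h =
        (\<Sum>k\<in>UNIV. if h = k then M 0 (f k) else 0) - (if h = 0 then (\<Sum>k\<in>UNIV. M k (f k)) else 0)"
      unfolding sum_fun_apply \<delta>_def sum_subtractf by (simp add: glat_mult[OF M])
    then show ?thesis by (simp add: syz_def aug_def finite_klein)
  qed
  then have "syz M 0 = (\<lambda>f. \<Sum>k\<in>UNIV. \<delta> k (M 0 (f k)))" by (intro ext) simp
  then show "finrank (syz M 0)"
    using finrank_sum[OF finite_klein finrank_comp[OF glat_finrank[OF M] \<delta> zlin_eval]] by simp
qed

lemma glat_cosyz:
  assumes M: "glat M"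
  shows "glat (cosyz M)"
  unfolding glat_def
proof (intro conjI allI)
  note l = glat_lin[OF M]
  show "zlin (cosyz M g)" for g
    by (rule zlinI) (auto simp: cosyz_def fun_eq_iff zlin_add[OF l] zlin_scale[OF l] zscale_diff_right)
  show "cosyz M g (cosyz M k f) = cosyz M (g + k) f" for g k f
    by (simp add: cosyz_def fun_eq_iff zlin_diff[OF l] glat_mult[OF M] add_ac)
  define \<delta> where "\<delta> k m = (\<lambda>h. (if h = k then m else 0) - (if k = 0 then M h m else 0))" for k m
  have \<delta>: "zlin (\<delta> k)" for k
    by (rule zlinI) (auto simp: \<delta>_def fun_eq_iff zlin_add[OF l] zlin_scale[OF l] zscale_diff_right)
  have "cosyz M 0 f h = (\<Sum>k\<in>UNIV. \<delta> k (M 0 (f k))) h" for f h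
  proof -
    have "(\<Sum>k\<in>UNIV. \<delta> k (M 0 (f k))) h =
        (\<Sum>k\<in>UNIV. if h = k then M 0 (f k) else 0) - (\<Sum>k\<in>UNIV. if k = 0 then M h (f k) else 0)"
      unfolding sum_fun_apply \<delta>_def sum_subtractf by (simp add: glat_mult[OF M] if_distrib cong: if_cong)
    then show ?thesis by (simp add: cosyz_def finite_klein)
  qed
  then have "cosyz M 0 = (\<lambda>f. \<Sum>k\<in>UNIV. \<delta> k (M 0 (f k)))" by (intro ext) simp
  then show "finrank (cosyz M 0)"
    using finrank_sum[OF finite_klein finrank_comp[OF glat_finrank[OF M] \<delta> zlin_eval]] by simp
qed

text \<open>The cocycle defines \<open>\<phi>\<close> from \<open>syz M\<close> to \<open>M'\<close>, and a homomorphism \<open>f\<close> out of \<open>M'\<close> turns the cocycle into a coboundary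
only if \<open>f \<circ> \<phi>\<close> is null. So the almost split property is the hypothesis of \<open>retract_of_source\<close>.\<close>

lemma retract_of_syz:
  assumes M: "glat M" and M': "glat M'" and c: "cocycle M M' c" and nc: "\<not> coboundary M M' c"
    and ar: "\<And>\<epsilon> f. summand (syz M) \<epsilon> \<Longrightarrow> indec (sub (syz M) \<epsilon>) \<Longrightarrow> ghom M' (sub (syz M) \<epsilon>) f \<Longrightarrow>
      \<not> giso M' (sub (syz M) \<epsilon>) f \<Longrightarrow> coboundary M (sub (syz M) \<epsilon>) (\<lambda>g x. f (c g x))"
  shows "retract M' (syz M)"
proof -
  note K = glat_syz[OF M] and l = glat_lin[OF M] and l' = glat_lin[OF M']
  note cl = cocycleD(1)[OF c]
  \<comment> \<open>A linear section of an extension extends equivariantly to the induced module; \<open>\<phi>\<close> is the restriction of this extension to the syzygy.\<close>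
  define \<phi> where "\<phi> f = (\<Sum>k\<in>UNIV. c k (f k))" for f
  have \<phi>_lin: "zlin \<phi>"
    by (rule zlinI) (simp_all add: \<phi>_def zlin_add[OF cl] zlin_scale[OF cl] sum.distrib zscale_sum_right)
  have \<phi>: "ghom (syz M) M' \<phi>"
  proof (rule ghomI[OF \<phi>_lin])
    show "\<phi> (syz M g f) = M' g (\<phi> f)" for g f
    proof -
      have "\<phi> (syz M g f) = (\<Sum>k\<in>UNIV. c k (f (g + k))) - (\<Sum>k\<in>UNIV. if k = g then c g (aug M f) else 0)"
        unfolding \<phi>_def syz_def sum_subtractf[symmetric]
        by (intro sum.cong) (auto simp: zlin_diff[OF cl] zlin_zero[OF cl] cocycleD(2)[OF c])
      also have "(\<Sum>k\<in>UNIV. c k (f (g + k))) = (\<Sum>k\<in>UNIV. c (g + k) (f (g + (g + k))))"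
        by (rule sum_klein_shift[symmetric])
      also have "\<dots> = c g (aug M f) + M' g (\<phi> f)"
        by (simp add: klein_add_left_cancel_self cocycleD(4)[OF c] sum.distrib aug_def \<phi>_def zlin_sum[OF cl] zlin_sum[OF l'])
      finally show ?thesis by (simp add: finite_klein)
    qed
    show "M' 0 (\<phi> f) = \<phi> f" for f
      by (simp add: \<phi>_def zlin_sum[OF l'] cocycleD(3)[OF c])
  qed
  have "\<not> null (syz M) M' \<phi>"
  proof
    assume "null (syz M) M' \<phi>"
    then obtain k where k: "zlin k" "\<phi> = nm (syz M) M' k" by (auto simp: null_def)
    \<comment> \<open>These elements generate the syzygy, and \<open>\<phi>\<close> takes the value \<open>c g m\<close> on them.\<close>
    define \<kappa> where "\<kappa> g m = (\<lambda>h. (if h = g then M 0 m else 0) - (if h = 0 then M g m else 0))" for g m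
    have \<kappa>_lin: "zlin (\<kappa> g)" for g
      by (rule zlinI) (auto simp: \<kappa>_def fun_eq_iff zlin_add[OF l] zlin_scale[OF l] zscale_diff_right)
    define \<theta> where "\<theta> m = (\<Sum>h\<in>UNIV. M' h (k (\<kappa> h m)))" for m
    have \<theta>_lin: "zlin \<theta>"
      unfolding \<theta>_def by (rule zlin_sum') (rule zlin_comp[OF l' zlin_comp[OF k(1) \<kappa>_lin]])
    have "c g m = M' g (\<theta> m) - \<theta> (M g m)" for g m
    proof -
      have sk: "syz M h (\<kappa> g m) = \<kappa> (g + h) m - \<kappa> h (M g m)" for h
      proof -
        have "M y (\<kappa> g m y) = (if y = g then M g m else 0) - (if y = 0 then M g m else 0)" for y
          by (auto simp: \<kappa>_def zlin_diff[OF l] zlin_zero[OF l] glat_mult[OF M])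
        then have "aug M (\<kappa> g m) = 0" by (simp add: aug_def sum_subtractf finite_klein)
        then show ?thesis
          by (auto simp: syz_def \<kappa>_def fun_eq_iff zlin_diff[OF l] zlin_zero[OF l] glat_mult[OF M] klein_add_eq_iff
              klein_add_self add_ac)
      qed
      have "c h (\<kappa> g m h) = (if h = g then c g m else 0)" for h
        by (auto simp: \<kappa>_def zlin_diff[OF cl] zlin_zero[OF cl] cocycleD(2)[OF c] cocycle_0[OF c])
      then have "c g m = \<phi> (\<kappa> g m)" by (simp add: \<phi>_def finite_klein)
      also have "\<dots> = (\<Sum>h\<in>UNIV. M' h (k (syz M h (\<kappa> g m))))" by (simp add: k(2) nm_def)
      also have "\<dots> = (\<Sum>h\<in>UNIV. M' h (k (\<kappa> (g + h) m - \<kappa> h (M g m))))" by (simp only: sk)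
      also have "\<dots> =
          (\<Sum>h\<in>UNIV. M' h (k (\<kappa> (g + h) m))) - \<theta> (M g m)"
        by (simp add: \<theta>_def zlin_diff[OF k(1)] zlin_diff[OF l'] sum_subtractf)
      also have "(\<Sum>h\<in>UNIV. M' h (k (\<kappa> (g + h) m))) = (\<Sum>h\<in>UNIV. M' (g + h) (k (\<kappa> (g + (g + h)) m)))"
        by (rule sum_klein_shift[symmetric])
      also have "\<dots> = M' g (\<theta> m)"
        by (simp add: \<theta>_def klein_add_left_cancel_self zlin_sum[OF l'] glat_mult[OF M'])
      finally show ?thesis .
    qed
    then have "coboundary M M' c" using \<theta>_lin by (auto simp: coboundary_def)
    then show False using nc by simp
  qed
  then show ?thesis
  proof (rule retract_of_source[OF K M' \<phi>])
    fix \<epsilon> f assume *: "summand (syz M) \<epsilon>" "indec (sub (syz M) \<epsilon>)" "ghom M' (sub (syz M) \<epsilon>) f"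
      "\<not> giso M' (sub (syz M) \<epsilon>) f"
    define Z where "Z = sub (syz M) \<epsilon>"
    have Z: "glat Z" unfolding Z_def by (rule sub_glat[OF K *(1)])
    have f: "ghom M' Z f" using *(3) by (simp add: Z_def)
    have "coboundary M Z (\<lambda>g x. f (c g x))" unfolding Z_def by (rule ar[OF *])
    then obtain \<theta> where \<theta>: "zlin \<theta>" "\<And>g x. f (c g x) = Z g (\<theta> x) - \<theta> (M g x)"
      "\<And>x. \<theta> (M 0 x) = \<theta> x" "\<And>x. Z 0 (\<theta> x) = \<theta> x"
      using coboundary_fixed[OF M Z, of "\<lambda>g x. f (c g x)"] cocycleD(2)[OF c] ghom_fix[OF f] by metis
    have "f (\<phi> x) = nm (syz M) Z (\<lambda>x. \<theta> (x 0)) x" for x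
    proof -
      have "f (\<phi> x) = (\<Sum>k\<in>UNIV. Z k (\<theta> (x k))) - \<theta> (aug M x)"
        by (simp add: \<phi>_def zlin_sum[OF ghom_lin[OF f]] \<theta>(2) sum_subtractf aug_def zlin_sum[OF \<theta>(1)])
      also have "\<theta> (aug M x) = (\<Sum>k\<in>(UNIV :: klein set). if k = 0 then \<theta> (aug M x) else 0)" by (simp add: finite_klein)
      also have "(\<Sum>k\<in>UNIV. Z k (\<theta> (x k))) - \<dots> = nm (syz M) Z (\<lambda>x. \<theta> (x 0)) x"
      proof -
        have "Z k (\<theta> (x k)) - (if k = 0 then \<theta> (aug M x) else 0) = Z k (\<theta> (syz M k x 0))" for k
          by (auto simp: syz_def zlin_diff[OF \<theta>(1)] zlin_diff[OF glat_lin[OF Z]] zlin_zero[OF \<theta>(1)]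
              zlin_zero[OF glat_lin[OF Z]] \<theta>(3,4))
        then show ?thesis unfolding nm_def sum_subtractf[symmetric] by simp
      qed
      finally show ?thesis .
    qed
    then have "(\<lambda>x. f (\<phi> x)) = nm (syz M) Z (\<lambda>x. \<theta> (x 0))" by (rule ext)
    moreover have "zlin (\<lambda>x::klein \<Rightarrow> _. \<theta> (x 0))" by (rule zlin_comp[OF \<theta>(1) zlin_eval])
    ultimately show "null (syz M) (sub (syz M) \<epsilon>) (\<lambda>x. f (\<phi> x))" unfolding null_def Z_def by blast
  qed
qed

text \<open>Dual to the previous lemma: the cocycle, read as a function of its first argument, maps \<open>M\<close> to \<open>cosyz M'\<close>.\<close>

lemma retract_of_cosyz:
  assumes M: "glat M" and M': "glat M'" and c: "cocycle M M' c" and nc: "\<not> coboundary M M' c"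
    and ar: "\<And>\<epsilon> f. summand (cosyz M') \<epsilon> \<Longrightarrow> indec (sub (cosyz M') \<epsilon>) \<Longrightarrow> ghom (sub (cosyz M') \<epsilon>) M f \<Longrightarrow>
      \<not> giso (sub (cosyz M') \<epsilon>) M f \<Longrightarrow> coboundary (sub (cosyz M') \<epsilon>) M' (\<lambda>g x. c g (f x))"
  shows "retract M (cosyz M')"
proof -
  note C = glat_cosyz[OF M'] and l = glat_lin[OF M] and l' = glat_lin[OF M']
  note cl = cocycleD(1)[OF c]
  define \<chi> where "\<chi> m = (\<lambda>h. c h m)" for m
  have \<chi>: "ghom M (cosyz M') \<chi>"
  proof (rule ghomI)
    show "zlin \<chi>" unfolding \<chi>_def by (rule zlin_fun) (rule cl)
    show 1: "\<chi> (M g m) = cosyz M' g (\<chi> m)" for g m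
      by (simp add: \<chi>_def cosyz_def fun_eq_iff cocycleD(3)[OF c])
        (metis add.commute add_diff_cancel_right' cocycleD(4)[OF c])
    show "cosyz M' 0 (\<chi> m) = \<chi> m" for m
      by (simp add: 1[symmetric]) (simp add: \<chi>_def cocycleD(2)[OF c])
  qed
  have "\<not> null M (cosyz M') \<chi>"
  proof
    assume "null M (cosyz M') \<chi>"
    then obtain k where k: "zlin k" "\<chi> = nm M (cosyz M') k" by (auto simp: null_def)
    define \<theta> where "\<theta> m = - (\<Sum>g\<in>UNIV. M' 0 (k (M g m) g))" for m
    have "zlin \<theta>"
      unfolding \<theta>_def
      by (intro zlin_uminus zlin_sum') (rule zlin_comp[OF l' zlin_app[OF zlin_comp[OF k(1) l]]])
    moreover have "c h m = M' h (\<theta> m) - \<theta> (M h m)" for h m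
    proof -
      have "c h m = \<chi> m h" by (simp add: \<chi>_def)
      also have "\<dots> = (\<Sum>g\<in>UNIV. M' 0 (k (M g m) (g + h))) - (\<Sum>g\<in>UNIV. M' h (k (M g m) g))"
        by (simp add: k(2) nm_def cosyz_def sum_subtractf)
      also have "(\<Sum>g\<in>UNIV. M' h (k (M g m) g)) = - M' h (\<theta> m)"
        by (simp add: \<theta>_def zlin_minus[OF l'] zlin_sum[OF l'] glat_mult[OF M'])
      also have "(\<Sum>g\<in>UNIV. M' 0 (k (M g m) (g + h))) = (\<Sum>g\<in>UNIV. M' 0 (k (M (h + g) m) ((h + g) + h)))"
        by (rule sum_klein_shift[symmetric])
      also have "\<dots> = - \<theta> (M h m)"
        by (simp add: \<theta>_def glat_mult[OF M] add.commute[of _ h] klein_add_left_cancel_self)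
      finally show ?thesis by simp
    qed
    ultimately have "coboundary M M' c" by (auto simp: coboundary_def)
    then show False using nc by simp
  qed
  then show ?thesis
  proof (rule retract_of_target[OF M C \<chi>])
    fix \<epsilon> f assume *: "summand (cosyz M') \<epsilon>" "indec (sub (cosyz M') \<epsilon>)" "ghom (sub (cosyz M') \<epsilon>) M f"
      "\<not> giso (sub (cosyz M') \<epsilon>) M f"
    define Z where "Z = sub (cosyz M') \<epsilon>"
    have Z: "glat Z" unfolding Z_def by (rule sub_glat[OF C *(1)])
    have f: "ghom Z M f" using *(3) by (simp add: Z_def)
    have "coboundary Z M' (\<lambda>g x. c g (f x))" unfolding Z_def by (rule ar[OF *])
    then obtain \<theta> where \<theta>: "zlin \<theta>" "\<And>g x. c g (f x) = M' g (\<theta> x) - \<theta> (Z g x)"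
      "\<And>x. \<theta> (Z 0 x) = \<theta> x" "\<And>x. M' 0 (\<theta> x) = \<theta> x"
      using coboundary_fixed[OF Z M', of "\<lambda>g x. c g (f x)"] cocycleD(3)[OF c] ghom_fix'[OF f] by metis
    define k where "k z = (\<lambda>y::klein. if y = 0 then - \<theta> z else 0)" for z
    have k_lin: "zlin k"
      by (rule zlinI) (auto simp: k_def fun_eq_iff zlin_add[OF \<theta>(1)] zlin_scale[OF \<theta>(1)])
    have "\<chi> (f x) h = nm Z (cosyz M') k x h" for x h
    proof -
      have "nm Z (cosyz M') k x h = (\<Sum>g\<in>UNIV. M' 0 (k (Z g x) (g + h))) - (\<Sum>g\<in>UNIV. M' h (k (Z g x) g))"
        by (simp add: nm_def cosyz_def sum_subtractf)
      also have "(\<Sum>g\<in>UNIV. M' h (k (Z g x) g)) = (\<Sum>g\<in>(UNIV :: klein set). if g = 0 then - M' h (\<theta> x) else 0)"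
        by (intro sum.cong) (auto simp: k_def zlin_zero[OF l'] zlin_minus[OF l'] \<theta>(3))
      also have "(\<Sum>g\<in>UNIV. M' 0 (k (Z g x) (g + h))) = (\<Sum>g\<in>UNIV. if g = h then - \<theta> (Z h x) else 0)"
        by (intro sum.cong) (auto simp: k_def zlin_zero[OF l'] zlin_minus[OF l'] \<theta>(4) klein_add_self klein_add_eq_iff)
      finally show ?thesis by (simp add: finite_klein \<chi>_def \<theta>(2))
    qed
    then have "(\<lambda>x. \<chi> (f x)) = nm Z (cosyz M') k" by (intro ext) simp
    then show "null (sub (cosyz M') \<epsilon>) (cosyz M') (\<lambda>x. \<chi> (f x))" using k_lin unfolding null_def Z_def by blast
  qed
qed

section \<open>The Tate complex\<close>

text \<open>The alternating sum over the deletions of one entry, by recursion on the list; this form reduces the vanishing of the square to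
a short induction.\<close>

fun dele :: "(klein list \<Rightarrow> 'v::zmod) \<Rightarrow> klein list \<Rightarrow> 'v" where
  "dele c [] = 0"
| "dele c (x # t) = c t - dele (\<lambda>u. c (x # u)) t"

text \<open>The transpose of \<open>dele\<close>: the alternating sum over all insertions of one group element.\<close>

fun inse :: "(klein list \<Rightarrow> 'v::zmod) \<Rightarrow> klein list \<Rightarrow> 'v" where
  "inse c [] = (\<Sum>g\<in>UNIV. c [g])"
| "inse c (x # t) = (\<Sum>g\<in>UNIV. c (g # x # t)) - inse (\<lambda>u. c (x # u)) t"

lemma dele_cong: "(\<And>u. Suc (length u) = length t \<Longrightarrow> c u = c' u) \<Longrightarrow> dele c t = dele c' t"
proof (induction t arbitrary: c c')
  case (Cons x t)
  have "dele (\<lambda>u. c (x # u)) t = dele (\<lambda>u. c' (x # u)) t"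
    by (rule Cons.IH) (simp add: Cons.prems)
  then show ?case by (simp add: Cons.prems)
qed simp

lemma inse_cong: "(\<And>u. length u = Suc (length t) \<Longrightarrow> c u = c' u) \<Longrightarrow> inse c t = inse c' t"
proof (induction t arbitrary: c c')
  case (Cons x t)
  have "inse (\<lambda>u. c (x # u)) t = inse (\<lambda>u. c' (x # u)) t"
    by (rule Cons.IH) (simp add: Cons.prems)
  then show ?case by (simp add: Cons.prems)
qed simp

lemma zlin_dele: "zlin (dele :: (klein list \<Rightarrow> 'v::zmod) \<Rightarrow> _)"
proof (rule zlin_fun)
  show "zlin (\<lambda>c :: klein list \<Rightarrow> 'v. dele c t)" for t
  proof (induction t)
    case (Cons x t)
    have "zlin (\<lambda>c :: klein list \<Rightarrow> 'v. \<lambda>u. c (x # u))" by (rule zlin_fun) (rule zlin_eval)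
    from zlin_comp[OF Cons.IH this] show ?case by (simp add: zlin_minus' zlin_eval)
  qed (simp add: zlin_0)
qed

lemma zlin_inse: "zlin (inse :: (klein list \<Rightarrow> 'v::zmod) \<Rightarrow> _)"
proof (rule zlin_fun)
  show "zlin (\<lambda>c :: klein list \<Rightarrow> 'v. inse c t)" for t
  proof (induction t)
    case (Cons x t)
    have "zlin (\<lambda>c :: klein list \<Rightarrow> 'v. \<lambda>u. c (x # u))" by (rule zlin_fun) (rule zlin_eval)
    from zlin_comp[OF Cons.IH this] show ?case by (simp add: zlin_minus' zlin_sum' zlin_eval)
  qed (simp add: zlin_sum' zlin_eval)
qed

lemma dele_map: "zlin f \<Longrightarrow> f (dele c t) = dele (\<lambda>u. f (c u)) t"
  by (induction t arbitrary: c) (simp_all add: zlin_zero zlin_diff)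

lemma inse_map: "zlin f \<Longrightarrow> f (inse c t) = inse (\<lambda>u. f (c u)) t"
  by (induction t arbitrary: c) (simp_all add: zlin_sum zlin_diff)

lemma dele_shift: "dele c (map ((+) g) t) = dele (\<lambda>u. c (map ((+) g) u)) t"
  by (induction t arbitrary: c) simp_all

lemma inse_shift: "inse c (map ((+) g) t) = inse (\<lambda>u. c (map ((+) g) u)) t"
proof (induction t arbitrary: c)
  case Nil
  show ?case using sum_klein_shift[of "\<lambda>h. c [h]" g] by simp
next
  case (Cons x t)
  have "(\<Sum>h\<in>UNIV. c (h # (g + x) # map ((+) g) t)) = (\<Sum>h\<in>UNIV. c ((g + h) # (g + x) # map ((+) g) t))"
    by (rule sum_klein_shift[symmetric])
  then show ?case by (simp add: Cons.IH)
qed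

lemma dele_dele: "dele (dele c) t = 0"
proof (induction t arbitrary: c)
  case (Cons x t)
  have "dele (\<lambda>u. dele c (x # u)) t = dele (c - dele (\<lambda>u. c (x # u))) t"
    by (rule arg_cong[where f = "\<lambda>c. dele c t"]) (simp add: fun_eq_iff)
  then have "dele (\<lambda>u. dele c (x # u)) t = dele c t - dele (dele (\<lambda>u. c (x # u))) t"
    by (simp add: zlin_diff[OF zlin_dele])
  then show ?case using Cons.IH by (simp del: dele.simps(2) add: dele.simps(2)[of "dele c"])
qed simp

lemma inse_inse: "inse (inse c) t = 0"
proof (induction t arbitrary: c)
  case Nil
  show ?case using sum.swap[of "\<lambda>g h. c [g, h]" UNIV UNIV] by (simp add: sum_subtractf)
next
  case (Cons x t)
  define cx where "cx y u = c (y # u)" for y u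
  have "inse (\<lambda>u. inse c (x # u)) t = inse ((\<Sum>g\<in>UNIV. (\<lambda>u. c (g # x # u))) - inse (cx x)) t"
    by (rule arg_cong[where f = "\<lambda>c. inse c t"]) (simp add: fun_eq_iff cx_def[abs_def])
  also have "\<dots> = (\<Sum>g\<in>UNIV. inse (\<lambda>u. c (g # x # u)) t)"
    using Cons.IH[of "cx x"] by (simp add: zlin_diff[OF zlin_inse] zlin_sum[OF zlin_inse])
  finally have 1: "inse (\<lambda>u. inse c (x # u)) t = (\<Sum>g\<in>UNIV. inse (\<lambda>u. c (g # x # u)) t)" .
  have "(\<Sum>g\<in>UNIV. inse c (g # x # t)) = (\<Sum>g\<in>UNIV. \<Sum>h\<in>UNIV. c (h # g # x # t)) -
      (\<Sum>g\<in>UNIV. \<Sum>h\<in>UNIV. c (g # h # x # t)) + (\<Sum>g\<in>UNIV. inse (\<lambda>u. c (g # x # u)) t)"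
    by (simp add: sum_subtractf sum.distrib)
  also have "(\<Sum>g\<in>UNIV. \<Sum>h\<in>UNIV. c (h # g # x # t)) = (\<Sum>g\<in>UNIV. \<Sum>h\<in>UNIV. c (g # h # x # t))"
    by (rule sum.swap)
  finally show ?case using 1 by (simp del: inse.simps(2) add: inse.simps(2)[of "inse c"])
qed

text \<open>The Tate differential on all cochains, equivariant or not. In degree \<open>-1\<close> the value does not depend on the argument.\<close>

definition dif :: "int \<Rightarrow> (klein list \<Rightarrow> 'v::zmod) \<Rightarrow> klein list \<Rightarrow> 'v" where
  "dif n c = (\<lambda>t. if t \<in> tuples (n + 1) then (if n \<ge> 0 then dele c t else if n = -1 then inse c [] else inse c t) else 0)"

lemma zlin_dif: "zlin (dif n :: (klein list \<Rightarrow> 'v::zmod) \<Rightarrow> _)"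
proof (rule zlin_fun)
  show "zlin (\<lambda>c :: klein list \<Rightarrow> 'v. dif n c t)" for t
    by (cases "t \<in> tuples (n + 1)"; cases "n \<ge> 0"; cases "n = -1")
      (simp_all add: dif_def zlin_0 zlin_app[OF zlin_dele] zlin_app[OF zlin_inse] del: inse.simps)
qed

lemma dif_map: "zlin f \<Longrightarrow> f (dif n c t) = dif n (\<lambda>u. f (c u)) t"
  by (simp add: dif_def dele_map inse_map zlin_zero del: inse.simps)

lemma tuples_map [simp]: "map f t \<in> tuples n \<longleftrightarrow> t \<in> tuples n"
  by (simp add: tuples_def)

lemma map_add_add: "map ((+) h) (map ((+) g) u) = map ((+) (g + h)) u" for g :: klein
  by (induction u) (simp_all add: add_ac)

lemma tuples_nonempty: "t \<in> tuples n \<Longrightarrow> t \<noteq> []"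
  by (auto simp: tuples_def split: if_splits)

lemma dif_shift: "dif n c (map ((+) g) t) = dif n (\<lambda>u. c (map ((+) g) u)) t"
  using inse_shift[of c g "[]"] by (simp add: dif_def dele_shift inse_shift del: inse.simps)

lemma dif_outside: "t \<notin> tuples (n + 1) \<Longrightarrow> dif n c t = 0"
  by (simp add: dif_def)

lemma dif_dif: "dif (n + 1) (dif n c) = 0"
proof
  fix t
  show "dif (n + 1) (dif n c) t = 0 t"
  proof (cases "t \<in> tuples (n + 2)")
    case t: True
    consider "n \<ge> 0" | "n = -1" | "n = -2" | "n \<le> -3" by linarith
    then show ?thesis
    proof cases
      case 1
      have "dele (dif n c) t = dele (dele c) t"
        using 1 t by (intro dele_cong) (auto simp: dif_def tuples_def)
      then show ?thesis using 1 by (simp add: dif_def[of "n + 1"] dele_dele)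
    next
      case 2
      then have "length t = 2" using t by (simp add: tuples_def)
      then obtain x y where "t = [x, y]" by (auto simp: length_Suc_conv numeral_2_eq_2)
      then show ?thesis using 2 by (simp add: dif_def tuples_def)
    next
      case 3
      have "inse (dif n c) [] = inse (inse c) []"
        using 3 by (intro inse_cong) (auto simp: dif_def tuples_def)
      then show ?thesis using 3 by (simp add: dif_def[of "- 1"] inse_inse del: inse.simps)
    next
      case 4
      have "inse (dif n c) t = inse (inse c) t"
        using 4 t by (intro inse_cong) (auto simp: dif_def tuples_def)
      then show ?thesis using 4 by (simp add: dif_def[of "n + 1"] inse_inse)
    qed
  qed (simp add: dif_def add.assoc)
qed

subsection \<open>A contracting homotopy\<close>

text \<open>In degrees above zero the homotopy prepends \<open>0\<close>; in negative degrees it is the transpose, and in degree zero it places the value of a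
constant function at the single argument \<open>[0]\<close>.\<close>

definition hs :: "int \<Rightarrow> (klein list \<Rightarrow> 'v::zmod) \<Rightarrow> klein list \<Rightarrow> 'v" where
  "hs n c = (\<lambda>u. if u \<in> tuples (n - 1) then
     (if n \<ge> 1 then c (0 # u) else if n = 0 then (if u = [0] then c [0] else 0)
      else if hd u = 0 then c (tl u) else 0) else 0)"

lemma zlin_hs: "zlin (hs n)"
  by (rule zlinI) (auto simp: hs_def fun_eq_iff)

lemma hs_outside: "u \<notin> tuples (n - 1) \<Longrightarrow> hs n c u = 0"
  by (simp add: hs_def)

lemma hs_map: "zlin f \<Longrightarrow> f (hs n c u) = hs n (\<lambda>u. f (c u)) u"
  by (simp add: hs_def zlin_zero)

text \<open>Without the equivariance condition the complete complex is exact.\<close>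

lemma contraction:
  fixes c :: "klein list \<Rightarrow> 'v::zmod"
  assumes c: "\<And>t. t \<notin> tuples n \<Longrightarrow> c t = 0" and d: "dif n c = 0"
  shows "dif (n - 1) (hs n c) = c"
proof
  fix t
  have d': "dif n c u = 0" for u by (simp add: d)
  show "dif (n - 1) (hs n c) t = c t"
  proof (cases "t \<in> tuples n")
    case t: True
    consider "n \<ge> 1" | "n = 0" | "n \<le> -1" by linarith
    then show ?thesis
    proof cases
      case 1
      have "0 # t \<in> tuples (n + 1)" using 1 t by (simp add: tuples_def)
      then have "dele c (0 # t) = 0" using d'[of "0 # t"] 1 by (simp add: dif_def)
      moreover have "dele (hs n c) t = dele (\<lambda>u. c (0 # u)) t"
        using 1 t by (intro dele_cong) (auto simp: hs_def tuples_def)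
      ultimately show ?thesis using 1 t by (simp add: dif_def)
    next
      case 2
      then have "length t = 1" using t by (simp add: tuples_def)
      then obtain x where x: "t = [x]" by (auto simp: length_Suc_conv)
      have "c [x] = c [0]" using d'[of "[0, x]"] 2 by (simp add: dif_def tuples_def)
      moreover have "hs n c [g] = (if g = 0 then c [0] else 0)" for g
        using 2 by (simp add: hs_def tuples_def)
      ultimately show ?thesis using 2 x by (simp add: dif_def tuples_def finite_klein)
    next
      case 3
      obtain x t' where x: "t = x # t'" using t tuples_nonempty by (cases t) auto
      have len: "int (length t') = - n - 1" using 3 t x by (auto simp: tuples_def split: if_splits)
      have hs1: "hs n c (y # u) = (if y = 0 then c u else 0)" if "int (length u) = - n" for y u
        using 3 that by (simp add: hs_def tuples_def)
      have z: "inse c t' = 0"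
      proof (cases "n = -1")
        case True
        then show ?thesis using len d'[of "[0]"] by (simp add: dif_def tuples_def)
      next
        case False
        then show ?thesis using len 3 d'[of t'] by (simp add: dif_def tuples_def)
      qed
      have "inse (\<lambda>u. hs n c (x # u)) t' = inse (\<lambda>u. if x = 0 then c u else 0) t'"
        using len by (intro inse_cong) (auto simp: hs1)
      also have "\<dots> = 0"
      proof (cases "x = 0")
        case False
        have "inse (0 :: klein list \<Rightarrow> 'v) t' = 0" by (simp add: zlin_zero[OF zlin_inse])
        then show ?thesis using False by (simp add: zero_fun_def)
      qed (simp add: z)
      finally have "inse (hs n c) t = (\<Sum>g\<in>UNIV. hs n c (g # x # t'))" by (simp add: x)
      also have "\<dots> = c t" using len by (simp add: hs1 x finite_klein)
      finally show ?thesis using 3 t by (simp add: dif_def)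
    qed
  qed (simp add: c dif_outside)
qed

subsection \<open>Cohomology and dimension shifting\<close>

text \<open>The values lie in the lattice automatically, by equivariance under \<open>0\<close>.\<close>

definition coch :: "'v::zmod rep \<Rightarrow> int \<Rightarrow> (klein list \<Rightarrow> 'v) set" where
  "coch \<rho> n = {c. (\<forall>t. t \<notin> tuples n \<longrightarrow> c t = 0) \<and> (\<forall>g t. c (map ((+) g) t) = \<rho> g (c t))}"

definition cocy :: "'v::zmod rep \<Rightarrow> int \<Rightarrow> (klein list \<Rightarrow> 'v) set" where
  "cocy \<rho> n = {c \<in> coch \<rho> n. dif n c = 0}"

definition cobd :: "'v::zmod rep \<Rightarrow> int \<Rightarrow> (klein list \<Rightarrow> 'v) set" where
  "cobd \<rho> n = dif (n - 1) ` coch \<rho> (n - 1)"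

lemma cochD: "c \<in> coch \<rho> n \<Longrightarrow> t \<notin> tuples n \<Longrightarrow> c t = 0" "c \<in> coch \<rho> n \<Longrightarrow> c (map ((+) g) t) = \<rho> g (c t)"
  unfolding coch_def by blast+

lemma coch_fix: "c \<in> coch \<rho> n \<Longrightarrow> \<rho> 0 (c t) = c t"
  using cochD(2)[of c \<rho> n 0 t] by (simp add: map_idI)

lemma cochI: "(\<And>t. t \<notin> tuples n \<Longrightarrow> c t = 0) \<Longrightarrow> (\<And>g t. c (map ((+) g) t) = \<rho> g (c t)) \<Longrightarrow> c \<in> coch \<rho> n"
  by (simp add: coch_def)

lemma coch_add: "glat \<rho> \<Longrightarrow> c \<in> coch \<rho> n \<Longrightarrow> c' \<in> coch \<rho> n \<Longrightarrow> c + c' \<in> coch \<rho> n"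
  by (rule cochI) (simp_all add: cochD zlin_add[OF glat_lin])

lemma coch_diff: "glat \<rho> \<Longrightarrow> c \<in> coch \<rho> n \<Longrightarrow> c' \<in> coch \<rho> n \<Longrightarrow> c - c' \<in> coch \<rho> n"
  by (rule cochI) (simp_all add: cochD zlin_diff[OF glat_lin])

lemma coch_0: "glat \<rho> \<Longrightarrow> 0 \<in> coch \<rho> n"
  by (rule cochI) (simp_all add: zlin_zero[OF glat_lin])

lemma coch_dif: "glat \<rho> \<Longrightarrow> c \<in> coch \<rho> n \<Longrightarrow> dif n c \<in> coch \<rho> (n + 1)"
  by (rule cochI) (simp_all add: dif_outside dif_shift cochD dif_map[OF glat_lin])

lemma cocyD: "c \<in> cocy \<rho> n \<Longrightarrow> c \<in> coch \<rho> n" "c \<in> cocy \<rho> n \<Longrightarrow> dif n c = 0"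
  by (simp_all add: cocy_def)

lemma cocy_add: "glat \<rho> \<Longrightarrow> c \<in> cocy \<rho> n \<Longrightarrow> c' \<in> cocy \<rho> n \<Longrightarrow> c + c' \<in> cocy \<rho> n"
  by (simp add: cocy_def coch_add zlin_add[OF zlin_dif])

lemma cocy_diff: "glat \<rho> \<Longrightarrow> c \<in> cocy \<rho> n \<Longrightarrow> c' \<in> cocy \<rho> n \<Longrightarrow> c - c' \<in> cocy \<rho> n"
  by (simp add: cocy_def coch_diff zlin_diff[OF zlin_dif])

lemma cocy_0: "glat \<rho> \<Longrightarrow> 0 \<in> cocy \<rho> n"
  by (simp add: cocy_def coch_0 zlin_zero[OF zlin_dif])

lemma cobd_sub_cocy: "glat \<rho> \<Longrightarrow> cobd \<rho> n \<subseteq> cocy \<rho> n"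
  using coch_dif[of \<rho> _ "n - 1"] dif_dif[of "n - 1"] by (auto simp: cobd_def cocy_def)

lemma cobd_add:
  assumes "glat \<rho>" "c \<in> cobd \<rho> n" "c' \<in> cobd \<rho> n"
  shows "c + c' \<in> cobd \<rho> n"
proof -
  obtain a b where "a \<in> coch \<rho> (n - 1)" "b \<in> coch \<rho> (n - 1)" "c = dif (n - 1) a" "c' = dif (n - 1) b"
    using assms(2,3) by (auto simp: cobd_def)
  then have "a + b \<in> coch \<rho> (n - 1)" "c + c' = dif (n - 1) (a + b)"
    using coch_add[OF assms(1)] by (simp_all add: zlin_add[OF zlin_dif])
  then show ?thesis by (auto simp: cobd_def)
qed

lemma cobd_uminus:
  assumes "glat \<rho>" "c \<in> cobd \<rho> n"
  shows "- c \<in> cobd \<rho> n"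
proof -
  obtain a where "a \<in> coch \<rho> (n - 1)" "c = dif (n - 1) a"
    using assms(2) by (auto simp: cobd_def)
  then have "0 - a \<in> coch \<rho> (n - 1)" "- c = dif (n - 1) (0 - a)"
    using coch_diff[OF assms(1) coch_0[OF assms(1)]] by (simp_all add: zlin_minus[OF zlin_dif])
  then show ?thesis unfolding cobd_def by blast
qed

lemma cobd_0: "glat \<rho> \<Longrightarrow> 0 \<in> cobd \<rho> n"
  unfolding cobd_def using coch_0 zlin_zero[OF zlin_dif] by (metis imageI)

text \<open>An injective homomorphism between the cohomology groups, represented by an additive map on cocycles.\<close>

definition temb :: "'v::zmod rep \<Rightarrow> int \<Rightarrow> 'w::zmod rep \<Rightarrow> int \<Rightarrow> bool" where
  "temb \<rho> n \<sigma> m \<longleftrightarrow> (\<exists>F. (\<forall>c\<in>cocy \<rho> n. F c \<in> cocy \<sigma> m) \<and>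
     (\<forall>c\<in>cocy \<rho> n. \<forall>c'\<in>cocy \<rho> n. F (c + c') = F c + F c') \<and>
     (\<forall>c\<in>cocy \<rho> n. F c \<in> cobd \<sigma> m \<longleftrightarrow> c \<in> cobd \<rho> n))"

lemma temb_trans:
  assumes "temb \<rho> n \<sigma> m" "temb \<sigma> m \<tau> k"
  shows "temb \<rho> n \<tau> k"
proof -
  obtain F where F: "\<forall>c\<in>cocy \<rho> n. F c \<in> cocy \<sigma> m" "\<forall>c\<in>cocy \<rho> n. \<forall>c'\<in>cocy \<rho> n. F (c + c') = F c + F c'"
     "\<forall>c\<in>cocy \<rho> n. F c \<in> cobd \<sigma> m \<longleftrightarrow> c \<in> cobd \<rho> n" using assms(1) unfolding temb_def by blast
  obtain H where H: "\<forall>c\<in>cocy \<sigma> m. H c \<in> cocy \<tau> k" "\<forall>c\<in>cocy \<sigma> m. \<forall>c'\<in>cocy \<sigma> m. H (c + c') = H c + H c'"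
     "\<forall>c\<in>cocy \<sigma> m. H c \<in> cobd \<tau> k \<longleftrightarrow> c \<in> cobd \<sigma> m" using assms(2) unfolding temb_def by blast
  show ?thesis unfolding temb_def by (rule exI[of _ "\<lambda>c. H (F c)"]) (use F H in simp)
qed

lemma coch_ghom:
  assumes "ghom \<rho> \<sigma> f" "c \<in> coch \<rho> n"
  shows "(\<lambda>t. f (c t)) \<in> coch \<sigma> n"
  by (rule cochI) (simp_all add: cochD[OF assms(2)] zlin_zero[OF ghom_lin[OF assms(1)]] ghom_comm[OF assms(1)])

lemma cobd_ghom:
  assumes "ghom \<rho> \<sigma> f" "c \<in> cobd \<rho> n"
  shows "(\<lambda>t. f (c t)) \<in> cobd \<sigma> n"
proof -
  obtain a where a: "a \<in> coch \<rho> (n - 1)" "c = dif (n - 1) a" using assms(2) by (auto simp: cobd_def)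
  then have "(\<lambda>t. f (c t)) = dif (n - 1) (\<lambda>t. f (a t))"
    by (simp add: fun_eq_iff dif_map[OF ghom_lin[OF assms(1)]])
  then show ?thesis using coch_ghom[OF assms(1) a(1)] by (auto simp: cobd_def)
qed

lemma temb_retract:
  assumes "retract \<rho> \<sigma>"
  shows "temb \<rho> n \<sigma> n"
proof -
  obtain i p where i: "ghom \<rho> \<sigma> i" and p: "ghom \<sigma> \<rho> p" and pi: "\<And>x. p (i x) = \<rho> 0 x"
    using assms by (auto simp: retract_def)
  show ?thesis
    unfolding temb_def
  proof (intro exI[of _ "\<lambda>c t. i (c t)"] conjI ballI)
    fix c assume c: "c \<in> cocy \<rho> n"
    have "dif n (\<lambda>t. i (c t)) = (\<lambda>t. i (dif n c t))" by (simp add: fun_eq_iff dif_map[OF ghom_lin[OF i]])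
    then have "dif n (\<lambda>t. i (c t)) = 0"
      by (simp add: cocyD(2)[OF c] zlin_zero[OF ghom_lin[OF i]] fun_eq_iff)
    then show "(\<lambda>t. i (c t)) \<in> cocy \<sigma> n"
      using coch_ghom[OF i cocyD(1)[OF c]] by (simp add: cocy_def)
    have "(\<lambda>t. p (i (c t))) = c" by (simp add: pi coch_fix[OF cocyD(1)[OF c]])
    then show "(\<lambda>t. i (c t)) \<in> cobd \<sigma> n \<longleftrightarrow> c \<in> cobd \<rho> n"
      using cobd_ghom[OF i, of c n] cobd_ghom[OF p, of "\<lambda>t. i (c t)" n] by auto
    show "(\<lambda>t. i ((c + c') t)) = (\<lambda>t. i (c t)) + (\<lambda>t. i (c' t))" for c'
      by (simp add: fun_eq_iff zlin_add[OF ghom_lin[OF i]])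
  qed
qed

text \<open>The norm of a cochain: it produces equivariant cochains and commutes with the differential. Its value at a tuple \<open>u\<close> is the
augmentation of the function \<open>h \<mapsto> p (h u)\<close> on the group.\<close>

definition tra :: "'v::zmod rep \<Rightarrow> (klein list \<Rightarrow> 'v) \<Rightarrow> klein list \<Rightarrow> 'v" where
  "tra M p u = (\<Sum>h\<in>UNIV. M h (p (map ((+) h) u)))"

lemma zlin_tra:
  assumes "glat M"
  shows "zlin (tra M)"
  by (rule zlinI) (simp_all add: tra_def fun_eq_iff zlin_add[OF glat_lin[OF assms]] zlin_scale[OF glat_lin[OF assms]]
      sum.distrib zscale_sum_right)

lemma tra_coch:
  assumes M: "glat M" and p: "\<And>u. u \<notin> tuples n \<Longrightarrow> p u = 0"
  shows "tra M p \<in> coch M n"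
proof (rule cochI)
  show "tra M p u = 0" if "u \<notin> tuples n" for u
    using that by (simp add: tra_def p zlin_zero[OF glat_lin[OF M]])
  fix g u
  have "tra M p (map ((+) g) u) = (\<Sum>h\<in>UNIV. M h (p (map ((+) (g + h)) u)))"
    by (simp add: tra_def map_add_add del: map_map)
  also have "\<dots> = (\<Sum>h\<in>UNIV. M (g + h) (p (map ((+) (g + (g + h))) u)))" by (rule sum_klein_shift[symmetric])
  also have "\<dots> = M g (tra M p u)"
    by (simp add: tra_def klein_add_left_cancel_self zlin_sum[OF glat_lin[OF M]] glat_mult[OF M])
  finally show "tra M p (map ((+) g) u) = M g (tra M p u)" .
qed

lemma tra_dif:
  assumes M: "glat M"
  shows "tra M (dif n p) = dif n (tra M p)"
proof
  fix u
  have "tra M (dif n p) u = (\<Sum>h\<in>UNIV. dif n (\<lambda>u. M h (p (map ((+) h) u))) u)"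
    by (simp add: tra_def dif_shift dif_map[OF glat_lin[OF M]])
  also have "\<dots> = dif n (\<Sum>h\<in>UNIV. (\<lambda>u. M h (p (map ((+) h) u)))) u"
    by (simp add: zlin_sum[OF zlin_dif])
  also have "(\<Sum>h\<in>UNIV. (\<lambda>u. M h (p (map ((+) h) u)))) = tra M p"
    by (simp add: fun_eq_iff tra_def)
  finally show "tra M (dif n p) u = dif n (tra M p) u" .
qed

lemma hd_map_add: "u \<in> tuples n \<Longrightarrow> hd (map ((+) g) u) = g + hd u"
  by (simp add: hd_map tuples_nonempty)

text \<open>Each equivariant cochain is the norm of its part supported on the tuples that start with \<open>0\<close>.\<close>

lemma tra_lift:
  assumes M: "glat M" and w: "w \<in> coch M n"
  shows "tra M (\<lambda>u. if hd u = 0 then w u else 0) = w"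
proof
  fix u
  show "tra M (\<lambda>u. if hd u = 0 then w u else 0) u = w u"
  proof (cases "u \<in> tuples n")
    case True
    have "M h (if hd (map ((+) h) u) = 0 then w (map ((+) h) u) else 0) = (if h = hd u then w u else 0)" for h
      by (auto simp: hd_map_add[OF True] cochD(2)[OF w] glat_self[OF M] coch_fix[OF w] zlin_zero[OF glat_lin[OF M]]
          klein_add_eq_iff klein_add_self)
    then show ?thesis by (simp add: tra_def finite_klein)
  next
    case False
    then have "w (map ((+) h) u) = 0" for h by (simp add: cochD(1)[OF w])
    then show ?thesis using False by (simp add: tra_def cochD(1)[OF w] zlin_zero[OF glat_lin[OF M]] cong: if_cong)
  qed
qed

lemma syz_aug_0: "aug M f = 0 \<Longrightarrow> syz M g f h = M 0 (f (g + h))"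
  by (simp add: syz_def)

text \<open>By equivariance a cochain with values in functions on the group is determined by its component at \<open>0\<close>; taking values in
the syzygy means that this component has norm zero.\<close>

lemma syz_coch:
  assumes M: "glat M" and z: "z \<in> coch (syz M) n"
  shows "aug M (z t) = 0" "M 0 (z t h) = z t h" "z t h = z (map ((+) h) t) 0" "tra M (\<lambda>u. z u 0) = 0"
proof -
  have f: "syz M 0 (z t) = z t" for t by (rule coch_fix[OF z])
  show 0: "aug M (z t) = 0" for t using aug_syz[OF M, of 0 "z t"] by (simp add: f)
  have "z t h = M 0 (z t h)" for h t using fun_cong[OF f[of t], of h] by (simp add: syz_aug_0[OF 0])
  then show 1: "M 0 (z t h) = z t h" for h t by simp
  show 2: "z t h = z (map ((+) h) t) 0" for t h
    using cochD(2)[OF z, of h t] by (simp add: syz_aug_0[OF 0] 1)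
  show "tra M (\<lambda>u. z u 0) = 0"
    using 0 by (simp add: fun_eq_iff tra_def aug_def 2[symmetric])
qed

text \<open>The inverse connecting map. The component at \<open>0\<close> of a cocycle is a cocycle without equivariance, hence the differential of some
\<open>p\<close>; as its norm vanishes, the norm of \<open>p\<close> is a cocycle of degree one less.\<close>

lemma temb_syz:
  assumes M: "glat M"
  shows "temb (syz M) n M (n - 1)"
  unfolding temb_def
proof (intro exI[of _ "\<lambda>z. tra M (hs n (\<lambda>u. z u 0))"] conjI ballI)
  note lt = zlin_tra[OF M] and l = glat_lin[OF M]
  have p_supp: "hs n c u = 0" if "u \<notin> tuples (n - 1)" for c :: "klein list \<Rightarrow> 'a" and u
    using that by (rule hs_outside)
  fix z assume z: "z \<in> cocy (syz M) n"
  note zc = cocyD(1)[OF z] and sz = syz_coch[OF M cocyD(1)[OF z]]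
  define z0 where "z0 u = z u 0" for u
  have z0d: "dif n z0 = 0"
    using dif_map[OF zlin_eval[of 0], where n = n and c = z] cocyD(2)[OF z] by (simp add: fun_eq_iff z0_def[abs_def])
  have z0s: "z0 t = 0" if "t \<notin> tuples n" for t using cochD(1)[OF zc that] by (simp add: z0_def)
  define p where "p = hs n z0"
  have dp: "dif (n - 1) p = z0" unfolding p_def by (rule contraction[OF z0s z0d])
  have pM: "M 0 (p u) = p u" for u
  proof -
    have "M 0 (z0 u) = z0 u" for u by (simp add: z0_def sz(2))
    then show ?thesis unfolding p_def by (simp add: hs_map[OF l])
  qed
  have ps: "p u = 0" if "u \<notin> tuples (n - 1)" for u unfolding p_def using that by (rule p_supp)
  have F: "tra M (hs n (\<lambda>u. z u 0)) = tra M p" by (simp add: p_def z0_def[abs_def])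
  have t0: "tra M z0 = 0" using sz(4) by (simp add: z0_def[abs_def])
  show "tra M (hs n (\<lambda>u. z u 0)) \<in> cocy M (n - 1)"
    unfolding F cocy_def using tra_coch[OF M ps] by (simp add: tra_dif[OF M, symmetric] dp t0)
  show "tra M (hs n (\<lambda>u. (z + z') u 0)) = tra M (hs n (\<lambda>u. z u 0)) + tra M (hs n (\<lambda>u. z' u 0))" for z'
  proof -
    have "(\<lambda>u. (z + z') u 0) = (\<lambda>u. z u 0) + (\<lambda>u. z' u 0)" by (simp add: fun_eq_iff)
    then show ?thesis by (simp add: zlin_add[OF zlin_hs] zlin_add[OF lt])
  qed
  show "tra M (hs n (\<lambda>u. z u 0)) \<in> cobd M (n - 1) \<longleftrightarrow> z \<in> cobd (syz M) n"
    unfolding F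
  proof
    assume "tra M p \<in> cobd M (n - 1)"
    then obtain w where w: "w \<in> coch M (n - 1 - 1)" "tra M p = dif (n - 1 - 1) w" by (auto simp: cobd_def)
    define w0 where "w0 u = (if hd u = 0 then w u else 0)" for u
    have tw: "tra M w0 = w" unfolding w0_def by (rule tra_lift[OF M w(1)])
    have w0M: "M 0 (w0 u) = w0 u" for u by (simp add: w0_def coch_fix[OF w(1)] zlin_zero[OF l])
    define k0 where "k0 = p - dif (n - 1 - 1) w0"
    have k0t: "tra M k0 = 0" by (simp add: k0_def zlin_diff[OF lt] tra_dif[OF M] tw w(2))
    have k0d: "dif (n - 1) k0 = z0" using dif_dif[of "n - 1 - 1" w0] by (simp add: k0_def zlin_diff[OF zlin_dif] dp)
    have k0M: "M 0 (k0 u) = k0 u" for u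
      by (simp add: k0_def zlin_diff[OF l] pM dif_map[OF l] w0M)
    have k0s: "k0 u = 0" if "u \<notin> tuples (n - 1)" for u
      using that by (simp add: k0_def ps dif_outside)
    define k where "k u h = k0 (map ((+) h) u)" for u h
    have "k \<in> coch (syz M) (n - 1)"
    proof (rule cochI)
      show "k u = 0" if "u \<notin> tuples (n - 1)" for u using that by (simp add: k_def fun_eq_iff k0s)
      show "k (map ((+) g) u) = syz M g (k u)" for g u
      proof -
        have "aug M (k u) = 0" using fun_cong[OF k0t, of u] by (simp add: aug_def tra_def k_def)
        then show ?thesis
          by (intro ext) (simp add: syz_aug_0, simp add: k_def k0M map_add_add del: map_map)
      qed
    qed
    moreover have "z = dif (n - 1) k"
    proof (intro ext)
      fix t h
      have "dif (n - 1) k t h = dif (n - 1) (\<lambda>u. k u h) t" by (rule dif_map[OF zlin_eval])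
      also have "\<dots> = dif (n - 1) k0 (map ((+) h) t)" by (simp add: k_def dif_shift)
      also have "\<dots> = z t h" by (simp add: k0d z0_def sz(3)[symmetric])
      finally show "z t h = dif (n - 1) k t h" by simp
    qed
    ultimately show "z \<in> cobd (syz M) n" by (auto simp: cobd_def)
  next
    assume "z \<in> cobd (syz M) n"
    then obtain k where k: "k \<in> coch (syz M) (n - 1)" "z = dif (n - 1) k" by (auto simp: cobd_def)
    define k0 where "k0 u = k u 0" for u
    have "dif (n - 1) k0 = z0"
      using dif_map[OF zlin_eval[of 0], where n = "n - 1" and c = k] by (simp add: fun_eq_iff z0_def k0_def[abs_def] k(2))
    then have d0: "dif (n - 1) (p - k0) = 0" by (simp add: zlin_diff[OF zlin_dif] dp)
    have s0: "(p - k0) u = 0" if "u \<notin> tuples (n - 1)" for u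
      using cochD(1)[OF k(1) that] by (simp add: ps[OF that] k0_def)
    define q where "q = hs (n - 1) (p - k0)"
    have "dif (n - 1 - 1) q = p - k0" unfolding q_def by (rule contraction[OF s0 d0])
    then have "tra M p = tra M k0 + dif (n - 1 - 1) (tra M q)"
      by (simp add: tra_dif[OF M, symmetric] zlin_diff[OF lt])
    also have "tra M k0 = 0" using syz_coch(4)[OF M k(1)] by (simp add: k0_def[abs_def])
    finally have "tra M p = dif (n - 1 - 1) (tra M q)" by simp
    moreover have "tra M q \<in> coch M (n - 1 - 1)"
      unfolding q_def by (rule tra_coch[OF M hs_outside])
    ultimately show "tra M p \<in> cobd M (n - 1)" by (auto simp: cobd_def)
  qed
qed

text \<open>An equivariant cochain with values in the cosyzygy lifts to the coinduced module; \<open>low\<close> is the component at \<open>0\<close> of such a lift.\<close>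

definition low :: "'v::zmod rep \<Rightarrow> (klein list \<Rightarrow> klein \<Rightarrow> 'v) \<Rightarrow> klein list \<Rightarrow> 'v" where
  "low M c u = - M (hd u) (c u (hd u))"

lemma zlin_low: "glat M \<Longrightarrow> zlin (low M)"
  by (rule zlinI) (simp_all add: low_def fun_eq_iff zlin_add[OF glat_lin] zlin_scale[OF glat_lin])

lemma low_coch:
  assumes M: "glat M" and c: "c \<in> coch (cosyz M) n"
  shows "u \<notin> tuples n \<Longrightarrow> low M c u = 0"
    "c u h = low M c (map ((+) h) u) - M h (low M c u)" "M 0 (low M c u) = low M c u"
proof -
  note l = glat_lin[OF M]
  have f: "cosyz M 0 (c u) = c u" for u by (rule coch_fix[OF c])
  show s: "low M c u = 0" if "u \<notin> tuples n" for u
    by (simp add: low_def cochD(1)[OF c that] zlin_zero[OF l])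
  show "M 0 (low M c u) = low M c u" by (simp add: low_def zlin_minus[OF l] glat_mult[OF M])
  have fx: "M 0 (c u h) = c u h" for u h
  proof -
    have "M 0 (cosyz M 0 (c u) h) = cosyz M 0 (c u) h"
      by (simp add: cosyz_def zlin_diff[OF l] glat_mult[OF M])
    then show ?thesis by (simp add: f)
  qed
  show "c u h = low M c (map ((+) h) u) - M h (low M c u)"
  proof (cases "u \<in> tuples n")
    case True
    have "c (map ((+) h) u) (h + hd u) = c u (hd u) - M (h + hd u) (c u h)"
      by (simp add: cochD(2)[OF c] cosyz_def fx klein_add_left_cancel_self)
    then have "low M c (map ((+) h) u) = - M (h + hd u) (c u (hd u)) + c u h"
      by (simp add: low_def hd_map_add[OF True] zlin_diff[OF l] glat_self[OF M] fx)
    then show ?thesis by (simp add: low_def[of M c u] zlin_minus[OF l] glat_mult[OF M])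
  next
    case False
    then show ?thesis by (simp add: s cochD(1)[OF c] zlin_zero[OF l])
  qed
qed

text \<open>The connecting map: lift the cocycle to the coinduced module and take the differential.\<close>

lemma temb_cosyz:
  assumes M: "glat M"
  shows "temb (cosyz M) n M (n + 1)"
  unfolding temb_def
proof (intro exI[of _ "\<lambda>c. dif n (low M c)"] conjI ballI)
  note l = glat_lin[OF M]
  have key: "dif m (\<lambda>u. r (map ((+) h) u) - M h (r u)) t = dif m r (map ((+) h) t) - M h (dif m r t)"
    for m r h t
  proof -
    have "dif m (\<lambda>u. r (map ((+) h) u) - M h (r u)) t = dif m ((\<lambda>u. r (map ((+) h) u)) - (\<lambda>u. M h (r u))) t"
      by (rule arg_cong[where f = "\<lambda>c. dif m c t"]) (simp add: fun_eq_iff)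
    then show ?thesis by (simp add: zlin_diff[OF zlin_dif] dif_shift dif_map[OF l])
  qed
  have key': "dif m c t h = dif m (low M c) (map ((+) h) t) - M h (dif m (low M c) t)"
    if "c \<in> coch (cosyz M) m" for m c t h
  proof -
    have "dif m c t h = dif m (\<lambda>u. c u h) t" by (rule dif_map[OF zlin_eval])
    also have "(\<lambda>u. c u h) = (\<lambda>u. low M c (map ((+) h) u) - M h (low M c u))"
      by (rule ext) (rule low_coch(2)[OF M that])
    finally show ?thesis by (simp only: key)
  qed
  fix c assume c: "c \<in> cocy (cosyz M) n"
  note cc = cocyD(1)[OF c]
  have "dif n (low M c) \<in> coch M (n + 1)"
  proof (rule cochI)
    show "dif n (low M c) (map ((+) g) t) = M g (dif n (low M c) t)" for g t
      using key'[OF cc, of t g] cocyD(2)[OF c] by simp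
  qed (rule dif_outside)
  then show "dif n (low M c) \<in> cocy M (n + 1)" by (simp add: cocy_def dif_dif)
  show "dif n (low M (c + c')) = dif n (low M c) + dif n (low M c')" for c'
    by (simp add: zlin_add[OF zlin_low[OF M]] zlin_add[OF zlin_dif])
  show "dif n (low M c) \<in> cobd M (n + 1) \<longleftrightarrow> c \<in> cobd (cosyz M) n"
  proof
    assume "dif n (low M c) \<in> cobd M (n + 1)"
    then obtain w where w: "w \<in> coch M n" "dif n (low M c) = dif n w" by (auto simp: cobd_def)
    define r where "r = low M c - w"
    have rd: "dif n r = 0" by (simp add: r_def zlin_diff[OF zlin_dif] w(2))
    have rs: "r u = 0" if "u \<notin> tuples n" for u
      using that by (simp add: r_def low_coch(1)[OF M cc] cochD(1)[OF w(1)])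
    have rM: "M 0 (r u) = r u" for u
      by (simp add: r_def zlin_diff[OF l] low_coch(3)[OF M cc] coch_fix[OF w(1)])
    define q where "q = hs n r"
    have dq: "dif (n - 1) q = r" unfolding q_def by (rule contraction[OF rs rd])
    have qM: "M 0 (q u) = q u" for u unfolding q_def by (simp add: hs_map[OF l] rM)
    define k where "k u h = q (map ((+) h) u) - M h (q u)" for u h
    have "k \<in> coch (cosyz M) (n - 1)"
    proof (rule cochI)
      show "k u = 0" if "u \<notin> tuples (n - 1)" for u
        using that by (simp add: k_def fun_eq_iff q_def hs_outside zlin_zero[OF l])
      show "k (map ((+) g) u) = cosyz M g (k u)" for g u
        by (intro ext)
          (simp add: k_def cosyz_def zlin_diff[OF l] glat_mult[OF M] qM map_add_add add.commute[of g] del: map_map)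
    qed
    moreover have "c = dif (n - 1) k"
    proof (intro ext)
      fix t h
      have "dif (n - 1) k t h = dif (n - 1) (\<lambda>u. k u h) t" by (rule dif_map[OF zlin_eval])
      also have "\<dots> = r (map ((+) h) t) - M h (r t)" by (simp add: k_def key dq)
      also have "\<dots> = c t h"
        by (simp add: r_def cochD(2)[OF w(1)] zlin_diff[OF l] low_coch(2)[OF M cc, of t h])
      finally show "c t h = dif (n - 1) k t h" by simp
    qed
    ultimately show "c \<in> cobd (cosyz M) n" by (auto simp: cobd_def)
  next
    assume "c \<in> cobd (cosyz M) n"
    then obtain k where k: "k \<in> coch (cosyz M) (n - 1)" "c = dif (n - 1) k" by (auto simp: cobd_def)
    define w where "w = low M c - dif (n - 1) (low M k)"
    have "w \<in> coch M n"
    proof (rule cochI)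
      show "w u = 0" if "u \<notin> tuples n" for u
        using that by (simp add: w_def low_coch(1)[OF M cc] dif_outside)
      show "w (map ((+) g) u) = M g (w u)" for g u
      proof -
        have 1: "low M c (map ((+) g) u) = c u g + M g (low M c u)"
          using low_coch(2)[OF M cc, of u g] by simp
        have 2: "dif (n - 1) (low M k) (map ((+) g) u) = c u g + M g (dif (n - 1) (low M k) u)"
          using key'[OF k(1), of u g] by (simp add: k(2)[symmetric])
        show ?thesis by (simp add: w_def zlin_diff[OF l] 1 2)
      qed
    qed
    moreover have "dif n (low M c) = dif n w"
      using dif_dif[of "n - 1" "low M k"] by (simp add: w_def zlin_diff[OF zlin_dif])
    ultimately show "dif n (low M c) \<in> cobd M (n + 1)" by (auto simp: cobd_def)
  qed
qed

section \<open>Lattices as modules over the group ring\<close>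

lemma ring_on_simps [simp]: "carrier (ring_on S) = S" "mult (ring_on S) = (*)" "one (ring_on S) = 1"
  "zero (ring_on S) = 0" "add (ring_on S) = (+)"
  by (simp_all add: ring_on_def)

lemma Z2_closed: "0 \<in> Z2" "1 \<in> Z2" "x \<in> Z2 \<Longrightarrow> y \<in> Z2 \<Longrightarrow> x + y \<in> Z2" "x \<in> Z2 \<Longrightarrow> y \<in> Z2 \<Longrightarrow> x * y \<in> Z2"
  "x \<in> Z2 \<Longrightarrow> - x \<in> Z2" "to_fract c \<in> Z2"
proof -
  show "x + y \<in> Z2" "x * y \<in> Z2" if "x \<in> Z2" "y \<in> Z2"
    using that by (auto simp: Z2_def simp flip: to_fract_add to_fract_mult)
  show "- x \<in> Z2" if "x \<in> Z2" using that by (auto simp: Z2_def simp flip: to_fract_uminus)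
  show "0 \<in> Z2" "1 \<in> Z2" unfolding Z2_def by (metis rangeI to_fract_0, metis rangeI to_fract_1)
  show "to_fract c \<in> Z2" by (simp add: Z2_def)
qed

lemma Z2_sum: "(\<And>i. i \<in> I \<Longrightarrow> f i \<in> Z2) \<Longrightarrow> sum f I \<in> Z2"
  by (induction I rule: infinite_finite_induct) (simp_all add: Z2_closed)

lemma q2G_expand: "x = (\<Sum>g\<in>UNIV. Poly_Mapping.single g (Poly_Mapping.lookup x g))" for x :: q2G
proof (rule poly_mapping_eqI)
  fix k
  have "(\<Sum>g\<in>UNIV. Poly_Mapping.lookup (Poly_Mapping.single g (Poly_Mapping.lookup x g)) k) =
      (\<Sum>g\<in>UNIV. if g = k then Poly_Mapping.lookup x k else 0)"
    by (intro sum.cong) (auto simp: lookup_single when_def)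
  then show "Poly_Mapping.lookup x k = Poly_Mapping.lookup (\<Sum>g\<in>UNIV. Poly_Mapping.single g (Poly_Mapping.lookup x g)) k"
    by (simp add: lookup_sum finite_klein)
qed

lemma lookup_q2G_mult:
  "Poly_Mapping.lookup (x * y) g = (\<Sum>h\<in>UNIV. Poly_Mapping.lookup x h * Poly_Mapping.lookup y (g + h))" for x y :: q2G
proof -
  have "x * y = (\<Sum>h\<in>UNIV. \<Sum>k\<in>UNIV. Poly_Mapping.single (h + k) (Poly_Mapping.lookup x h * Poly_Mapping.lookup y k))"
    by (subst q2G_expand[of x], subst q2G_expand[of y]) (simp add: sum_product mult_single)
  then have "Poly_Mapping.lookup (x * y) g =
      (\<Sum>h\<in>UNIV. \<Sum>k\<in>UNIV. if k = g + h then Poly_Mapping.lookup x h * Poly_Mapping.lookup y (g + h) else 0)"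
    by (simp add: lookup_sum lookup_single when_def) (intro sum.cong refl, auto simp: klein_add_eq_iff klein_add_self
      klein_add_left_cancel_self add.commute)
  then show ?thesis by (simp add: finite_klein)
qed

lemma Z2G_closed: "0 \<in> Z2G" "1 \<in> Z2G" "x \<in> Z2G \<Longrightarrow> y \<in> Z2G \<Longrightarrow> x + y \<in> Z2G" "x \<in> Z2G \<Longrightarrow> y \<in> Z2G \<Longrightarrow> x * y \<in> Z2G"
  "x \<in> Z2G \<Longrightarrow> - x \<in> Z2G" "scalar c \<in> Z2G" "Poly_Mapping.single g 1 \<in> Z2G"
  by (auto simp: Z2G_def lookup_q2G_mult lookup_add lookup_one lookup_single when_def scalar_def intro!: Z2_closed Z2_sum)

lemma scalar_simps: "scalar 0 = 0" "scalar 1 = 1" "scalar (c + d) = scalar c + scalar d" "scalar (c * d) = scalar c * scalar d"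
  "scalar (- c) = - scalar c" "scalar c * Poly_Mapping.single g 1 = Poly_Mapping.single g (to_fract c)"
  by (simp_all add: scalar_def single_add mult_single single_uminus)

lemma cring_ring_on:
  assumes "0 \<in> S" "1 \<in> S" "\<And>x y. x \<in> S \<Longrightarrow> y \<in> S \<Longrightarrow> x + y \<in> S" "\<And>x y. x \<in> S \<Longrightarrow> y \<in> S \<Longrightarrow> x * y \<in> S"
    "\<And>x. x \<in> S \<Longrightarrow> - x \<in> S"
  shows "cring (ring_on (S :: 'a::comm_ring_1 set))"
proof (rule cringI)
  show "abelian_group (ring_on S)"
    by (rule abelian_groupI) (use assms in \<open>auto simp: add_ac intro!: bexI[of _ "- _"]\<close>)
  show "comm_monoid (ring_on S)"
    by (rule comm_monoidI) (use assms in \<open>auto simp: mult_ac\<close>)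
qed (simp add: distrib_right)

lemma cring_Z2G: "cring (ring_on Z2G)"
  by (rule cring_ring_on) (simp_all add: Z2G_closed)

definition co :: "q2G \<Rightarrow> klein \<Rightarrow> z2adic" where
  "co r g = (SOME c. to_fract c = Poly_Mapping.lookup r g)"

lemma co_eq: "to_fract c = Poly_Mapping.lookup r g \<Longrightarrow> co r g = c"
  unfolding co_def by (rule some_equality, assumption) (metis to_fract_eq_iff)

lemma to_fract_co: "r \<in> Z2G \<Longrightarrow> to_fract (co r g) = Poly_Mapping.lookup r g"
proof -
  assume "r \<in> Z2G"
  then obtain c where c: "Poly_Mapping.lookup r g = to_fract c" unfolding Z2G_def Z2_def by blast
  then have "co r g = c" by (intro co_eq) simp
  then show ?thesis using c by simp
qed

lemma co_simps: "co (scalar c) g = (if g = 0 then c else 0)" "co (Poly_Mapping.single h 1) g = (if g = h then 1 else 0)"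
  "co 1 g = (if g = 0 then 1 else 0)"
  by (auto intro!: co_eq simp: scalar_def lookup_single lookup_one when_def)

lemma co_add: "r \<in> Z2G \<Longrightarrow> s \<in> Z2G \<Longrightarrow> co (r + s) g = co r g + co s g"
  by (rule co_eq) (simp add: to_fract_co lookup_add)

lemma co_mult: "r \<in> Z2G \<Longrightarrow> s \<in> Z2G \<Longrightarrow> co (r * s) g = (\<Sum>h\<in>UNIV. co r h * co s (g + h))"
  by (rule co_eq) (simp add: to_fract_co lookup_q2G_mult to_fract_sum)

definition act :: "'v::zmod rep \<Rightarrow> q2G \<Rightarrow> 'v \<Rightarrow> 'v" where
  "act \<rho> r v = (\<Sum>g\<in>UNIV. co r g *z \<rho> g v)"

lemma act_add: "r \<in> Z2G \<Longrightarrow> s \<in> Z2G \<Longrightarrow> act \<rho> (r + s) v = act \<rho> r v + act \<rho> s v"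
  by (simp add: act_def co_add zscale_add_left sum.distrib)

lemma act_scalar: "act \<rho> (scalar c) v = c *z \<rho> 0 v"
proof -
  have "act \<rho> (scalar c) v = (\<Sum>g\<in>(UNIV :: klein set). if g = 0 then c *z \<rho> 0 v else 0)"
    unfolding act_def by (intro sum.cong) (auto simp: co_simps)
  then show ?thesis by (simp add: finite_klein)
qed

lemma act_single: "act \<rho> (Poly_Mapping.single h 1) v = \<rho> h v"
proof -
  have "act \<rho> (Poly_Mapping.single h 1) v = (\<Sum>g\<in>UNIV. if g = h then \<rho> h v else 0)"
    unfolding act_def by (intro sum.cong) (auto simp: co_simps)
  then show ?thesis by (simp add: finite_klein)
qed

lemma act_one: "act \<rho> 1 v = \<rho> 0 v"
  using act_scalar[of \<rho> 1 v] by (simp add: scalar_simps)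

lemma zlin_act: "glat \<rho> \<Longrightarrow> zlin (act \<rho> r)"
proof -
  assume "glat \<rho>"
  then have "zlin (\<lambda>v. act \<rho> r v)" unfolding act_def by (intro zlin_sum' zlin_scale' glat_lin)
  then show ?thesis by simp
qed

lemma act_fix: "glat \<rho> \<Longrightarrow> \<rho> 0 (act \<rho> r v) = act \<rho> r v"
  by (simp add: act_def zlin_sum[OF glat_lin] zlin_scale[OF glat_lin] glat_mult)

lemma act_mult:
  assumes \<rho>: "glat \<rho>" and r: "r \<in> Z2G" "s \<in> Z2G"
  shows "act \<rho> (r * s) v = act \<rho> r (act \<rho> s v)"
proof -
  have "act \<rho> (r * s) v = (\<Sum>g\<in>UNIV. \<Sum>h\<in>UNIV. (co r h * co s (g + h)) *z \<rho> g v)"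
    by (simp add: act_def co_mult[OF r] zscale_sum_left)
  also have "\<dots> = (\<Sum>h\<in>UNIV. \<Sum>g\<in>UNIV. (co r h * co s (g + h)) *z \<rho> g v)" by (rule sum.swap)
  also have "\<dots> = (\<Sum>h\<in>UNIV. co r h *z \<rho> h (act \<rho> s v))"
  proof (rule sum.cong[OF refl])
    fix h :: klein
    have "(\<Sum>g\<in>UNIV. (co r h * co s (g + h)) *z \<rho> g v) = (\<Sum>g\<in>UNIV. (co r h * co s ((h + g) + h)) *z \<rho> (h + g) v)"
      by (rule sum_klein_shift[symmetric])
    then show "(\<Sum>g\<in>UNIV. (co r h * co s (g + h)) *z \<rho> g v) = co r h *z \<rho> h (act \<rho> s v)"
      by (simp add: act_def zlin_sum[OF glat_lin[OF \<rho>]] zlin_scale[OF glat_lin[OF \<rho>]] glat_mult[OF \<rho>]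
          zscale_sum_right add.commute[of _ h] klein_add_left_cancel_self)
  qed
  finally show ?thesis by (simp add: act_def)
qed

lemma act_ghom: "ghom \<rho> \<sigma> f \<Longrightarrow> f (act \<rho> r v) = act \<sigma> r (f v)"
  by (simp add: act_def zlin_sum[OF ghom_lin] zlin_scale[OF ghom_lin] ghom_comm)

text \<open>\<open>\<kappa>\<close> identifies the lattice \<open>M\<close> with the image of \<open>\<rho> 0\<close>.\<close>

definition presents :: "(q2G, 'a) module \<Rightarrow> 'v::zmod rep \<Rightarrow> ('a \<Rightarrow> 'v) \<Rightarrow> bool" where
  "presents M \<rho> \<kappa> \<longleftrightarrow> glat \<rho> \<and> bij_betw \<kappa> (carrier M) {v. \<rho> 0 v = v} \<and>
     (\<forall>x\<in>carrier M. \<forall>y\<in>carrier M. \<kappa> (x \<oplus>\<^bsub>M\<^esub> y) = \<kappa> x + \<kappa> y) \<and>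
     (\<forall>r\<in>Z2G. \<forall>x\<in>carrier M. \<kappa> (r \<odot>\<^bsub>M\<^esub> x) = act \<rho> r (\<kappa> x))"

lemma submoduleD:
  assumes "submodule H (ring_on \<Lambda>) M"
  shows "H \<subseteq> carrier M" "\<zero>\<^bsub>M\<^esub> \<in> H" "x \<in> H \<Longrightarrow> y \<in> H \<Longrightarrow> x \<oplus>\<^bsub>M\<^esub> y \<in> H" "x \<in> H \<Longrightarrow> \<ominus>\<^bsub>M\<^esub> x \<in> H"
    "r \<in> \<Lambda> \<Longrightarrow> x \<in> H \<Longrightarrow> r \<odot>\<^bsub>M\<^esub> x \<in> H"
proof -
  have s: "subgroup H (add_monoid M)" using assms by (simp add: submodule_def)
  show "H \<subseteq> carrier M" "\<zero>\<^bsub>M\<^esub> \<in> H" "x \<in> H \<Longrightarrow> y \<in> H \<Longrightarrow> x \<oplus>\<^bsub>M\<^esub> y \<in> H" "x \<in> H \<Longrightarrow> \<ominus>\<^bsub>M\<^esub> x \<in> H"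
    using subgroup.subset[OF s] subgroup.one_closed[OF s] subgroup.m_closed[OF s] subgroup.m_inv_closed[OF s]
    by (simp_all add: a_inv_def)
  show "r \<in> \<Lambda> \<Longrightarrow> x \<in> H \<Longrightarrow> r \<odot>\<^bsub>M\<^esub> x \<in> H" using submodule.smult_closed[OF assms] by simp
qed

subsection \<open>Every lattice is presented by a representation\<close>

text \<open>A finite generating set closed under the group generates the lattice over the 2-adic integers. The relations form a pure
submodule by torsion freeness, so the lattice is the image of a projection \<open>p\<close> of the functions on the generators, to which the
action is transported.\<close>

lemma lattice_presented:
  fixes M :: "(q2G, 'a) module"
  assumes lat: "is_lattice Z2G M"
  shows "\<exists>(\<rho> :: ('a \<Rightarrow> z2adic) rep) \<kappa>. presents M \<rho> \<kappa>"
proof -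
  interpret module "ring_on Z2G" M using lat by (simp add: is_lattice_def)
  obtain S where S: "finite S" "S \<subseteq> carrier M" "generated_submodule Z2G M S = carrier M"
    using lat by (auto simp: is_lattice_def)
  have tf: "c = 0 \<or> x = \<zero>\<^bsub>M\<^esub>" if "x \<in> carrier M" "scalar c \<odot>\<^bsub>M\<^esub> x = \<zero>\<^bsub>M\<^esub>" for c x
    using lat that by (auto simp: is_lattice_def)
  define G where "G g x = Poly_Mapping.single g 1 \<odot>\<^bsub>M\<^esub> x" for g x
  have sc: "a \<odot>\<^bsub>M\<^esub> x \<in> carrier M" if "a \<in> Z2G" "x \<in> carrier M" for a x
    using smult_closed[of a x] that by simp
  have Gc: "G g x \<in> carrier M" if "x \<in> carrier M" for g x
    using that by (simp add: G_def sc Z2G_closed)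
  have GG: "G g (G h x) = G (g + h) x" if "x \<in> carrier M" for g h x
    using smult_assoc1[of "Poly_Mapping.single g 1" "Poly_Mapping.single h 1" x] that
    by (simp add: G_def Z2G_closed mult_single)
  have G0: "G 0 x = x" if "x \<in> carrier M" for x using smult_one[of x] that by (simp add: G_def)
  have G_add: "G g (x \<oplus>\<^bsub>M\<^esub> y) = G g x \<oplus>\<^bsub>M\<^esub> G g y" if "x \<in> carrier M" "y \<in> carrier M" for g x y
    unfolding G_def by (rule smult_r_distr) (simp_all add: that Z2G_closed)
  have G_sc: "G g (scalar a \<odot>\<^bsub>M\<^esub> x) = scalar a \<odot>\<^bsub>M\<^esub> G g x" if "x \<in> carrier M" for g a x
    using smult_assoc1[of "Poly_Mapping.single g 1" "scalar a" x] smult_assoc1[of "scalar a" "Poly_Mapping.single g 1" x] that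
    by (simp add: G_def Z2G_closed mult.commute)
  define I where "I = (\<Union>g. G g ` S)"
  have I: "finite I" "I \<subseteq> carrier M" using S finite_klein Gc by (auto simp: I_def)
  have GI: "G g i \<in> I" if i: "i \<in> I" for g i
  proof -
    obtain h s where "i = G h s" "s \<in> S" using i by (auto simp: I_def)
    then have "G g i = G (g + h) s" using S(2) by (simp add: GG subset_iff)
    then show ?thesis using \<open>s \<in> S\<close> unfolding I_def by blast
  qed
  define ev where "ev c = (\<Oplus>\<^bsub>M\<^esub>i\<in>I. scalar (c i) \<odot>\<^bsub>M\<^esub> i)" for c
  have tc: "scalar (c i) \<odot>\<^bsub>M\<^esub> i \<in> carrier M" if "i \<in> I" for c :: "'a \<Rightarrow> z2adic" and i
    using that I by (auto intro!: sc simp: Z2G_closed)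
  have evc: "ev c \<in> carrier M" for c unfolding ev_def using tc by (intro finsum_closed) auto
  have ev_add: "ev (c + c') = ev c \<oplus>\<^bsub>M\<^esub> ev c'" for c c'
  proof -
    have "ev (c + c') = (\<Oplus>\<^bsub>M\<^esub>i\<in>I. scalar (c i) \<odot>\<^bsub>M\<^esub> i \<oplus>\<^bsub>M\<^esub> scalar (c' i) \<odot>\<^bsub>M\<^esub> i)"
      unfolding ev_def using I tc smult_l_distr
      by (intro finsum_cong') (auto simp: scalar_simps Z2G_closed)
    also have "\<dots> = ev c \<oplus>\<^bsub>M\<^esub> ev c'" unfolding ev_def using tc by (intro finsum_addf) auto
    finally show ?thesis .
  qed
  have ev_sc: "ev (a *z c) = scalar a \<odot>\<^bsub>M\<^esub> ev c" for a c
  proof -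
    have "scalar a \<odot>\<^bsub>M\<^esub> ev c = (\<Oplus>\<^bsub>M\<^esub>i\<in>I. scalar a \<odot>\<^bsub>M\<^esub> (scalar (c i) \<odot>\<^bsub>M\<^esub> i))"
      unfolding ev_def using I tc by (intro finsum_smult_ldistr) (auto simp: Z2G_closed)
    also have "\<dots> = ev (a *z c)"
      unfolding ev_def using I tc sc smult_assoc1
      by (intro finsum_cong') (auto simp: scalar_simps Z2G_closed subset_iff)
    finally show ?thesis by simp
  qed
  have ev_0: "ev 0 = \<zero>\<^bsub>M\<^esub>" using ev_sc[of 0 0] smult_l_null[OF evc[of 0]] by (simp add: scalar_simps)
  have ev_unit: "ev (\<lambda>k. if k = i then 1 else 0) = i" if "i \<in> I" for i
  proof -
    have "ev (\<lambda>k. if k = i then 1 else 0) = (\<Oplus>\<^bsub>M\<^esub>k\<in>I. if i = k then k else \<zero>\<^bsub>M\<^esub>)"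
      unfolding ev_def using I smult_one smult_l_null
      by (intro finsum_cong') (auto simp: scalar_simps subset_iff)
    also have "\<dots> = i" using I that by (intro finsum_singleton) auto
    finally show ?thesis .
  qed
  have ev_supp: "ev c = ev (\<lambda>i. if i \<in> I then c i else 0)" for c
    unfolding ev_def using tc by (intro finsum_cong') auto
  have G_ev: "\<exists>c'. G g (ev c) = ev c'" for g c
  proof -
    have "\<exists>c'. G g (\<Oplus>\<^bsub>M\<^esub>i\<in>K. scalar (c i) \<odot>\<^bsub>M\<^esub> i) = ev c'" if "K \<subseteq> I" for K
      using finite_subset[OF that I(1)] that
    proof (induction K rule: finite_induct)
      case empty
      have "G g \<zero>\<^bsub>M\<^esub> = \<zero>\<^bsub>M\<^esub>" unfolding G_def by (rule smult_r_null) (simp add: Z2G_closed)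
      then show ?case by (metis ev_0 finsum_empty)
    next
      case (insert i K)
      then obtain c' where c': "G g (\<Oplus>\<^bsub>M\<^esub>i\<in>K. scalar (c i) \<odot>\<^bsub>M\<^esub> i) = ev c'" by auto
      have "i \<in> I" "K \<subseteq> I" using insert by auto
      then have "(\<Oplus>\<^bsub>M\<^esub>i\<in>insert i K. scalar (c i) \<odot>\<^bsub>M\<^esub> i) =
          scalar (c i) \<odot>\<^bsub>M\<^esub> i \<oplus>\<^bsub>M\<^esub> (\<Oplus>\<^bsub>M\<^esub>i\<in>K. scalar (c i) \<odot>\<^bsub>M\<^esub> i)"
        using insert.hyps tc by (intro finsum_insert) auto
      moreover have "(\<Oplus>\<^bsub>M\<^esub>i\<in>K. scalar (c i) \<odot>\<^bsub>M\<^esub> i) \<in> carrier M"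
        using \<open>K \<subseteq> I\<close> tc by (intro finsum_closed) auto
      ultimately have "G g (\<Oplus>\<^bsub>M\<^esub>i\<in>insert i K. scalar (c i) \<odot>\<^bsub>M\<^esub> i) = scalar (c i) \<odot>\<^bsub>M\<^esub> G g i \<oplus>\<^bsub>M\<^esub> ev c'"
        using \<open>i \<in> I\<close> I tc by (auto simp: G_add G_sc c')
      also have "\<dots> = ev (c i *z (\<lambda>k. if k = G g i then 1 else 0) + c')"
        by (simp add: ev_add ev_sc ev_unit GI \<open>i \<in> I\<close>)
      finally show ?case by blast
    qed
    then show ?thesis unfolding ev_def by blast
  qed
  have span: "\<exists>c. (\<forall>i. i \<notin> I \<longrightarrow> c i = 0) \<and> ev c = x" if "x \<in> carrier M" for x
  proof -
    have act_ev: "\<exists>c'. r \<odot>\<^bsub>M\<^esub> ev c = ev c'" if r: "r \<in> Z2G" for r c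
    proof -
      define t where "t g = scalar (co r g) * Poly_Mapping.single g 1" for g
      have t: "t g \<in> Z2G" for g by (simp add: t_def Z2G_closed)
      have "\<exists>c'. sum t K \<odot>\<^bsub>M\<^esub> ev c = ev c' \<and> sum t K \<in> Z2G" if "finite K" for K
        using that
      proof (induction K rule: finite_induct)
        case empty
        have "sum t {} \<odot>\<^bsub>M\<^esub> ev c = ev 0" using smult_l_null[OF evc[of c]] by (simp add: ev_0)
        then show ?case using Z2G_closed(1) by (metis sum.empty)
      next
        case (insert g K)
        then obtain c' where c': "sum t K \<odot>\<^bsub>M\<^esub> ev c = ev c'" "sum t K \<in> Z2G" by blast
        obtain c'' where c'': "G g (ev c) = ev c''" using G_ev by blast
        have "t g \<odot>\<^bsub>M\<^esub> ev c = scalar (co r g) \<odot>\<^bsub>M\<^esub> G g (ev c)"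
          using smult_assoc1[of "scalar (co r g)" "Poly_Mapping.single g 1" "ev c"] evc by (simp add: t_def G_def Z2G_closed)
        then have "t g \<odot>\<^bsub>M\<^esub> ev c = ev (co r g *z c'')" by (simp add: c'' ev_sc)
        moreover have "(t g + sum t K) \<odot>\<^bsub>M\<^esub> ev c = t g \<odot>\<^bsub>M\<^esub> ev c \<oplus>\<^bsub>M\<^esub> sum t K \<odot>\<^bsub>M\<^esub> ev c"
          using smult_l_distr[of "t g" "sum t K" "ev c"] evc t c'(2) by simp
        ultimately have "sum t (insert g K) \<odot>\<^bsub>M\<^esub> ev c = ev (co r g *z c'' + c')"
          using insert.hyps by (simp add: c'(1) ev_add)
        then show ?case using insert.hyps c'(2) t by (auto simp: Z2G_closed)
      qed
      from this[OF finite_klein] have "\<exists>c'. (\<Sum>g\<in>UNIV. t g) \<odot>\<^bsub>M\<^esub> ev c = ev c'" by blast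
      moreover have "(\<Sum>g\<in>UNIV. t g) = r"
        using q2G_expand[of r] by (simp add: t_def scalar_simps to_fract_co[OF r])
      ultimately show ?thesis by simp
    qed
    have sub: "submodule (range ev) (ring_on Z2G) M"
    proof (rule submoduleI)
      show "range ev \<subseteq> carrier M" using evc by auto
      show "\<zero>\<^bsub>M\<^esub> \<in> range ev" using ev_0 by (metis rangeI)
      show "\<ominus>\<^bsub>M\<^esub> a \<in> range ev" if a: "a \<in> range ev" for a
      proof -
        obtain c where c: "a = ev c" using a by auto
        have "\<ominus>\<^bsub>M\<^esub> a = ev ((- 1) *z c)"
        proof (rule minus_equality)
          have "ev ((- 1) *z c) \<oplus>\<^bsub>M\<^esub> a = ev ((- 1) *z c + c)" by (simp only: c ev_add)
          then show "ev ((- 1) *z c) \<oplus>\<^bsub>M\<^esub> a = \<zero>\<^bsub>M\<^esub>" by (simp add: ev_0)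
        qed (simp_all add: c evc)
        then show ?thesis by blast
      qed
      show "a \<oplus>\<^bsub>M\<^esub> b \<in> range ev" if "a \<in> range ev" "b \<in> range ev" for a b
        using that by (auto simp: ev_add[symmetric])
      show "a \<odot>\<^bsub>M\<^esub> x \<in> range ev" if a: "a \<in> carrier (ring_on Z2G)" and x: "x \<in> range ev" for a x
      proof -
        obtain c where c: "x = ev c" using x by blast
        obtain c' where "a \<odot>\<^bsub>M\<^esub> ev c = ev c'" using act_ev a by auto
        then show ?thesis by (simp add: c)
      qed
    qed
    moreover have "S \<subseteq> range ev"
    proof
      fix s assume "s \<in> S"
      then have "s \<in> I" unfolding I_def using G0[of s] S(2) by (metis UN_I UNIV_I image_eqI subsetD)
      then show "s \<in> range ev" using ev_unit by (metis rangeI)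
    qed
    ultimately have "carrier M \<subseteq> range ev" using S(3) unfolding generated_submodule_def by blast
    then obtain c where "x = ev c" using \<open>x \<in> carrier M\<close> by blast
    then show ?thesis using ev_supp[of c] by (intro exI[of _ "\<lambda>i. if i \<in> I then c i else 0"]) simp
  qed
  define Rel where "Rel = {c. (\<forall>i. i \<notin> I \<longrightarrow> c i = 0) \<and> ev c = \<zero>\<^bsub>M\<^esub>}"
  have "pure_submodule Rel"
    unfolding pure_submodule_def
  proof (intro conjI ballI allI impI)
    show "0 \<in> Rel" by (simp add: Rel_def ev_0)
    show "x + y \<in> Rel" if "x \<in> Rel" "y \<in> Rel" for x y using that by (simp add: Rel_def ev_add)
    show "c *z x \<in> Rel" if "x \<in> Rel" for c x
      using that smult_r_null[of "scalar c"] by (simp add: Rel_def ev_sc Z2G_closed)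
    show "x \<in> Rel" if "c \<noteq> 0" "c *z x \<in> Rel" for c x
      using that tf[OF evc[of x], of c] by (auto simp: Rel_def ev_sc)
  qed
  moreover have "\<forall>c\<in>Rel. \<forall>i. i \<notin> I \<longrightarrow> c i = 0" by (simp add: Rel_def)
  ultimately obtain J p where J: "J \<subseteq> I" and p: "zlin p"
    "\<forall>c. (\<forall>i. i \<notin> I \<longrightarrow> c i = 0) \<longrightarrow> c - p c \<in> Rel \<and> (\<forall>i. i \<notin> J \<longrightarrow> p c i = 0)"
    "\<forall>c\<in>Rel. p c = 0" "\<forall>c. (\<forall>i. i \<notin> J \<longrightarrow> c i = 0) \<longrightarrow> p c = c"
    using pure_submodule_complement[OF I(1), of Rel] by blast
  define cut where "cut v = (\<lambda>i. if i \<in> J then v i else 0 :: z2adic)" for v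
  have cutI: "\<forall>i. i \<notin> I \<longrightarrow> cut v i = 0" and cutJ: "\<forall>i. i \<notin> J \<longrightarrow> cut v i = 0" for v using J by (auto simp: cut_def)
  have cut_lin: "cut (v + w) = cut v + cut w" "cut (c *z v) = c *z cut v" for v w c
    by (auto simp: cut_def fun_eq_iff)
  have cut_id: "cut v = v" if "\<forall>i. i \<notin> J \<longrightarrow> v i = 0" for v using that by (auto simp: cut_def)
  define cd where "cd x = (SOME c. (\<forall>i. i \<notin> I \<longrightarrow> c i = 0) \<and> ev c = x)" for x
  define \<kappa> where "\<kappa> x = p (cd x)" for x
  have cd: "\<forall>i. i \<notin> I \<longrightarrow> cd x i = 0" "ev (cd x) = x" if "x \<in> carrier M" for x
    using someI_ex[OF span[OF that]] unfolding cd_def by blast+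
  have ev_diff: "ev c = ev c'" if "ev (c - c') = \<zero>\<^bsub>M\<^esub>" for c c'
  proof -
    have "ev c = ev (c - c') \<oplus>\<^bsub>M\<^esub> ev c'" by (simp flip: ev_add)
    then show ?thesis using that evc[of c'] by simp
  qed
  have \<kappa>_ev: "\<kappa> (ev c) = p c" if "\<forall>i. i \<notin> I \<longrightarrow> c i = 0" for c
  proof -
    have "ev c = ev (cd (ev c) - c) \<oplus>\<^bsub>M\<^esub> ev c" using cd(2)[OF evc[of c]] by (simp flip: ev_add)
    then have "ev (cd (ev c) - c) = \<zero>\<^bsub>M\<^esub>" using evc by (metis add.r_cancel_one)
    then have "cd (ev c) - c \<in> Rel" using cd(1)[OF evc[of c]] that by (simp add: Rel_def)
    then have "p (cd (ev c) - c) = 0" using p(3) by blast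
    then show ?thesis by (simp add: \<kappa>_def zlin_diff[OF p(1)])
  qed
  have \<kappa>J: "\<forall>i. i \<notin> J \<longrightarrow> \<kappa> x i = 0" if "x \<in> carrier M" for x
    using p(2) cd[OF that] unfolding \<kappa>_def by blast
  have ev\<kappa>: "ev (\<kappa> x) = x" if "x \<in> carrier M" for x
  proof -
    have "cd x - p (cd x) \<in> Rel" using p(2) cd(1)[OF that] by blast
    then have "ev (cd x) = ev (p (cd x))" by (intro ev_diff) (simp add: Rel_def)
    then show ?thesis using cd(2)[OF that] by (simp add: \<kappa>_def)
  qed
  have \<kappa>cut: "\<kappa> (ev (cut v)) = cut v" for v
    using \<kappa>_ev[OF cutI[of v]] p(4) cutJ[of v] by simp
  have \<kappa>_add: "\<kappa> (x \<oplus>\<^bsub>M\<^esub> y) = \<kappa> x + \<kappa> y" if "x \<in> carrier M" "y \<in> carrier M" for x y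
  proof -
    have "\<kappa> (ev (cd x + cd y)) = p (cd x + cd y)" by (rule \<kappa>_ev) (simp add: cd that)
    then show ?thesis using that by (simp add: ev_add cd zlin_add[OF p(1)] \<kappa>_def[of x] \<kappa>_def[of y])
  qed
  have \<kappa>_sc: "\<kappa> (scalar a \<odot>\<^bsub>M\<^esub> x) = a *z \<kappa> x" if "x \<in> carrier M" for a x
  proof -
    have "\<kappa> (ev (a *z cd x)) = p (a *z cd x)" by (rule \<kappa>_ev) (simp add: cd that)
    then show ?thesis using that by (simp add: ev_sc cd zlin_scale[OF p(1)] \<kappa>_def[of x])
  qed
  define \<rho> where "\<rho> g v = \<kappa> (G g (ev (cut v)))" for g v
  have \<rho>0: "\<rho> 0 v = cut v" for v by (simp add: \<rho>_def G0 evc \<kappa>cut)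
  have \<rho>\<kappa>: "\<rho> g (\<kappa> x) = \<kappa> (G g x)" if "x \<in> carrier M" for g x
    using cut_id[OF \<kappa>J[OF that]] by (simp add: \<rho>_def ev\<kappa> that)
  have "glat \<rho>"
    unfolding glat_def
  proof (intro conjI allI)
    show "zlin (\<rho> g)" for g
      by (rule zlinI) (simp_all add: \<rho>_def cut_lin ev_add ev_sc G_add G_sc evc Gc \<kappa>_add \<kappa>_sc)
    show "\<rho> g (\<rho> h v) = \<rho> (g + h) v" for g h v
      unfolding \<rho>_def[of h] by (simp add: \<rho>\<kappa> Gc evc GG) (simp add: \<rho>_def)
    show "finrank (\<rho> 0)"
    proof (rule finrankI[where I = J and d = "\<lambda>j v. v j" and e = "\<lambda>j k. if k = j then 1 else 0"])
      show "finite J" using J I(1) finite_subset by blast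
      then show "\<rho> 0 v = (\<Sum>j\<in>J. v j *z (\<lambda>k. if k = j then 1 else 0))" for v
        by (intro ext) (simp add: \<rho>0 cut_def if_distrib cong: if_cong)
    qed (rule zlin_eval)
  qed
  moreover have "bij_betw \<kappa> (carrier M) {v. \<rho> 0 v = v}"
  proof (rule bij_betw_byWitness[where f' = ev])
    show "\<kappa> ` carrier M \<subseteq> {v. \<rho> 0 v = v}" using \<kappa>J cut_id by (auto simp: \<rho>0)
    show "ev ` {v. \<rho> 0 v = v} \<subseteq> carrier M" using evc by auto
    show "\<forall>v\<in>{v. \<rho> 0 v = v}. \<kappa> (ev v) = v"
    proof
      fix v assume "v \<in> {v. \<rho> 0 v = v}"
      then have "cut v = v" by (simp add: \<rho>0)
      then show "\<kappa> (ev v) = v" using \<kappa>cut[of v] by simp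
    qed
  qed (simp add: ev\<kappa>)
  moreover have "\<kappa> (r \<odot>\<^bsub>M\<^esub> x) = act \<rho> r (\<kappa> x)" if r: "r \<in> Z2G" and x: "x \<in> carrier M" for r x
  proof -
    define t where "t g = scalar (co r g) * Poly_Mapping.single g 1" for g
    have t: "t g \<in> Z2G" for g by (simp add: t_def Z2G_closed)
    have "sum t K \<in> Z2G \<and> \<kappa> (sum t K \<odot>\<^bsub>M\<^esub> x) = (\<Sum>g\<in>K. co r g *z \<rho> g (\<kappa> x))" if "finite K" for K
      using that
    proof (induction K rule: finite_induct)
      case empty
      then show ?case using smult_l_null[OF x] \<kappa>_sc[OF x, of 0] by (simp add: Z2G_closed scalar_simps)
    next
      case (insert g K)
      have "t g \<odot>\<^bsub>M\<^esub> x = scalar (co r g) \<odot>\<^bsub>M\<^esub> G g x"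
        using smult_assoc1[of "scalar (co r g)" "Poly_Mapping.single g 1" x] x by (simp add: t_def G_def Z2G_closed)
      then have "\<kappa> (t g \<odot>\<^bsub>M\<^esub> x) = co r g *z \<rho> g (\<kappa> x)" by (simp add: \<kappa>_sc Gc x \<rho>\<kappa>)
      moreover have "(t g + sum t K) \<odot>\<^bsub>M\<^esub> x = t g \<odot>\<^bsub>M\<^esub> x \<oplus>\<^bsub>M\<^esub> sum t K \<odot>\<^bsub>M\<^esub> x"
        using smult_l_distr[of "t g" "sum t K" x] x t insert.IH by simp
      ultimately show ?case using insert t x by (simp add: \<kappa>_add sc Z2G_closed)
    qed
    from this[OF finite_klein] have "\<kappa> ((\<Sum>g\<in>UNIV. t g) \<odot>\<^bsub>M\<^esub> x) = act \<rho> r (\<kappa> x)" by (simp add: act_def)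
    moreover have "(\<Sum>g\<in>UNIV. t g) = r"
      using q2G_expand[of r] by (simp add: t_def scalar_simps to_fract_co[OF r])
    ultimately show ?thesis by simp
  qed
  ultimately have "presents M \<rho> \<kappa>" unfolding presents_def using \<kappa>_add by blast
  then show ?thesis by blast
qed

subsection \<open>Homomorphisms of presented lattices\<close>

lemma mod_homD:
  assumes "f \<in> mod_hom \<Lambda> M N"
  shows "x \<in> carrier M \<Longrightarrow> f x \<in> carrier N"
    "x \<in> carrier M \<Longrightarrow> y \<in> carrier M \<Longrightarrow> f (x \<oplus>\<^bsub>M\<^esub> y) = f x \<oplus>\<^bsub>N\<^esub> f y"
    "r \<in> \<Lambda> \<Longrightarrow> x \<in> carrier M \<Longrightarrow> f (r \<odot>\<^bsub>M\<^esub> x) = r \<odot>\<^bsub>N\<^esub> f x"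
  using assms unfolding mod_hom_def by blast+

lemma mod_homI:
  assumes "\<And>x. x \<in> carrier M \<Longrightarrow> f x \<in> carrier N"
    "\<And>x y. x \<in> carrier M \<Longrightarrow> y \<in> carrier M \<Longrightarrow> f (x \<oplus>\<^bsub>M\<^esub> y) = f x \<oplus>\<^bsub>N\<^esub> f y"
    "\<And>r x. r \<in> \<Lambda> \<Longrightarrow> x \<in> carrier M \<Longrightarrow> f (r \<odot>\<^bsub>M\<^esub> x) = r \<odot>\<^bsub>N\<^esub> f x"
  shows "f \<in> mod_hom \<Lambda> M N"
  using assms unfolding mod_hom_def by blast

text \<open>The map \<open>un\<close> defined here inverts \<open>\<kappa>\<close> on the lattice and factors through \<open>\<rho> 0\<close>.\<close>

locale presented =
  fixes M :: "(q2G, 'a) module" and \<rho> :: "'v::zmod rep" and \<kappa> :: "'a \<Rightarrow> 'v"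
  assumes mod: "module (ring_on Z2G) M" and pres: "presents M \<rho> \<kappa>"
begin

sublocale Mod: module "ring_on Z2G" M by (rule mod)

definition un :: "'v \<Rightarrow> 'a" where "un v = inv_into (carrier M) \<kappa> (\<rho> 0 v)"

lemma glat: "glat \<rho>" using pres by (simp add: presents_def)

lemmas rep_lin = glat_lin[OF glat] and rep_mult = glat_mult[OF glat]

lemma inj: "inj_on \<kappa> (carrier M)" and onto: "\<kappa> ` carrier M = {v. \<rho> 0 v = v}"
  using pres by (auto simp: presents_def bij_betw_def)

lemma \<kappa>_add: "x \<in> carrier M \<Longrightarrow> y \<in> carrier M \<Longrightarrow> \<kappa> (x \<oplus>\<^bsub>M\<^esub> y) = \<kappa> x + \<kappa> y"
  and \<kappa>_act: "r \<in> Z2G \<Longrightarrow> x \<in> carrier M \<Longrightarrow> \<kappa> (r \<odot>\<^bsub>M\<^esub> x) = act \<rho> r (\<kappa> x)"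
  using pres unfolding presents_def by blast+

lemma \<kappa>_fix: "x \<in> carrier M \<Longrightarrow> \<rho> 0 (\<kappa> x) = \<kappa> x"
  using onto by blast

lemma un_closed: "un v \<in> carrier M" and \<kappa>_un: "\<kappa> (un v) = \<rho> 0 v"
proof -
  have "\<rho> 0 v \<in> \<kappa> ` carrier M" unfolding onto by (simp add: rep_mult)
  then show "un v \<in> carrier M" "\<kappa> (un v) = \<rho> 0 v"
    unfolding un_def by (rule inv_into_into, rule f_inv_into_f)
qed

lemma un_\<kappa>: "x \<in> carrier M \<Longrightarrow> un (\<kappa> x) = x"
  using inj_onD[OF inj, of "un (\<kappa> x)" x] by (simp add: \<kappa>_un \<kappa>_fix un_closed)

lemma un_eqI: "x \<in> carrier M \<Longrightarrow> \<kappa> x = \<rho> 0 v \<Longrightarrow> un v = x"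
  using inj_onD[OF inj, of "un v" x] by (simp add: \<kappa>_un un_closed)

lemma smult_in: "r \<in> Z2G \<Longrightarrow> x \<in> carrier M \<Longrightarrow> r \<odot>\<^bsub>M\<^esub> x \<in> carrier M"
  using Mod.smult_closed[of r x] by simp

lemma un_add: "un (v + w) = un v \<oplus>\<^bsub>M\<^esub> un w"
  by (rule un_eqI) (simp_all add: un_closed \<kappa>_add \<kappa>_un zlin_add[OF rep_lin])

lemma un_act: "r \<in> Z2G \<Longrightarrow> un (act \<rho> r v) = r \<odot>\<^bsub>M\<^esub> un v"
proof (rule un_eqI)
  assume r: "r \<in> Z2G"
  have "act \<rho> r (\<rho> 0 v) = act \<rho> r v" by (simp add: act_def rep_mult)
  then show "\<kappa> (r \<odot>\<^bsub>M\<^esub> un v) = \<rho> 0 (act \<rho> r v)" by (simp add: \<kappa>_act un_closed \<kappa>_un r act_fix[OF glat])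
  show "r \<odot>\<^bsub>M\<^esub> un v \<in> carrier M" by (rule smult_in[OF r un_closed])
qed

lemma \<kappa>_zero: "\<kappa> \<zero>\<^bsub>M\<^esub> = 0"
proof -
  have "\<kappa> (\<zero>\<^bsub>M\<^esub> \<oplus>\<^bsub>M\<^esub> \<zero>\<^bsub>M\<^esub>) = \<kappa> \<zero>\<^bsub>M\<^esub> + \<kappa> \<zero>\<^bsub>M\<^esub>" by (rule \<kappa>_add) simp_all
  then show ?thesis by simp
qed

lemma \<kappa>_eq_0: "x \<in> carrier M \<Longrightarrow> \<kappa> x = 0 \<longleftrightarrow> x = \<zero>\<^bsub>M\<^esub>"
  using inj_on_eq_iff[OF inj, of x "\<zero>\<^bsub>M\<^esub>"] by (simp add: \<kappa>_zero)

lemma \<kappa>_uminus: "x \<in> carrier M \<Longrightarrow> \<kappa> (\<ominus>\<^bsub>M\<^esub> x) = - \<kappa> x"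
proof -
  assume x: "x \<in> carrier M"
  have "\<kappa> (x \<oplus>\<^bsub>M\<^esub> \<ominus>\<^bsub>M\<^esub> x) = \<kappa> x + \<kappa> (\<ominus>\<^bsub>M\<^esub> x)" using x by (intro \<kappa>_add) simp_all
  then have "\<kappa> x + \<kappa> (\<ominus>\<^bsub>M\<^esub> x) = 0" using x by (simp add: Mod.r_neg \<kappa>_zero)
  then show ?thesis by (simp add: eq_neg_iff_add_eq_0 add.commute)
qed

lemma un_scale: "un (c *z v) = scalar c \<odot>\<^bsub>M\<^esub> un v"
proof -
  have "un (c *z v) = un (act \<rho> (scalar c) v)"
    unfolding un_def by (simp add: act_scalar zlin_scale[OF rep_lin] rep_mult)
  then show ?thesis by (simp add: un_act Z2G_closed)
qed

lemma \<kappa>_scalar: "x \<in> carrier M \<Longrightarrow> \<kappa> (scalar c \<odot>\<^bsub>M\<^esub> x) = c *z \<kappa> x"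
  by (simp add: \<kappa>_act Z2G_closed act_scalar \<kappa>_fix)

lemma \<kappa>_group: "x \<in> carrier M \<Longrightarrow> \<kappa> (Poly_Mapping.single g 1 \<odot>\<^bsub>M\<^esub> x) = \<rho> g (\<kappa> x)"
  by (simp add: \<kappa>_act Z2G_closed act_single)

end

lemma ghom_of_hom:
  assumes "presented M \<rho> \<kappa>" "presented N \<sigma> \<mu>" "f \<in> mod_hom Z2G M N"
  shows "ghom \<rho> \<sigma> (\<lambda>v. \<mu> (f (presented.un M \<rho> \<kappa> v)))"
proof -
  interpret M: presented M \<rho> \<kappa> by fact
  interpret N: presented N \<sigma> \<mu> by fact
  note f = mod_homD[OF assms(3)]
  have fc: "f (M.un v) \<in> carrier N" for v by (intro f(1) M.un_closed)
  show ?thesis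
  proof (rule ghomI)
    show "zlin (\<lambda>v. \<mu> (f (M.un v)))"
      by (rule zlinI) (simp_all add: M.un_add M.un_scale f M.un_closed N.\<kappa>_add N.\<kappa>_scalar fc Z2G_closed)
    show "\<mu> (f (M.un (\<rho> g v))) = \<sigma> g (\<mu> (f (M.un v)))" for g v
    proof -
      have "M.un (\<rho> g v) = Poly_Mapping.single g 1 \<odot>\<^bsub>M\<^esub> M.un v"
        using M.un_act[of "Poly_Mapping.single g 1" v] by (simp add: Z2G_closed act_single)
      then show ?thesis by (simp add: f M.un_closed Z2G_closed N.\<kappa>_group fc)
    qed
    show "\<sigma> 0 (\<mu> (f (M.un v))) = \<mu> (f (M.un v))" for v by (rule N.\<kappa>_fix[OF fc])
  qed
qed

lemma hom_of_ghom:
  assumes "presented M \<rho> \<kappa>" "presented N \<sigma> \<mu>" "ghom \<rho> \<sigma> F"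
  shows "(\<lambda>x. presented.un N \<sigma> \<mu> (F (\<kappa> x))) \<in> mod_hom Z2G M N"
proof -
  interpret M: presented M \<rho> \<kappa> by fact
  interpret N: presented N \<sigma> \<mu> by fact
  show ?thesis
    by (rule mod_homI) (simp_all add: N.un_closed M.\<kappa>_add zlin_add[OF ghom_lin[OF assms(3)]] N.un_add
        M.\<kappa>_act act_ghom[OF assms(3)] N.un_act)
qed

text \<open>The inverse of a bijective homomorphism is a homomorphism.\<close>

lemma giso_of_bij:
  assumes "presented M \<rho> \<kappa>" "presented N \<sigma> \<mu>" "ghom \<rho> \<sigma> F"
    and bij: "bij_betw (\<lambda>x. presented.un N \<sigma> \<mu> (F (\<kappa> x))) (carrier M) (carrier N)"
  shows "giso \<rho> \<sigma> F"
proof -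
  interpret M: presented M \<rho> \<kappa> by fact
  interpret N: presented N \<sigma> \<mu> by fact
  define f where "f x = N.un (F (\<kappa> x))" for x
  have f: "f \<in> mod_hom Z2G M N" using hom_of_ghom[OF assms(1-3)] by (simp add: f_def[abs_def])
  note fD = mod_homD[OF f]
  define g where "g = inv_into (carrier M) f"
  have bf: "bij_betw f (carrier M) (carrier N)" using bij by (simp add: f_def[abs_def])
  have gc: "g y \<in> carrier M" and fg: "f (g y) = y" if "y \<in> carrier N" for y
    using bf that by (auto simp: g_def bij_betw_def inv_into_into f_inv_into_f)
  have gf: "g (f x) = x" if "x \<in> carrier M" for x
    using bf that by (simp add: g_def bij_betw_def inv_into_f_f)
  have "g \<in> mod_hom Z2G N M"
  proof (rule mod_homI)
    show "g (x \<oplus>\<^bsub>N\<^esub> y) = g x \<oplus>\<^bsub>M\<^esub> g y" if "x \<in> carrier N" "y \<in> carrier N" for x y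
      using gf[of "g x \<oplus>\<^bsub>M\<^esub> g y"] that by (simp add: fD gc fg)
    show "g (r \<odot>\<^bsub>N\<^esub> x) = r \<odot>\<^bsub>M\<^esub> g x" if "r \<in> Z2G" "x \<in> carrier N" for r x
      using gf[of "r \<odot>\<^bsub>M\<^esub> g x"] that by (simp add: fD gc fg M.smult_in)
  qed (rule gc)
  from ghom_of_hom[OF assms(2,1) this]
  have G: "ghom \<sigma> \<rho> (\<lambda>v. \<kappa> (g (N.un v)))" .
  have F0: "F (\<rho> 0 v) = F v" "\<sigma> 0 (F v) = F v" for v using ghom_fix'[OF assms(3)] ghom_fix[OF assms(3)] by auto
  have "\<kappa> (g (N.un (F v))) = \<rho> 0 v" for v
  proof -
    have "N.un (F v) = f (M.un v)" by (simp add: f_def M.\<kappa>_un F0)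
    then show ?thesis by (simp add: gf M.un_closed M.\<kappa>_un)
  qed
  moreover have "F (\<kappa> (g (N.un w))) = \<sigma> 0 w" for w
  proof -
    have "\<mu> (f (g (N.un w))) = \<mu> (N.un w)" by (simp add: fg N.un_closed)
    then show ?thesis by (simp add: f_def N.\<kappa>_un F0)
  qed
  ultimately show ?thesis using assms(3) G unfolding giso_def by blast
qed

subsection \<open>Every representation presents a lattice\<close>

text \<open>The almost split property quantifies over lattices whose carrier lies in \<open>nat \<Rightarrow> q2adic\<close>. To apply it to a summand of a
syzygy, the summand is embedded in that type by the coordinates with respect to a basis.\<close>

lemma rep_lattice:
  fixes \<rho> :: "'v::zmod rep"
  assumes \<rho>: "glat \<rho>"
  shows "\<exists>(X :: lat) \<kappa>. is_lattice Z2G X \<and> presents X \<rho> \<kappa>"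
proof -
  note l = glat_lin[OF \<rho>] and m = glat_mult[OF \<rho>]
  obtain n e d where b: "is_basis (\<rho> 0) n e d" using zproj_basis[OF glat_zproj[OF \<rho>]] by blast
  note dl = basis_lin[OF b]
  define F where "F = {v. \<rho> 0 v = v}"
  define emb where "emb v i = (if i < n then to_fract (d i v) else 0)" for v and i :: nat
  have inj: "inj_on emb F"
  proof (rule inj_onI)
    fix v w assume "v \<in> F" "w \<in> F" "emb v = emb w"
    then have "d i v = d i w" if "i < n" for i using that by (auto simp: emb_def fun_eq_iff dest: spec[of _ i])
    then have "\<rho> 0 v = \<rho> 0 w" by (simp add: basis_expand[OF b])
    then show "v = w" using \<open>v \<in> F\<close> \<open>w \<in> F\<close> by (simp add: F_def)
  qed
  define un where "un = inv_into F emb"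
  have un: "un (emb v) = v" if "v \<in> F" for v using inj that by (simp add: un_def)
  have F_add: "v + w \<in> F" if "v \<in> F" "w \<in> F" for v w using that by (simp add: F_def zlin_add[OF l])
  have F_act: "act \<rho> r v \<in> F" for r v by (simp add: F_def act_fix[OF \<rho>])
  have F_0: "0 \<in> F" by (simp add: F_def zlin_zero[OF l])
  have F_minus: "- v \<in> F" if "v \<in> F" for v using that by (simp add: F_def zlin_minus[OF l])
  define X :: lat where "X = \<lparr>carrier = emb ` F, mult = undefined, one = undefined, zero = emb 0,
    add = (\<lambda>x y. emb (un x + un y)), smult = (\<lambda>r x. emb (act \<rho> r (un x)))\<rparr>"
  have X: "carrier X = emb ` F" "\<zero>\<^bsub>X\<^esub> = emb 0" "x \<oplus>\<^bsub>X\<^esub> y = emb (un x + un y)" "r \<odot>\<^bsub>X\<^esub> x = emb (act \<rho> r (un x))" for x y r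
    by (simp_all add: X_def)
  have ag: "abelian_group X"
  proof (rule abelian_groupI)
    show "\<exists>y\<in>carrier X. y \<oplus>\<^bsub>X\<^esub> x = \<zero>\<^bsub>X\<^esub>" if x: "x \<in> carrier X" for x
    proof -
      obtain v where v: "v \<in> F" "x = emb v" using x by (auto simp: X)
      have "emb (- v) \<oplus>\<^bsub>X\<^esub> x = \<zero>\<^bsub>X\<^esub>" by (simp add: X v un F_minus)
      then show ?thesis using F_minus[OF v(1)] by (auto simp: X)
    qed
  qed (auto simp: X un F_add F_0 add_ac)
  have modX: "module (ring_on Z2G) X"
    by (rule moduleI[OF cring_Z2G ag])
      (auto simp: X un F_add F_act act_add act_mult[OF \<rho>] act_one zlin_add[OF zlin_act[OF \<rho>]] F_def[symmetric],
        simp_all add: F_def)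
  interpret module "ring_on Z2G" X by (rule modX)
  have eF: "e i \<in> F" if "i < n" for i using basis_fixed[OF b that] by (simp add: F_def)
  have "\<exists>S. finite S \<and> S \<subseteq> carrier X \<and> generated_submodule Z2G X S = carrier X"
  proof (intro exI conjI)
    show "finite ((\<lambda>i. emb (e i)) ` {..<n})" by simp
    show sub: "(\<lambda>i. emb (e i)) ` {..<n} \<subseteq> carrier X" using eF by (auto simp: X)
    show "generated_submodule Z2G X ((\<lambda>i. emb (e i)) ` {..<n}) = carrier X"
    proof
      show "generated_submodule Z2G X ((\<lambda>i. emb (e i)) ` {..<n}) \<subseteq> carrier X"
        unfolding generated_submodule_def using carrier_is_submodule sub by blast
      show "carrier X \<subseteq> generated_submodule Z2G X ((\<lambda>i. emb (e i)) ` {..<n})"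
        unfolding generated_submodule_def
      proof (intro subsetI InterI)
        fix x H assume x: "x \<in> carrier X" and "H \<in> {H. submodule H (ring_on Z2G) X \<and> (\<lambda>i. emb (e i)) ` {..<n} \<subseteq> H}"
        then have H: "submodule H (ring_on Z2G) X" "\<And>i. i < n \<Longrightarrow> emb (e i) \<in> H" by auto
        note Hp = submoduleD[OF H(1)]
        obtain v where v: "v \<in> F" "x = emb v" using x by (auto simp: X)
        have "(\<Sum>i<k. d i v *z e i) \<in> F \<and> emb (\<Sum>i<k. d i v *z e i) \<in> H" if "k \<le> n" for k
          using that
        proof (induction k)
          case 0
          then show ?case using Hp(2) by (simp add: X F_0)
        next
          case (Suc k)
          then have k: "e k \<in> F" "emb (e k) \<in> H" using eF H(2) by auto
          have e1: "act \<rho> (scalar (d k v)) (e k) = d k v *z e k" using k(1) by (simp add: act_scalar F_def)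
          have e2: "d k v *z e k \<in> F" using F_act[of "scalar (d k v)" "e k"] by (simp add: e1)
          have "scalar (d k v) \<odot>\<^bsub>X\<^esub> emb (e k) \<in> H" by (rule Hp(5)[OF Z2G_closed(6) k(2)])
          then have e3: "emb (d k v *z e k) \<in> H" by (simp add: X un k(1) e1)
          have s: "(\<Sum>i<k. d i v *z e i) \<in> F" "emb (\<Sum>i<k. d i v *z e i) \<in> H" using Suc by auto
          have "emb (\<Sum>i<k. d i v *z e i) \<oplus>\<^bsub>X\<^esub> emb (d k v *z e k) \<in> H" by (rule Hp(3)[OF s(2) e3])
          then show ?case using s e2 by (simp add: X un F_add)
        qed
        from this[of n] have "emb (\<rho> 0 v) \<in> H" by (simp add: basis_expand[OF b])
        then show "x \<in> H" using v by (simp add: F_def)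
      qed
    qed
  qed
  moreover have "c = 0 \<or> x = \<zero>\<^bsub>X\<^esub>" if x: "x \<in> carrier X" and z: "scalar c \<odot>\<^bsub>X\<^esub> x = \<zero>\<^bsub>X\<^esub>" for c x
  proof -
    obtain v where v: "v \<in> F" "x = emb v" using x by (auto simp: X)
    have "emb (act \<rho> (scalar c) v) = emb 0" using z by (simp add: X v un)
    then have "act \<rho> (scalar c) v = 0" using inj_onD[OF inj] F_act F_0 by blast
    then show ?thesis using v by (auto simp: act_scalar F_def X)
  qed
  ultimately have "is_lattice Z2G X" using modX unfolding is_lattice_def by blast
  moreover have "presents X \<rho> un"
    unfolding presents_def
  proof (intro conjI ballI)
    show "bij_betw un (carrier X) {v. \<rho> 0 v = v}"
      using inj_on_imp_bij_betw[OF inj] bij_betw_inv_into unfolding X un_def F_def by blast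
    show "un (x \<oplus>\<^bsub>X\<^esub> y) = un x + un y" if "x \<in> carrier X" "y \<in> carrier X" for x y
      using that by (auto simp: X un F_add)
    show "un (r \<odot>\<^bsub>X\<^esub> x) = act \<rho> r (un x)" if "x \<in> carrier X" for r x
      using that by (auto simp: X un F_act)
  qed (rule \<rho>)
  ultimately show ?thesis by blast
qed

text \<open>The projection along a direct decomposition is an idempotent homomorphism.\<close>

lemma indec_lattice_of_indec:
  assumes lat: "is_lattice Z2G X" and P: "presents X \<rho> \<kappa>" and ind: "indec \<rho>"
  shows "indec_lattice Z2G X"
proof -
  have modX: "module (ring_on Z2G) X" using lat by (simp add: is_lattice_def)
  interpret presented X \<rho> \<kappa> using modX P by (rule presented.intro)
  have "H = {\<zero>\<^bsub>X\<^esub>} \<or> K = {\<zero>\<^bsub>X\<^esub>}" if H: "submodule H (ring_on Z2G) X" and K: "submodule K (ring_on Z2G) X"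
    and HK: "H \<inter> K = {\<zero>\<^bsub>X\<^esub>}" "H <+>\<^bsub>X\<^esub> K = carrier X" for H K
  proof -
    note Hp = submoduleD[OF H] and Kp = submoduleD[OF K]
    have Hc: "h \<in> carrier X" if "h \<in> H" for h using Hp(1) that by blast
    have Kc: "k \<in> carrier X" if "k \<in> K" for k using Kp(1) that by blast
    define p where "p x = (SOME h. h \<in> H \<and> (\<exists>k\<in>K. x = h \<oplus>\<^bsub>X\<^esub> k))" for x
    have ex: "\<exists>h. h \<in> H \<and> (\<exists>k\<in>K. x = h \<oplus>\<^bsub>X\<^esub> k)" if "x \<in> carrier X" for x
    proof -
      have "x \<in> H <+>\<^bsub>X\<^esub> K" using that HK(2) by simp
      then show ?thesis unfolding set_add_def set_mult_def by auto
    qed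
    have p: "p x \<in> H" "\<exists>k\<in>K. x = p x \<oplus>\<^bsub>X\<^esub> k" if "x \<in> carrier X" for x
      using someI_ex[OF ex[OF that]] unfolding p_def by blast+
    have p_eq: "p (h \<oplus>\<^bsub>X\<^esub> k) = h" if h: "h \<in> H" and k: "k \<in> K" for h k
    proof -
      have x: "h \<oplus>\<^bsub>X\<^esub> k \<in> carrier X" using Hc[OF h] Kc[OF k] by simp
      obtain k' where k': "k' \<in> K" "h \<oplus>\<^bsub>X\<^esub> k = p (h \<oplus>\<^bsub>X\<^esub> k) \<oplus>\<^bsub>X\<^esub> k'" using p(2)[OF x] by blast
      define h' where "h' = p (h \<oplus>\<^bsub>X\<^esub> k)"
      have h': "h' \<in> H" using p(1)[OF x] by (simp add: h'_def)
      note c = Hc[OF h] Hc[OF h'] Kc[OF k] Kc[OF k'(1)]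
      have "\<kappa> (h \<oplus>\<^bsub>X\<^esub> k) = \<kappa> (h' \<oplus>\<^bsub>X\<^esub> k')" using k'(2) by (simp add: h'_def)
      then have e: "\<kappa> h + \<kappa> k = \<kappa> h' + \<kappa> k'" using c by (simp add: \<kappa>_add)
      note inv = \<kappa>_uminus
      have "\<kappa> (h \<oplus>\<^bsub>X\<^esub> \<ominus>\<^bsub>X\<^esub> h') = \<kappa> (k' \<oplus>\<^bsub>X\<^esub> \<ominus>\<^bsub>X\<^esub> k)"
        using c e by (simp add: \<kappa>_add inv algebra_simps)
      then have e1: "h \<oplus>\<^bsub>X\<^esub> \<ominus>\<^bsub>X\<^esub> h' = k' \<oplus>\<^bsub>X\<^esub> \<ominus>\<^bsub>X\<^esub> k"
        by (intro inj_onD[OF inj]) (use c in simp_all)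
      have e2: "h \<oplus>\<^bsub>X\<^esub> \<ominus>\<^bsub>X\<^esub> h' \<in> H" by (rule Hp(3)[OF h Hp(4)[OF h']])
      have e3: "k' \<oplus>\<^bsub>X\<^esub> \<ominus>\<^bsub>X\<^esub> k \<in> K" by (rule Kp(3)[OF k'(1) Kp(4)[OF k]])
      have "h \<oplus>\<^bsub>X\<^esub> \<ominus>\<^bsub>X\<^esub> h' \<in> H \<inter> K" using e2 e3 unfolding e1[symmetric] by (rule IntI)
      then have "h \<oplus>\<^bsub>X\<^esub> \<ominus>\<^bsub>X\<^esub> h' = \<zero>\<^bsub>X\<^esub>" using HK(1) by simp
      then have "\<kappa> h - \<kappa> h' = 0" using c \<kappa>_zero by (metis Mod.a_inv_closed \<kappa>_add diff_conv_add_uminus inv)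
      then have "h = h'" by (intro inj_onD[OF inj]) (use c in simp_all)
      then show ?thesis by (simp add: h'_def)
    qed
    have "p \<in> mod_hom Z2G X X"
    proof (rule mod_homI)
      show "p x \<in> carrier X" if "x \<in> carrier X" for x using p(1)[OF that] Hc by blast
      show "p (x \<oplus>\<^bsub>X\<^esub> y) = p x \<oplus>\<^bsub>X\<^esub> p y" if x: "x \<in> carrier X" and y: "y \<in> carrier X" for x y
      proof -
        obtain k k' where k: "k \<in> K" "x = p x \<oplus>\<^bsub>X\<^esub> k" "k' \<in> K" "y = p y \<oplus>\<^bsub>X\<^esub> k'" using p(2) x y by blast
        have "x \<oplus>\<^bsub>X\<^esub> y = (p x \<oplus>\<^bsub>X\<^esub> k) \<oplus>\<^bsub>X\<^esub> (p y \<oplus>\<^bsub>X\<^esub> k')" using k by simp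
        also have "\<dots> = (p x \<oplus>\<^bsub>X\<^esub> p y) \<oplus>\<^bsub>X\<^esub> (k \<oplus>\<^bsub>X\<^esub> k')"
          using Hc[OF p(1)[OF x]] Hc[OF p(1)[OF y]] Kc[OF k(1)] Kc[OF k(3)] by (simp add: Mod.a_ac)
        finally show ?thesis using p_eq Hp(3) Kp(3) p(1) x y k by simp
      qed
      show "p (r \<odot>\<^bsub>X\<^esub> x) = r \<odot>\<^bsub>X\<^esub> p x" if r: "r \<in> Z2G" and x: "x \<in> carrier X" for r x
      proof -
        obtain k where k: "k \<in> K" "x = p x \<oplus>\<^bsub>X\<^esub> k" using p(2) x by blast
        have "r \<odot>\<^bsub>X\<^esub> (p x \<oplus>\<^bsub>X\<^esub> k) = r \<odot>\<^bsub>X\<^esub> p x \<oplus>\<^bsub>X\<^esub> r \<odot>\<^bsub>X\<^esub> k"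
          by (rule Mod.smult_r_distr) (use r Hc[OF p(1)[OF x]] Kc[OF k(1)] in simp_all)
        then have "r \<odot>\<^bsub>X\<^esub> x = r \<odot>\<^bsub>X\<^esub> p x \<oplus>\<^bsub>X\<^esub> r \<odot>\<^bsub>X\<^esub> k" using k(2) by simp
        then show ?thesis using p_eq Hp(5)[OF r] Kp(5)[OF r] p(1)[OF x] k(1) by simp
      qed
    qed
    from ghom_of_hom[OF presented_axioms presented_axioms this]
    have g: "ghom \<rho> \<rho> (\<lambda>v. \<kappa> (p (un v)))" .
    have pH: "p h = h" if "h \<in> H" for h using p_eq[OF that Kp(2)] Hc[OF that] by simp
    have pK: "p k = \<zero>\<^bsub>X\<^esub>" if "k \<in> K" for k using p_eq[OF Hp(2) that] Kc[OF that] by simp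
    have "summand \<rho> (\<lambda>v. \<kappa> (p (un v)))"
      unfolding summand_def using g p(1)[OF un_closed] Hc by (simp add: un_\<kappa> pH)
    then have "(\<forall>v. \<kappa> (p (un v)) = 0) \<or> (\<forall>v. \<kappa> (p (un v)) = \<rho> 0 v)"
      using ind unfolding indec_def by blast
    then show ?thesis
    proof
      assume *: "\<forall>v. \<kappa> (p (un v)) = 0"
      have "h = \<zero>\<^bsub>X\<^esub>" if h: "h \<in> H" for h
        using *[rule_format, of "\<kappa> h"] Hc[OF h] by (simp add: un_\<kappa> pH[OF h] \<kappa>_eq_0)
      then show ?thesis using Hp(2) by blast
    next
      assume *: "\<forall>v. \<kappa> (p (un v)) = \<rho> 0 v"
      have "k = \<zero>\<^bsub>X\<^esub>" if k: "k \<in> K" for k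
        using *[rule_format, of "\<kappa> k"] Kc[OF k] by (simp add: un_\<kappa> pK[OF k] \<kappa>_zero \<kappa>_fix \<kappa>_eq_0[symmetric])
      then show ?thesis using Kp(2) by blast
    qed
  qed
  moreover have "carrier X \<noteq> {\<zero>\<^bsub>X\<^esub>}"
  proof
    assume c: "carrier X = {\<zero>\<^bsub>X\<^esub>}"
    obtain v where "\<rho> 0 v \<noteq> 0" using ind by (auto simp: indec_def)
    moreover have "un v = \<zero>\<^bsub>X\<^esub>" using un_closed[of v] c by blast
    ultimately show False using \<kappa>_un[of v] by (simp add: \<kappa>_zero)
  qed
  ultimately show ?thesis using lat unfolding indec_lattice_def by blast
qed

section \<open>Auslander-Reiten translates are syzygies up to stable equivalence\<close>

text \<open>A short exact sequence of representations. Exactness refers to the images of \<open>\<rho> 0\<close>, \<open>\<nu> 0\<close> and \<open>\<mu> 0\<close>. It splits over the 2-adic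
integers, and the linear section \<open>s\<close> yields its class \<open>c\<close>.\<close>

locale extension =
  fixes \<rho> :: "'u::zmod rep" and \<nu> :: "'v::zmod rep" and \<mu> :: "'w::zmod rep" and b :: "'u \<Rightarrow> 'v" and a :: "'v \<Rightarrow> 'w"
  assumes \<rho>: "glat \<rho>" and \<nu>: "glat \<nu>" and \<mu>: "glat \<mu>" and b: "ghom \<rho> \<nu> b" and a: "ghom \<nu> \<mu> a"
    and b_inj: "\<And>x. b x = 0 \<Longrightarrow> \<rho> 0 x = 0"
    and ab: "\<And>x. a (b x) = 0" and exact: "\<And>y. \<nu> 0 y = y \<Longrightarrow> a y = 0 \<Longrightarrow> \<exists>x. b x = y"
    and a_onto: "\<And>z. \<mu> 0 z = z \<Longrightarrow> \<exists>y. a y = z"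
begin

definition lift :: "'v \<Rightarrow> 'u" where
  "lift y = \<rho> 0 (SOME x. b x = y)"

lemma b_lift: "\<nu> 0 y = y \<Longrightarrow> a y = 0 \<Longrightarrow> b (lift y) = y"
  unfolding lift_def using someI_ex[OF exact, of y] by (simp add: ghom_fix'[OF b])

lemma lift_fix: "\<rho> 0 (lift y) = lift y"
  by (simp add: lift_def glat_mult[OF \<rho>])

lemma b_eqD: "b x = b x' \<Longrightarrow> \<rho> 0 x = \<rho> 0 x'"
  using b_inj[of "x - x'"] by (simp add: zlin_diff[OF ghom_lin[OF b]] zlin_diff[OF glat_lin[OF \<rho>]])

lemma lift_eqI: "\<nu> 0 y = y \<Longrightarrow> a y = 0 \<Longrightarrow> \<rho> 0 x = x \<Longrightarrow> b x = y \<Longrightarrow> lift y = x"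
  using b_eqD[of "lift y" x] by (simp add: b_lift lift_fix)

lemma section_exists: "\<exists>s. zlin s \<and> (\<forall>x. a (s x) = \<mu> 0 x) \<and> (\<forall>x. \<nu> 0 (s x) = s x) \<and> (\<forall>x. s (\<mu> 0 x) = s x)"
proof -
  obtain n e d where B: "is_basis (\<mu> 0) n e d" using zproj_basis[OF glat_zproj[OF \<mu>]] by blast
  have "\<exists>y. i < n \<longrightarrow> \<nu> 0 y = y \<and> a y = e i" for i
  proof (cases "i < n")
    case True
    then obtain y where "a y = e i" using a_onto[OF basis_fixed[OF B True]] by blast
    then have "\<nu> 0 (\<nu> 0 y) = \<nu> 0 y \<and> a (\<nu> 0 y) = e i" by (simp add: glat_mult[OF \<nu>] ghom_fix'[OF a])
    then show ?thesis by blast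
  qed simp
  then obtain y where y: "\<And>i. i < n \<Longrightarrow> \<nu> 0 (y i) = y i" "\<And>i. i < n \<Longrightarrow> a (y i) = e i" by metis
  define s where "s x = (\<Sum>i<n. d i x *z y i)" for x
  have s: "zlin s" unfolding s_def by (rule zlin_sum') (rule zlin_scale_vec[OF basis_lin[OF B]])
  have as: "a (s x) = \<mu> 0 x" for x
    by (simp add: s_def zlin_sum[OF ghom_lin[OF a]] zlin_scale[OF ghom_lin[OF a]] y basis_expand[OF B])
  have fs: "\<nu> 0 (s x) = s x" for x
    by (simp add: s_def zlin_sum[OF glat_lin[OF \<nu>]] zlin_scale[OF glat_lin[OF \<nu>]] y)
  define s' where "s' x = s (\<mu> 0 x)" for x
  have "zlin s'" unfolding s'_def by (rule zlin_comp[OF s glat_lin[OF \<mu>]])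
  then show ?thesis by (intro exI[of _ s']) (simp add: s'_def as fs glat_mult[OF \<mu>])
qed

definition s :: "'w \<Rightarrow> 'v" where
  "s = (SOME s. zlin s \<and> (\<forall>x. a (s x) = \<mu> 0 x) \<and> (\<forall>x. \<nu> 0 (s x) = s x) \<and> (\<forall>x. s (\<mu> 0 x) = s x))"

lemma s: "zlin s" "a (s x) = \<mu> 0 x" "\<nu> 0 (s x) = s x" "s (\<mu> 0 x) = s x"
  using someI_ex[OF section_exists] unfolding s_def by blast+

definition c :: "klein \<Rightarrow> 'w \<Rightarrow> 'u" where
  "c g x = lift (\<nu> g (s x) - s (\<mu> g x))"

lemma ker: "\<nu> 0 (\<nu> g (s x) - s (\<mu> g x)) = \<nu> g (s x) - s (\<mu> g x)" "a (\<nu> g (s x) - s (\<mu> g x)) = 0"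
  by (simp_all add: zlin_diff[OF glat_lin[OF \<nu>]] glat_mult[OF \<nu>] s zlin_diff[OF ghom_lin[OF a]] ghom_comm[OF a]
      glat_mult[OF \<mu>])

lemma bc: "b (c g x) = \<nu> g (s x) - s (\<mu> g x)"
  unfolding c_def by (rule b_lift[OF ker])

lemma c_eqI: "\<rho> 0 y = y \<Longrightarrow> b y = \<nu> g (s x) - s (\<mu> g x) \<Longrightarrow> c g x = y"
  unfolding c_def by (rule lift_eqI[OF ker])

lemma c_fix: "\<rho> 0 (c g x) = c g x"
  by (simp add: c_def lift_fix)

lemma cocycle_c: "cocycle \<mu> \<rho> c"
  unfolding cocycle_def
proof (intro conjI allI)
  note lb = ghom_lin[OF b] and l\<nu> = glat_lin[OF \<nu>] and l\<mu> = glat_lin[OF \<mu>] and l\<rho> = glat_lin[OF \<rho>]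
  show "zlin (c g)" for g
  proof (rule zlinI)
    show "c g (x + y) = c g x + c g y" for x y
      by (rule c_eqI) (simp_all add: zlin_add[OF l\<rho>] c_fix zlin_add[OF lb] bc zlin_add[OF s(1)] zlin_add[OF l\<nu>] zlin_add[OF l\<mu>])
    show "c g (k *z x) = k *z c g x" for k x
      by (rule c_eqI) (simp_all add: zlin_scale[OF l\<rho>] c_fix zlin_scale[OF lb] bc zlin_scale[OF s(1)]
          zlin_scale[OF l\<nu>] zlin_scale[OF l\<mu>] zscale_diff_right)
  qed
  show "c g (\<mu> 0 x) = c g x" for g x by (simp add: c_def s(4) glat_mult[OF \<mu>])
  show "\<rho> 0 (c g x) = c g x" for g x by (rule c_fix)
  show "c (g + h) x = c g (\<mu> h x) + \<rho> g (c h x)" for g h x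
    by (rule c_eqI) (simp_all add: zlin_add[OF l\<rho>] c_fix glat_mult[OF \<rho>] zlin_add[OF lb] bc ghom_comm[OF b]
        zlin_diff[OF l\<nu>] glat_mult[OF \<nu>] glat_mult[OF \<mu>])
qed

lemma split_of_coboundary:
  assumes "coboundary \<mu> \<rho> c"
  shows "\<exists>\<sigma>. ghom \<mu> \<nu> \<sigma> \<and> (\<forall>x. a (\<sigma> x) = \<mu> 0 x)"
proof -
  note lb = ghom_lin[OF b] and l\<nu> = glat_lin[OF \<nu>]
  obtain \<theta> where \<theta>: "zlin \<theta>" "\<And>g x. c g x = \<rho> g (\<theta> x) - \<theta> (\<mu> g x)"
    using assms by (auto simp: coboundary_def)
  define \<sigma> where "\<sigma> x = s x - b (\<theta> x)" for x
  have "ghom \<mu> \<nu> \<sigma>"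
  proof (rule ghomI)
    show "zlin \<sigma>" unfolding \<sigma>_def by (rule zlin_minus'[OF s(1) zlin_comp[OF lb \<theta>(1)]])
    show "\<sigma> (\<mu> g x) = \<nu> g (\<sigma> x)" for g x
      using bc[of g x] by (simp add: \<sigma>_def \<theta>(2) zlin_diff[OF lb] ghom_comm[OF b] zlin_diff[OF l\<nu>] algebra_simps)
    show "\<nu> 0 (\<sigma> x) = \<sigma> x" for x by (simp add: \<sigma>_def zlin_diff[OF l\<nu>] s(3) ghom_fix[OF b])
  qed
  moreover have "a (\<sigma> x) = \<mu> 0 x" for x by (simp add: \<sigma>_def zlin_diff[OF ghom_lin[OF a]] s(2) ab)
  ultimately show ?thesis by blast
qed

lemma coboundary_of_extension:
  assumes "ghom \<nu> Z h"
  shows "coboundary \<mu> Z (\<lambda>g x. h (b (c g x)))"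
  unfolding coboundary_def
  by (rule exI[of _ "\<lambda>x. h (s x)"])
    (simp add: zlin_comp[OF ghom_lin[OF assms] s(1)] bc zlin_diff[OF ghom_lin[OF assms]] ghom_comm[OF assms])

lemma coboundary_of_lifting:
  assumes f: "ghom Z \<mu> f" and h: "ghom Z \<nu> h" and ah: "\<And>z. a (h z) = f z"
  shows "coboundary Z \<rho> (\<lambda>g z. c g (f z))"
proof -
  note lb = ghom_lin[OF b] and l\<nu> = glat_lin[OF \<nu>] and l\<rho> = glat_lin[OF \<rho>]
  define \<tau> where "\<tau> z = lift (s (f z) - h z)" for z
  have k: "\<nu> 0 (s (f z) - h z) = s (f z) - h z" "a (s (f z) - h z) = 0" for z
    by (simp_all add: zlin_diff[OF l\<nu>] s ghom_fix[OF h] zlin_diff[OF ghom_lin[OF a]] ah ghom_fix[OF f])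
  have b\<tau>: "b (\<tau> z) = s (f z) - h z" for z unfolding \<tau>_def by (rule b_lift[OF k])
  have \<tau>_fix: "\<rho> 0 (\<tau> z) = \<tau> z" for z by (simp add: \<tau>_def lift_fix)
  have "zlin \<tau>"
  proof (rule zlinI)
    note sf = zlin_comp[OF s(1) ghom_lin[OF f]]
    show "\<tau> (x + y) = \<tau> x + \<tau> y" for x y
      unfolding \<tau>_def[of "x + y"]
      by (rule lift_eqI[OF k]) (simp_all add: zlin_add[OF l\<rho>] \<tau>_fix zlin_add[OF lb] b\<tau> zlin_add[OF sf] zlin_add[OF ghom_lin[OF h]])
    show "\<tau> (m *z x) = m *z \<tau> x" for m x
      unfolding \<tau>_def[of "m *z x"]
      by (rule lift_eqI[OF k]) (simp_all add: zlin_scale[OF l\<rho>] \<tau>_fix zlin_scale[OF lb] b\<tau> zlin_scale[OF sf]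
          zlin_scale[OF ghom_lin[OF h]] zscale_diff_right)
  qed
  moreover have "c g (f z) = \<rho> g (\<tau> z) - \<tau> (Z g z)" for g z
    by (rule c_eqI) (simp_all add: zlin_diff[OF l\<rho>] glat_mult[OF \<rho>] \<tau>_fix zlin_diff[OF lb] ghom_comm[OF b] b\<tau>
        zlin_diff[OF l\<nu>] ghom_comm[OF f] ghom_comm[OF h])
  ultimately show ?thesis by (auto simp: coboundary_def)
qed

end

text \<open>The class of the sequence is not a coboundary since the sequence does not split. A homomorphism out of \<open>M'\<close> that extends to
\<open>N\<close>, or one into \<open>M\<close> that lifts to \<open>N\<close>, turns it into a coboundary; so the almost split property supplies the hypotheses of
the two retract lemmas.\<close>

lemma ar_retracts:
  assumes ar: "ar_sequence Z2G M' \<beta> N \<alpha> M" and P': "presents M' \<rho> \<kappa>'" and P: "presents M \<mu> \<kappa>"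
  shows "retract \<rho> (syz \<mu>)" "retract \<mu> (cosyz \<rho>)"
proof -
  have lats: "is_lattice Z2G M'" "is_lattice Z2G N" "is_lattice Z2G M"
    using ar by (auto simp: ar_sequence_def indec_lattice_def)
  have ex: "\<beta> \<in> mod_hom Z2G M' N" "\<alpha> \<in> mod_hom Z2G N M" "inj_on \<beta> (carrier M')" "\<alpha> ` carrier N = carrier M"
    "\<beta> ` carrier M' = {x \<in> carrier N. \<alpha> x = \<zero>\<^bsub>M\<^esub>}"
    using ar by (auto simp: ar_sequence_def short_exact_def)
  have lift_ext: "\<forall>(X :: lat) f. indec_lattice Z2G X \<and> f \<in> mod_hom Z2G M' X \<and> \<not> bij_betw f (carrier M') (carrier X) \<longrightarrow>
        (\<exists>h\<in>mod_hom Z2G N X. \<forall>x\<in>carrier M'. h (\<beta> x) = f x)"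
    using ar[unfolded ar_sequence_def] by (elim conjE)
  have lift_src: "\<forall>(X :: lat) f. indec_lattice Z2G X \<and> f \<in> mod_hom Z2G X M \<and> \<not> bij_betw f (carrier X) (carrier M) \<longrightarrow>
        (\<exists>h\<in>mod_hom Z2G X N. \<forall>x\<in>carrier X. \<alpha> (h x) = f x)"
    using ar[unfolded ar_sequence_def] by (elim conjE)
  have nonsplit: "\<not> (\<exists>\<sigma>\<in>mod_hom Z2G M N. \<forall>x\<in>carrier M. \<alpha> (\<sigma> x) = x)"
    using ar[unfolded ar_sequence_def] by (elim conjE)
  obtain \<nu> \<kappa>N where PN: "presents N (\<nu> :: ((nat \<Rightarrow> q2adic) \<Rightarrow> z2adic) rep) \<kappa>N"
    using lattice_presented[OF lats(2)] by blast
  have mods: "module (ring_on Z2G) M'" "module (ring_on Z2G) N" "module (ring_on Z2G) M"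
    using lats by (auto simp: is_lattice_def)
  interpret M': presented M' \<rho> \<kappa>' using mods(1) P' by (rule presented.intro)
  interpret N: presented N \<nu> \<kappa>N using mods(2) PN by (rule presented.intro)
  interpret M: presented M \<mu> \<kappa> using mods(3) P by (rule presented.intro)
  define b where "b v = \<kappa>N (\<beta> (M'.un v))" for v
  define a where "a v = \<kappa> (\<alpha> (N.un v))" for v
  note \<beta> = mod_homD[OF ex(1)] and \<alpha> = mod_homD[OF ex(2)]
  have b: "ghom \<rho> \<nu> b" unfolding b_def by (rule ghom_of_hom[OF M'.presented_axioms N.presented_axioms ex(1)])
  have a: "ghom \<nu> \<mu> a" unfolding a_def by (rule ghom_of_hom[OF N.presented_axioms M.presented_axioms ex(2)])
  have \<beta>c: "\<beta> (M'.un v) \<in> carrier N" for v by (rule \<beta>(1)[OF M'.un_closed])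
  interpret E: extension \<rho> \<nu> \<mu> b a
  proof
    show "\<rho> 0 x = 0" if "b x = 0" for x
    proof -
      have "\<kappa>N (\<beta> (M'.un x)) = \<kappa>N (\<beta> (M'.un 0))"
        using that zlin_zero[OF ghom_lin[OF b]] by (simp add: b_def)
      then have "\<beta> (M'.un x) = \<beta> (M'.un 0)" by (rule inj_onD[OF N.inj]) (rule \<beta>c)+
      then have "M'.un x = M'.un 0" by (rule inj_onD[OF ex(3)]) (rule M'.un_closed)+
      then have "\<rho> 0 x = \<rho> 0 0" by (metis M'.\<kappa>_un)
      then show ?thesis by (simp add: zlin_zero[OF M'.rep_lin])
    qed
    show "a (b x) = 0" for x
    proof -
      have "\<beta> (M'.un x) \<in> {x \<in> carrier N. \<alpha> x = \<zero>\<^bsub>M\<^esub>}" using ex(5) M'.un_closed by blast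
      then show ?thesis by (simp add: a_def b_def N.un_\<kappa> M.\<kappa>_zero)
    qed
    show "\<exists>x. b x = y" if "\<nu> 0 y = y" "a y = 0" for y
    proof -
      have "\<alpha> (N.un y) = \<zero>\<^bsub>M\<^esub>"
        using that(2) M.\<kappa>_eq_0[OF \<alpha>(1)[OF N.un_closed]] by (simp add: a_def)
      then have "N.un y \<in> \<beta> ` carrier M'" using ex(5) N.un_closed by blast
      then obtain z where z: "z \<in> carrier M'" "N.un y = \<beta> z" by blast
      have "b (\<kappa>' z) = \<kappa>N (N.un y)" by (simp add: b_def M'.un_\<kappa> z)
      then show ?thesis using that(1) by (auto simp: N.\<kappa>_un)
    qed
    show "\<exists>y. a y = z" if "\<mu> 0 z = z" for z
    proof -
      obtain y where y: "y \<in> carrier N" "\<alpha> y = M.un z" using ex(4) M.un_closed by (metis imageE)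
      have "a (\<kappa>N y) = z" using that by (simp add: a_def N.un_\<kappa> y M.\<kappa>_un)
      then show ?thesis by blast
    qed
  qed (rule M'.glat N.glat M.glat b a)+
  have nc: "\<not> coboundary \<mu> \<rho> E.c"
  proof
    assume "coboundary \<mu> \<rho> E.c"
    then obtain \<sigma> where \<sigma>: "ghom \<mu> \<nu> \<sigma>" "\<And>x. a (\<sigma> x) = \<mu> 0 x" using E.split_of_coboundary by blast
    have "\<alpha> (N.un (\<sigma> (\<kappa> x))) = x" if "x \<in> carrier M" for x
    proof (rule inj_onD[OF M.inj])
      show "\<kappa> (\<alpha> (N.un (\<sigma> (\<kappa> x)))) = \<kappa> x" using \<sigma>(2)[of "\<kappa> x"] that by (simp add: a_def M.\<kappa>_fix)
    qed (use that in \<open>auto intro: \<alpha>(1) N.un_closed\<close>)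
    then have "\<exists>\<sigma>\<in>mod_hom Z2G M N. \<forall>x\<in>carrier M. \<alpha> (\<sigma> x) = x"
      by (intro bexI[OF _ hom_of_ghom[OF M.presented_axioms N.presented_axioms \<sigma>(1)]] ballI)
    then show False using nonsplit by (rule notE[rotated])
  qed
  show "retract \<rho> (syz \<mu>)"
  proof (rule retract_of_syz[OF M.glat M'.glat E.cocycle_c nc])
    fix \<epsilon> f assume *: "summand (syz \<mu>) \<epsilon>" "indec (sub (syz \<mu>) \<epsilon>)" "ghom \<rho> (sub (syz \<mu>) \<epsilon>) f"
      "\<not> giso \<rho> (sub (syz \<mu>) \<epsilon>) f"
    define Z where "Z = sub (syz \<mu>) \<epsilon>"
    have Z: "glat Z" unfolding Z_def by (rule sub_glat[OF glat_syz[OF M.glat] *(1)])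
    obtain X :: lat and \<kappa>X where X: "is_lattice Z2G X" "presents X Z \<kappa>X" using rep_lattice[OF Z] by blast
    interpret X: presented X Z \<kappa>X using X by (intro presented.intro) (simp_all add: is_lattice_def)
    have f: "ghom \<rho> Z f" using *(3) by (simp add: Z_def)
    have iX: "indec_lattice Z2G X" by (rule indec_lattice_of_indec[OF X]) (use *(2) in \<open>simp add: Z_def\<close>)
    have f': "(\<lambda>x. X.un (f (\<kappa>' x))) \<in> mod_hom Z2G M' X" by (rule hom_of_ghom[OF M'.presented_axioms X.presented_axioms f])
    have nb: "\<not> bij_betw (\<lambda>x. X.un (f (\<kappa>' x))) (carrier M') (carrier X)"
      using giso_of_bij[OF M'.presented_axioms X.presented_axioms f] *(4) by (auto simp: Z_def)
    have "\<exists>h\<in>mod_hom Z2G N X. \<forall>x\<in>carrier M'. h (\<beta> x) = X.un (f (\<kappa>' x))"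
      using lift_ext[THEN spec, THEN spec, THEN mp, OF conjI[OF iX conjI[OF f' nb]]] .
    then obtain h where h: "h \<in> mod_hom Z2G N X" "\<And>x. x \<in> carrier M' \<Longrightarrow> h (\<beta> x) = X.un (f (\<kappa>' x))" by blast
    have gh: "ghom \<nu> Z (\<lambda>v. \<kappa>X (h (N.un v)))" by (rule ghom_of_hom[OF N.presented_axioms X.presented_axioms h(1)])
    have "\<kappa>X (h (N.un (b x))) = f x" for x
      by (simp add: b_def N.un_\<kappa> \<beta>c h(2) M'.un_closed X.\<kappa>_un M'.\<kappa>_un ghom_fix'[OF f] ghom_fix[OF f])
    then show "coboundary \<mu> (sub (syz \<mu>) \<epsilon>) (\<lambda>g x. f (E.c g x))"
      using E.coboundary_of_extension[OF gh] by (simp add: Z_def)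
  qed
  show "retract \<mu> (cosyz \<rho>)"
  proof (rule retract_of_cosyz[OF M.glat M'.glat E.cocycle_c nc])
    fix \<epsilon> f assume *: "summand (cosyz \<rho>) \<epsilon>" "indec (sub (cosyz \<rho>) \<epsilon>)" "ghom (sub (cosyz \<rho>) \<epsilon>) \<mu> f"
      "\<not> giso (sub (cosyz \<rho>) \<epsilon>) \<mu> f"
    define Z where "Z = sub (cosyz \<rho>) \<epsilon>"
    have Z: "glat Z" unfolding Z_def by (rule sub_glat[OF glat_cosyz[OF M'.glat] *(1)])
    obtain X :: lat and \<kappa>X where X: "is_lattice Z2G X" "presents X Z \<kappa>X" using rep_lattice[OF Z] by blast
    interpret X: presented X Z \<kappa>X using X by (intro presented.intro) (simp_all add: is_lattice_def)
    have f: "ghom Z \<mu> f" using *(3) by (simp add: Z_def)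
    have iX: "indec_lattice Z2G X" by (rule indec_lattice_of_indec[OF X]) (use *(2) in \<open>simp add: Z_def\<close>)
    have f': "(\<lambda>x. M.un (f (\<kappa>X x))) \<in> mod_hom Z2G X M" by (rule hom_of_ghom[OF X.presented_axioms M.presented_axioms f])
    have nb: "\<not> bij_betw (\<lambda>x. M.un (f (\<kappa>X x))) (carrier X) (carrier M)"
      using giso_of_bij[OF X.presented_axioms M.presented_axioms f] *(4) by (auto simp: Z_def)
    have "\<exists>h\<in>mod_hom Z2G X N. \<forall>x\<in>carrier X. \<alpha> (h x) = M.un (f (\<kappa>X x))"
      using lift_src[THEN spec, THEN spec, THEN mp, OF conjI[OF iX conjI[OF f' nb]]] .
    then obtain h where h: "h \<in> mod_hom Z2G X N" "\<And>x. x \<in> carrier X \<Longrightarrow> \<alpha> (h x) = M.un (f (\<kappa>X x))" by blast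
    have gh: "ghom Z \<nu> (\<lambda>v. \<kappa>N (h (X.un v)))" by (rule ghom_of_hom[OF X.presented_axioms N.presented_axioms h(1)])
    have "a (\<kappa>N (h (X.un z))) = f z" for z
      using mod_homD(1)[OF h(1) X.un_closed]
      by (simp add: a_def N.un_\<kappa> h(2) X.un_closed M.\<kappa>_un X.\<kappa>_un ghom_fix'[OF f] ghom_fix[OF f])
    then show "coboundary (sub (cosyz \<rho>) \<epsilon>) \<rho> (\<lambda>g z. E.c g (f z))"
      using E.coboundary_of_lifting[OF f gh] by (simp add: Z_def)
  qed
qed

section \<open>Tate cohomology groups of a presented lattice\<close>

definition cocycle_group :: "'v::zmod rep \<Rightarrow> int \<Rightarrow> (klein list \<Rightarrow> 'v) monoid" where
  "cocycle_group \<rho> n = \<lparr>carrier = cocy \<rho> n, mult = (+), one = 0\<rparr>"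

definition tate_rep :: "'v::zmod rep \<Rightarrow> int \<Rightarrow> (klein list \<Rightarrow> 'v) set monoid" where
  "tate_rep \<rho> n = cocycle_group \<rho> n Mod cobd \<rho> n"

lemma cocycle_group_simps [simp]: "carrier (cocycle_group \<rho> n) = cocy \<rho> n" "x \<otimes>\<^bsub>cocycle_group \<rho> n\<^esub> y = x + y"
  "\<one>\<^bsub>cocycle_group \<rho> n\<^esub> = 0"
  by (simp_all add: cocycle_group_def)

lemma cocy_uminus: "glat \<rho> \<Longrightarrow> c \<in> cocy \<rho> n \<Longrightarrow> - c \<in> cocy \<rho> n"
  using cocy_diff[of \<rho> 0 n c] cocy_0[of \<rho> n] by simp

lemma comm_group_cocycle_group: "glat \<rho> \<Longrightarrow> comm_group (cocycle_group \<rho> n)"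
  by (rule comm_groupI) (auto simp: cocy_add cocy_0 add_ac intro!: bexI[of _ "- _"] cocy_uminus)

lemma normal_cobd:
  assumes \<rho>: "glat \<rho>"
  shows "cobd \<rho> n \<lhd> cocycle_group \<rho> n"
proof -
  interpret comm_group "cocycle_group \<rho> n" by (rule comm_group_cocycle_group[OF \<rho>])
  have inv: "inv\<^bsub>cocycle_group \<rho> n\<^esub> c = - c" if "c \<in> cocy \<rho> n" for c
    using that cocy_uminus[OF \<rho> that] by (intro inv_equality) simp_all
  show ?thesis
  proof (rule subgroup_imp_normal, rule subgroupI)
    show "cobd \<rho> n \<subseteq> carrier (cocycle_group \<rho> n)" using cobd_sub_cocy[OF \<rho>] by simp
    show "cobd \<rho> n \<noteq> {}" using cobd_0[OF \<rho>] by blast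
    show "inv\<^bsub>cocycle_group \<rho> n\<^esub> c \<in> cobd \<rho> n" if "c \<in> cobd \<rho> n" for c
    proof -
      have "c \<in> cocy \<rho> n" using that cobd_sub_cocy[OF \<rho>] by blast
      then show ?thesis using inv cobd_uminus[OF \<rho> that] by simp
    qed
    show "c \<otimes>\<^bsub>cocycle_group \<rho> n\<^esub> d \<in> cobd \<rho> n" if "c \<in> cobd \<rho> n" "d \<in> cobd \<rho> n" for c d
      using cobd_add[OF \<rho> that] by simp
  qed
qed

lemma coset_map_group_hom:
  assumes "N \<lhd> G" "group T" "h \<in> hom T G"
  shows "group_hom T (G Mod N) (\<lambda>x. N #>\<^bsub>G\<^esub> h x)"
    "kernel T (G Mod N) (\<lambda>x. N #>\<^bsub>G\<^esub> h x) = {x \<in> carrier T. h x \<in> N}"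
proof -
  interpret normal N G by fact
  interpret T: group T by fact
  interpret Q: group "G Mod N" by (rule factorgroup_is_group)
  have "(\<lambda>x. N #>\<^bsub>G\<^esub> h x) \<in> hom T (G Mod N)"
  proof (rule homI)
    fix x y assume xy: "x \<in> carrier T" "y \<in> carrier T"
    have hx: "h x \<in> carrier G" "h y \<in> carrier G" using assms(3) xy by (auto simp: hom_def)
    then show "N #>\<^bsub>G\<^esub> h x \<in> carrier (G Mod N)" using hom_in_carrier[OF r_coset_hom_Mod] by blast
    show "N #>\<^bsub>G\<^esub> h (x \<otimes>\<^bsub>T\<^esub> y) = (N #>\<^bsub>G\<^esub> h x) \<otimes>\<^bsub>G Mod N\<^esub> (N #>\<^bsub>G\<^esub> h y)"
      unfolding hom_mult[OF assms(3) xy] by (rule hom_mult[OF r_coset_hom_Mod hx])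
  qed
  then show "group_hom T (G Mod N) (\<lambda>x. N #>\<^bsub>G\<^esub> h x)"
    by (simp add: group_hom_def group_hom_axioms_def T.group_axioms Q.group_axioms)
  have "N #>\<^bsub>G\<^esub> h x = N \<longleftrightarrow> h x \<in> N" if "x \<in> carrier T" for x
  proof -
    have hx: "h x \<in> carrier G" using assms(3) that by (auto simp: hom_def)
    show ?thesis
      using coset_join2[OF hx subgroup_axioms] rcos_self[OF hx subgroup_axioms] by auto
  qed
  then show "kernel T (G Mod N) (\<lambda>x. N #>\<^bsub>G\<^esub> h x) = {x \<in> carrier T. h x \<in> N}"
    by (auto simp: kernel_def FactGroup_def)
qed

lemma temb_inj:
  assumes \<rho>: "glat \<rho>" and \<sigma>: "glat \<sigma>" and t: "temb \<rho> n \<sigma> m"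
  shows "\<exists>h \<in> hom (tate_rep \<rho> n) (tate_rep \<sigma> m). inj_on h (carrier (tate_rep \<rho> n))"
proof -
  obtain F where F: "\<forall>c\<in>cocy \<rho> n. F c \<in> cocy \<sigma> m" "\<forall>c\<in>cocy \<rho> n. \<forall>c'\<in>cocy \<rho> n. F (c + c') = F c + F c'"
     "\<forall>c\<in>cocy \<rho> n. F c \<in> cobd \<sigma> m \<longleftrightarrow> c \<in> cobd \<rho> n" using t unfolding temb_def by blast
  have "F \<in> hom (cocycle_group \<rho> n) (cocycle_group \<sigma> m)" using F by (auto simp: hom_def)
  note g = coset_map_group_hom[OF normal_cobd[OF \<sigma>] comm_group.axioms(2)[OF comm_group_cocycle_group[OF \<rho>]] this]
  have k: "{x \<in> carrier (cocycle_group \<rho> n). F x \<in> cobd \<sigma> m} = cobd \<rho> n"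
    using F(3) cobd_sub_cocy[OF \<rho>] by auto
  interpret group_hom "cocycle_group \<rho> n" "cocycle_group \<sigma> m Mod cobd \<sigma> m"
    "\<lambda>x. cobd \<sigma> m #>\<^bsub>cocycle_group \<sigma> m\<^esub> F x" by (rule g(1))
  show ?thesis
    using FactGroup_hom FactGroup_inj_on unfolding g(2) k tate_rep_def by blast
qed

text \<open>Finite groups that embed in each other have the same cardinality.\<close>

lemma temb_finite_iso:
  assumes \<rho>: "glat \<rho>" and \<sigma>: "glat \<sigma>" and t: "temb \<rho> n \<sigma> m" "temb \<sigma> m \<rho> n"
    and fin: "finite (carrier (tate_rep \<rho> n)) \<or> finite (carrier (tate_rep \<sigma> m))"
  shows "tate_rep \<rho> n \<cong> tate_rep \<sigma> m"
proof -
  obtain h where h: "h \<in> hom (tate_rep \<rho> n) (tate_rep \<sigma> m)" "inj_on h (carrier (tate_rep \<rho> n))"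
    using temb_inj[OF \<rho> \<sigma> t(1)] by blast
  obtain k where k: "k \<in> hom (tate_rep \<sigma> m) (tate_rep \<rho> n)" "inj_on k (carrier (tate_rep \<sigma> m))"
    using temb_inj[OF \<sigma> \<rho> t(2)] by blast
  have hc: "h ` carrier (tate_rep \<rho> n) \<subseteq> carrier (tate_rep \<sigma> m)" and kc: "k ` carrier (tate_rep \<sigma> m) \<subseteq> carrier (tate_rep \<rho> n)"
    using h(1) k(1) by (auto simp: hom_def)
  have f: "finite (carrier (tate_rep \<rho> n))" "finite (carrier (tate_rep \<sigma> m))"
    using fin inj_on_finite[OF h(2) hc] inj_on_finite[OF k(2) kc] by blast+
  have "card (carrier (tate_rep \<sigma> m)) \<le> card (h ` carrier (tate_rep \<rho> n))"
    using card_inj_on_le[OF k(2) kc f(1)] by (simp add: card_image[OF h(2)])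
  then have "h ` carrier (tate_rep \<rho> n) = carrier (tate_rep \<sigma> m)"
    by (intro card_seteq[OF f(2) hc])
  then have "h \<in> iso (tate_rep \<rho> n) (tate_rep \<sigma> m)" using h by (simp add: iso_iff)
  then show ?thesis by (rule is_isoI)
qed

text \<open>Used to see that the kernel of the Tate differential is a group: its structure is pulled back from the cocycles of a representation.\<close>

lemma group_of_bij:
  assumes G: "group G" and b: "bij_betw f (carrier T) (carrier G)"
    and c: "\<And>x y. x \<in> carrier T \<Longrightarrow> y \<in> carrier T \<Longrightarrow> x \<otimes>\<^bsub>T\<^esub> y \<in> carrier T"
    and m: "\<And>x y. x \<in> carrier T \<Longrightarrow> y \<in> carrier T \<Longrightarrow> f (x \<otimes>\<^bsub>T\<^esub> y) = f x \<otimes>\<^bsub>G\<^esub> f y"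
    and o: "\<one>\<^bsub>T\<^esub> \<in> carrier T" "f \<one>\<^bsub>T\<^esub> = \<one>\<^bsub>G\<^esub>"
  shows "group T"
proof -
  interpret group G by fact
  have i: "x = y" if "f x = f y" "x \<in> carrier T" "y \<in> carrier T" for x y
    using b that by (auto simp: bij_betw_def inj_on_def)
  have fc: "f x \<in> carrier G" if "x \<in> carrier T" for x using b that by (auto simp: bij_betw_def)
  show ?thesis
  proof (rule groupI)
    show "\<exists>y\<in>carrier T. y \<otimes>\<^bsub>T\<^esub> x = \<one>\<^bsub>T\<^esub>" if x: "x \<in> carrier T" for x
    proof -
      have "inv\<^bsub>G\<^esub> (f x) \<in> f ` carrier T" using b fc[OF x] by (simp add: bij_betw_def)
      then obtain y where y: "y \<in> carrier T" "f y = inv\<^bsub>G\<^esub> (f x)" by force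
      have "f (y \<otimes>\<^bsub>T\<^esub> x) = f \<one>\<^bsub>T\<^esub>" using fc[OF x] by (simp add: m[OF y(1) x] y(2) o(2))
      then show ?thesis using i[OF _ c[OF y(1) x] o(1)] y(1) by blast
    qed
    show "x \<otimes>\<^bsub>T\<^esub> y \<otimes>\<^bsub>T\<^esub> z = x \<otimes>\<^bsub>T\<^esub> (y \<otimes>\<^bsub>T\<^esub> z)" if "x \<in> carrier T" "y \<in> carrier T" "z \<in> carrier T" for x y z
      by (rule i) (simp_all add: that c m fc m_assoc)
    show "\<one>\<^bsub>T\<^esub> \<otimes>\<^bsub>T\<^esub> x = x" if "x \<in> carrier T" for x
      by (rule i) (simp_all add: that c m fc o)
  qed (fact c o)+
qed

lemma dele_eq_sum: "dele c t = (\<Sum>i<length t. (- 1) ^ i *z c (take i t @ drop (Suc i) t))"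
proof (induction t arbitrary: c)
  case (Cons x t)
  show ?case
    by (simp add: Cons.IH sum.lessThan_Suc_shift sum_negf del: sum.lessThan_Suc)
qed simp

lemma inse_eq_sum: "inse c t = (\<Sum>i\<le>length t. (- 1) ^ i *z (\<Sum>g\<in>UNIV. c (take i t @ g # drop i t)))"
proof (induction t arbitrary: c)
  case (Cons x t)
  show ?case
    by (simp add: Cons.IH sum.atMost_Suc_shift sum_negf del: sum.atMost_Suc)
qed simp

context presented
begin

lemma \<kappa>_finsum:
  assumes "finite I" "\<And>i. i \<in> I \<Longrightarrow> f i \<in> carrier M"
  shows "\<kappa> (\<Oplus>\<^bsub>M\<^esub>i\<in>I. f i) = (\<Sum>i\<in>I. \<kappa> (f i)) \<and> (\<Oplus>\<^bsub>M\<^esub>i\<in>I. f i) \<in> carrier M"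
  using assms
proof (induction I rule: finite_induct)
  case empty
  then show ?case by (simp add: \<kappa>_zero)
next
  case (insert i I)
  then have "(\<Oplus>\<^bsub>M\<^esub>i\<in>insert i I. f i) = f i \<oplus>\<^bsub>M\<^esub> (\<Oplus>\<^bsub>M\<^esub>i\<in>I. f i)"
    by (intro Mod.finsum_insert) auto
  then show ?case using insert by (simp add: \<kappa>_add)
qed

lemma \<kappa>_sign:
  assumes x: "x \<in> carrier M"
  shows "\<kappa> ([((- 1) ^ i :: int)] \<cdot>\<^bsub>M\<^esub> x) = (- 1) ^ i *z \<kappa> x \<and> [((- 1) ^ i :: int)] \<cdot>\<^bsub>M\<^esub> x \<in> carrier M"
proof -
  have 1: "[(1 :: int)] \<cdot>\<^bsub>M\<^esub> x = x" using group.int_pow_1[OF Mod.a_group, of x] x by (simp add: add_pow_def)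
  have 2: "[(- 1 :: int)] \<cdot>\<^bsub>M\<^esub> x = \<ominus>\<^bsub>M\<^esub> x"
    using group.int_pow_neg[OF Mod.a_group, of x 1] group.int_pow_1[OF Mod.a_group, of x] x
    by (simp add: add_pow_def a_inv_def)
  show ?thesis
    by (cases "even i") (simp_all add: 1 2 x \<kappa>_uminus)
qed

definition to_rep :: "int \<Rightarrow> (klein list \<Rightarrow> 'a) \<Rightarrow> klein list \<Rightarrow> 'v" where
  "to_rep n c = (\<lambda>t. if t \<in> tuples n then \<kappa> (c t) else 0)"

abbreviation "gact \<equiv> (\<lambda>g x. Poly_Mapping.single g 1 \<odot>\<^bsub>M\<^esub> x)"

lemma gact_closed: "x \<in> carrier M \<Longrightarrow> Poly_Mapping.single g 1 \<odot>\<^bsub>M\<^esub> x \<in> carrier M"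
  by (rule smult_in[OF Z2G_closed(7)])

lemma to_rep_bij: "bij_betw (to_rep n) (tate_cochains gact M n) (coch \<rho> n)"
proof (rule bij_betw_byWitness[where f' = "\<lambda>c. \<lambda>t\<in>tuples n. un (c t)"])
  show "\<forall>c\<in>tate_cochains gact M n. (\<lambda>t\<in>tuples n. un (to_rep n c t)) = c"
  proof
    fix c assume c: "c \<in> tate_cochains gact M n"
    show "(\<lambda>t\<in>tuples n. un (to_rep n c t)) = c"
    proof
      fix t show "(\<lambda>t\<in>tuples n. un (to_rep n c t)) t = c t"
        using c by (cases "t \<in> tuples n") (auto simp: tate_cochains_def to_rep_def un_\<kappa> PiE_iff extensional_def)
    qed
  qed
  show "\<forall>c\<in>coch \<rho> n. to_rep n (\<lambda>t\<in>tuples n. un (c t)) = c"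
    by (auto simp: to_rep_def fun_eq_iff \<kappa>_un coch_fix cochD(1))
  show "to_rep n ` tate_cochains gact M n \<subseteq> coch \<rho> n"
  proof
    fix c' assume "c' \<in> to_rep n ` tate_cochains gact M n"
    then obtain c where c: "c \<in> tate_cochains gact M n" "c' = to_rep n c" by blast
    have cc: "c t \<in> carrier M" if "t \<in> tuples n" for t using c that by (auto simp: tate_cochains_def)
    have ce: "c (map ((+) g) t) = gact g (c t)" if "t \<in> tuples n" for g t
      using c that unfolding tate_cochains_def by blast
    show "c' \<in> coch \<rho> n"
      by (rule cochI) (auto simp: c(2) to_rep_def ce \<kappa>_group cc zlin_zero[OF rep_lin])
  qed
  show "(\<lambda>c. \<lambda>t\<in>tuples n. un (c t)) ` coch \<rho> n \<subseteq> tate_cochains gact M n"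
  proof
    fix c' assume "c' \<in> (\<lambda>c. \<lambda>t\<in>tuples n. un (c t)) ` coch \<rho> n"
    then obtain c where c: "c \<in> coch \<rho> n" "c' = (\<lambda>t\<in>tuples n. un (c t))" by blast
    have "un (\<rho> g v) = gact g (un v)" for g v
      using un_act[of "Poly_Mapping.single g 1" v] by (simp add: Z2G_closed act_single)
    then show "c' \<in> tate_cochains gact M n"
      unfolding tate_cochains_def c(2) using un_closed cochD(2)[OF c(1)] by auto
  qed
qed

lemma cochain_closed: "c \<in> tate_cochains gact M n \<Longrightarrow> t \<in> tuples n \<Longrightarrow> c t \<in> carrier M"
  by (auto simp: tate_cochains_def)

lemma tate_diff_value:
  assumes c: "c \<in> tate_cochains gact M n" and t: "t \<in> tuples (n + 1)"
  shows "\<kappa> (tate_diff M n c t) = dif n (to_rep n c) t \<and> tate_diff M n c t \<in> carrier M"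
proof -
  have cc: "c u \<in> carrier M" "\<kappa> (c u) = to_rep n c u" if "u \<in> tuples n" for u
    using cochain_closed[OF c that] that by (auto simp: to_rep_def)
  consider "n \<ge> 0" | "n = -1" | "n \<le> -2" by linarith
  then show ?thesis
  proof cases
    case 1
    have len: "take i t @ drop (Suc i) t \<in> tuples n" if "i < length t" for i
      using 1 t that by (auto simp: tuples_def)
    have "\<kappa> (\<Oplus>\<^bsub>M\<^esub>i\<in>{..<length t}. [((- 1) ^ i :: int)] \<cdot>\<^bsub>M\<^esub> c (take i t @ drop (Suc i) t)) =
        (\<Sum>i<length t. \<kappa> ([((- 1) ^ i :: int)] \<cdot>\<^bsub>M\<^esub> c (take i t @ drop (Suc i) t))) \<and>
      (\<Oplus>\<^bsub>M\<^esub>i\<in>{..<length t}. [((- 1) ^ i :: int)] \<cdot>\<^bsub>M\<^esub> c (take i t @ drop (Suc i) t)) \<in> carrier M"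
      using \<kappa>_sign[OF cc(1)[OF len]] by (intro \<kappa>_finsum) auto
    moreover have "\<kappa> ([((- 1) ^ i :: int)] \<cdot>\<^bsub>M\<^esub> c (take i t @ drop (Suc i) t)) =
        (- 1) ^ i *z to_rep n c (take i t @ drop (Suc i) t)" if "i < length t" for i
      using \<kappa>_sign[OF cc(1)[OF len[OF that]]] cc(2)[OF len[OF that]] by simp
    ultimately show ?thesis using 1 t by (simp add: tate_diff_def dif_def dele_eq_sum)
  next
    case 2
    have "[g] \<in> tuples n" for g :: klein using 2 by (simp add: tuples_def)
    then have "\<kappa> (\<Oplus>\<^bsub>M\<^esub>g\<in>UNIV. c [g]) = (\<Sum>g\<in>UNIV. to_rep n c [g]) \<and> (\<Oplus>\<^bsub>M\<^esub>g\<in>UNIV. c [g]) \<in> carrier M"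
      using \<kappa>_finsum[OF finite_klein, of "\<lambda>g. c [g]"] cc by simp
    then show ?thesis using 2 t by (simp add: tate_diff_def dif_def)
  next
    case 3
    define S where "S i = (\<Oplus>\<^bsub>M\<^esub>g\<in>UNIV. c (take i t @ g # drop i t))" for i
    have S: "\<kappa> (S i) = (\<Sum>g\<in>UNIV. to_rep n c (take i t @ g # drop i t))" "S i \<in> carrier M" if "i \<le> length t" for i
    proof -
      have "take i t @ g # drop i t \<in> tuples n" for g using 3 t that by (auto simp: tuples_def)
      then show "\<kappa> (S i) = (\<Sum>g\<in>UNIV. to_rep n c (take i t @ g # drop i t))" "S i \<in> carrier M"
        unfolding S_def using \<kappa>_finsum[OF finite_klein, of "\<lambda>g. c (take i t @ g # drop i t)"] cc by simp_all
    qed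
    have "\<kappa> (\<Oplus>\<^bsub>M\<^esub>i\<in>{..length t}. [((- 1) ^ i :: int)] \<cdot>\<^bsub>M\<^esub> S i) = (\<Sum>i\<le>length t. \<kappa> ([((- 1) ^ i :: int)] \<cdot>\<^bsub>M\<^esub> S i)) \<and>
      (\<Oplus>\<^bsub>M\<^esub>i\<in>{..length t}. [((- 1) ^ i :: int)] \<cdot>\<^bsub>M\<^esub> S i) \<in> carrier M"
      using \<kappa>_sign[OF S(2)] by (intro \<kappa>_finsum) auto
    moreover have "\<kappa> ([((- 1) ^ i :: int)] \<cdot>\<^bsub>M\<^esub> S i) = (- 1) ^ i *z (\<Sum>g\<in>UNIV. to_rep n c (take i t @ g # drop i t))"
      if "i \<le> length t" for i
      using \<kappa>_sign[OF S(2)[OF that]] S(1)[OF that] by simp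
    ultimately show ?thesis using 3 t by (simp add: tate_diff_def dif_def inse_eq_sum S_def)
  qed
qed

lemma to_rep_diff:
  assumes c: "c \<in> tate_cochains gact M n"
  shows "to_rep (n + 1) (tate_diff M n c) = dif n (to_rep n c)" "tate_diff M n c \<in> tate_cochains gact M (n + 1)"
proof -
  show 1: "to_rep (n + 1) (tate_diff M n c) = dif n (to_rep n c)"
    using tate_diff_value[OF c] by (auto simp: to_rep_def fun_eq_iff dif_outside)
  have cc: "to_rep n c \<in> coch \<rho> n" using to_rep_bij c by (auto simp: bij_betw_def)
  have "tate_diff M n c (map ((+) g) t) = gact g (tate_diff M n c t)" if t: "t \<in> tuples (n + 1)" for g t
  proof (rule inj_onD[OF inj])
    have "dif n (to_rep n c) (map ((+) g) t) = \<rho> g (dif n (to_rep n c) t)"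
      by (rule cochD(2)[OF coch_dif[OF glat cc]])
    then show "\<kappa> (tate_diff M n c (map ((+) g) t)) = \<kappa> (gact g (tate_diff M n c t))"
      using tate_diff_value[OF c, of t] tate_diff_value[OF c, of "map ((+) g) t"] t by (simp add: \<kappa>_group)
  qed (use t tate_diff_value[OF c] gact_closed in auto)
  moreover have "tate_diff M n c \<in> tuples (n + 1) \<rightarrow>\<^sub>E carrier M"
    using tate_diff_value[OF c] by (auto simp: tate_diff_def PiE_iff)
  ultimately show "tate_diff M n c \<in> tate_cochains gact M (n + 1)" by (simp add: tate_cochains_def)
qed

lemma tate_iso: "tate n M \<cong> tate_rep \<rho> n"
proof -
  define T where "T = (tate_group gact M n)\<lparr>carrier := kernel (tate_group gact M n) (tate_group gact M (n + 1)) (tate_diff M n)\<rparr>"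
  note bd = to_rep_bij[of n, unfolded bij_betw_def]
  have T: "carrier T = {c \<in> tate_cochains gact M n. dif n (to_rep n c) = 0}"
  proof -
    have "tate_diff M n c = (\<lambda>s\<in>tuples (n + 1). \<zero>\<^bsub>M\<^esub>) \<longleftrightarrow> dif n (to_rep n c) = 0" if c: "c \<in> tate_cochains gact M n" for c
    proof
      assume "tate_diff M n c = (\<lambda>s\<in>tuples (n + 1). \<zero>\<^bsub>M\<^esub>)"
      then show "dif n (to_rep n c) = 0"
        unfolding to_rep_diff(1)[OF c, symmetric] by (simp add: to_rep_def \<kappa>_zero fun_eq_iff)
    next
      assume z: "dif n (to_rep n c) = 0"
      show "tate_diff M n c = (\<lambda>s\<in>tuples (n + 1). \<zero>\<^bsub>M\<^esub>)"
      proof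
        fix t show "tate_diff M n c t = (\<lambda>s\<in>tuples (n + 1). \<zero>\<^bsub>M\<^esub>) t"
        proof (cases "t \<in> tuples (n + 1)")
          case True
          then show ?thesis using tate_diff_value[OF c True] z \<kappa>_eq_0[of "tate_diff M n c t"] by simp
        qed (simp add: tate_diff_def)
      qed
    qed
    then show ?thesis by (auto simp: T_def kernel_def tate_group_def)
  qed
  have Tm: "x \<otimes>\<^bsub>T\<^esub> y = (\<lambda>s\<in>tuples n. x s \<oplus>\<^bsub>M\<^esub> y s)" "\<one>\<^bsub>T\<^esub> = (\<lambda>s\<in>tuples n. \<zero>\<^bsub>M\<^esub>)" for x y
    by (simp_all add: T_def tate_group_def)
  have fm: "to_rep n (x \<otimes>\<^bsub>T\<^esub> y) = to_rep n x + to_rep n y" if "x \<in> tate_cochains gact M n" "y \<in> tate_cochains gact M n" for x y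
    using cochain_closed[OF that(1)] cochain_closed[OF that(2)] by (auto simp: Tm to_rep_def fun_eq_iff \<kappa>_add)
  have f1: "to_rep n \<one>\<^bsub>T\<^esub> = 0" by (auto simp: Tm to_rep_def fun_eq_iff \<kappa>_zero)
  have Tc: "x \<otimes>\<^bsub>T\<^esub> y \<in> tate_cochains gact M n" if x: "x \<in> tate_cochains gact M n" and y: "y \<in> tate_cochains gact M n" for x y
  proof -
    have "gact g (x s \<oplus>\<^bsub>M\<^esub> y s) = gact g (x s) \<oplus>\<^bsub>M\<^esub> gact g (y s)" if "s \<in> tuples n" for g s
      by (rule Mod.smult_r_distr) (simp_all add: Z2G_closed cochain_closed[OF x that] cochain_closed[OF y that])
    moreover have "x (map ((+) g) s) = gact g (x s)" "y (map ((+) g) s) = gact g (y s)" if "s \<in> tuples n" for g s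
      using x y that unfolding tate_cochains_def by blast+
    ultimately show ?thesis
      unfolding Tm tate_cochains_def using cochain_closed[OF x] cochain_closed[OF y] by auto
  qed
  have T1: "\<one>\<^bsub>T\<^esub> \<in> tate_cochains gact M n"
    unfolding Tm tate_cochains_def using Mod.smult_r_null[of "Poly_Mapping.single _ 1"] by (auto simp: Z2G_closed)
  have b: "bij_betw (to_rep n) (carrier T) (carrier (cocycle_group \<rho> n))"
  proof -
    have "to_rep n ` carrier T = cocy \<rho> n"
      unfolding T cocy_def using bd by auto
    moreover have "inj_on (to_rep n) (carrier T)" unfolding T using bd by (auto intro: inj_on_subset)
    ultimately show ?thesis by (simp add: bij_betw_def)
  qed
  interpret C: comm_group "cocycle_group \<rho> n" by (rule comm_group_cocycle_group[OF glat])
  have gT: "group T"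
    by (rule group_of_bij[OF C.group_axioms b])
      (auto simp: fm f1, auto simp: T Tc T1 fm f1 zlin_add[OF zlin_dif] zlin_zero[OF zlin_dif])
  have h: "to_rep n \<in> hom T (cocycle_group \<rho> n)"
    using b fm by (auto simp: hom_def bij_betw_def T)
  note g = coset_map_group_hom[OF normal_cobd[OF glat] gT h]
  have "{x \<in> carrier T. to_rep n x \<in> cobd \<rho> n} = tate_diff M (n - 1) ` tate_cochains gact M (n - 1)"
  proof (intro subset_antisym subsetI)
    fix x assume "x \<in> {x \<in> carrier T. to_rep n x \<in> cobd \<rho> n}"
    then have x: "x \<in> tate_cochains gact M n" "to_rep n x \<in> cobd \<rho> n" by (auto simp: T)
    then obtain w where w: "w \<in> coch \<rho> (n - 1)" "to_rep n x = dif (n - 1) w" by (auto simp: cobd_def)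
    obtain y where y: "y \<in> tate_cochains gact M (n - 1)" "w = to_rep (n - 1) y"
      using to_rep_bij[of "n - 1"] w(1) by (auto simp: bij_betw_def)
    have "to_rep n x = to_rep n (tate_diff M (n - 1) y)" using to_rep_diff(1)[OF y(1)] w(2) y(2) by simp
    then have "x = tate_diff M (n - 1) y"
      using bd x(1) to_rep_diff(2)[OF y(1)] by (auto simp: inj_on_def)
    then show "x \<in> tate_diff M (n - 1) ` tate_cochains gact M (n - 1)" using y(1) by blast
  next
    fix x assume "x \<in> tate_diff M (n - 1) ` tate_cochains gact M (n - 1)"
    then obtain y where y: "y \<in> tate_cochains gact M (n - 1)" "x = tate_diff M (n - 1) y" by blast
    have x: "to_rep n x = dif (n - 1) (to_rep (n - 1) y)" "x \<in> tate_cochains gact M n"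
      using to_rep_diff[OF y(1)] by (simp_all add: y(2))
    have "to_rep (n - 1) y \<in> coch \<rho> (n - 1)" using to_rep_bij[of "n - 1"] y(1) by (auto simp: bij_betw_def)
    then have c: "to_rep n x \<in> cobd \<rho> n" unfolding x(1) cobd_def by blast
    then have "dif n (to_rep n x) = 0" using cobd_sub_cocy[OF glat] cocyD(2) by blast
    then show "x \<in> {x \<in> carrier T. to_rep n x \<in> cobd \<rho> n}" using x(2) c by (simp add: T)
  qed
  note k = g(2)[unfolded this]
  interpret group_hom T "cocycle_group \<rho> n Mod cobd \<rho> n" "\<lambda>x. cobd \<rho> n #>\<^bsub>cocycle_group \<rho> n\<^esub> to_rep n x" by (rule g(1))
  have "(\<lambda>x. cobd \<rho> n #>\<^bsub>cocycle_group \<rho> n\<^esub> to_rep n x) ` carrier T = carrier (cocycle_group \<rho> n Mod cobd \<rho> n)"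
  proof -
    have "(\<lambda>x. cobd \<rho> n #>\<^bsub>cocycle_group \<rho> n\<^esub> to_rep n x) ` carrier T =
        (\<lambda>x. cobd \<rho> n #>\<^bsub>cocycle_group \<rho> n\<^esub> x) ` (to_rep n ` carrier T)" by (simp add: image_image)
    then show ?thesis using b by (auto simp: bij_betw_def FactGroup_def RCOSETS_def)
  qed
  from FactGroup_iso[OF this, unfolded k] show ?thesis
    by (simp add: tate_def tate_cohomology_def tate_rep_def T_def)
qed

end

lemma F2_sum_simps: "carrier (F2_sum r) = {..<r} \<rightarrow>\<^sub>E UNIV" "x \<otimes>\<^bsub>F2_sum r\<^esub> y = (\<lambda>i\<in>{..<r}. x i + y i)"
  "\<one>\<^bsub>F2_sum r\<^esub> = (\<lambda>i\<in>{..<r}. 0)" "group (F2_sum r)"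
proof -
  have g: "group \<lparr>carrier = (UNIV :: bit set), mult = (+), one = 0\<rparr>"
    by (rule groupI) (auto simp: add_ac intro: exI[of _ "- _"])
  show "carrier (F2_sum r) = {..<r} \<rightarrow>\<^sub>E UNIV" unfolding F2_sum_def by (subst carrier_sum_group[OF g]) auto
  show "group (F2_sum r)" unfolding F2_sum_def by (rule sum_group[OF g])
  show "x \<otimes>\<^bsub>F2_sum r\<^esub> y = (\<lambda>i\<in>{..<r}. x i + y i)" "\<one>\<^bsub>F2_sum r\<^esub> = (\<lambda>i\<in>{..<r}. 0)"
    by (simp_all add: F2_sum_def)
qed

lemma finite_F2_sum: "finite (carrier (F2_sum r))"
  by (simp add: F2_sum_simps finite_PiE UNIV_bit)

text \<open>A cocycle of degree zero is a constant function with fixed value, and a coboundary is one whose value is a norm. So the group is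
the quotient of the fixed points by the norms, here computed by a map \<open>\<theta>\<close>.\<close>

lemma tate_rep_0:
  assumes \<rho>: "glat \<rho>"
    and onto: "\<theta> ` {v. \<forall>g. \<rho> g v = v} = {..<r} \<rightarrow>\<^sub>E UNIV"
    and add: "\<And>v w. \<forall>g. \<rho> g v = v \<Longrightarrow> \<forall>g. \<rho> g w = w \<Longrightarrow> \<theta> (v + w) = (\<lambda>i\<in>{..<r}. \<theta> v i + \<theta> w i :: bit)"
    and ker: "\<And>v. \<forall>g. \<rho> g v = v \<Longrightarrow> \<theta> v = (\<lambda>i\<in>{..<r}. 0) \<longleftrightarrow> (\<exists>w. v = (\<Sum>g\<in>UNIV. \<rho> g w))"
  shows "tate_rep \<rho> 0 \<cong> F2_sum r"
proof -
  have s1: "[x] \<in> tuples 0" "[x] \<in> tuples (- 1)" for x :: klein by (simp_all add: tuples_def)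
  have cons: "c [x] = c [0]" if "c \<in> cocy \<rho> 0" for c x
  proof -
    have "dif 0 c [0, x] = 0" using cocyD(2)[OF that] by simp
    then show ?thesis by (simp add: dif_def tuples_def)
  qed
  have fixed: "\<rho> g (c [0]) = c [0]" if "c \<in> cocy \<rho> 0" for c g
    using cochD(2)[OF cocyD(1)[OF that], of g "[0]"] cons[OF that, of g] by simp
  have tup: "\<exists>x. t = [x]" if "t \<in> tuples 0" for t :: "klein list"
    using that by (auto simp: tuples_def length_Suc_conv)
  define const where "const v t = (if t \<in> tuples 0 then v else 0 :: 'a)" for v and t :: "klein list"
  have const: "const v \<in> cocy \<rho> 0" if v: "\<forall>g. \<rho> g v = v" for v
  proof -
    have "const v \<in> coch \<rho> 0" by (rule cochI) (auto simp: const_def v zlin_zero[OF glat_lin[OF \<rho>]])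
    moreover have "dif 0 (const v) t = 0" for t
    proof (cases "t \<in> tuples 1")
      case True
      then obtain x y where "t = [x, y]" by (auto simp: tuples_def length_Suc_conv numeral_2_eq_2)
      then show ?thesis by (simp add: dif_def const_def tuples_def)
    qed (simp add: dif_def)
    ultimately show ?thesis by (simp add: cocy_def fun_eq_iff)
  qed
  have c0: "const v [0] = v" for v by (simp add: const_def s1)
  have img: "(\<lambda>c. \<theta> (c [0])) ` cocy \<rho> 0 = {..<r} \<rightarrow>\<^sub>E UNIV"
  proof -
    have "(\<lambda>c. c [0]) ` cocy \<rho> 0 = {v. \<forall>g. \<rho> g v = v}"
    proof (intro subset_antisym subsetI)
      fix v assume "v \<in> {v. \<forall>g. \<rho> g v = v}"
      then have "const v \<in> cocy \<rho> 0" using const[of v] by blast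
      then show "v \<in> (\<lambda>c. c [0]) ` cocy \<rho> 0" by (intro image_eqI[of v "\<lambda>c. c [0]" "const v"] c0[symmetric])
    next
      fix v assume "v \<in> (\<lambda>c. c [0]) ` cocy \<rho> 0"
      then obtain c where "c \<in> cocy \<rho> 0" "v = c [0]" by blast
      then show "v \<in> {v. \<forall>g. \<rho> g v = v}" using fixed[of c] by simp
    qed
    then show ?thesis using onto by (metis image_image)
  qed
  have hom: "(\<lambda>c. \<theta> (c [0])) \<in> hom (cocycle_group \<rho> 0) (F2_sum r)"
  proof (rule homI)
    show "\<theta> (c [0]) \<in> carrier (F2_sum r)" if "c \<in> carrier (cocycle_group \<rho> 0)" for c
      using img that by (auto simp: F2_sum_simps(1))
    show "\<theta> ((c \<otimes>\<^bsub>cocycle_group \<rho> 0\<^esub> d) [0]) = \<theta> (c [0]) \<otimes>\<^bsub>F2_sum r\<^esub> \<theta> (d [0])"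
      if "c \<in> carrier (cocycle_group \<rho> 0)" "d \<in> carrier (cocycle_group \<rho> 0)" for c d
    proof -
      have "\<forall>g. \<rho> g (c [0]) = c [0]" "\<forall>g. \<rho> g (d [0]) = d [0]" using fixed[of c] fixed[of d] that by simp_all
      from add[OF this] show ?thesis by (simp add: F2_sum_simps)
    qed
  qed
  have gh: "group_hom (cocycle_group \<rho> 0) (F2_sum r) (\<lambda>c. \<theta> (c [0]))"
    using comm_group.axioms(2)[OF comm_group_cocycle_group[OF \<rho>]] F2_sum_simps(4) hom
    by (simp add: group_hom_def group_hom_axioms_def)
  have "kernel (cocycle_group \<rho> 0) (F2_sum r) (\<lambda>c. \<theta> (c [0])) = cobd \<rho> 0"
  proof (intro subset_antisym subsetI)
    fix c assume "c \<in> kernel (cocycle_group \<rho> 0) (F2_sum r) (\<lambda>c. \<theta> (c [0]))"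
    then have c: "c \<in> cocy \<rho> 0" "\<theta> (c [0]) = (\<lambda>i\<in>{..<r}. 0)" by (simp_all add: kernel_def F2_sum_simps)
    then obtain w where w: "c [0] = (\<Sum>g\<in>UNIV. \<rho> g w)" using ker[of "c [0]"] fixed[OF c(1)] by blast
    define b where "b t = (if t \<in> tuples (- 1) then \<rho> (hd t) w else 0)" for t
    have "b \<in> coch \<rho> (- 1)"
      by (rule cochI) (auto simp: b_def hd_map_add glat_mult[OF \<rho>] zlin_zero[OF glat_lin[OF \<rho>]])
    moreover have "c = dif (- 1) b"
    proof
      fix t show "c t = dif (- 1) b t"
      proof (cases "t \<in> tuples 0")
        case True
        then obtain x where "t = [x]" using tup by blast
        then show ?thesis using True cons[OF c(1)] by (simp add: dif_def w b_def s1)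
      qed (simp add: cochD(1)[OF cocyD(1)[OF c(1)]] dif_def)
    qed
    ultimately show "c \<in> cobd \<rho> 0" by (auto simp: cobd_def)
  next
    fix c assume c: "c \<in> cobd \<rho> 0"
    then have cc: "c \<in> cocy \<rho> 0" using cobd_sub_cocy[OF \<rho>] by blast
    obtain b where b: "b \<in> coch \<rho> (- 1)" "c = dif (- 1) b" using c by (auto simp: cobd_def)
    have e: "b [g] = \<rho> g (b [0])" for g using cochD(2)[OF b(1), of g "[0]"] by simp
    have "c [0] = (\<Sum>g\<in>UNIV. b [g])" by (simp add: b(2) dif_def s1)
    also have "\<dots> = (\<Sum>g\<in>UNIV. \<rho> g (b [0]))" by (intro sum.cong refl e)
    finally have "\<theta> (c [0]) = (\<lambda>i\<in>{..<r}. 0)" using ker[of "c [0]"] fixed[OF cc] by blast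
    then show "c \<in> kernel (cocycle_group \<rho> 0) (F2_sum r) (\<lambda>c. \<theta> (c [0]))"
      using cc by (simp add: kernel_def F2_sum_simps)
  qed
  then show ?thesis using group_hom.FactGroup_iso[OF gh] img unfolding tate_rep_def by (simp add: F2_sum_simps)
qed

section \<open>The minimal overring\<close>

lemma sum_klein: "(\<Sum>g\<in>(UNIV :: klein set). f g) = f (0, 0) + f (0, 1) + f (1, 0) + f (1, 1)"
  by (simp add: UNIV_bit sum.cartesian_product' flip: UNIV_Times_UNIV) (simp add: add_ac)

text \<open>Such an element divides a 2-adic unit: multiplying by its conjugates under \<open>b \<mapsto> - b\<close> and then \<open>a \<mapsto> - a\<close> leaves
a scalar, which is odd.\<close>

lemma Z2G_odd_unit:
  assumes y: "y \<in> Z2G" "\<not> 2 dvd co y 0" "\<And>g. g \<noteq> 0 \<Longrightarrow> 2 dvd co y g"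
  shows "\<exists>z\<in>Z2G. z * y = 1"
proof -
  define a :: q2G where "a = Poly_Mapping.single (1, 0) 1"
  define b :: q2G where "b = Poly_Mapping.single (0, 1) 1"
  have ab: "a * a = 1" "b * b = 1" "a * b = Poly_Mapping.single (1, 1) 1"
    by (simp_all add: a_def b_def mult_single single_one[symmetric] zero_prod_def[symmetric] del: single_one)
  define s where "s g = scalar (co y g)" for g
  have "y = (\<Sum>g\<in>UNIV. s g * Poly_Mapping.single g 1)"
    using q2G_expand[of y] by (simp add: s_def scalar_simps to_fract_co[OF y(1)])
  also have "\<dots> = s (0,0) + s (1,0) * a + (s (0,1) + s (1,1) * a) * b"
    unfolding sum_klein by (simp add: ab(3)[symmetric] a_def[symmetric] b_def[symmetric] distrib_right mult.assoc
        zero_prod_def[symmetric] add_ac)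
  finally have y_eq: "y = s (0,0) + s (1,0) * a + (s (0,1) + s (1,1) * a) * b" .
  define c0 where "c0 = co y (0,0) ^ 2 + co y (1,0) ^ 2 - co y (0,1) ^ 2 - co y (1,1) ^ 2"
  define c1 where "c1 = 2 * (co y (0,0) * co y (1,0) - co y (0,1) * co y (1,1))"
  have sc_diff: "scalar (c - d) = scalar c - scalar d" for c d
    by (simp add: scalar_def single_diff)
  \<comment> \<open>The conjugate of \<open>y\<close> under \<open>b \<mapsto> - b\<close>; the product with \<open>y\<close> lies in the subring generated by \<open>a\<close>.\<close>
  define w where "w = s (0,0) + s (1,0) * a - (s (0,1) + s (1,1) * a) * b"
  have yw: "y * w = scalar c0 + scalar c1 * a"
  proof -
    have two: "scalar 2 = 2" using scalar_simps(3)[of 1 1] by (simp add: scalar_simps)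
    have "y * w = (s (0,0) + s (1,0) * a) * (s (0,0) + s (1,0) * a) -
        (s (0,1) + s (1,1) * a) * (s (0,1) + s (1,1) * a) * (b * b)"
      by (simp add: y_eq w_def algebra_simps)
    also have "\<dots> = s (0,0) * s (0,0) + s (1,0) * s (1,0) * (a * a) + 2 * (s (0,0) * s (1,0)) * a -
        (s (0,1) * s (0,1) + s (1,1) * s (1,1) * (a * a) + 2 * (s (0,1) * s (1,1)) * a)"
      unfolding ab(2) by (simp add: algebra_simps)
    also have "\<dots> = scalar c0 + scalar c1 * a"
      unfolding ab(1) by (simp add: c0_def c1_def s_def sc_diff scalar_simps power2_eq_square two algebra_simps)
    finally show ?thesis .
  qed
  have "y * w * (scalar c0 - scalar c1 * a) = scalar (c0 * c0) - scalar (c1 * c1) * (a * a)"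
    unfolding yw by (simp add: algebra_simps scalar_simps)
  then have norm: "y * w * (scalar c0 - scalar c1 * a) = scalar (c0 * c0 - c1 * c1)"
    by (simp add: ab sc_diff)
  have sq: "2 dvd x ^ 2 \<longleftrightarrow> 2 dvd x" for x :: z2adic by (simp add: power2_eq_square prime_two)
  have nz: "2 dvd co y (1,0)" "2 dvd co y (0,1)" "2 dvd co y (1,1)"
    using y(3) by (simp_all add: zero_prod_def)
  have "\<not> 2 dvd c0"
  proof
    assume "2 dvd c0"
    then have "2 dvd c0 - co y (1,0) ^ 2 + co y (0,1) ^ 2 + co y (1,1) ^ 2"
      using nz sq by (intro dvd_add dvd_diff) auto
    then have "2 dvd co y (0,0) ^ 2" by (simp add: c0_def)
    then show False using y(2) sq by (simp add: zero_prod_def)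
  qed
  moreover have "2 dvd c1" by (simp add: c1_def)
  ultimately have "\<not> 2 dvd (c0 * c0 - c1 * c1)"
    by (metis diff_add_cancel dvd_add dvd_mult prime_two)
  then obtain u where u: "(c0 * c0 - c1 * c1) * u = 1" using odd_z2adic_is_unit by blast
  define z where "z = scalar u * (w * (scalar c0 - scalar c1 * a))"
  have "z * y = scalar u * (y * w * (scalar c0 - scalar c1 * a))" by (simp add: z_def mult_ac)
  also have "\<dots> = scalar u * scalar (c0 * c0 - c1 * c1)" by (simp only: norm)
  also have "\<dots> = scalar ((c0 * c0 - c1 * c1) * u)" by (simp only: scalar_simps(4) mult.commute)
  finally have "z * y = 1" by (simp add: u scalar_simps)
  moreover have "z \<in> Z2G"
  proof -
    have minus: "x - x' \<in> Z2G" if "x \<in> Z2G" "x' \<in> Z2G" for x x'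
      using Z2G_closed(3)[OF that(1) Z2G_closed(5)[OF that(2)]] by simp
    then show ?thesis unfolding z_def w_def s_def a_def b_def by (intro minus Z2G_closed(3,4,6,7))
  qed
  ultimately show ?thesis by blast
qed

text \<open>If \<open>2\<close> were outside a maximal ideal, the ideal would contain some \<open>1 - 2 r\<close>, which is a unit. The square of \<open>g - 1\<close> is a multiple
of \<open>2\<close>.\<close>

lemma maximalideal_props:
  assumes I: "maximalideal I (ring_on Z2G)"
  shows "2 \<in> I" "Poly_Mapping.single g 1 - 1 \<in> I"
    "x \<in> I \<Longrightarrow> y \<in> I \<Longrightarrow> x + y \<in> I" "x \<in> I \<Longrightarrow> - x \<in> I" "x \<in> I \<Longrightarrow> r \<in> Z2G \<Longrightarrow> x * r \<in> I" "0 \<in> I" "I \<subseteq> Z2G"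
proof -
  interpret R: cring "ring_on Z2G" by (rule cring_Z2G)
  interpret maximalideal I "ring_on Z2G" by fact
  have idl: "ideal I (ring_on Z2G)" by (rule is_ideal)
  show sub: "I \<subseteq> Z2G" using a_subset by simp
  show zero: "0 \<in> I" using zero_closed by simp
  show add: "x \<in> I \<Longrightarrow> y \<in> I \<Longrightarrow> x + y \<in> I" for x y using a_closed[of x y] by simp
  show mult: "x \<in> I \<Longrightarrow> r \<in> Z2G \<Longrightarrow> x * r \<in> I" for x r using I_r_closed[of x r] by simp
  show neg: "x \<in> I \<Longrightarrow> - x \<in> I" for x
    using mult[of x "- 1"] Z2G_closed(2,5) by simp
  have two: "(2 :: q2G) \<in> Z2G" using Z2G_closed(3)[OF Z2G_closed(2) Z2G_closed(2)] by simp
  have scalar2: "scalar 2 = 2" using scalar_simps(3)[of 1 1] by (simp add: scalar_simps)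
  show 2: "2 \<in> I"
  proof (rule ccontr)
    assume n: "2 \<notin> I"
    define J where "J = {i + 2 * r | i r. i \<in> I \<and> r \<in> Z2G}"
    have Jc: "J \<subseteq> Z2G" using sub two by (auto simp: J_def Z2G_closed)
    have "ideal J (ring_on Z2G)"
    proof (rule idealI)
      show "ring (ring_on Z2G)" by (rule R.ring_axioms)
      show "subgroup J (add_monoid (ring_on Z2G))"
      proof (rule R.add.subgroupI)
        show "J \<subseteq> carrier (ring_on Z2G)" using Jc by simp
        show "J \<noteq> {}" using zero Z2G_closed(1) by (auto simp: J_def)
        show "\<ominus>\<^bsub>ring_on Z2G\<^esub> x \<in> J" if xJ: "x \<in> J" for x
        proof -
          obtain i r where x: "i \<in> I" "r \<in> Z2G" "x = i + 2 * r" using xJ unfolding J_def by blast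
          have "\<ominus>\<^bsub>ring_on Z2G\<^esub> x = - x"
            using xJ Jc Z2G_closed(5)[of x] by (intro R.minus_equality) auto
          also have "\<dots> = - i + 2 * (- r)" by (simp add: x(3))
          finally show ?thesis unfolding J_def using neg[OF x(1)] Z2G_closed(5)[OF x(2)] by blast
        qed
        show "x \<oplus>\<^bsub>ring_on Z2G\<^esub> y \<in> J" if "x \<in> J" "y \<in> J" for x y
        proof -
          obtain i r i' r' where x: "i \<in> I" "r \<in> Z2G" "x = i + 2 * r" "i' \<in> I" "r' \<in> Z2G" "y = i' + 2 * r'"
            using \<open>x \<in> J\<close> \<open>y \<in> J\<close> unfolding J_def by blast
          have "x \<oplus>\<^bsub>ring_on Z2G\<^esub> y = (i + i') + 2 * (r + r')" by (simp add: x algebra_simps)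
          then show ?thesis unfolding J_def using add[OF x(1,4)] Z2G_closed(3)[OF x(2,5)] by blast
        qed
      qed
      show xJ: "x \<otimes>\<^bsub>ring_on Z2G\<^esub> a \<in> J" if a: "a \<in> J" and x: "x \<in> carrier (ring_on Z2G)" for a x
      proof -
        obtain i r where a: "i \<in> I" "r \<in> Z2G" "a = i + 2 * r" using a unfolding J_def by blast
        have xZ: "x \<in> Z2G" using x by simp
        have "x \<otimes>\<^bsub>ring_on Z2G\<^esub> a = i * x + 2 * (r * x)" by (simp add: a algebra_simps)
        then show ?thesis unfolding J_def using mult[OF a(1) xZ] Z2G_closed(4)[OF a(2) xZ] by blast
      qed
      show "a \<otimes>\<^bsub>ring_on Z2G\<^esub> x \<in> J" if "a \<in> J" "x \<in> carrier (ring_on Z2G)" for a x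
        using xJ[OF that] by (simp add: mult.commute)
    qed
    moreover have "I \<subseteq> J"
    proof
      fix i assume "i \<in> I"
      then show "i \<in> J" unfolding J_def using Z2G_closed(1) by (intro CollectI exI[of _ i] exI[of _ 0]) simp
    qed
    moreover have "2 \<in> J" unfolding J_def using zero Z2G_closed(2) by (intro CollectI exI[of _ 0] exI[of _ 1]) simp
    ultimately have "J = Z2G" using I_maximal[of J] Jc n by auto
    then have "1 \<in> J" using Z2G_closed(2) by simp
    then obtain i r where ir: "i \<in> I" "r \<in> Z2G" "1 = i + 2 * r" by (auto simp: J_def)
    have i: "i \<in> Z2G" using ir(1) sub by blast
    have m2: "- (2 * r) = scalar (- 2) * r" by (simp add: scalar_simps scalar2)
    have mz: "scalar (- 2) * r \<in> Z2G" using Z2G_closed(4)[OF Z2G_closed(6) ir(2)] .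
    have "i = 1 + - (2 * r)" using ir(3) by (simp add: eq_diff_eq)
    then have i_eq: "i = 1 + scalar (- 2) * r" unfolding m2 .
    have cm: "co (scalar (- 2) * r) g = - 2 * co r g" for g
    proof (rule co_eq)
      show "to_fract (- 2 * co r g) = Poly_Mapping.lookup (scalar (- 2) * r) g"
      proof -
        have "Poly_Mapping.lookup (scalar (- 2) * r) g =
            (\<Sum>h\<in>(UNIV :: klein set). if h = 0 then to_fract (- 2) * Poly_Mapping.lookup r g else 0)"
          unfolding lookup_q2G_mult by (rule sum.cong[OF refl]) (auto simp: scalar_def lookup_single when_def)
        then show ?thesis by (simp add: finite_klein to_fract_co[OF ir(2)])
      qed
    qed
    have ci: "co i g = co 1 g - 2 * co r g" for g
      unfolding i_eq co_add[OF Z2G_closed(2) mz] cm by simp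
    have "\<not> 2 dvd co i 0"
    proof
      assume "2 dvd co i 0"
      then have "2 dvd co i 0 + 2 * co r 0" by (intro dvd_add) auto
      then show False using not_two_dvd_one by (simp add: ci co_simps)
    qed
    moreover have "2 dvd co i g" if "g \<noteq> 0" for g using that by (simp add: ci co_simps)
    ultimately obtain z where z: "z \<in> Z2G" "z * i = 1" using Z2G_odd_unit[OF i] by blast
    then have "1 \<in> I" using mult[OF ir(1) z(1)] by (simp add: mult.commute)
    then have "I = carrier (ring_on Z2G)" using mult[of 1] sub by auto
    then show False using I_notcarr by simp
  qed
  show "Poly_Mapping.single g 1 - 1 \<in> I"
  proof -
    define t :: q2G where "t = Poly_Mapping.single g 1 - 1"
    have t: "t \<in> Z2G"
      using Z2G_closed(3)[OF Z2G_closed(7) Z2G_closed(5)[OF Z2G_closed(2)], of g] by (simp add: t_def)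
    have "Poly_Mapping.single g 1 * Poly_Mapping.single g 1 = (1 :: q2G)"
      by (simp add: mult_single klein_add_self)
    then have "t * t = 2 * (- t)" by (simp add: t_def algebra_simps)
    then have "t * t \<in> I" using mult[OF 2 Z2G_closed(5)[OF t]] by simp
    moreover have "primeideal I (ring_on Z2G)" by (rule R.maximalideal_prime[OF I])
    ultimately have "t \<in> I" using primeideal.I_prime[of I "ring_on Z2G" t t] t by auto
    then show ?thesis by (simp add: t_def)
  qed
qed

text \<open>Half the sum of the group elements, the generator of the minimal overring over \<open>Z2G\<close>.\<close>

definition half_norm :: q2G where
  "half_norm = (\<Sum>g\<in>UNIV. Poly_Mapping.single g (inverse 2))"

lemma lookup_half_norm: "Poly_Mapping.lookup half_norm g = inverse 2"
  by (simp add: half_norm_def lookup_sum lookup_single when_def finite_klein)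

text \<open>The quotient of \<open>A\<close> by \<open>Z2G\<close> is killed by the radical, hence by \<open>2\<close> and by all \<open>g - 1\<close>. So for \<open>x\<close> in \<open>A\<close> outside \<open>Z2G\<close> the
coefficients are congruent to one another modulo the 2-adic integers and lie in \<open>1/2\<close> times the 2-adic integers, but not
in these; therefore \<open>half_norm + x\<close> lies in \<open>Z2G\<close>.\<close>

lemma minimal_overring_facts:
  assumes "minimal_overring A"
  shows "Z2G \<subseteq> A" "\<And>x y. x \<in> A \<Longrightarrow> y \<in> A \<Longrightarrow> x + y \<in> A" "\<And>x y. x \<in> A \<Longrightarrow> y \<in> A \<Longrightarrow> x * y \<in> A" "\<And>x. x \<in> A \<Longrightarrow> - x \<in> A"
    "half_norm \<in> A"
proof -
  have sr: "subring A (ring_on UNIV)" and sub: "Z2G \<subset> A"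
    and iso: "mod_iso Z2G (quot_module (as_module A) Z2G) (quot_module (as_module Z2G) (radical Z2G))"
    using assms by (auto simp: minimal_overring_def)
  have cU: "cring (ring_on (UNIV :: q2G set))" by (rule cring_ring_on) simp_all
  interpret U: cring "ring_on (UNIV :: q2G set)" by (rule cU)
  note sp = subringE[OF sr]
  show Z: "Z2G \<subseteq> A" using sub by blast
  show add: "x + y \<in> A" if "x \<in> A" "y \<in> A" for x y using sp(7)[OF that] by simp
  show mult: "x * y \<in> A" if "x \<in> A" "y \<in> A" for x y using sp(6)[OF that] by simp
  have neg1: "- 1 \<in> A" using Z Z2G_closed(2,5) by blast
  show neg: "- x \<in> A" if "x \<in> A" for x using mult[OF neg1 that] by simp
  obtain f where f: "f \<in> mod_hom Z2G (quot_module (as_module A) Z2G) (quot_module (as_module Z2G) (radical Z2G))"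
    "bij_betw f (carrier (quot_module (as_module A) Z2G)) (carrier (quot_module (as_module Z2G) (radical Z2G)))"
    using iso by (auto simp: mod_iso_def)
  define cs where "cs H x = {h + x | h. h \<in> H}" for H :: "q2G set" and x
  have cosA: "H +>\<^bsub>as_module S\<^esub> x = cs H x" for H S x
    by (auto simp: a_r_coset_def r_coset_def as_module_def cs_def)
  have carr: "carrier (quot_module (as_module S) H) = {cs H x | x. x \<in> S}" for S H
    by (auto simp: quot_module_def A_RCOSETS_def RCOSETS_def a_r_coset_def[symmetric] cosA)
      (auto simp: as_module_def)
  have sm: "r \<odot>\<^bsub>quot_module (as_module S) H\<^esub> X = (\<Union>x\<in>X. cs H (r * x))" for S H r X
    by (simp add: quot_module_def cosA) (simp add: as_module_def)
  obtain x where x: "x \<in> A" "x \<notin> Z2G" using sub by blast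
  define Y where "Y = cs Z2G x"
  have cs_in: "cs Z2G t = Z2G" if "t \<in> Z2G" for t
  proof (intro subset_antisym subsetI)
    show "u \<in> Z2G" if "u \<in> cs Z2G t" for u using that \<open>t \<in> Z2G\<close> by (auto simp: cs_def Z2G_closed)
    show "u \<in> cs Z2G t" if "u \<in> Z2G" for u
      unfolding cs_def using Z2G_closed(3)[OF that Z2G_closed(5)[OF \<open>t \<in> Z2G\<close>]]
      by (intro CollectI exI[of _ "u + - t"]) simp
  qed
  have cs_shift: "cs Z2G (h + t) = cs Z2G t" if h: "h \<in> Z2G" for h t
  proof (intro subset_antisym subsetI)
    fix u assume "u \<in> cs Z2G (h + t)"
    then obtain k where k: "k \<in> Z2G" "u = k + (h + t)" by (auto simp: cs_def)
    then show "u \<in> cs Z2G t" unfolding cs_def using Z2G_closed(3)[OF k(1) h]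
      by (intro CollectI exI[of _ "k + h"]) (simp add: add_ac)
  next
    fix u assume "u \<in> cs Z2G t"
    then obtain k where k: "k \<in> Z2G" "u = k + t" by (auto simp: cs_def)
    then show "u \<in> cs Z2G (h + t)" unfolding cs_def using Z2G_closed(3)[OF k(1) Z2G_closed(5)[OF h]]
      by (intro CollectI exI[of _ "k + - h"]) simp
  qed
  \<comment> \<open>The quotient of \<open>A\<close> is isomorphic to \<open>Z2G\<close> modulo its radical and so is killed by the radical.\<close>
  have key: "r * x \<in> Z2G" if r: "r \<in> Z2G" "\<And>I. maximalideal I (ring_on Z2G) \<Longrightarrow> r \<in> I" for r
  proof -
    have Yc: "Y \<in> carrier (quot_module (as_module A) Z2G)" using x by (auto simp: carr Y_def)
    have sY: "q \<odot>\<^bsub>quot_module (as_module A) Z2G\<^esub> Y = cs Z2G (q * x)" if q: "q \<in> Z2G" for q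
    proof -
      have "cs Z2G (q * y) = cs Z2G (q * x)" if "y \<in> Y" for y
      proof -
        obtain h where h: "h \<in> Z2G" "y = h + x" using \<open>y \<in> Y\<close> by (auto simp: Y_def cs_def)
        have "q * y = q * h + q * x" by (simp add: h distrib_left)
        then show ?thesis using cs_shift[OF Z2G_closed(4)[OF q h(1)]] by simp
      qed
      moreover have "x \<in> Y" unfolding Y_def cs_def using Z2G_closed(1) by (intro CollectI exI[of _ 0]) simp
      ultimately show ?thesis unfolding sm by blast
    qed
    have sYc: "cs Z2G (q * x) \<in> carrier (quot_module (as_module A) Z2G)" if "q \<in> Z2G" for q
      using mult[of q x] x that Z by (auto simp: carr)
    have "f Y \<in> {cs (radical Z2G) s | s. s \<in> Z2G}"
      using mod_homD(1)[OF f(1) Yc] by (simp add: carr)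
    then obtain s where s: "s \<in> Z2G" "f Y = cs (radical Z2G) s" by blast
    have rad: "u \<in> radical Z2G \<longleftrightarrow> (\<forall>I. maximalideal I (ring_on Z2G) \<longrightarrow> u \<in> I)" for u
      by (auto simp: radical_def)
    have ry: "q * y \<in> radical Z2G" if q: "q \<in> Z2G" "\<And>I. maximalideal I (ring_on Z2G) \<Longrightarrow> q \<in> I" and y: "y \<in> f Y" for q y
      unfolding rad
    proof (intro allI impI)
      fix I assume I: "maximalideal I (ring_on Z2G)"
      obtain h where h: "h \<in> radical Z2G" "y = h + s" using y by (auto simp: s(2) cs_def)
      have "h \<in> Z2G" using h(1) I maximalideal_props(7)[OF I] by (auto simp: rad)
      then have "y \<in> Z2G" using h(2) s(1) Z2G_closed(3) by simp
      then show "q * y \<in> I" by (rule maximalideal_props(5)[OF I q(2)[OF I]])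
    qed
    have cs_rad: "cs (radical Z2G) t = radical Z2G" if t: "t \<in> radical Z2G" for t
    proof (intro subset_antisym subsetI)
      fix u assume "u \<in> cs (radical Z2G) t"
      then obtain h where "h \<in> radical Z2G" "u = h + t" by (auto simp: cs_def)
      then show "u \<in> radical Z2G" using t maximalideal_props(3) unfolding rad by blast
    next
      fix u assume u: "u \<in> radical Z2G"
      have "u + - t \<in> radical Z2G" using t u maximalideal_props(3,4) unfolding rad by blast
      then show "u \<in> cs (radical Z2G) t" unfolding cs_def by (intro CollectI exI[of _ "u + - t"]) simp
    qed
    have fr: "f (cs Z2G (q * x)) = radical Z2G" if q: "q \<in> Z2G" "\<And>I. maximalideal I (ring_on Z2G) \<Longrightarrow> q \<in> I" for q
    proof -
      have "f (cs Z2G (q * x)) = (\<Union>y\<in>f Y. cs (radical Z2G) (q * y))"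
        using mod_homD(3)[OF f(1) q(1) Yc] unfolding sY[OF q(1)] unfolding sm .
      also have "\<dots> = (\<Union>y\<in>f Y. radical Z2G)" using cs_rad[OF ry[OF q]] by (intro SUP_cong) auto
      also have "\<dots> = radical Z2G"
      proof -
        have "0 \<in> radical Z2G" using maximalideal_props(6) by (auto simp: rad)
        then have "0 + s \<in> f Y" unfolding s(2) cs_def by blast
        then show ?thesis by auto
      qed
      finally show ?thesis .
    qed
    have "f (cs Z2G (r * x)) = f (cs Z2G (0 * x))"
      using fr[OF r] fr[of 0] Z2G_closed(1) maximalideal_props(6) by simp
    then have "cs Z2G (r * x) = cs Z2G (0 * x)"
      using f(2) sYc[OF r(1)] sYc[OF Z2G_closed(1)] by (auto simp: bij_betw_def inj_on_def)
    also have "\<dots> = Z2G" using cs_in[OF Z2G_closed(1)] by simp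
    finally have "0 + r * x \<in> Z2G" unfolding cs_def using Z2G_closed(1) by blast
    then show ?thesis by simp
  qed
  have two: "2 * x \<in> Z2G"
    using key[of 2] maximalideal_props(1) Z2G_closed(3)[OF Z2G_closed(2) Z2G_closed(2)] by simp
  have grp: "(Poly_Mapping.single g 1 - 1) * x \<in> Z2G" for g
    using key[OF _ maximalideal_props(2)] Z2G_closed(3)[OF Z2G_closed(7) Z2G_closed(5)[OF Z2G_closed(2)], of g] by simp
  define X where "X g = Poly_Mapping.lookup x g" for g
  have dX: "X g - X 0 \<in> Z2" for g
  proof -
    have "Poly_Mapping.lookup (Poly_Mapping.single g 1 * x) 0 = (\<Sum>h\<in>UNIV. if h = g then X g else 0)"
      unfolding lookup_q2G_mult by (intro sum.cong) (auto simp: lookup_single when_def X_def)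
    then have "Poly_Mapping.lookup ((Poly_Mapping.single g 1 - 1) * x) 0 = X g - X 0"
      by (simp add: left_diff_distrib lookup_minus finite_klein X_def)
    then show ?thesis using grp[of g] unfolding Z2G_def by (metis (mono_tags) mem_Collect_eq)
  qed
  have "2 * X 0 \<in> Z2"
  proof -
    have "Poly_Mapping.lookup (x + x) 0 = X 0 + X 0" by (simp only: lookup_add X_def)
    then show ?thesis using two unfolding Z2G_def by (metis (mono_tags) mem_Collect_eq mult_2)
  qed
  then obtain c where c: "2 * X 0 = to_fract c" by (auto simp: Z2_def)
  have tf2: "to_fract (2 :: z2adic) = 2" using to_fract_add[of 1 1] by simp
  have two0: "(2 :: q2adic) \<noteq> 0" using to_fract_eq_0_iff[of "2 :: z2adic"] tf2 by simp
  have "\<not> 2 dvd c"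
  proof
    assume "2 dvd c"
    then obtain d where "c = 2 * d" by auto
    then have "2 * X 0 = 2 * to_fract d" using c tf2 by simp
    then have "X 0 = to_fract d" using two0 by (metis mult_left_cancel)
    then have "X g \<in> Z2" for g using Z2_closed(3)[OF dX[of g] Z2_closed(6)[of d]] by simp
    then show False using x(2) by (simp add: Z2G_def X_def)
  qed
  then have "2 dvd c + 1" using odd_plus_odd not_two_dvd_one by blast
  then obtain d where d: "c + 1 = 2 * d" by auto
  have inv2: "inverse 2 * (2 :: q2adic) = 1" using two0 by simp
  have X0: "X 0 = to_fract d - inverse 2"
  proof -
    have "2 * X 0 = 2 * (to_fract d - inverse 2)"
      using c d tf2 inv2 by (metis (no_types, lifting) add_diff_cancel_right' mult.commute right_diff_distrib to_fract_1 to_fract_diff to_fract_mult)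
    then show ?thesis using two0 by (metis mult_left_cancel)
  qed
  have "half_norm + x \<in> Z2G"
  proof -
    have "Poly_Mapping.lookup (half_norm + x) g = to_fract d + (X g - X 0)" for g
      by (simp add: lookup_add lookup_half_norm X_def[symmetric] X0)
    then show ?thesis using Z2_closed(3)[OF Z2_closed(6) dX] by (simp add: Z2G_def)
  qed
  then have "half_norm + x + - x \<in> A" using Z x(1) add neg by blast
  then show "half_norm \<in> A" by simp
qed

section \<open>Tate cohomology in degree zero\<close>

lemma submoduleI':
  assumes "H \<subseteq> carrier M" "\<zero>\<^bsub>M\<^esub> \<in> H" "\<And>x y. x \<in> H \<Longrightarrow> y \<in> H \<Longrightarrow> x \<oplus>\<^bsub>M\<^esub> y \<in> H"
    "\<And>x. x \<in> H \<Longrightarrow> \<ominus>\<^bsub>M\<^esub> x \<in> H" "\<And>r x. r \<in> \<Lambda> \<Longrightarrow> x \<in> H \<Longrightarrow> r \<odot>\<^bsub>M\<^esub> x \<in> H"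
  shows "submodule H (ring_on \<Lambda>) M"
proof (intro submodule.intro subgroup.intro)
  show "submodule_axioms H (ring_on \<Lambda>) M" unfolding submodule_axioms_def using assms(5) by simp
qed (use assms in \<open>auto simp: a_inv_def\<close>)

lemma module_restrict:
  assumes "module (ring_on \<Lambda>) M" "\<Lambda>' \<subseteq> \<Lambda>" "cring (ring_on \<Lambda>')"
  shows "module (ring_on \<Lambda>') M"
proof -
  interpret module "ring_on \<Lambda>" M by fact
  have s: "r \<in> \<Lambda>" if "r \<in> \<Lambda>'" for r using assms(2) that by blast
  show ?thesis
  proof (rule moduleI[OF assms(3) abelian_group_axioms])
    show "a \<odot>\<^bsub>M\<^esub> x \<in> carrier M" if "a \<in> carrier (ring_on \<Lambda>')" "x \<in> carrier M" for a x
      using smult_closed[of a x] s that by simp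
    show "(a \<oplus>\<^bsub>ring_on \<Lambda>'\<^esub> b) \<odot>\<^bsub>M\<^esub> x = a \<odot>\<^bsub>M\<^esub> x \<oplus>\<^bsub>M\<^esub> b \<odot>\<^bsub>M\<^esub> x"
      if "a \<in> carrier (ring_on \<Lambda>')" "b \<in> carrier (ring_on \<Lambda>')" "x \<in> carrier M" for a b x
      using smult_l_distr[of a b x] s that by simp
    show "a \<odot>\<^bsub>M\<^esub> (x \<oplus>\<^bsub>M\<^esub> y) = a \<odot>\<^bsub>M\<^esub> x \<oplus>\<^bsub>M\<^esub> a \<odot>\<^bsub>M\<^esub> y"
      if "a \<in> carrier (ring_on \<Lambda>')" "x \<in> carrier M" "y \<in> carrier M" for a x y
      using smult_r_distr[of a x y] s that by simp
    show "a \<otimes>\<^bsub>ring_on \<Lambda>'\<^esub> b \<odot>\<^bsub>M\<^esub> x = a \<odot>\<^bsub>M\<^esub> (b \<odot>\<^bsub>M\<^esub> x)"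
      if "a \<in> carrier (ring_on \<Lambda>')" "b \<in> carrier (ring_on \<Lambda>')" "x \<in> carrier M" for a b x
      using smult_assoc1[of a b x] s that by simp
    show "\<one>\<^bsub>ring_on \<Lambda>'\<^esub> \<odot>\<^bsub>M\<^esub> x = x" if "x \<in> carrier M" for x using smult_one[of x] that by simp
  qed
qed

text \<open>The trivial character, by which \<open>q2G\<close> acts on \<open>L (Plus, Plus)\<close>.\<close>

definition chi :: "q2G \<Rightarrow> q2adic" where "chi x = (\<Sum>g\<in>UNIV. Poly_Mapping.lookup x g)"

text \<open>The idempotent of the trivial character. It is integral over every subring, so it acts on the span of the lattice over the integral closure.\<close>

definition avg :: q2G where "avg = (\<Sum>g\<in>UNIV. Poly_Mapping.single g (inverse 4))"

definition gnorm :: q2G where "gnorm = (\<Sum>g\<in>UNIV. Poly_Mapping.single g 1)"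

lemma four_q2adic: "to_fract (4 :: z2adic) = 4" "(4 :: q2adic) \<noteq> 0" "to_fract (2 :: z2adic) = 2" "(2 :: q2adic) \<noteq> 0"
proof -
  show 2: "to_fract (2 :: z2adic) = 2" using to_fract_add[of 1 1] by simp
  show 4: "to_fract (4 :: z2adic) = 4" using to_fract_add[of "2 :: z2adic" 2] 2 by simp
  show "(4 :: q2adic) \<noteq> 0" "(2 :: q2adic) \<noteq> 0"
    using to_fract_eq_0_iff[of "4 :: z2adic"] to_fract_eq_0_iff[of "2 :: z2adic"] 2 4 by simp_all
qed

lemma lookup_avg: "Poly_Mapping.lookup avg g = inverse 4"
  by (simp add: avg_def lookup_sum lookup_single when_def finite_klein)

lemma lookup_gnorm: "Poly_Mapping.lookup gnorm g = 1"
  by (simp add: gnorm_def lookup_sum lookup_single when_def finite_klein)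

lemma gnorm_Z2G: "gnorm \<in> Z2G"
  by (simp add: Z2G_def lookup_gnorm Z2_closed)

lemma avg_idem: "avg * avg = avg"
proof (rule poly_mapping_eqI)
  fix k
  have "4 * (inverse 4 * inverse 4) = inverse (4 :: q2adic)"
    by (simp only: mult.assoc[symmetric] right_inverse[OF four_q2adic(2)] mult_1_left)
  then show "Poly_Mapping.lookup (avg * avg) k = Poly_Mapping.lookup avg k"
    by (simp only: lookup_q2G_mult lookup_avg sum_constant card_klein of_nat_numeral)
qed

lemma avg_eq: "avg = Poly_Mapping.single 0 (inverse 4) * gnorm"
  by (simp add: avg_def gnorm_def sum_distrib_left mult_single)

lemma single_mult_const:
  assumes "\<And>g. Poly_Mapping.lookup x g = q"
  shows "Poly_Mapping.single h 1 * x = (x :: q2G)"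
proof (rule poly_mapping_eqI)
  fix k
  have "Poly_Mapping.lookup (Poly_Mapping.single h 1 * x) k = (\<Sum>g\<in>UNIV. if g = h then q else 0)"
    unfolding lookup_q2G_mult by (intro sum.cong) (auto simp: lookup_single when_def assms)
  then show "Poly_Mapping.lookup (Poly_Mapping.single h 1 * x) k = Poly_Mapping.lookup x k"
    by (simp add: finite_klein assms)
qed

lemma chi_simps: "chi (scalar c) = to_fract c" "chi (Poly_Mapping.single g 1) = 1" "chi half_norm = to_fract 2"
  "chi gnorm = to_fract 4" "chi 0 = 0"
proof -
  have "(4 :: q2adic) = 2 * 2" by simp
  then have "4 * inverse 2 = 2 * (2 * inverse (2 :: q2adic))" by (simp only: mult.assoc)
  then have "4 * inverse 2 = (2 :: q2adic)" by (simp only: right_inverse[OF four_q2adic(4)] mult_1_right)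
  then show "chi half_norm = to_fract 2" by (simp add: chi_def lookup_half_norm card_klein four_q2adic)
qed (simp_all add: chi_def scalar_def lookup_single when_def finite_klein lookup_gnorm card_klein four_q2adic)

lemma smult_L: "r \<odot>\<^bsub>L (Plus, Plus)\<^esub> z = chi r * z"
  by (simp add: L_def chi_def)

lemma avg_on_L: "avg \<odot>\<^bsub>L uv\<^esub> z = (if uv = (Plus, Plus) then z else 0)"
proof -
  obtain u v where uv: "uv = (u, v)" by (cases uv)
  have "(\<Sum>g\<in>UNIV. inverse 4 * (sign_pow u (fst g) * sign_pow v (snd g))) = (if uv = (Plus, Plus) then 1 else 0 :: q2adic)"
    unfolding sum_klein using four_q2adic(2) by (cases u; cases v) (simp_all add: uv)
  then show ?thesis by (simp add: L_def uv lookup_avg)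
qed

lemma power_module_simps: "carrier (power_module m N) = {..<m} \<rightarrow>\<^sub>E carrier N"
  "x \<oplus>\<^bsub>power_module m N\<^esub> y = (\<lambda>i\<in>{..<m}. x i \<oplus>\<^bsub>N\<^esub> y i)"
  "r \<odot>\<^bsub>power_module m N\<^esub> x = (\<lambda>i\<in>{..<m}. r \<odot>\<^bsub>N\<^esub> x i)"
  by (simp_all add: power_module_def)

lemma L_simps: "carrier (L uv) = Z2" "x \<oplus>\<^bsub>L uv\<^esub> y = x + y"
  by (simp_all add: L_def)

text \<open>\<open>\<pi> x\<close> consists of the coordinates of \<open>avg x\<close> in the summand \<open>H (Plus, Plus)\<close>, which is a power of the trivial lattice. On that
summand \<open>A\<close> acts through \<open>chi\<close>. Fixed vectors satisfy \<open>avg x = x\<close>, so they are determined by their coordinates and \<open>A\<close> acts on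
them by scalars.\<close>

lemma character_coordinates:
  fixes M :: lat
  assumes A: "minimal_overring A" and modM: "module (ring_on A) M" and mult: "multiplicities A M r"
  defines "m \<equiv> r (Plus, Plus)"
  shows "\<exists>\<pi> :: _ \<Rightarrow> nat \<Rightarrow> z2adic.
    (\<forall>x\<in>carrier M. \<forall>y\<in>carrier M. \<forall>i<m. \<pi> (x \<oplus>\<^bsub>M\<^esub> y) i = \<pi> x i + \<pi> y i) \<and>
    (\<forall>\<alpha>\<in>A. m > 0 \<longrightarrow> (\<exists>c. to_fract c = chi \<alpha> \<and> (\<forall>x\<in>carrier M. \<forall>i<m. \<pi> (\<alpha> \<odot>\<^bsub>M\<^esub> x) i = c * \<pi> x i) \<and>
       (\<forall>x\<in>carrier M. (\<forall>g. Poly_Mapping.single g 1 \<odot>\<^bsub>M\<^esub> x = x) \<longrightarrow> \<alpha> \<odot>\<^bsub>M\<^esub> x = scalar c \<odot>\<^bsub>M\<^esub> x))) \<and>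
    (\<forall>v. \<exists>x\<in>carrier M. \<forall>i<m. \<pi> x i = v i) \<and>
    (\<forall>x\<in>carrier M. (\<forall>g. Poly_Mapping.single g 1 \<odot>\<^bsub>M\<^esub> x = x) \<longrightarrow> (\<forall>i<m. \<pi> x i = 0) \<longrightarrow> x = \<zero>\<^bsub>M\<^esub>)"
proof -
  note Af = minimal_overring_facts[OF A]
  obtain V :: lat and j H where hull: "rational_hull A M V j"
    and dec: "direct_decomp (integral_closure A)
       (V\<lparr>carrier := generated_submodule (integral_closure A) V (j ` carrier M)\<rparr>) UNIV H"
    and isos: "\<And>uv. mod_iso (integral_closure A) (V\<lparr>carrier := H uv\<rparr>) (power_module (r uv) (L uv))"
    using mult unfolding multiplicities_def by blast
  define C where "C = integral_closure A"
  define E where "E = generated_submodule C V (j ` carrier M)"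
  have modV: "module (ring_on UNIV) V" and jh: "j \<in> mod_hom A M V" and j_inj: "inj_on j (carrier M)"
    using hull by (auto simp: rational_hull_def)
  interpret V: module "ring_on UNIV" V by (rule modV)
  interpret M: module "ring_on A" M by (rule modM)
  note j = mod_homD[OF jh]
  have Vsm: "q \<odot>\<^bsub>V\<^esub> x \<in> carrier V" if "x \<in> carrier V" for q x using V.smult_closed[of q x] that by simp
  have Vadd: "q \<odot>\<^bsub>V\<^esub> (x \<oplus>\<^bsub>V\<^esub> y) = q \<odot>\<^bsub>V\<^esub> x \<oplus>\<^bsub>V\<^esub> q \<odot>\<^bsub>V\<^esub> y" if "x \<in> carrier V" "y \<in> carrier V" for q x y
    using V.smult_r_distr[of q x y] that by simp
  have Vass: "(q * q') \<odot>\<^bsub>V\<^esub> x = q \<odot>\<^bsub>V\<^esub> (q' \<odot>\<^bsub>V\<^esub> x)" if "x \<in> carrier V" for q q' x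
    using V.smult_assoc1[of q q' x] that by simp
  have Vcomm: "q \<odot>\<^bsub>V\<^esub> (q' \<odot>\<^bsub>V\<^esub> x) = q' \<odot>\<^bsub>V\<^esub> (q \<odot>\<^bsub>V\<^esub> x)" if "x \<in> carrier V" for q q' x
    using that by (simp flip: Vass add: mult.commute)
  have V0: "0 \<odot>\<^bsub>V\<^esub> x = \<zero>\<^bsub>V\<^esub>" if "x \<in> carrier V" for x using V.smult_l_null[of x] that by simp
  have Vr0: "q \<odot>\<^bsub>V\<^esub> \<zero>\<^bsub>V\<^esub> = \<zero>\<^bsub>V\<^esub>" for q using V.smult_r_null[of q] by simp
  have AC: "A \<subseteq> C"
  proof
    fix x assume x: "x \<in> A"
    have "Polynomial.coeff [:- x, 1:] i \<in> A" for i
    proof (cases i)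
      case (Suc k)
      then show ?thesis using Af(1) Z2G_closed(1,2) by (cases k) auto
    qed (use Af(4)[OF x] in simp)
    then show "x \<in> C" unfolding C_def integral_closure_def by (intro CollectI exI[of _ "[:- x, 1:]"]) simp
  qed
  have AA: "0 \<in> A" "1 \<in> A" "- 1 \<in> A" using Af(1) Z2G_closed(1,2) Z2G_closed(5)[OF Z2G_closed(2)] by blast+
  have avgC: "avg \<in> C"
  proof -
    have "Polynomial.coeff [:0, - 1, 1:] i \<in> A" for i :: nat
    proof -
      consider "i = 0" | "i = 1" | "i = 2" | k where "i = Suc (Suc (Suc k))"
        by (metis Suc_1 not0_implies_Suc One_nat_def)
      then show ?thesis by cases (use AA in \<open>auto simp: numeral_2_eq_2\<close>)
    qed
    then show ?thesis
      unfolding C_def integral_closure_def by (intro CollectI exI[of _ "[:0, - 1, 1:]"]) (simp add: avg_idem algebra_simps)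
  qed
  have scA: "scalar c \<in> A" for c using Af(1) Z2G_closed(6) by blast
  have scC: "scalar c \<in> C" for c using scA AC by blast
  have sgA: "Poly_Mapping.single g 1 \<in> A" for g using Af(1) Z2G_closed(7) by blast
  have E_sub: "E \<subseteq> K" if "submodule K (ring_on C) V" "j ` carrier M \<subseteq> K" for K
    unfolding E_def generated_submodule_def using that by blast
  have carV: "submodule (carrier V) (ring_on C) V" by (rule submoduleI') (use Vsm in auto)
  have jV: "j ` carrier M \<subseteq> carrier V" using j(1) by blast
  have EV: "E \<subseteq> carrier V" by (rule E_sub[OF carV jV])
  have jE: "j x \<in> E" if "x \<in> carrier M" for x unfolding E_def generated_submodule_def using that by blast
  have E: "submodule E (ring_on C) V"
  proof (rule submoduleI'[OF EV])
    have E_I: "x \<in> E" if "\<And>K. submodule K (ring_on C) V \<Longrightarrow> j ` carrier M \<subseteq> K \<Longrightarrow> x \<in> K" for x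
      unfolding E_def generated_submodule_def using that by blast
    show "\<zero>\<^bsub>V\<^esub> \<in> E" by (rule E_I) (rule submoduleD(2))
    show "x \<oplus>\<^bsub>V\<^esub> y \<in> E" if x: "x \<in> E" and y: "y \<in> E" for x y
    proof (rule E_I)
      fix K assume K: "submodule K (ring_on C) V" "j ` carrier M \<subseteq> K"
      show "x \<oplus>\<^bsub>V\<^esub> y \<in> K" by (rule submoduleD(3)[OF K(1)]) (use E_sub[OF K] x y in blast)+
    qed
    show "\<ominus>\<^bsub>V\<^esub> x \<in> E" if x: "x \<in> E" for x
    proof (rule E_I)
      fix K assume K: "submodule K (ring_on C) V" "j ` carrier M \<subseteq> K"
      show "\<ominus>\<^bsub>V\<^esub> x \<in> K" by (rule submoduleD(4)[OF K(1)]) (use E_sub[OF K] x in blast)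
    qed
    show "q \<odot>\<^bsub>V\<^esub> x \<in> E" if q: "q \<in> C" and x: "x \<in> E" for q x
    proof (rule E_I)
      fix K assume K: "submodule K (ring_on C) V" "j ` carrier M \<subseteq> K"
      show "q \<odot>\<^bsub>V\<^esub> x \<in> K" by (rule submoduleD(5)[OF K(1) q]) (use E_sub[OF K] x in blast)
    qed
  qed
  note Ep = submoduleD[OF E]
  define W where "W = V\<lparr>carrier := E\<rparr>"
  have W: "carrier W = E" "\<zero>\<^bsub>W\<^esub> = \<zero>\<^bsub>V\<^esub>" "x \<oplus>\<^bsub>W\<^esub> y = x \<oplus>\<^bsub>V\<^esub> y" "q \<odot>\<^bsub>W\<^esub> x = q \<odot>\<^bsub>V\<^esub> x" for x y q
    by (simp_all add: W_def)
  have dec': "\<And>uv. submodule (H uv) (ring_on C) W"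
    "bij_betw (\<lambda>x. \<Oplus>\<^bsub>W\<^esub>i\<in>UNIV. x i) (Pi\<^sub>E UNIV H) E"
    using dec by (auto simp: direct_decomp_def W_def E_def C_def)
  have Hp: "H uv \<subseteq> E" "\<zero>\<^bsub>V\<^esub> \<in> H uv" "x \<in> H uv \<Longrightarrow> y \<in> H uv \<Longrightarrow> x \<oplus>\<^bsub>V\<^esub> y \<in> H uv"
    "q \<in> C \<Longrightarrow> x \<in> H uv \<Longrightarrow> q \<odot>\<^bsub>V\<^esub> x \<in> H uv" for uv x y q
    using submoduleD(1,2,3,5)[OF dec'(1)[of uv]] by (simp_all add: W)
  have HV: "x \<in> carrier V" if "x \<in> H uv" for x uv using Hp(1) EV that by blast
  have mVZ: "module (ring_on Z2G) V" by (rule module_restrict[OF modV _ cring_Z2G]) simp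
  have Z2GC: "Z2G \<subseteq> C" using Af(1) AC by blast
  have "submodule E (ring_on Z2G) V" by (rule submoduleI'[OF EV]) (use Ep Z2GC in auto)
  then have "module (ring_on Z2G) W" unfolding W_def by (rule submodule.submodule_is_module[OF _ mVZ])
  then interpret W: module "ring_on Z2G" W .
  have phi: "\<exists>f. bij_betw f (H uv) ({..<r uv} \<rightarrow>\<^sub>E Z2) \<and>
      (\<forall>x\<in>H uv. \<forall>y\<in>H uv. f (x \<oplus>\<^bsub>V\<^esub> y) = (\<lambda>i\<in>{..<r uv}. f x i + f y i)) \<and>
      (\<forall>q\<in>C. \<forall>x\<in>H uv. f (q \<odot>\<^bsub>V\<^esub> x) = (\<lambda>i\<in>{..<r uv}. q \<odot>\<^bsub>L uv\<^esub> f x i))" for uv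
  proof -
    obtain f where f: "f \<in> mod_hom C (V\<lparr>carrier := H uv\<rparr>) (power_module (r uv) (L uv))"
      "bij_betw f (H uv) ({..<r uv} \<rightarrow>\<^sub>E Z2)"
      using isos[of uv] unfolding mod_iso_def C_def[symmetric] by (auto simp: power_module_simps L_simps)
    show ?thesis using f(2) mod_homD(2,3)[OF f(1)] by (intro exI[of _ f]) (simp add: power_module_simps L_simps)
  qed
  have avg_H: "avg \<odot>\<^bsub>V\<^esub> x = (if uv = (Plus, Plus) then x else \<zero>\<^bsub>V\<^esub>)" if x: "x \<in> H uv" for uv x
  proof -
    obtain f where f: "bij_betw f (H uv) ({..<r uv} \<rightarrow>\<^sub>E Z2)"
      "\<forall>q\<in>C. \<forall>x\<in>H uv. f (q \<odot>\<^bsub>V\<^esub> x) = (\<lambda>i\<in>{..<r uv}. q \<odot>\<^bsub>L uv\<^esub> f x i)" using phi by blast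
    have fx: "f x \<in> {..<r uv} \<rightarrow>\<^sub>E Z2" using f(1) x by (auto simp: bij_betw_def)
    have inj: "y = z" if "f y = f z" "y \<in> H uv" "z \<in> H uv" for y z
      using f(1) that by (auto simp: bij_betw_def inj_on_def)
    have ax: "f (avg \<odot>\<^bsub>V\<^esub> x) = (\<lambda>i\<in>{..<r uv}. if uv = (Plus, Plus) then f x i else 0)"
      using f(2) avgC x by (simp add: avg_on_L)
    show ?thesis
    proof (cases "uv = (Plus, Plus)")
      case True
      then have "f (avg \<odot>\<^bsub>V\<^esub> x) = f x" using ax fx by (auto simp: fun_eq_iff PiE_iff extensional_def)
      then show ?thesis using inj[OF _ Hp(4)[OF avgC x] x] True by simp
    next
      case False
      have "0 \<odot>\<^bsub>L uv\<^esub> z = 0" for z by (simp add: L_def)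
      then have "f (0 \<odot>\<^bsub>V\<^esub> x) = (\<lambda>i\<in>{..<r uv}. 0)" using f(2) x AA(1) AC by (simp add: subset_iff)
      then have "f (avg \<odot>\<^bsub>V\<^esub> x) = f (0 \<odot>\<^bsub>V\<^esub> x)" using ax False by simp
      then have "avg \<odot>\<^bsub>V\<^esub> x = 0 \<odot>\<^bsub>V\<^esub> x" using inj Hp(4)[OF avgC x] Hp(4)[OF _ x, of 0] AA(1) AC by blast
      then show ?thesis using False V0[OF HV[OF x]] by simp
    qed
  qed
  define Q where "Q = H (Plus, Plus)"
  have avg_E: "avg \<odot>\<^bsub>V\<^esub> y \<in> Q" if yE: "y \<in> E" for y
  proof -
    obtain x where x: "x \<in> Pi\<^sub>E UNIV H" "y = (\<Oplus>\<^bsub>W\<^esub>i\<in>UNIV. x i)"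
      using yE unfolding bij_betw_imp_surj_on[OF dec'(2), symmetric] by blast
    have xi: "x i \<in> H i" for i using x(1) by auto
    have xE: "x i \<in> E" for i using xi Hp(1) by blast
    have "finite (UNIV :: (sign \<times> sign) set)"
    proof -
      have "finite (UNIV :: sign set)"
      proof (rule finite_subset)
        show "(UNIV :: sign set) \<subseteq> {Plus, Minus}" using sign.exhaust by blast
      qed simp
      then show ?thesis unfolding finite_prod by blast
    qed
    moreover have "avg \<odot>\<^bsub>V\<^esub> (\<Oplus>\<^bsub>W\<^esub>i\<in>I. x i) \<in> Q \<and> (\<Oplus>\<^bsub>W\<^esub>i\<in>I. x i) \<in> E" if "finite I" for I
      using that
    proof (induction I rule: finite_induct)
      case empty
      show ?case using Hp(2) Ep(2) by (simp add: W Vr0 Q_def)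
    next
      case (insert i I)
      have s: "(\<Oplus>\<^bsub>W\<^esub>k\<in>insert i I. x k) = x i \<oplus>\<^bsub>V\<^esub> (\<Oplus>\<^bsub>W\<^esub>k\<in>I. x k)"
        using insert.hyps xE W.finsum_insert[of I i x] by (simp add: W)
      have "avg \<odot>\<^bsub>V\<^esub> x i \<in> Q"
      proof (cases "i = (Plus, Plus)")
        case True
        then show ?thesis using avg_H[OF xi[of i]] xi[of i] by (simp add: Q_def)
      next
        case False
        then show ?thesis using avg_H[OF xi[of i]] Hp(2) by (simp add: Q_def)
      qed
      moreover have "avg \<odot>\<^bsub>V\<^esub> (x i \<oplus>\<^bsub>V\<^esub> (\<Oplus>\<^bsub>W\<^esub>k\<in>I. x k)) = avg \<odot>\<^bsub>V\<^esub> x i \<oplus>\<^bsub>V\<^esub> avg \<odot>\<^bsub>V\<^esub> (\<Oplus>\<^bsub>W\<^esub>k\<in>I. x k)"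
        using xE insert.IH EV by (intro Vadd) blast+
      ultimately show ?case
        using insert.IH Hp(3)[of _ "(Plus, Plus)"] Ep(3)[OF xE] unfolding s Q_def[symmetric] by simp
    qed
    ultimately show ?thesis using x(2) by blast
  qed
  have avg_Q: "avg \<odot>\<^bsub>V\<^esub> y = y" if "y \<in> Q" for y using avg_H that by (simp add: Q_def)
  obtain \<phi> where \<phi>: "bij_betw \<phi> Q ({..<m} \<rightarrow>\<^sub>E Z2)"
    "\<And>x y. x \<in> Q \<Longrightarrow> y \<in> Q \<Longrightarrow> \<phi> (x \<oplus>\<^bsub>V\<^esub> y) = (\<lambda>i\<in>{..<m}. \<phi> x i + \<phi> y i)"
    "\<And>q x. q \<in> C \<Longrightarrow> x \<in> Q \<Longrightarrow> \<phi> (q \<odot>\<^bsub>V\<^esub> x) = (\<lambda>i\<in>{..<m}. chi q * \<phi> x i)"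
    using phi[of "(Plus, Plus)"] unfolding Q_def[symmetric] m_def[symmetric] smult_L by blast
  have \<phi>_inj: "x = y" if "\<phi> x = \<phi> y" "x \<in> Q" "y \<in> Q" for x y
    using \<phi>(1) that by (auto simp: bij_betw_def inj_on_def)
  have \<phi>_mem: "\<phi> x i \<in> Z2" if "x \<in> Q" "i < m" for x i using \<phi>(1) that by (auto simp: bij_betw_def PiE_iff)
  have Q_sm: "q \<odot>\<^bsub>V\<^esub> x \<in> Q" if "q \<in> C" "x \<in> Q" for q x using Hp(4) that by (simp add: Q_def)
  have QV: "x \<in> carrier V" if "x \<in> Q" for x using HV that by (simp add: Q_def)
  have scal: "\<exists>c. to_fract c = chi \<alpha> \<and> (\<forall>y\<in>Q. \<alpha> \<odot>\<^bsub>V\<^esub> y = scalar c \<odot>\<^bsub>V\<^esub> y)" if \<alpha>: "\<alpha> \<in> C" and m: "m > 0" for \<alpha>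
  proof -
    have "(\<lambda>i\<in>{..<m}. 1) \<in> \<phi> ` Q" unfolding bij_betw_imp_surj_on[OF \<phi>(1)] using Z2_closed(2) by auto
    then obtain y0 where y0: "y0 \<in> Q" "\<phi> y0 = (\<lambda>i\<in>{..<m}. 1)" by (elim imageE) (rule that, assumption, rule sym)
    have "\<phi> (\<alpha> \<odot>\<^bsub>V\<^esub> y0) 0 = chi \<alpha>" using \<phi>(3)[OF \<alpha> y0(1)] y0(2) m by simp
    then have "chi \<alpha> \<in> Z2" using \<phi>_mem[OF Q_sm[OF \<alpha> y0(1)] m] by simp
    then obtain c where c: "chi \<alpha> = to_fract c" by (auto simp: Z2_def)
    have "\<alpha> \<odot>\<^bsub>V\<^esub> y = scalar c \<odot>\<^bsub>V\<^esub> y" if y: "y \<in> Q" for y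
      by (rule \<phi>_inj) (simp_all add: \<phi>(3)[OF \<alpha> y] \<phi>(3)[OF scC y] chi_simps c Q_sm \<alpha> scC y)
    then show ?thesis using c by auto
  qed
  have jQ: "avg \<odot>\<^bsub>V\<^esub> j x \<in> Q" if "x \<in> carrier M" for x by (rule avg_E[OF jE[OF that]])
  define \<pi> where "\<pi> x i = (SOME c. to_fract c = \<phi> (avg \<odot>\<^bsub>V\<^esub> j x) i)" for x i
  have \<pi>: "to_fract (\<pi> x i) = \<phi> (avg \<odot>\<^bsub>V\<^esub> j x) i" if x: "x \<in> carrier M" and i: "i < m" for x i
  proof -
    obtain c where "to_fract c = \<phi> (avg \<odot>\<^bsub>V\<^esub> j x) i" using \<phi>_mem[OF jQ[OF x] i] unfolding Z2_def by (metis imageE)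
    then show ?thesis unfolding \<pi>_def by (rule someI)
  qed
  have \<pi>_eqI: "\<pi> x i = c" if "x \<in> carrier M" "i < m" "\<phi> (avg \<odot>\<^bsub>V\<^esub> j x) i = to_fract c" for x i c
    using \<pi>[OF that(1,2)] that(3) by simp
  have jx: "j x \<in> carrier V" if "x \<in> carrier M" for x using j(1)[OF that] .
  have fixed: "avg \<odot>\<^bsub>V\<^esub> j x = j x" if x: "x \<in> carrier M" and g: "\<And>g. Poly_Mapping.single g 1 \<odot>\<^bsub>M\<^esub> x = x" for x
  proof -
    have s: "Poly_Mapping.single g 1 \<odot>\<^bsub>V\<^esub> j x = 1 \<odot>\<^bsub>V\<^esub> j x" for g
      using j(3)[OF sgA x, of g] g[of g] V.smult_one[OF jx[OF x]] by simp
    have l: "(p + q) \<odot>\<^bsub>V\<^esub> j x = p \<odot>\<^bsub>V\<^esub> j x \<oplus>\<^bsub>V\<^esub> q \<odot>\<^bsub>V\<^esub> j x" for p q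
      using V.smult_l_distr[of p q "j x"] jx[OF x] by simp
    have "gnorm \<odot>\<^bsub>V\<^esub> j x = (1 + 1 + 1 + 1) \<odot>\<^bsub>V\<^esub> j x"
      unfolding gnorm_def sum_klein by (simp only: l s)
    also have "(1 + 1 + 1 + 1 :: q2G) = Poly_Mapping.single 0 (1 + 1 + 1 + 1)"
      by (simp only: single_add single_one)
    also have "(1 + 1 + 1 + 1 :: q2adic) = 4" by simp
    finally have "avg \<odot>\<^bsub>V\<^esub> j x = (Poly_Mapping.single 0 (inverse 4) * Poly_Mapping.single 0 4) \<odot>\<^bsub>V\<^esub> j x"
      unfolding avg_eq by (simp only: Vass[OF jx[OF x]])
    also have "Poly_Mapping.single 0 (inverse 4) * Poly_Mapping.single 0 4 = (1 :: q2G)"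
      by (simp only: mult_single add_0 left_inverse[OF four_q2adic(2)] single_one)
    finally show ?thesis using V.smult_one[OF jx[OF x]] by simp
  qed
  have p1: "\<pi> (x \<oplus>\<^bsub>M\<^esub> y) i = \<pi> x i + \<pi> y i" if "x \<in> carrier M" "y \<in> carrier M" "i < m" for x y i
  proof (rule \<pi>_eqI)
    have "avg \<odot>\<^bsub>V\<^esub> j (x \<oplus>\<^bsub>M\<^esub> y) = avg \<odot>\<^bsub>V\<^esub> j x \<oplus>\<^bsub>V\<^esub> avg \<odot>\<^bsub>V\<^esub> j y"
      using that by (simp add: j(2) Vadd jx)
    then show "\<phi> (avg \<odot>\<^bsub>V\<^esub> j (x \<oplus>\<^bsub>M\<^esub> y)) i = to_fract (\<pi> x i + \<pi> y i)"
      using that by (simp add: \<phi>(2) jQ \<pi>)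
  qed (use that in auto)
  have p2: "\<exists>c. to_fract c = chi \<alpha> \<and> (\<forall>x\<in>carrier M. \<forall>i<m. \<pi> (\<alpha> \<odot>\<^bsub>M\<^esub> x) i = c * \<pi> x i) \<and>
       (\<forall>x\<in>carrier M. (\<forall>g. Poly_Mapping.single g 1 \<odot>\<^bsub>M\<^esub> x = x) \<longrightarrow> \<alpha> \<odot>\<^bsub>M\<^esub> x = scalar c \<odot>\<^bsub>M\<^esub> x)"
    if \<alpha>: "\<alpha> \<in> A" and m: "m > 0" for \<alpha>
  proof -
    have \<alpha>C: "\<alpha> \<in> C" using \<alpha> AC by blast
    obtain c where c: "to_fract c = chi \<alpha>" "\<And>y. y \<in> Q \<Longrightarrow> \<alpha> \<odot>\<^bsub>V\<^esub> y = scalar c \<odot>\<^bsub>V\<^esub> y"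
      using scal[OF \<alpha>C m] by blast
    have Mc: "q \<odot>\<^bsub>M\<^esub> x \<in> carrier M" if "q \<in> A" "x \<in> carrier M" for q x using M.smult_closed[of q x] that by simp
    have "\<pi> (\<alpha> \<odot>\<^bsub>M\<^esub> x) i = c * \<pi> x i" if "x \<in> carrier M" "i < m" for x i
    proof (rule \<pi>_eqI)
      have "avg \<odot>\<^bsub>V\<^esub> j (\<alpha> \<odot>\<^bsub>M\<^esub> x) = \<alpha> \<odot>\<^bsub>V\<^esub> (avg \<odot>\<^bsub>V\<^esub> j x)"
        using Vcomm[OF jx[OF that(1)]] by (simp add: j(3)[OF \<alpha> that(1)])
      then show "\<phi> (avg \<odot>\<^bsub>V\<^esub> j (\<alpha> \<odot>\<^bsub>M\<^esub> x)) i = to_fract (c * \<pi> x i)"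
        using that by (simp add: \<phi>(3)[OF \<alpha>C jQ] c(1) \<pi>)
    qed (use that \<alpha> Mc in auto)
    moreover have "\<alpha> \<odot>\<^bsub>M\<^esub> x = scalar c \<odot>\<^bsub>M\<^esub> x" if x: "x \<in> carrier M" and g: "\<forall>g. Poly_Mapping.single g 1 \<odot>\<^bsub>M\<^esub> x = x" for x
    proof (rule inj_onD[OF j_inj])
      have "j x \<in> Q" using jQ[OF x] fixed[OF x] g by simp
      then show "j (\<alpha> \<odot>\<^bsub>M\<^esub> x) = j (scalar c \<odot>\<^bsub>M\<^esub> x)" by (simp add: j(3)[OF \<alpha> x] j(3)[OF scA x] c(2))
    qed (use x \<alpha> scA Mc in auto)
    ultimately show ?thesis using c(1) by blast
  qed
  have p3: "\<exists>x\<in>carrier M. \<forall>i<m. \<pi> x i = v i" for v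
  proof (cases "m > 0")
    case False
    then show ?thesis using M.zero_closed by blast
  next
    case m: True
    \<comment> \<open>The projection of \<open>E\<close> is no larger than that of \<open>M\<close>: the integral closure acts on it by 2-adic integers.\<close>
    define K where "K = {y \<in> E. \<exists>x\<in>carrier M. avg \<odot>\<^bsub>V\<^esub> y = avg \<odot>\<^bsub>V\<^esub> j x}"
    have KV: "y \<in> carrier V" if "y \<in> K" for y using that EV by (auto simp: K_def)
    have "submodule K (ring_on C) V"
    proof (rule submoduleI')
      show "K \<subseteq> carrier V" using KV by blast
      have j0: "j \<zero>\<^bsub>M\<^esub> = \<zero>\<^bsub>V\<^esub>"
      proof -
        have "j (0 \<odot>\<^bsub>M\<^esub> \<zero>\<^bsub>M\<^esub>) = 0 \<odot>\<^bsub>V\<^esub> j \<zero>\<^bsub>M\<^esub>" by (rule j(3)[OF AA(1)]) simp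
        then show ?thesis using M.smult_r_null[of 0] AA(1) V0[OF jx[of "\<zero>\<^bsub>M\<^esub>"]] by simp
      qed
      show "\<zero>\<^bsub>V\<^esub> \<in> K" unfolding K_def using Ep(2) j0 by (auto intro!: bexI[of _ "\<zero>\<^bsub>M\<^esub>"])
      show "y \<oplus>\<^bsub>V\<^esub> y' \<in> K" if y: "y \<in> K" and y': "y' \<in> K" for y y'
      proof -
        obtain x x' where x: "x \<in> carrier M" "avg \<odot>\<^bsub>V\<^esub> y = avg \<odot>\<^bsub>V\<^esub> j x" "x' \<in> carrier M" "avg \<odot>\<^bsub>V\<^esub> y' = avg \<odot>\<^bsub>V\<^esub> j x'"
          using y y' unfolding K_def by blast
        have "avg \<odot>\<^bsub>V\<^esub> (y \<oplus>\<^bsub>V\<^esub> y') = avg \<odot>\<^bsub>V\<^esub> j (x \<oplus>\<^bsub>M\<^esub> x')"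
          using x by (simp add: Vadd KV[OF y] KV[OF y'] j(2) jx)
        moreover have "y \<oplus>\<^bsub>V\<^esub> y' \<in> E" using y y' Ep(3) by (simp add: K_def)
        ultimately show ?thesis unfolding K_def using x(1,3) M.a_closed by blast
      qed
      show sm: "q \<odot>\<^bsub>V\<^esub> y \<in> K" if q: "q \<in> C" and y: "y \<in> K" for q y
      proof -
        obtain x where x: "x \<in> carrier M" "avg \<odot>\<^bsub>V\<^esub> y = avg \<odot>\<^bsub>V\<^esub> j x" using y unfolding K_def by blast
        obtain c where c: "\<And>y. y \<in> Q \<Longrightarrow> q \<odot>\<^bsub>V\<^esub> y = scalar c \<odot>\<^bsub>V\<^esub> y" using scal[OF q m] by blast
        have "avg \<odot>\<^bsub>V\<^esub> (q \<odot>\<^bsub>V\<^esub> y) = q \<odot>\<^bsub>V\<^esub> (avg \<odot>\<^bsub>V\<^esub> j x)" using Vcomm[OF KV[OF y], of avg q] x(2) by simp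
        also have "\<dots> = scalar c \<odot>\<^bsub>V\<^esub> (avg \<odot>\<^bsub>V\<^esub> j x)" by (rule c[OF jQ[OF x(1)]])
        also have "\<dots> = avg \<odot>\<^bsub>V\<^esub> j (scalar c \<odot>\<^bsub>M\<^esub> x)" unfolding j(3)[OF scA x(1)] by (rule Vcomm[OF jx[OF x(1)]])
        finally have "avg \<odot>\<^bsub>V\<^esub> (q \<odot>\<^bsub>V\<^esub> y) = avg \<odot>\<^bsub>V\<^esub> j (scalar c \<odot>\<^bsub>M\<^esub> x)" .
        moreover have "scalar c \<odot>\<^bsub>M\<^esub> x \<in> carrier M" using M.smult_closed[of "scalar c" x] scA x(1) by simp
        moreover have "q \<odot>\<^bsub>V\<^esub> y \<in> E" using y q Ep(5) by (simp add: K_def)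
        ultimately show ?thesis unfolding K_def by blast
      qed
      show "\<ominus>\<^bsub>V\<^esub> y \<in> K" if y: "y \<in> K" for y
      proof -
        have "\<ominus>\<^bsub>V\<^esub> y = (- 1) \<odot>\<^bsub>V\<^esub> y"
        proof (rule V.minus_equality)
          have "(- 1 + 1) \<odot>\<^bsub>V\<^esub> y = (- 1) \<odot>\<^bsub>V\<^esub> y \<oplus>\<^bsub>V\<^esub> 1 \<odot>\<^bsub>V\<^esub> y"
            using V.smult_l_distr[of "- 1" 1 y] KV[OF y] by simp
          then show "(- 1) \<odot>\<^bsub>V\<^esub> y \<oplus>\<^bsub>V\<^esub> y = \<zero>\<^bsub>V\<^esub>" using V0[OF KV[OF y]] V.smult_one[OF KV[OF y]] by simp
        qed (use KV[OF y] Vsm in auto)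
        then show ?thesis using sm[OF _ y, of "- 1"] AA(3) AC by auto
      qed
    qed
    moreover have "j ` carrier M \<subseteq> K" unfolding K_def using jE by blast
    ultimately have EK: "E \<subseteq> K" by (rule E_sub)
    have "(\<lambda>i\<in>{..<m}. to_fract (v i)) \<in> \<phi> ` Q"
      unfolding bij_betw_imp_surj_on[OF \<phi>(1)] using Z2_closed(6) by auto
    then obtain y where y: "y \<in> Q" "\<phi> y = (\<lambda>i\<in>{..<m}. to_fract (v i))" by (elim imageE) (rule that, assumption, rule sym)
    have "y \<in> K" using y(1) Hp(1) EK by (auto simp: Q_def)
    then obtain x where x: "x \<in> carrier M" "y = avg \<odot>\<^bsub>V\<^esub> j x" using avg_Q[OF y(1)] by (auto simp: K_def)
    have "\<pi> x i = v i" if "i < m" for i by (rule \<pi>_eqI[OF x(1) that]) (simp add: x(2)[symmetric] y(2) that)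
    then show ?thesis using x(1) by blast
  qed
  have p4: "x = \<zero>\<^bsub>M\<^esub>" if x: "x \<in> carrier M" and g: "\<forall>g. Poly_Mapping.single g 1 \<odot>\<^bsub>M\<^esub> x = x" and z: "\<forall>i<m. \<pi> x i = 0" for x
  proof -
    have jxQ: "j x \<in> Q" using jQ[OF x] fixed[OF x] g by simp
    have "\<phi> (j x) = \<phi> (0 \<odot>\<^bsub>V\<^esub> j x)"
    proof
      fix i
      show "\<phi> (j x) i = \<phi> (0 \<odot>\<^bsub>V\<^esub> j x) i"
      proof (cases "i < m")
        case True
        then have "\<phi> (j x) i = 0" using \<pi>[OF x True] z fixed[OF x] g by simp
        then show ?thesis using \<phi>(3)[OF _ jxQ, of 0] AA(1) AC True by (auto simp: chi_simps)
      next
        case False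
        have "\<phi> (j x) \<in> {..<m} \<rightarrow>\<^sub>E Z2" using \<phi>(1) jxQ by (auto simp: bij_betw_def)
        then show ?thesis using \<phi>(3)[OF _ jxQ, of 0] AA(1) AC False by (auto simp: PiE_iff extensional_def)
      qed
    qed
    then have "j x = 0 \<odot>\<^bsub>V\<^esub> j x" using \<phi>_inj jxQ Q_sm[OF _ jxQ, of 0] AA(1) AC by blast
    also have "\<dots> = j (0 \<odot>\<^bsub>M\<^esub> x)" by (simp add: j(3)[OF AA(1) x])
    finally have "j x = j \<zero>\<^bsub>M\<^esub>" using M.smult_l_null[OF x] by simp
    then show ?thesis using inj_onD[OF j_inj] x by simp
  qed
  show ?thesis by (rule exI[of _ \<pi>]) (use p1 p2 p3 p4 in blast)
qed

lemma act_gnorm: "act \<rho> gnorm w = (\<Sum>g\<in>UNIV. \<rho> g w)"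
proof -
  have "co gnorm g = 1" for g by (rule co_eq) (simp add: lookup_gnorm)
  then show ?thesis by (simp add: act_def)
qed

text \<open>In the coordinates \<open>\<pi>\<close> the fixed vectors of \<open>M\<close> become \<open>2\<close> times, and the norms \<open>4\<close> times, the full lattice
of rank \<open>r (Plus, Plus)\<close>.\<close>

lemma tate_degree_zero:
  fixes M :: lat
  assumes A: "minimal_overring A" and ind: "indec_lattice A M" and lat: "is_lattice Z2G M"
    and mult: "multiplicities A M r" and niso: "\<not> mod_iso Z2G M (L (Plus, Plus))"
    and P: "presents M \<rho> \<kappa>"
  shows "tate_rep \<rho> 0 \<cong> F2_sum (r (Plus, Plus))"
proof -
  define m where "m = r (Plus, Plus)"
  note Af = minimal_overring_facts[OF A]
  have modA: "module (ring_on A) M" using ind by (simp add: indec_lattice_def is_lattice_def)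
  have modZ: "module (ring_on Z2G) M" using lat by (simp add: is_lattice_def)
  interpret presented M \<rho> \<kappa> by (rule presented.intro[OF modZ P])
  interpret MA: module "ring_on A" M by (rule modA)
  obtain \<pi> :: "_ \<Rightarrow> nat \<Rightarrow> z2adic" where
    p1: "\<forall>x\<in>carrier M. \<forall>y\<in>carrier M. \<forall>i<m. \<pi> (x \<oplus>\<^bsub>M\<^esub> y) i = \<pi> x i + \<pi> y i" and
    p2: "\<forall>\<alpha>\<in>A. m > 0 \<longrightarrow> (\<exists>c. to_fract c = chi \<alpha> \<and> (\<forall>x\<in>carrier M. \<forall>i<m. \<pi> (\<alpha> \<odot>\<^bsub>M\<^esub> x) i = c * \<pi> x i) \<and>
       (\<forall>x\<in>carrier M. (\<forall>g. Poly_Mapping.single g 1 \<odot>\<^bsub>M\<^esub> x = x) \<longrightarrow> \<alpha> \<odot>\<^bsub>M\<^esub> x = scalar c \<odot>\<^bsub>M\<^esub> x))" and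
    p3: "\<forall>v. \<exists>x\<in>carrier M. \<forall>i<m. \<pi> x i = v i" and
    p4: "\<forall>x\<in>carrier M. (\<forall>g. Poly_Mapping.single g 1 \<odot>\<^bsub>M\<^esub> x = x) \<longrightarrow> (\<forall>i<m. \<pi> x i = 0) \<longrightarrow> x = \<zero>\<^bsub>M\<^esub>"
    using character_coordinates[OF A modA mult, folded m_def] by (elim exE conjE) (rule that)
  define G where "G = {x \<in> carrier M. \<forall>g. Poly_Mapping.single g 1 \<odot>\<^bsub>M\<^esub> x = x}"
  have scA: "scalar c \<in> A" for c using Af(1) Z2G_closed(6) by blast
  have sgA: "Poly_Mapping.single g 1 \<in> A" for g using Af(1) Z2G_closed(7) by blast
  have gnA: "gnorm \<in> A" using Af(1) gnorm_Z2G by blast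
  have cl: "\<alpha> \<odot>\<^bsub>M\<^esub> x \<in> carrier M" if "\<alpha> \<in> A" "x \<in> carrier M" for \<alpha> x using MA.smult_closed[of \<alpha> x] that by simp
  have ass: "(\<alpha> * \<beta>) \<odot>\<^bsub>M\<^esub> x = \<alpha> \<odot>\<^bsub>M\<^esub> (\<beta> \<odot>\<^bsub>M\<^esub> x)" if "\<alpha> \<in> A" "\<beta> \<in> A" "x \<in> carrier M" for \<alpha> \<beta> x
    using MA.smult_assoc1[of \<alpha> \<beta> x] that by simp
  have comm: "\<alpha> \<odot>\<^bsub>M\<^esub> (\<beta> \<odot>\<^bsub>M\<^esub> x) = \<beta> \<odot>\<^bsub>M\<^esub> (\<alpha> \<odot>\<^bsub>M\<^esub> x)" if "\<alpha> \<in> A" "\<beta> \<in> A" "x \<in> carrier M" for \<alpha> \<beta> x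
    using ass[OF that] ass[OF that(2,1,3)] by (simp add: mult.commute)
  have distr: "\<alpha> \<odot>\<^bsub>M\<^esub> (x \<oplus>\<^bsub>M\<^esub> y) = \<alpha> \<odot>\<^bsub>M\<^esub> x \<oplus>\<^bsub>M\<^esub> \<alpha> \<odot>\<^bsub>M\<^esub> y" if "\<alpha> \<in> A" "x \<in> carrier M" "y \<in> carrier M" for \<alpha> x y
    using MA.smult_r_distr[of \<alpha> x y] that by simp
  have s_add: "scalar (c + d) \<odot>\<^bsub>M\<^esub> x = scalar c \<odot>\<^bsub>M\<^esub> x \<oplus>\<^bsub>M\<^esub> scalar d \<odot>\<^bsub>M\<^esub> x" if "x \<in> carrier M" for c d x
    using MA.smult_l_distr[of "scalar c" "scalar d" x] scA that by (simp add: scalar_simps(3))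
  have s_mult: "scalar c \<odot>\<^bsub>M\<^esub> (scalar d \<odot>\<^bsub>M\<^esub> x) = scalar (c * d) \<odot>\<^bsub>M\<^esub> x" if "x \<in> carrier M" for c d x
    using ass[OF scA scA that] by (simp add: scalar_simps(4))
  have s0: "scalar 0 \<odot>\<^bsub>M\<^esub> x = \<zero>\<^bsub>M\<^esub>" if "x \<in> carrier M" for x
    using MA.smult_l_null[OF that] by (simp add: scalar_simps(1))
  have s1: "scalar 1 \<odot>\<^bsub>M\<^esub> x = x" if "x \<in> carrier M" for x
    using MA.smult_one[OF that] by (simp add: scalar_simps(2))
  have s_neg: "\<ominus>\<^bsub>M\<^esub> x = scalar (- 1) \<odot>\<^bsub>M\<^esub> x" if x: "x \<in> carrier M" for x
  proof (rule Mod.minus_equality)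
    show "scalar (- 1) \<odot>\<^bsub>M\<^esub> x \<oplus>\<^bsub>M\<^esub> x = \<zero>\<^bsub>M\<^esub>" using s_add[OF x, of "- 1" 1] s0[OF x] s1[OF x] by simp
  qed (use x scA cl in auto)
  have s_eq: "x = y" if x: "x \<in> carrier M" and y: "y \<in> carrier M" and z: "x \<oplus>\<^bsub>M\<^esub> scalar (- 1) \<odot>\<^bsub>M\<^esub> y = \<zero>\<^bsub>M\<^esub>" for x y
    using Mod.minus_equality[OF z] s_neg[OF y] cl[OF scA y] x y z
    by (metis Mod.minus_equality Mod.minus_minus)
  have pact: "\<pi> (\<alpha> \<odot>\<^bsub>M\<^esub> x) i = c * \<pi> x i" if "\<alpha> \<in> A" "to_fract c = chi \<alpha>" "x \<in> carrier M" "i < m" for \<alpha> c x i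
  proof -
    have "m > 0" using \<open>i < m\<close> by simp
    then obtain d where d: "to_fract d = chi \<alpha>" "\<forall>x\<in>carrier M. \<forall>i<m. \<pi> (\<alpha> \<odot>\<^bsub>M\<^esub> x) i = d * \<pi> x i"
      using p2 \<open>\<alpha> \<in> A\<close> by blast
    have "d = c" using d(1) that(2) by (metis to_fract_eq_iff)
    then show ?thesis using d(2) that(3,4) by blast
  qed
  have pscal: "\<pi> (scalar c \<odot>\<^bsub>M\<^esub> x) i = c * \<pi> x i" if "x \<in> carrier M" "i < m" for c x i
    by (rule pact[OF scA _ that]) (simp add: chi_simps)
  have p0: "\<pi> \<zero>\<^bsub>M\<^esub> i = 0" if "i < m" for i
    using pscal[OF Mod.zero_closed that, of 0] s0[OF Mod.zero_closed] by simp
  have GD: "x \<in> carrier M" "Poly_Mapping.single g 1 \<odot>\<^bsub>M\<^esub> x = x" if "x \<in> G" for x g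
    using that unfolding G_def by blast+
  have GI: "x \<in> G" if "x \<in> carrier M" "\<And>g. Poly_Mapping.single g 1 \<odot>\<^bsub>M\<^esub> x = x" for x
    using that unfolding G_def by blast
  have G_const: "\<alpha> \<odot>\<^bsub>M\<^esub> x \<in> G" if \<alpha>: "\<alpha> \<in> A" "\<And>g. Poly_Mapping.lookup \<alpha> g = q" and x: "x \<in> carrier M" for \<alpha> x q
  proof (rule GI[OF cl[OF \<alpha>(1) x]])
    fix g show "Poly_Mapping.single g 1 \<odot>\<^bsub>M\<^esub> (\<alpha> \<odot>\<^bsub>M\<^esub> x) = \<alpha> \<odot>\<^bsub>M\<^esub> x"
      using ass[OF sgA[of g] \<alpha>(1) x] single_mult_const[OF \<alpha>(2), of g] by simp
  qed
  have G_eq: "x = y" if x: "x \<in> G" and y: "y \<in> G" and xy: "\<And>i. i < m \<Longrightarrow> \<pi> x i = \<pi> y i" for x y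
  proof (rule s_eq[OF GD(1)[OF x] GD(1)[OF y]])
    have c: "x \<oplus>\<^bsub>M\<^esub> scalar (- 1) \<odot>\<^bsub>M\<^esub> y \<in> carrier M" using GD(1)[OF x] cl[OF scA GD(1)[OF y]] by simp
    have "Poly_Mapping.single g 1 \<odot>\<^bsub>M\<^esub> (x \<oplus>\<^bsub>M\<^esub> scalar (- 1) \<odot>\<^bsub>M\<^esub> y) = x \<oplus>\<^bsub>M\<^esub> scalar (- 1) \<odot>\<^bsub>M\<^esub> y" for g
      using distr[OF sgA GD(1)[OF x] cl[OF scA GD(1)[OF y]], of g] comm[OF sgA scA GD(1)[OF y], of g] GD(2)[OF x, of g] GD(2)[OF y, of g]
      by simp
    moreover have "\<pi> (x \<oplus>\<^bsub>M\<^esub> scalar (- 1) \<odot>\<^bsub>M\<^esub> y) i = 0" if "i < m" for i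
      using p1 GD(1)[OF x] cl[OF scA GD(1)[OF y]] that pscal[OF GD(1)[OF y] that] xy[OF that] by simp
    ultimately show "x \<oplus>\<^bsub>M\<^esub> scalar (- 1) \<odot>\<^bsub>M\<^esub> y = \<zero>\<^bsub>M\<^esub>" using p4 c by blast
  qed
  have even: "2 dvd \<pi> x i" if x: "x \<in> G" and i: "i < m" for x i
  proof (rule ccontr)
    assume "\<not> 2 dvd \<pi> x i"
    then obtain u where u: "\<pi> x i * u = 1" using odd_z2adic_is_unit by blast
    have chi_ex: "\<exists>c. to_fract c = chi \<alpha> \<and> \<alpha> \<odot>\<^bsub>M\<^esub> x = scalar c \<odot>\<^bsub>M\<^esub> x" if "\<alpha> \<in> A" for \<alpha>
    proof -
      have "m > 0" using i by simp
      then show ?thesis using p2 that x unfolding G_def by blast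
    qed
    note xc = GD(1)[OF x]
    \<comment> \<open>A fixed vector with a unit coordinate splits off: \<open>M\<close> is the sum of its multiples and the kernel of that coordinate, so by
    indecomposability \<open>M\<close> is the trivial lattice.\<close>
    define H where "H = range (\<lambda>c. scalar c \<odot>\<^bsub>M\<^esub> x)"
    define K where "K = {y \<in> carrier M. \<pi> y i = 0}"
    have H: "submodule H (ring_on A) M"
    proof (rule submoduleI')
      show "H \<subseteq> carrier M" using cl[OF scA xc] by (auto simp: H_def)
      show "\<zero>\<^bsub>M\<^esub> \<in> H" unfolding H_def using s0[OF xc] by (metis rangeI)
      show "y \<oplus>\<^bsub>M\<^esub> z \<in> H" if yz: "y \<in> H" "z \<in> H" for y z
      proof -
        obtain c d where "y = scalar c \<odot>\<^bsub>M\<^esub> x" "z = scalar d \<odot>\<^bsub>M\<^esub> x" using yz unfolding H_def by blast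
        then have "y \<oplus>\<^bsub>M\<^esub> z = scalar (c + d) \<odot>\<^bsub>M\<^esub> x" using s_add[OF xc] by simp
        then show ?thesis unfolding H_def by blast
      qed
      show "\<ominus>\<^bsub>M\<^esub> y \<in> H" if y: "y \<in> H" for y
      proof -
        obtain c where "y = scalar c \<odot>\<^bsub>M\<^esub> x" using y unfolding H_def by blast
        then have "\<ominus>\<^bsub>M\<^esub> y = scalar (- 1 * c) \<odot>\<^bsub>M\<^esub> x" using s_neg[OF cl[OF scA xc]] s_mult[OF xc] by simp
        then show ?thesis unfolding H_def by blast
      qed
      show "\<alpha> \<odot>\<^bsub>M\<^esub> y \<in> H" if \<alpha>: "\<alpha> \<in> A" and y: "y \<in> H" for \<alpha> y
      proof -
        obtain c where c: "y = scalar c \<odot>\<^bsub>M\<^esub> x" using y unfolding H_def by blast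
        obtain d where d: "\<alpha> \<odot>\<^bsub>M\<^esub> x = scalar d \<odot>\<^bsub>M\<^esub> x" using chi_ex[OF \<alpha>] by blast
        have "\<alpha> \<odot>\<^bsub>M\<^esub> y = scalar c \<odot>\<^bsub>M\<^esub> (scalar d \<odot>\<^bsub>M\<^esub> x)" unfolding c comm[OF \<alpha> scA xc] d ..
        then show ?thesis unfolding H_def s_mult[OF xc] by blast
      qed
    qed
    have K: "submodule K (ring_on A) M"
    proof (rule submoduleI')
      show "K \<subseteq> carrier M" by (auto simp: K_def)
      show "\<zero>\<^bsub>M\<^esub> \<in> K" by (simp add: K_def p0[OF i])
      show "y \<oplus>\<^bsub>M\<^esub> z \<in> K" if "y \<in> K" "z \<in> K" for y z using that p1 i by (simp add: K_def)
      show "\<ominus>\<^bsub>M\<^esub> y \<in> K" if "y \<in> K" for y using that by (simp add: K_def s_neg cl[OF scA] pscal[OF _ i])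
      show "\<alpha> \<odot>\<^bsub>M\<^esub> y \<in> K" if "\<alpha> \<in> A" "y \<in> K" for \<alpha> y
      proof -
        obtain d where "to_fract d = chi \<alpha>" using chi_ex[OF \<open>\<alpha> \<in> A\<close>] by blast
        then show ?thesis using pact[OF \<open>\<alpha> \<in> A\<close> _ _ i] that cl by (simp add: K_def)
      qed
    qed
    have pxn: "\<pi> x i \<noteq> 0" using u by auto
    have HK: "H \<inter> K = {\<zero>\<^bsub>M\<^esub>}"
    proof (intro subset_antisym subsetI)
      fix y assume y: "y \<in> H \<inter> K"
      then obtain c where c: "y = scalar c \<odot>\<^bsub>M\<^esub> x" unfolding H_def by blast
      have "c * \<pi> x i = 0" using y pscal[OF xc i, of c] unfolding K_def c by simp
      then show "y \<in> {\<zero>\<^bsub>M\<^esub>}" using pxn s0[OF xc] c by simp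
    next
      fix y assume "y \<in> {\<zero>\<^bsub>M\<^esub>}"
      then show "y \<in> H \<inter> K" using submoduleD(2)[OF H] submoduleD(2)[OF K] by simp
    qed
    have sum: "H <+>\<^bsub>M\<^esub> K = carrier M"
    proof (intro subset_antisym subsetI)
      fix y assume "y \<in> H <+>\<^bsub>M\<^esub> K"
      then show "y \<in> carrier M" using submoduleD(1)[OF H] submoduleD(1)[OF K] by (auto simp: set_add_def' subset_iff)
    next
      fix y assume y: "y \<in> carrier M"
      define c where "c = u * \<pi> y i"
      define z where "z = y \<oplus>\<^bsub>M\<^esub> scalar (- c) \<odot>\<^bsub>M\<^esub> x"
      have zc: "z \<in> carrier M" using y cl[OF scA xc] by (simp add: z_def)
      have "\<pi> z i = \<pi> y i + (- c) * \<pi> x i"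
        unfolding z_def using p1 y cl[OF scA xc] i pscal[OF xc i] by simp
      also have "\<dots> = \<pi> y i * (1 - \<pi> x i * u)" by (simp add: c_def algebra_simps)
      finally have zK: "z \<in> K" using zc u by (simp add: K_def)
      have "scalar c \<odot>\<^bsub>M\<^esub> x \<oplus>\<^bsub>M\<^esub> scalar (- c) \<odot>\<^bsub>M\<^esub> x = \<zero>\<^bsub>M\<^esub>" using s_add[OF xc, of c "- c"] s0[OF xc] by simp
      then have "scalar c \<odot>\<^bsub>M\<^esub> x \<oplus>\<^bsub>M\<^esub> z = y"
        unfolding z_def using Mod.a_lcomm[OF cl[OF scA xc] y cl[OF scA xc]] y by simp
      moreover have "scalar c \<odot>\<^bsub>M\<^esub> x \<in> H" unfolding H_def by blast
      ultimately show "y \<in> H <+>\<^bsub>M\<^esub> K" unfolding set_add_def' using zK by blast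
    qed
    have "H = {\<zero>\<^bsub>M\<^esub>} \<or> K = {\<zero>\<^bsub>M\<^esub>}"
      using ind H K HK sum unfolding indec_lattice_def by blast
    then show False
    proof
      assume "H = {\<zero>\<^bsub>M\<^esub>}"
      moreover have "x \<in> H" unfolding H_def using s1[OF xc] by (metis rangeI)
      ultimately show False using pxn p0[OF i] by simp
    next
      assume K0: "K = {\<zero>\<^bsub>M\<^esub>}"
      define f where "f y = to_fract (u * \<pi> y i)" for y
      have fZ: "f y \<in> Z2" for y unfolding f_def by (rule Z2_closed(6))
      have "f \<in> mod_hom Z2G M (L (Plus, Plus))"
      proof (rule mod_homI)
        show "f y \<in> carrier (L (Plus, Plus))" for y by (simp add: L_simps fZ)
        show "f (y \<oplus>\<^bsub>M\<^esub> z) = f y \<oplus>\<^bsub>L (Plus, Plus)\<^esub> f z" if "y \<in> carrier M" "z \<in> carrier M" for y z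
          using p1 that i by (simp add: f_def L_simps distrib_left)
        show "f (\<alpha> \<odot>\<^bsub>M\<^esub> y) = \<alpha> \<odot>\<^bsub>L (Plus, Plus)\<^esub> f y" if "\<alpha> \<in> Z2G" "y \<in> carrier M" for \<alpha> y
        proof -
          have \<alpha>: "\<alpha> \<in> A" using that(1) Af(1) by blast
          obtain d where d: "to_fract d = chi \<alpha>" using chi_ex[OF \<alpha>] by blast
          show ?thesis using pact[OF \<alpha> d that(2) i] by (simp add: f_def smult_L d[symmetric] mult_ac)
        qed
      qed
      moreover have "bij_betw f (carrier M) (carrier (L (Plus, Plus)))"
        unfolding bij_betw_def
      proof
        show "inj_on f (carrier M)"
        proof (rule inj_onI)
          fix y z assume y: "y \<in> carrier M" and z: "z \<in> carrier M" and e: "f y = f z"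
          have "u \<noteq> 0" using u by auto
          then have "\<pi> y i = \<pi> z i" using e by (simp add: f_def)
          then have "\<pi> (y \<oplus>\<^bsub>M\<^esub> scalar (- 1) \<odot>\<^bsub>M\<^esub> z) i = 0" using p1 y cl[OF scA z] i pscal[OF z i] by simp
          moreover have "y \<oplus>\<^bsub>M\<^esub> scalar (- 1) \<odot>\<^bsub>M\<^esub> z \<in> carrier M" using y cl[OF scA z] by simp
          ultimately have "y \<oplus>\<^bsub>M\<^esub> scalar (- 1) \<odot>\<^bsub>M\<^esub> z \<in> K" by (simp add: K_def)
          then show "y = z" using s_eq[OF y z] unfolding K0 by blast
        qed
        show "f ` carrier M = carrier (L (Plus, Plus))"
        proof (intro subset_antisym subsetI)
          fix q assume "q \<in> carrier (L (Plus, Plus))"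
          then obtain c where c: "q = to_fract c" by (auto simp: L_simps Z2_def)
          have "f (scalar c \<odot>\<^bsub>M\<^esub> x) = to_fract (u * (c * \<pi> x i))" by (simp only: f_def pscal[OF xc i])
          also have "u * (c * \<pi> x i) = c * (\<pi> x i * u)" by (simp only: mult_ac)
          also have "to_fract \<dots> = q" by (simp only: u mult_1_right c)
          finally have "q = f (scalar c \<odot>\<^bsub>M\<^esub> x)" ..
          then show "q \<in> f ` carrier M" using cl[OF scA xc] by blast
        next
          fix q assume "q \<in> f ` carrier M"
          then show "q \<in> carrier (L (Plus, Plus))" by (auto simp: L_simps fZ)
        qed
      qed
      ultimately show False using niso unfolding mod_iso_def by blast
    qed
  qed
  define hlf where "hlf c = (SOME d. c = 2 * d)" for c :: z2adic
  have two0: "(2 :: z2adic) \<noteq> 0" using four_q2adic(3,4) to_fract_eq_0_iff[of "2 :: z2adic"] by simp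
  have hlf: "hlf (2 * d) = d" for d
  proof -
    have "2 * d = 2 * hlf (2 * d)" unfolding hlf_def by (rule someI[of _ d]) simp
    then show ?thesis using two0 by simp
  qed
  define red :: "z2adic \<Rightarrow> bit" where "red c = (if 2 dvd c then 0 else 1)" for c
  have red_add: "red (c + d) = red c + red d" for c d
    using odd_plus_odd[of c d] dvd_add_right_iff[of 2 c d] dvd_add_left_iff[of 2 d c] by (auto simp: red_def)
  \<comment> \<open>The coordinates of a fixed vector are even; \<open>\<theta>\<close> reduces their halves modulo \<open>2\<close>.\<close>
  define \<theta> where "\<theta> v = (\<lambda>i\<in>{..<m}. red (hlf (\<pi> (un v) i)))" for v
  have un_G: "un v \<in> G" if v: "\<forall>g. \<rho> g v = v" for v
  proof (rule GI[OF un_closed])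
    fix g show "Poly_Mapping.single g 1 \<odot>\<^bsub>M\<^esub> un v = un v"
      using un_act[OF Z2G_closed(7)[of g], of v] v by (simp add: act_single)
  qed
  have \<kappa>_G: "\<forall>g. \<rho> g (\<kappa> x) = \<kappa> x" if "x \<in> G" for x
    using \<kappa>_group[OF GD(1)[OF that]] GD(2)[OF that] by simp
  have "tate_rep \<rho> 0 \<cong> F2_sum m"
  proof (rule tate_rep_0[OF glat, of \<theta>])
    show "\<theta> ` {v. \<forall>g. \<rho> g v = v} = {..<m} \<rightarrow>\<^sub>E UNIV"
    proof (intro subset_antisym subsetI)
      fix w assume "w \<in> \<theta> ` {v. \<forall>g. \<rho> g v = v}"
      then obtain v where "w = \<theta> v" by blast
      then show "w \<in> {..<m} \<rightarrow>\<^sub>E UNIV" by (simp add: \<theta>_def PiE_iff)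
    next
      fix w :: "nat \<Rightarrow> bit" assume w: "w \<in> {..<m} \<rightarrow>\<^sub>E UNIV"
      obtain x where x: "x \<in> carrier M" "\<forall>i<m. \<pi> x i = (if w i = 0 then 0 else 1)"
        using p3[rule_format, of "\<lambda>i. if w i = 0 then 0 else 1"] by blast
      define y where "y = half_norm \<odot>\<^bsub>M\<^esub> x"
      have y: "y \<in> G" unfolding y_def by (rule G_const[OF Af(5) lookup_half_norm x(1)])
      have "\<theta> (\<kappa> y) i = w i" for i
      proof (cases "i < m")
        case True
        have "\<pi> y i = 2 * \<pi> x i" unfolding y_def by (rule pact[OF Af(5) _ x(1) True]) (simp add: chi_simps)
        then have "\<theta> (\<kappa> y) i = red (\<pi> x i)" using True GD(1)[OF y] by (simp add: \<theta>_def un_\<kappa> hlf)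
        also have "\<dots> = w i" using x(2) True not_two_dvd_one by (cases "w i = 0") (auto simp: red_def)
        finally show ?thesis .
      next
        case False
        then show ?thesis using w by (auto simp: \<theta>_def PiE_iff extensional_def)
      qed
      then have "w = \<theta> (\<kappa> y)" by (simp add: fun_eq_iff)
      then show "w \<in> \<theta> ` {v. \<forall>g. \<rho> g v = v}" using \<kappa>_G[OF y] by blast
    qed
    show "\<theta> (v + w) = (\<lambda>i\<in>{..<m}. \<theta> v i + \<theta> w i)" if v: "\<forall>g. \<rho> g v = v" and w: "\<forall>g. \<rho> g w = w" for v w
    proof
      fix i show "\<theta> (v + w) i = (\<lambda>i\<in>{..<m}. \<theta> v i + \<theta> w i) i"
      proof (cases "i < m")
        case True
        obtain a b where ab: "\<pi> (un v) i = 2 * a" "\<pi> (un w) i = 2 * b"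
          using even[OF un_G[OF v] True] even[OF un_G[OF w] True] by (auto elim!: dvdE)
        have "\<pi> (un (v + w)) i = 2 * (a + b)" using p1 True by (simp add: un_add un_closed ab distrib_left)
        then show ?thesis using True by (simp add: \<theta>_def ab hlf red_add del: distrib_left_numeral)
      qed (simp add: \<theta>_def)
    qed
    show "\<theta> v = (\<lambda>i\<in>{..<m}. 0) \<longleftrightarrow> (\<exists>w. v = (\<Sum>g\<in>UNIV. \<rho> g w))" if v: "\<forall>g. \<rho> g v = v" for v
    proof
      assume z: "\<theta> v = (\<lambda>i\<in>{..<m}. 0)"
      have "\<exists>d. \<pi> (un v) i = 4 * d" if i: "i < m" for i
      proof -
        obtain a where a: "\<pi> (un v) i = 2 * a" using even[OF un_G[OF v] i] by (elim dvdE)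
        have "red a = 0" using fun_cong[OF z, of i] i by (simp add: \<theta>_def a hlf)
        then obtain d where "a = 2 * d" by (auto simp: red_def split: if_splits elim: dvdE)
        then show ?thesis using a by auto
      qed
      then obtain d where d: "\<And>i. i < m \<Longrightarrow> \<pi> (un v) i = 4 * d i" by metis
      obtain y where y: "y \<in> carrier M" "\<forall>i<m. \<pi> y i = d i" using p3 by meson
      have "un v = gnorm \<odot>\<^bsub>M\<^esub> y"
      proof (rule G_eq[OF un_G[OF v] G_const[OF gnA lookup_gnorm y(1)]])
        fix i assume i: "i < m"
        have "\<pi> (gnorm \<odot>\<^bsub>M\<^esub> y) i = 4 * \<pi> y i" by (rule pact[OF gnA _ y(1) i]) (simp add: chi_simps)
        then show "\<pi> (un v) i = \<pi> (gnorm \<odot>\<^bsub>M\<^esub> y) i" using d[OF i] y(2) i by simp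
      qed
      then have "\<kappa> (un v) = act \<rho> gnorm (\<kappa> y)" using \<kappa>_act[OF gnorm_Z2G y(1)] by simp
      then show "\<exists>w. v = (\<Sum>g\<in>UNIV. \<rho> g w)" using v unfolding \<kappa>_un act_gnorm by metis
    next
      assume "\<exists>w. v = (\<Sum>g\<in>UNIV. \<rho> g w)"
      then obtain w where "v = act \<rho> gnorm w" unfolding act_gnorm by blast
      then have u: "un v = gnorm \<odot>\<^bsub>M\<^esub> un w" using un_act[OF gnorm_Z2G] by simp
      show "\<theta> v = (\<lambda>i\<in>{..<m}. 0)"
      proof
        fix i show "\<theta> v i = (\<lambda>i\<in>{..<m}. 0) i"
        proof (cases "i < m")
          case True
          have "\<pi> (un v) i = 4 * \<pi> (un w) i" unfolding u by (rule pact[OF gnA _ un_closed True]) (simp add: chi_simps)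
          also have "\<dots> = 2 * (2 * \<pi> (un w) i)" by simp
          finally show ?thesis using True by (simp only: \<theta>_def restrict_apply hlf lessThan_iff if_True) (simp add: red_def)
        qed (simp add: \<theta>_def)
      qed
    qed
  qed
  then show ?thesis by (simp add: m_def)
qed

section \<open>The tubes\<close>

text \<open>The retractions and the dimension shifts give embeddings in both directions.\<close>

lemma tau_shift:
  assumes tau: "is_tau M' M" and P': "presents M' \<rho> \<kappa>'" and P: "presents M \<mu> \<kappa>"
    and fin: "finite (carrier (tate_rep \<rho> n)) \<or> finite (carrier (tate_rep \<mu> (n - 1)))"
  shows "tate_rep \<rho> n \<cong> tate_rep \<mu> (n - 1)"
proof -
  obtain \<beta> N \<alpha> where ar: "ar_sequence Z2G M' \<beta> N \<alpha> M" using tau unfolding is_tau_def by blast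
  have g: "glat \<rho>" "glat \<mu>" using P P' by (auto simp: presents_def)
  note rt = ar_retracts[OF ar P' P]
  have 1: "temb \<rho> n \<mu> (n - 1)" by (rule temb_trans[OF temb_retract[OF rt(1)] temb_syz[OF g(2)]])
  have 2: "temb \<mu> (n - 1) \<rho> (n - 1 + 1)" by (rule temb_trans[OF temb_retract[OF rt(2)] temb_cosyz[OF g(1)]])
  show ?thesis by (rule temb_finite_iso[OF g 1 _ fin]) (use 2 in simp)
qed

lemma finite_carrier_iso: "G \<cong> H \<Longrightarrow> finite (carrier H) \<Longrightarrow> finite (carrier G)"
  by (auto simp: is_iso_def iso_def bij_betw_finite)

theorem theorem2p3:
  fixes A :: "q2G set" and T :: "vertex \<Rightarrow> lat"
  assumes "minimal_overring A"
    and "ar_quiver A T"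
  shows "\<forall>n :: int. \<forall>k \<ge> (1 :: nat).
    (\<forall>f :: bit poly. Factorial_Ring.irreducible f \<and> lead_coeff f = 1 \<and> f \<noteq> [:0, 1:] \<and> f \<noteq> [:-1, 1:] \<longrightarrow>
       tate n (T (Homog f k)) \<cong> F2_sum (k * Polynomial.degree f)) \<and>
    (\<forall>j \<in> {2, 3, 4}.
       (\<forall>i \<in> {1, 2}. tate n (T (Special j i (2 * k))) \<cong> F2_sum k) \<and>
       tate n (T (Special j 1 (2 * k - 1))) \<cong> F2_sum (if even \<bar>n\<bar> then k else k - 1) \<and>
       tate n (T (Special j 2 (2 * k - 1))) \<cong> F2_sum (if odd \<bar>n\<bar> then k else k - 1))"
proof -
  have q: "\<forall>v\<in>tube_vertices. indec_lattice A (T v) \<and> T v \<notin> prepro_preinj A"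
    "\<forall>v\<in>tube_vertices. \<exists>r. multiplicities A (T v) r \<and> r (Plus, Plus) = tube_rank v"
    "\<forall>v\<in>tube_vertices. is_tau (T (tube_tau v)) (T v)"
    using assms(2) unfolding ar_quiver_def by blast+
  have lat: "is_lattice Z2G (T v)" if "v \<in> tube_vertices" for v
    using q(3) that unfolding is_tau_def ar_sequence_def indec_lattice_def by blast
  define R :: "vertex \<Rightarrow> ((nat \<Rightarrow> q2adic) \<Rightarrow> z2adic) rep" where "R v = (SOME \<rho>. \<exists>\<kappa>. presents (T v) \<rho> \<kappa>)" for v
  have R: "\<exists>\<kappa>. presents (T v) (R v) \<kappa>" if "v \<in> tube_vertices" for v
    proof -
    have "\<exists>(\<rho> :: ((nat \<Rightarrow> q2adic) \<Rightarrow> z2adic) rep) \<kappa>. presents (T v) \<rho> \<kappa>"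
      by (rule lattice_presented[OF lat[OF that]])
    then show ?thesis unfolding R_def by (rule someI_ex)
  qed
  have grp: "group (tate_rep (R v) n)" if "v \<in> tube_vertices" for v n
    using R[OF that] normal.factorgroup_is_group[OF normal_cobd] unfolding presents_def tate_rep_def by blast
  have tt: "tube_tau v \<in> tube_vertices" "tube_tau (tube_tau v) = v" if "v \<in> tube_vertices" for v
    using that by (auto simp: tube_vertices_def)
  have shift: "tate_rep (R (tube_tau v)) n \<cong> tate_rep (R v) (n - 1)"
    if v: "v \<in> tube_vertices" and fin: "finite (carrier (tate_rep (R (tube_tau v)) n)) \<or> finite (carrier (tate_rep (R v) (n - 1)))" for v n
    using R[OF v] R[OF tt(1)[OF v]] tau_shift[OF _ _ _ fin] q(3) v by blast
  define rk where "rk n v = tube_rank (if even n then v else tube_tau v)" for n :: int and v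
  \<comment> \<open>Induction in both directions from degree zero. Finiteness of the group known by induction supplies the hypothesis of the shift.\<close>
  have main: "\<forall>v\<in>tube_vertices. tate_rep (R v) n \<cong> F2_sum (rk n v)" for n :: int
  proof (induction n rule: int_induct[where k = 0])
    case base
    show ?case
    proof
      fix v assume v: "v \<in> tube_vertices"
      obtain r where r: "multiplicities A (T v) r" "r (Plus, Plus) = tube_rank v" using q(2) v by blast
      obtain \<kappa> where \<kappa>: "presents (T v) (R v) \<kappa>" using R[OF v] by blast
      have ni: "\<not> mod_iso Z2G (T v) (L (Plus, Plus))"
      proof
        assume "mod_iso Z2G (T v) (L (Plus, Plus))"
        then have "T v \<in> tau_orbit (L (Plus, Plus))" by (rule tau_orbit.base[OF lat[OF v]])
        then show False using q(1) v unfolding prepro_preinj_def tau_orbits_def by blast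
      qed
      have iv: "indec_lattice A (T v)" using q(1) v by blast
      show "tate_rep (R v) 0 \<cong> F2_sum (rk 0 v)"
        using tate_degree_zero[OF assms(1) iv lat[OF v] r(1) ni \<kappa>] r(2) by (simp add: rk_def)
    qed
  next
    case (step1 n)
    show ?case
    proof
      fix w assume w: "w \<in> tube_vertices"
      note v = tt[OF w]
      have ih: "tate_rep (R (tube_tau w)) n \<cong> F2_sum (rk n (tube_tau w))" using step1 v(1) by blast
      have "finite (carrier (tate_rep (R (tube_tau w)) n))" by (rule finite_carrier_iso[OF ih finite_F2_sum])
      then have "tate_rep (R w) (n + 1) \<cong> tate_rep (R (tube_tau w)) n"
        using shift[OF v(1), of "n + 1"] by (simp add: v(2))
      also note ih
      also have "rk n (tube_tau w) = rk (n + 1) w" by (simp add: rk_def v(2))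
      finally show "tate_rep (R w) (n + 1) \<cong> F2_sum (rk (n + 1) w)" .
    qed
  next
    case (step2 n)
    show ?case
    proof
      fix v assume v: "v \<in> tube_vertices"
      note w = tt[OF v]
      have ih: "tate_rep (R (tube_tau v)) n \<cong> F2_sum (rk n (tube_tau v))" using step2 w(1) by blast
      have "finite (carrier (tate_rep (R (tube_tau v)) n))" by (rule finite_carrier_iso[OF ih finite_F2_sum])
      then have "tate_rep (R (tube_tau v)) n \<cong> tate_rep (R v) (n - 1)" by (intro shift[OF v] disjI1)
      then have 1: "tate_rep (R v) (n - 1) \<cong> tate_rep (R (tube_tau v)) n" by (rule group.iso_sym[OF grp[OF w(1)]])
      have 2: "rk n (tube_tau v) = rk (n - 1) v" by (simp add: rk_def w(2))
      show "tate_rep (R v) (n - 1) \<cong> F2_sum (rk (n - 1) v)" using iso_trans[OF 1 ih] unfolding 2 .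
    qed
  qed
  have fin: "tate n (T v) \<cong> F2_sum (rk n v)" if v: "v \<in> tube_vertices" for n v
  proof -
    obtain \<kappa> where \<kappa>: "presents (T v) (R v) \<kappa>" using R[OF v] by blast
    have "presented (T v) (R v) \<kappa>" using lat[OF v] \<kappa> by (simp add: presented_def is_lattice_def)
    then have "tate n (T v) \<cong> tate_rep (R v) n" by (rule presented.tate_iso)
    then show ?thesis using iso_trans main v by blast
  qed
  show ?thesis
  proof (intro allI impI conjI ballI)
    fix n :: int and k :: nat assume k: "1 \<le> k"
    {
      fix f :: "bit poly"
      assume "Factorial_Ring.irreducible f \<and> lead_coeff f = 1 \<and> f \<noteq> [:0, 1:] \<and> f \<noteq> [:-1, 1:]"
      then have "Homog f k \<in> tube_vertices" using k unfolding tube_vertices_def homog_param_def by blast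
      from fin[OF this, of n] show "tate n (T (Homog f k)) \<cong> F2_sum (k * Polynomial.degree f)"
        by (cases "even n") (simp_all add: rk_def)
    }
    fix j :: nat assume j: "j \<in> {2, 3, 4}"
    have V: "Special j i l \<in> tube_vertices" if "i \<in> {1, 2}" "1 \<le> l" for i l
      unfolding tube_vertices_def using that j by blast
    {
      fix i :: nat assume i: "i \<in> {1, 2}"
      have "rk n (Special j i (2 * k)) = k" by (simp add: rk_def)
      then show "tate n (T (Special j i (2 * k))) \<cong> F2_sum k" using fin[OF V[OF i, of "2 * k"], of n] k by simp
    }
    have o: "odd (2 * k - 1)" "1 \<le> 2 * k - 1" "(2 * k - 1 + 1) div 2 = k" "(2 * k - 1 - 1) div 2 = k - 1"
      using k by auto
    have "rk n (Special j 1 (2 * k - 1)) = (if even \<bar>n\<bar> then k else k - 1)"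
      using o(1,3,4) by (simp add: rk_def)
    then show "tate n (T (Special j 1 (2 * k - 1))) \<cong> F2_sum (if even \<bar>n\<bar> then k else k - 1)"
      using fin[OF V[OF _ o(2), of 1], of n] by simp
    have "rk n (Special j 2 (2 * k - 1)) = (if odd \<bar>n\<bar> then k else k - 1)"
      using o(1,3,4) by (simp add: rk_def)
    then show "tate n (T (Special j 2 (2 * k - 1))) \<cong> F2_sum (if odd \<bar>n\<bar> then k else k - 1)"
      using fin[OF V[OF _ o(2), of 2], of n] by simp
  qed
qed

end
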